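(* Let $D\in\mathcal{D}$ be a domain in $\mathbb{R}^d$ with $d\ge 1$. Let $m\in C_b(\overline{D})$ with $m(x)>0$ for every $x\in\overline{D}$, and write $m(dx)=m(x)\,dx$. Then the Dirichlet form $(\mathcal{E}^*,\mathcal{F}^* )=\left(\tfrac12\mathbf{D},\mathrm{BL}(D)\cap L^2(D;m)\right)$ is the active reflected Dirichlet form $(\mathcal{E}^{\rm ref},\mathcal{F}^{\rm ref}_a)$ of the Dirichlet form $(\mathcal{E}^{(0)},\mathcal{F}^{(0)})=\left(\tfrac12\mathbf{D},W^{1,2}_e(D)\cap L^2(D;m)\right)$ on $L^2(D;m)$, and $\mathrm{BL}(D)$ is the reflected Dirichlet space $\mathcal{F}^{\rm ref}$ of $(\mathcal{E}^{(0)},\mathcal{F}^{(0)})$.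
   Context: A domain is a nonempty connected open set. For a domain $D\subset\mathbb{R}^d$, $L^p(D)$ is taken with respect to Lebesgue measure. Let $\mathrm{BL}(D)=\{u\in L^2_{loc}(D):\partial u/\partial x_i\in L^2(D),\ 1\le i\le d\}$ (distributional derivatives), $\mathbf{D}(u,v)=\int_D\nabla u\cdot\nabla v\,dx$, and $W^{1,2}(D)=\mathrm{BL}(D)\cap L^2(D)$ with norm $\|u\|_{1,2}^2=\|u\|_{L^2(D)}^2+\mathbf{D}(u,u)$. Then $(\tfrac12\mathbf{D},W^{1,2}(D))$ is a Dirichlet form on $L^2(D)$. Class $\mathcal{D}$: the domains $D\subset\mathbb{R}^d$ for which this form is regular on $L^2(\overline{D})$ (identified with $L^2(D)$, i.e. $\partial D$ carries no mass), i.e. $W^{1,2}(D)\cap C_c(\overline{D})$ is dense in $(W^{1,2}(D),\|\cdot\|_{1,2})$ and in $(C_\infty(\overline{D}),\|\cdot\|_\infty)$, where $C_c(\overline D)$ (resp. $C_\infty(\overline{D})$) is the space of continuous functions on $\overline{D}$ with compact support (resp. vanishing at infinity). $W^{1,2}_e(D)$ is the extended Dirichlet space of $(\tfrac12\mathbf{D},W^{1,2}(D))$: the a.e. finite functions $u$ on $D$ for which there is a $\mathbf{D}$-Cauchy sequence $\{u_n\}\subset W^{1,2}(D)$ with $u_n\to u$ a.e. It is contained in $\mathrm{BL}(D)$. The form $(\mathcal{E}^{(0)},\mathcal{F}^{(0)})$ is a regular strongly local Dirichlet form on $L^2(\overline{D};m)$, where $m(\partial D)=0$. Reflected Dirichlet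 space: let $\varphi^k(t)=((-k)\vee t)\wedge k$ for $k\in\mathbb{N}$, and for an a.e. finite measurable function $f$ on $D$ put $f_k=\varphi^k\circ f$. Let $\mathcal{F}^{(0)}_{\rm loc}$ be the space of functions that on each relatively compact (relatively) open subset $G$ of $\overline{D}$ coincide $m$-a.e. with some element of $\mathcal{F}^{(0)}$. Then $$\mathcal{F}^{\rm ref}=\Big\{f:\ f_k\in\mathcal{F}^{(0)}_{\rm loc}\text{ for all }k\ge1\text{ and }\sup_{k\ge1}\mathbf{D}(f_k,f_k)<\infty\Big\},\qquad \mathcal{F}^{\rm ref}_a=\mathcal{F}^{\rm ref}\cap L^2(D;m),$$ $$\mathcal{E}^{\rm ref}(f,f)=\tfrac12\int_D|\nabla f(x)|^2dx=\tfrac12\mathbf{D}(f,f),\qquad f\in\mathcal{F}^{\rm ref}.$$ $\mathcal{F}^{\rm ref}$ is called the reflected Dirichlet space and $(\mathcal{E}^{\rm ref},\mathcal{F}^{\rm ref}_a)$ the active reflected Dirichlet form of $(\mathcal{E}^{(0)},\mathcal{F}^{(0)})$. *)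

theory Defs
  imports "HOL-Analysis.Analysis"
begin

text \<open>
  Functions on \<open>D\<close> are total functions whose values outside \<open>D\<close> are irrelevant, and function
  spaces contain every representative of each almost-everywhere class.  For this reason
  measurability on \<open>D\<close> refers to the complete measure \<^term>\<open>lebesgue_on D\<close>.
  Since values are real, every function is finite everywhere; an a.e. finite function is
  represented by changing it on a null set.
\<close>

definition L2_space :: "'a measure \<Rightarrow> ('a \<Rightarrow> real) set" where
  "L2_space M = {u \<in> borel_measurable M. integrable M (\<lambda>x. (u x)\<^sup>2)}"

definition L1_loc :: "'a::euclidean_space set \<Rightarrow> ('a \<Rightarrow> real) set" where
  "L1_loc D = {u \<in> borel_measurable (lebesgue_on D).
     \<forall>K. compact K \<and> K \<subseteq> D \<longrightarrow> set_integrable lebesgue K u}"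

definition L2_loc :: "'a::euclidean_space set \<Rightarrow> ('a \<Rightarrow> real) set" where
  "L2_loc D = {u \<in> borel_measurable (lebesgue_on D).
     \<forall>K. compact K \<and> K \<subseteq> D \<longrightarrow> set_integrable lebesgue K (\<lambda>x. (u x)\<^sup>2)}"

primrec C_k :: "nat \<Rightarrow> ('a::euclidean_space \<Rightarrow> real) \<Rightarrow> bool" where
  "C_k 0 f \<longleftrightarrow> continuous_on UNIV f"
| "C_k (Suc k) f \<longleftrightarrow> f differentiable_on UNIV \<and>
     (\<forall>b\<in>Basis. C_k k (\<lambda>x. frechet_derivative f (at x) b))"

definition test_functions :: "'a::euclidean_space set \<Rightarrow> ('a \<Rightarrow> real) set" where
  "test_functions D = {\<phi>. (\<forall>k. C_k k \<phi>) \<and>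
     compact (closure {x. \<phi> x \<noteq> 0}) \<and> closure {x. \<phi> x \<noteq> 0} \<subseteq> D}"

definition is_weak_pderiv ::
    "'a::euclidean_space set \<Rightarrow> 'a \<Rightarrow> ('a \<Rightarrow> real) \<Rightarrow> ('a \<Rightarrow> real) \<Rightarrow> bool" where
  "is_weak_pderiv D b u g \<longleftrightarrow> u \<in> L1_loc D \<and> g \<in> L1_loc D \<and>
     (\<forall>\<phi>\<in>test_functions D.
        (LINT x|lebesgue_on D. u x * frechet_derivative \<phi> (at x) b) =
        - (LINT x|lebesgue_on D. g x * \<phi> x))"

text \<open>The weak gradient is unique up to null sets where it exists, so the choice is harmless there;
  it is unspecified for a function without a locally integrable weak gradient.\<close>

definition weak_grad ::
    "'a::euclidean_space set \<Rightarrow> ('a \<Rightarrow> real) \<Rightarrow> 'a \<Rightarrow> 'a" where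
  "weak_grad D u = (SOME g. \<forall>b\<in>Basis. is_weak_pderiv D b u (\<lambda>x. g x \<bullet> b))"

definition BL :: "'a::euclidean_space set \<Rightarrow> ('a \<Rightarrow> real) set" where
  "BL D = {u \<in> L2_loc D. \<forall>b\<in>Basis. \<exists>g\<in>L2_space (lebesgue_on D). is_weak_pderiv D b u g}"

definition Dirichlet_int ::
    "'a::euclidean_space set \<Rightarrow> ('a \<Rightarrow> real) \<Rightarrow> ('a \<Rightarrow> real) \<Rightarrow> real" where
  "Dirichlet_int D u v = (LINT x|lebesgue_on D. weak_grad D u x \<bullet> weak_grad D v x)"

text \<open>The same quantity on the diagonal, but with the value \<open>\<infinity>\<close> when the gradient is not square
  integrable.\<close>

definition Dirichlet_int_ext :: "'a::euclidean_space set \<Rightarrow> ('a \<Rightarrow> real) \<Rightarrow> ennreal" where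
  "Dirichlet_int_ext D u = (\<integral>\<^sup>+ x. ennreal ((norm (weak_grad D u x))\<^sup>2) \<partial>lebesgue_on D)"

definition W12 :: "'a::euclidean_space set \<Rightarrow> ('a \<Rightarrow> real) set" where
  "W12 D = BL D \<inter> L2_space (lebesgue_on D)"

definition W12_norm :: "'a::euclidean_space set \<Rightarrow> ('a \<Rightarrow> real) \<Rightarrow> real" where
  "W12_norm D u = sqrt ((LINT x|lebesgue_on D. (u x)\<^sup>2) + Dirichlet_int D u u)"

definition Cc_closure :: "'a::euclidean_space set \<Rightarrow> ('a \<Rightarrow> real) set" where
  "Cc_closure D = {f. continuous_on (closure D) f \<and>
     (\<exists>K. compact K \<and> K \<subseteq> closure D \<and> (\<forall>x\<in>closure D - K. f x = 0))}"

definition Cinf_closure :: "'a::euclidean_space set \<Rightarrow> ('a \<Rightarrow> real) set" where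
  "Cinf_closure D = {f. continuous_on (closure D) f \<and>
     (\<forall>\<epsilon>>0. \<exists>K. compact K \<and> K \<subseteq> closure D \<and> (\<forall>x\<in>closure D - K. \<bar>f x\<bar> < \<epsilon>))}"

definition domain_class :: "'a::euclidean_space set set" where
  "domain_class = {D. D \<noteq> {} \<and> connected D \<and> open D \<and>
     (\<forall>u\<in>W12 D. \<forall>\<epsilon>>0. \<exists>v\<in>W12 D \<inter> Cc_closure D. W12_norm D (\<lambda>x. u x - v x) < \<epsilon>) \<and>
     (\<forall>f\<in>Cinf_closure D. \<forall>\<epsilon>>0. \<exists>v\<in>W12 D \<inter> Cc_closure D. \<forall>x\<in>closure D. \<bar>f x - v x\<bar> < \<epsilon>)}"

text \<open>The second clause says that form and domain depend only on almost-everywhere classes.\<close>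

definition dirichlet_form ::
    "'a measure \<Rightarrow> (('a \<Rightarrow> real) \<Rightarrow> ('a \<Rightarrow> real) \<Rightarrow> real) \<Rightarrow> ('a \<Rightarrow> real) set \<Rightarrow> bool" where
  "dirichlet_form M \<E> \<F> \<longleftrightarrow>
     \<F> \<subseteq> L2_space M \<and>
     (\<forall>u\<in>\<F>. \<forall>v\<in>borel_measurable M. (AE x in M. u x = v x) \<longrightarrow> v \<in> \<F> \<and> (\<forall>w\<in>\<F>. \<E> v w = \<E> u w)) \<and>
     (\<forall>u\<in>\<F>. \<forall>v\<in>\<F>. \<forall>a b. (\<lambda>x. a * u x + b * v x) \<in> \<F> \<and>
        (\<forall>w\<in>\<F>. \<E> (\<lambda>x. a * u x + b * v x) w = a * \<E> u w + b * \<E> v w)) \<and>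
     (\<forall>u\<in>\<F>. \<forall>v\<in>\<F>. \<E> u v = \<E> v u) \<and>
     (\<forall>u\<in>\<F>. 0 \<le> \<E> u u) \<and>
     (\<forall>f\<in>L2_space M. \<forall>\<epsilon>>0. \<exists>u\<in>\<F>. (LINT x|M. (f x - u x)\<^sup>2) < \<epsilon>) \<and>
     (let \<E>1 = (\<lambda>u. \<E> u u + (LINT x|M. (u x)\<^sup>2)) in
        \<forall>u. (\<forall>n::nat. u n \<in> \<F>) \<and>
            (\<forall>\<epsilon>>0. \<exists>N. \<forall>i\<ge>N. \<forall>j\<ge>N. \<E>1 (\<lambda>x. u i x - u j x) < \<epsilon>) \<longrightarrow>
            (\<exists>v\<in>\<F>. (\<lambda>n. \<E>1 (\<lambda>x. u n x - v x)) \<longlonglongrightarrow> 0)) \<and>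
     (\<forall>u\<in>\<F>. (\<lambda>x. min (max (u x) 0) 1) \<in> \<F> \<and>
        \<E> (\<lambda>x. min (max (u x) 0) 1) (\<lambda>x. min (max (u x) 0) 1) \<le> \<E> u u)"

definition same_form ::
    "(('a \<Rightarrow> real) \<Rightarrow> ('a \<Rightarrow> real) \<Rightarrow> real) \<times> ('a \<Rightarrow> real) set \<Rightarrow>
     (('a \<Rightarrow> real) \<Rightarrow> ('a \<Rightarrow> real) \<Rightarrow> real) \<times> ('a \<Rightarrow> real) set \<Rightarrow> bool" where
  "same_form A B \<longleftrightarrow> snd A = snd B \<and> (\<forall>u\<in>snd A. \<forall>v\<in>snd A. fst A u v = fst B u v)"

text \<open>Concentrated on \<open>D\<close> even if the boundary of \<open>D\<close> has positive Lebesgue measure.\<close>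

definition weighted :: "'a::euclidean_space set \<Rightarrow> ('a \<Rightarrow> real) \<Rightarrow> 'a measure" where
  "weighted D m = density (lebesgue_on D) (\<lambda>x. ennreal (m x))"

definition W12_ext :: "'a::euclidean_space set \<Rightarrow> ('a \<Rightarrow> real) set" where
  "W12_ext D = {u \<in> borel_measurable (lebesgue_on D). \<exists>w. (\<forall>n::nat. w n \<in> W12 D) \<and>
     (\<forall>\<epsilon>>0. \<exists>N. \<forall>i\<ge>N. \<forall>j\<ge>N.
        Dirichlet_int D (\<lambda>x. w i x - w j x) (\<lambda>x. w i x - w j x) < \<epsilon>) \<and>
     (AE x in lebesgue_on D. (\<lambda>n. w n x) \<longlonglongrightarrow> u x)}"

definition F0 :: "'a::euclidean_space set \<Rightarrow> ('a \<Rightarrow> real) \<Rightarrow> ('a \<Rightarrow> real) set" where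
  "F0 D m = W12_ext D \<inter> L2_space (weighted D m)"

definition F0_loc :: "'a::euclidean_space set \<Rightarrow> ('a \<Rightarrow> real) \<Rightarrow> ('a \<Rightarrow> real) set" where
  "F0_loc D m = {f. \<forall>G. openin (top_of_set (closure D)) G \<and> compact (closure G) \<longrightarrow>
     (\<exists>u\<in>F0 D m. AE x in weighted D m. x \<in> G \<longrightarrow> f x = u x)}"

definition trunc :: "nat \<Rightarrow> real \<Rightarrow> real" where
  "trunc k t = min (max (- real k) t) (real k)"

definition F_ref :: "'a::euclidean_space set \<Rightarrow> ('a \<Rightarrow> real) \<Rightarrow> ('a \<Rightarrow> real) set" where
  "F_ref D m = {f \<in> borel_measurable (lebesgue_on D).
     (\<forall>k\<ge>1. trunc k \<circ> f \<in> F0_loc D m) \<and>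
     (SUP k\<in>{1..}. Dirichlet_int_ext D (trunc k \<circ> f)) < \<infinity>}"

definition F_ref_active :: "'a::euclidean_space set \<Rightarrow> ('a \<Rightarrow> real) \<Rightarrow> ('a \<Rightarrow> real) set" where
  "F_ref_active D m = F_ref D m \<inter> L2_space (weighted D m)"

definition E_ref_diag :: "'a::euclidean_space set \<Rightarrow> ('a \<Rightarrow> real) \<Rightarrow> real" where
  "E_ref_diag D f = 1/2 * (LINT x|lebesgue_on D. (norm (weak_grad D f x))\<^sup>2)"

text \<open>The reflected form is given by its diagonal values; polarization gives the bilinear form.\<close>

definition E_ref ::
    "'a::euclidean_space set \<Rightarrow> ('a \<Rightarrow> real) \<Rightarrow> ('a \<Rightarrow> real) \<Rightarrow> real" where
  "E_ref D f g =
     1/2 * (E_ref_diag D (\<lambda>x. f x + g x) - E_ref_diag D f - E_ref_diag D g)"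

end

theory Submission
  imports Defs
begin

text \<open>
Both inclusions between \<open>BL D\<close> and the reflected Dirichlet space, and the closedness of the
weighted form, come down to two local facts about a function \<open>u\<close> with weak derivatives: how the
gradient behaves under truncation, and how \<open>u\<close> is controlled in \<open>L\<^sup>2\<close> of a ball by its Dirichlet
integral.  Both follow from one identity.  If \<open>g\<close> is the weak derivative of \<open>u\<close> in direction \<open>b\<close>,
then \<open>u (x + t b) - u x\<close> equals the integral of \<open>g (x + s b)\<close> over \<open>0 \<le> s \<le> t\<close> for almost every \<open>x\<close>
(\<open>weak_deriv_translation\<close>): paired with a test function this is the fundamental theorem of
calculus for the test function and Fubini's theorem, and the fundamental lemma
\<open>L1_loc_zero_if_weakly_zero\<close> removes the test function.  Hence a translation by \<open>t b\<close> moves \<open>u\<close> by at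
most \<open>t\<close> times the norm of \<open>g\<close> in \<open>L\<^sup>2\<close>.

Truncation.  For \<open>F\<close> with bounded Lipschitz derivative, the difference quotients of \<open>F \<circ> u\<close> and of
\<open>u\<close> are compared directly; every error is quadratic in the step by the translation estimate, so no
mollification enters (\<open>chain_rule_whole_space\<close>).  A dominated limit gives the positive part, and
linearity gives clipping: the gradient is kept where \<open>u\<close> is not clipped and is \<open>0\<close> elsewhere
(\<open>BL_clip\<close>).  This is the Markov property of the form, and it shows that the truncations of a
function in \<open>BL D\<close> have uniformly bounded Dirichlet integrals.

Local control.  Averaging the translation estimate over all short translations bounds the double
integral of \<open>(v y - v x)\<^sup>2\<close> over a ball (\<open>local_Poincare\<close>).  Consequently the \<open>L\<^sup>2\<close> norm of \<open>v\<close> on the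
ball is controlled by the Dirichlet integral and by the \<open>L\<^sup>2\<close> norm on any subset \<open>E\<close> of positive
measure (\<open>Poincare_lebesgue_on\<close>).  A finite function, or an almost everywhere convergent sequence, is
bounded on such a set \<open>E\<close>.  So a sequence that is Cauchy for the Dirichlet integral and converges
almost everywhere converges in \<open>L\<^sup>2\<close> locally, whence \<open>W12_ext D \<subseteq> BL D\<close> (\<open>W12_ext_subset_BL\<close>); and a
function whose truncations have bounded Dirichlet integrals is locally square integrable
(\<open>F_ref_L2_loc\<close>).

Given this, \<open>BL D\<close> is contained in the reflected space because a truncation can be clipped between
\<open>- \<psi>\<close> and \<open>\<psi>\<close> for a large bump function \<open>\<psi>\<close>, which gives an element of \<open>W12 D\<close> agreeing with it on a
prescribed bounded set (\<open>bounded_BL_in_F0_loc\<close>).  Conversely, the gradients of the local pieces of a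
truncation are pasted together, and the gradients of the truncations stabilize at every point as
the level grows, which produces the gradient of the limit (\<open>F_ref_subset_BL\<close>).  The weighted form is
complete because \<open>L\<^sup>2\<close> is and because the weight is bounded below on compact sets, and it is densely
defined because members of the domain class have enough continuous functions in \<open>W12 D\<close>.  On
\<open>BL D\<close> the polarized energy is half the Dirichlet integral since the weak gradient is linear up to
null sets.
\<close>

section \<open>Smooth bump functions\<close>

lemma C_k_Suc_imp:
  assumes "C_k (Suc k) f" shows "C_k k f"
  using assms
proof (induction k arbitrary: f)
  case 0
  then show ?case by (auto intro: differentiable_imp_continuous_on)
next
  case (Suc k)
  from Suc.prems have "f differentiable_on UNIV" and
    "\<And>b. b \<in> Basis \<Longrightarrow> C_k (Suc k) (\<lambda>x. frechet_derivative f (at x) b)" 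
    unfolding C_k.simps(2)[of "Suc k"] by auto
  then show ?case using Suc.IH by auto
qed

lemma C_k_const: "C_k k (\<lambda>x::'a::euclidean_space. c)"
  by (induction k arbitrary: c) (auto simp: frechet_derivative_const)

lemma C_k_add:
  assumes "C_k k f" "C_k k g" shows "C_k k (\<lambda>x. f x + g x)"
  using assms
proof (induction k arbitrary: f g)
  case 0 then show ?case by (auto intro: continuous_intros)
next
  case (Suc k)
  then have d: "f differentiable (at x)" "g differentiable (at x)" for x
    by (auto simp: differentiable_on_def)
  have "frechet_derivative (\<lambda>x. f x + g x) (at x) b =
        frechet_derivative f (at x) b + frechet_derivative g (at x) b" for x b
    using frechet_derivative_at[OF has_derivative_add[OF frechet_derivative_works[THEN iffD1, OF d(1)[of x]]
        frechet_derivative_works[THEN iffD1, OF d(2)[of x]]]]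
    by metis
  with Suc show ?case by (auto intro!: Suc.IH)
qed

lemma C_k_mult:
  assumes "C_k k f" "C_k k g" shows "C_k k (\<lambda>x. f x * g x)"
  using assms
proof (induction k arbitrary: f g)
  case 0 then show ?case by (auto intro: continuous_intros)
next
  case (Suc k)
  then have d: "f differentiable (at x)" "g differentiable (at x)" for x
    by (auto simp: differentiable_on_def)
  have "frechet_derivative (\<lambda>x. f x * g x) (at x) b =
        f x * frechet_derivative g (at x) b + frechet_derivative f (at x) b * g x" for x b
    using frechet_derivative_at[OF has_derivative_mult[OF frechet_derivative_works[THEN iffD1, OF d(1)[of x]]
        frechet_derivative_works[THEN iffD1, OF d(2)[of x]]]]
    by metis
  moreover have "C_k k f" "C_k k g" using Suc.prems C_k_Suc_imp by blast+
  ultimately show ?case using Suc by (auto intro!: Suc.IH C_k_add)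
qed

lemma C_k_prod:
  assumes "finite S" "\<And>i. i \<in> S \<Longrightarrow> C_k k (f i)"
  shows "C_k k (\<lambda>x. \<Prod>i\<in>S. f i x)"
  using assms by (induction S rule: finite_induct) (auto intro: C_k_const C_k_mult)

lemma C_k_power: "C_k k f \<Longrightarrow> C_k k (\<lambda>x. f x ^ n)"
  by (induction n) (auto intro: C_k_const C_k_mult)

lemma frechet_derivative_shift:
  fixes f :: "'a::euclidean_space \<Rightarrow> real"
  assumes "f differentiable (at (x + a))"
  shows "frechet_derivative (\<lambda>x. f (x + a)) (at x) = frechet_derivative f (at (x + a))"
    and "(\<lambda>x. f (x + a)) differentiable (at x)"
proof -
  have f: "(f has_derivative frechet_derivative f (at (x + a))) (at (x + a))"
    using assms frechet_derivative_works by blast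
  have "((\<lambda>x. x + a) has_derivative (\<lambda>h. h)) (at x)" by (auto intro!: derivative_eq_intros)
  from has_derivative_compose[OF this f]
  have "((\<lambda>x. f (x + a)) has_derivative frechet_derivative f (at (x + a))) (at x)" by simp
  then show "frechet_derivative (\<lambda>x. f (x + a)) (at x) = frechet_derivative f (at (x + a))"
    "(\<lambda>x. f (x + a)) differentiable (at x)"
    by (metis frechet_derivative_at, auto simp: differentiable_def)
qed

lemma C_k_shift: "C_k k f \<Longrightarrow> C_k k (\<lambda>x. f (x + a))"
proof (induction k arbitrary: f)
  case 0
  then have "continuous_on UNIV f" by simp
  then have "continuous_on UNIV (\<lambda>x. f (x + a))"
    by (rule continuous_on_compose2) (auto intro: continuous_intros)
  then show ?case by simp
next
  case (Suc k)
  then have d: "f differentiable (at x)" for x by (auto simp: differentiable_on_def)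
  then show ?case using Suc by (auto simp: differentiable_on_def frechet_derivative_shift)
qed

text \<open>
For \<open>p = 1\<close> this is the classical smooth function that vanishes to infinite order at \<open>0\<close>.  The
polynomial factor makes the family closed under differentiation, so that smoothness is a plain
induction.
\<close>

definition flat :: "real poly \<Rightarrow> real \<Rightarrow> real" where
  "flat p t = (if t > 0 then poly p (1 / t) * exp (- (1 / t)) else 0)"

lemma poly_exp_tendsto_0: "((\<lambda>s::real. poly p s * exp (- s)) \<longlongrightarrow> 0) at_top"
proof -
  have "((\<lambda>s::real. \<Sum>i\<le>degree p. coeff p i * (s ^ i / exp s)) \<longlongrightarrow> (\<Sum>i\<le>degree p. coeff p i * 0)) at_top"
    by (intro tendsto_intros tendsto_power_div_exp_0)
  then show ?thesis
    by (simp add: poly_altdef sum_distrib_right exp_minus divide_inverse mult.assoc)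
qed

lemma flat_tendsto_0: "((\<lambda>h. flat p h) \<longlongrightarrow> 0) (at 0)"
proof (rule filterlim_split_at)
  show "(flat p \<longlongrightarrow> 0) (at_left 0)"
    by (rule tendsto_eventually, rule eventually_mono[OF eventually_at_left_real[of "-1" 0]])
      (auto simp: flat_def)
  have "((\<lambda>h. poly p (inverse h) * exp (- inverse h)) \<longlongrightarrow> 0) (at_right (0::real))"
    by (rule filterlim_compose[OF poly_exp_tendsto_0 filterlim_inverse_at_top_right])
  moreover have "\<forall>\<^sub>F h in at_right 0. poly p (inverse h) * exp (- inverse h) = flat p h"
    by (rule eventually_mono[OF eventually_at_right_less[of 0]])
      (auto simp: flat_def inverse_eq_divide)
  ultimately show "(flat p \<longlongrightarrow> 0) (at_right 0)"
    by (rule Lim_transform_eventually)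
qed

text \<open>
At \<open>0\<close> the difference quotient is again a member of the family, and every member tends to \<open>0\<close> there.
\<close>

lemma flat_has_derivative:
  "(flat p has_real_derivative flat ([:0, 0, 1:] * (p - pderiv p)) t) (at t)"
proof -
  consider "t > 0" | "t < 0" | "t = 0" by linarith
  then show ?thesis
  proof cases
    case 1
    have d: "((\<lambda>t. poly p (1 / t) * exp (- (1 / t))) has_real_derivative
        flat ([:0, 0, 1:] * (p - pderiv p)) t) (at t)"
    proof -
      have inv: "((\<lambda>t. 1 / t) has_real_derivative - (1 / t)\<^sup>2) (at t)"
        using 1 by (auto intro!: derivative_eq_intros simp: power2_eq_square)
      have d: "((\<lambda>t. poly p (1 / t) * exp (- (1 / t))) has_real_derivative
          (poly (pderiv p) (1 / t) * - (1 / t)\<^sup>2) * exp (- (1 / t)) +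
          (exp (- (1 / t)) * - (- (1 / t)\<^sup>2)) * poly p (1 / t)) (at t)"
        by (rule DERIV_mult[OF DERIV_chain2[OF poly_DERIV inv]
              DERIV_chain2[OF DERIV_exp DERIV_minus[OF inv]]])
      have "(poly (pderiv p) (1 / t) * - (1 / t)\<^sup>2) * exp (- (1 / t)) +
          (exp (- (1 / t)) * - (- (1 / t)\<^sup>2)) * poly p (1 / t) =
          flat ([:0, 0, 1:] * (p - pderiv p)) t"
        using 1 by (simp add: flat_def power2_eq_square right_diff_distrib mult_ac)
      from DERIV_cong[OF d this] show ?thesis .
    qed
    have ev: "\<forall>\<^sub>F s in nhds t. poly p (1 / s) * exp (- (1 / s)) = flat p s"
      using eventually_nhds_in_open[of "{0<..}" t] 1
      by (auto elim!: eventually_mono simp: flat_def)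
    from d show ?thesis
      by (simp only: DERIV_cong_ev[OF refl ev refl])
  next
    case 2
    have d: "((\<lambda>t. 0) has_real_derivative flat ([:0, 0, 1:] * (p - pderiv p)) t) (at t)"
      using 2 by (auto simp: flat_def)
    have ev: "\<forall>\<^sub>F s in nhds t. 0 = flat p s"
      using eventually_nhds_in_open[of "{..<0}" t] 2
      by (auto elim!: eventually_mono simp: flat_def)
    from d show ?thesis by (simp only: DERIV_cong_ev[OF refl ev refl])
  next
    case 3
    have l: "((\<lambda>h. flat ([:0, 1:] * p) h) \<longlongrightarrow> 0) (at 0)" by (rule flat_tendsto_0)
    have e: "(flat p (0 + h) - flat p 0) / h = flat ([:0, 1:] * p) h" for h
      by (auto simp: flat_def)
    have "(flat p has_real_derivative 0) (at 0)"
      unfolding DERIV_def e by (rule l)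
    then show ?thesis using 3 by (simp add: flat_def)
  qed
qed

lemma C_k_flat_affine:
  fixes i :: "'a::euclidean_space"
  shows "C_k k (\<lambda>x::'a. flat p (c * (x \<bullet> i) + d))"
proof (induction k arbitrary: p)
  case 0
  have "continuous_on UNIV (flat p)"
    using flat_has_derivative by (meson DERIV_isCont continuous_at_imp_continuous_on)
  then show ?case
    by (auto intro!: continuous_on_compose2[of UNIV "flat p"] continuous_intros)
next
  case (Suc k)
  have D: "((\<lambda>x::'a. flat p (c * (x \<bullet> i) + d)) has_derivative
     (\<lambda>h. (c * (h \<bullet> i)) * flat ([:0, 0, 1:] * (p - pderiv p)) (c * (x \<bullet> i) + d))) (at x)" for x
  proof -
    have "((\<lambda>x::'a. c * (x \<bullet> i) + d) has_derivative (\<lambda>h. c * (h \<bullet> i))) (at x)"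
      by (auto intro!: derivative_eq_intros)
    from has_derivative_compose[OF this flat_has_derivative[unfolded has_field_derivative_def]]
    show ?thesis by (simp add: mult.commute)
  qed
  have "frechet_derivative (\<lambda>x::'a. flat p (c * (x \<bullet> i) + d)) (at x) b =
     (c * (b \<bullet> i)) * flat ([:0, 0, 1:] * (p - pderiv p)) (c * (x \<bullet> i) + d)" for x b
    using frechet_derivative_at[OF D] by metis
  moreover have "(\<lambda>x::'a. flat p (c * (x \<bullet> i) + d)) differentiable_on UNIV"
    using D by (auto simp: differentiable_on_def differentiable_def)
  ultimately show ?case by (auto intro!: C_k_mult C_k_const Suc.IH)
qed

definition bump :: "'a::euclidean_space \<Rightarrow> 'a \<Rightarrow> 'a \<Rightarrow> real" where
  "bump a b x = (\<Prod>i\<in>Basis. flat 1 (x \<bullet> i - a \<bullet> i) * flat 1 (b \<bullet> i - x \<bullet> i))"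

lemma flat_1_bounds: "0 \<le> flat 1 t" "flat 1 t < 1" "flat 1 t > 0 \<longleftrightarrow> t > 0"
  by (auto simp: flat_def)

lemma C_k_bump: "C_k k (bump a b)"
proof -
  have "C_k k (\<lambda>x. flat 1 (x \<bullet> i - a \<bullet> i))" for i
    using C_k_flat_affine[of k 1 1 i "- (a \<bullet> i)"] by simp
  moreover have "C_k k (\<lambda>x. flat 1 (b \<bullet> i - x \<bullet> i))" for i
    using C_k_flat_affine[of k 1 "-1" i "b \<bullet> i"] by (simp add: algebra_simps)
  ultimately show ?thesis
    unfolding bump_def[abs_def] by (intro C_k_prod finite_Basis C_k_mult)
qed

lemma bump_nonneg: "0 \<le> bump a b x"
  unfolding bump_def by (intro prod_nonneg mult_nonneg_nonneg flat_1_bounds)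

lemma bump_le_1: "bump a b x \<le> 1"
  unfolding bump_def
  by (intro prod_le_1 conjI mult_nonneg_nonneg flat_1_bounds mult_le_one less_imp_le)

lemma bump_pos_iff: "bump a b x > 0 \<longleftrightarrow> x \<in> box a b"
proof
  assume pos: "bump a b x > 0"
  show "x \<in> box a b"
    unfolding mem_box
  proof
    fix i :: 'a assume i: "i \<in> Basis"
    have "flat 1 (x \<bullet> i - a \<bullet> i) * flat 1 (b \<bullet> i - x \<bullet> i) \<noteq> 0"
    proof
      assume "flat 1 (x \<bullet> i - a \<bullet> i) * flat 1 (b \<bullet> i - x \<bullet> i) = 0"
      then have "bump a b x = 0" unfolding bump_def using i by (intro prod_zero) auto
      with pos show False by simp
    qed
    then have "x \<bullet> i - a \<bullet> i > 0 \<and> b \<bullet> i - x \<bullet> i > 0"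
      by (simp add: flat_def split: if_splits)
    then show "a \<bullet> i < x \<bullet> i \<and> x \<bullet> i < b \<bullet> i" by auto
  qed
next
  assume x: "x \<in> box a b"
  have "0 < flat 1 (x \<bullet> i - a \<bullet> i) * flat 1 (b \<bullet> i - x \<bullet> i)" if "i \<in> Basis" for i
    using x that by (simp add: flat_1_bounds(3) mem_box)
  then show "bump a b x > 0" unfolding bump_def by (rule prod_pos)
qed

lemma bump_eq_0: "x \<notin> box a b \<Longrightarrow> bump a b x = 0"
  using bump_pos_iff[of a b x] bump_nonneg[of a b x] by linarith

lemma test_functionsI:
  assumes "\<And>k. C_k k \<phi>" "compact K" "K \<subseteq> D" "\<And>x. x \<notin> K \<Longrightarrow> \<phi> x = 0"
  shows "\<phi> \<in> test_functions D"
proof -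
  have "closure {x. \<phi> x \<noteq> 0} \<subseteq> K"
    using assms by (intro closure_minimal) (auto simp: compact_imp_closed)
  moreover have "compact (closure {x. \<phi> x \<noteq> 0})"
    unfolding compact_closure
    by (rule bounded_subset[OF compact_imp_bounded[OF assms(2)]]) (use assms(4) in blast)
  ultimately show ?thesis using assms unfolding test_functions_def by blast
qed

text \<open>
The bump function lies in \<open>[0,1]\<close> and is positive exactly on the open box, so these smooth functions
increase to the indicator of the box; they are polynomials in the bump function, hence smooth.
\<close>

definition box_approx :: "'a::euclidean_space \<Rightarrow> 'a \<Rightarrow> nat \<Rightarrow> 'a \<Rightarrow> real" where
  "box_approx a b n x = 1 - (1 - bump a b x) ^ n"

lemma box_approx_test:
  assumes "cbox a b \<subseteq> D" shows "box_approx a b n \<in> test_functions D"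
proof (rule test_functionsI)
  have "C_k k (\<lambda>x. 1 + (-1) * (1 + (-1) * bump a b x) ^ n)" for k
    by (intro C_k_add C_k_const C_k_mult C_k_power C_k_bump[unfolded eta_contract_eq])
  then show "C_k k (box_approx a b n)" for k
    by (simp add: box_approx_def[abs_def])
  show "box_approx a b n x = 0" if "x \<notin> cbox a b" for x
  proof -
    have "x \<notin> box a b" using that box_subset_cbox[of a b] by blast
    then show ?thesis by (simp add: box_approx_def bump_eq_0)
  qed
qed (use assms in auto)

lemma box_approx_bounds: "0 \<le> box_approx a b n x" "box_approx a b n x \<le> 1"
  using bump_le_1[of a b x] bump_nonneg[of a b x]
  by (auto simp: box_approx_def intro: power_le_one)

lemma box_approx_tendsto: "(\<lambda>n. box_approx a b n x) \<longlonglongrightarrow> indicator (box a b) x"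
proof (cases "x \<in> box a b")
  case True
  then have "\<bar>1 - bump a b x\<bar> < 1" using bump_le_1[of a b x] bump_pos_iff[of a b x] by auto
  from LIMSEQ_abs_realpow_zero2[OF this] have "(\<lambda>n. 1 - (1 - bump a b x) ^ n) \<longlonglongrightarrow> 1 - 0"
    by (rule tendsto_diff[OF tendsto_const])
  then show ?thesis using True by (simp add: box_approx_def)
next
  case False
  then show ?thesis by (simp add: box_approx_def bump_eq_0)
qed

section \<open>The fundamental lemma of the calculus of variations\<close>

lemma enn2real_inject:
  assumes "enn2real a = enn2real b" "a < top" "b < top" shows "a = b"
proof -
  have "a = ennreal (enn2real a)" by (rule sym, rule ennreal_enn2real) fact
  also have "\<dots> = ennreal (enn2real b)" by (simp only: assms(1))
  also have "\<dots> = b" by (rule ennreal_enn2real) fact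
  finally show ?thesis .
qed

text \<open>
The positive and the negative part of \<open>g\<close> are densities of two measures that agree on boxes, hence
on all Borel sets, so they coincide almost everywhere.
\<close>

lemma AE_zero_if_integral_box_zero:
  fixes g :: "'a::euclidean_space \<Rightarrow> real"
  assumes int: "integrable lborel g"
    and zero: "\<And>a b. (LINT x|lborel. indicator (box a b) x * g x) = 0"
  shows "AE x in lborel. g x = 0"
proof -
  have [measurable]: "g \<in> borel_measurable borel" using int by auto
  let ?M = "\<lambda>h. density lborel (\<lambda>x. ennreal (h x))"
  have fin: "(\<integral>\<^sup>+x. ennreal (s * g x) * indicator A x \<partial>lborel) < \<infinity>"
    if "s \<in> {1, -1}" "A \<in> sets borel" for s A
  proof -
    have "(\<integral>\<^sup>+x. ennreal (s * g x) * indicator A x \<partial>lborel) \<le> (\<integral>\<^sup>+x. ennreal (norm (g x)) \<partial>lborel)"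
      using that by (intro nn_integral_mono) (auto split: split_indicator intro: ennreal_leI)
    also have "\<dots> < \<infinity>" using int by (auto simp: integrable_iff_bounded)
    finally show ?thesis .
  qed
  have eq: "?M g = ?M (\<lambda>x. - g x)"
  proof (rule measure_eqI_generator_eq[where E = "range (\<lambda>(a, b). box a b)" and \<Omega> = UNIV
        and A = "\<lambda>n::nat. box (- (real n *\<^sub>R One)) (real n *\<^sub>R One)"])
    show "Int_stable (range (\<lambda>(a, b). box a b))"
      by (auto simp: Int_stable_def box_Int_box)
    fix X assume "X \<in> range (\<lambda>(a, b). box a b :: 'a set)"
    then obtain a b where X: "X = box a b" by auto
    have I: "integrable lborel (\<lambda>x. indicator (box a b) x * g x)"
      using integrable_mult_indicator[OF _ int, of "box a b"] by simp
    have e: "(\<integral>\<^sup>+x. ennreal (s * (indicator (box a b) x * g x)) \<partial>lborel) =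
        (\<integral>\<^sup>+x. ennreal (s * g x) * indicator (box a b) x \<partial>lborel)" for s :: real
      by (intro nn_integral_cong) (auto split: split_indicator)
    have "enn2real (\<integral>\<^sup>+x. ennreal (1 * g x) * indicator (box a b) x \<partial>lborel) =
      enn2real (\<integral>\<^sup>+x. ennreal (-1 * g x) * indicator (box a b) x \<partial>lborel)"
      using zero[of a b] real_lebesgue_integral_def[OF I] e[of 1] e[of "-1"] by simp
    moreover have "(\<integral>\<^sup>+x. ennreal (1 * g x) * indicator (box a b) x \<partial>lborel) < top"
      "(\<integral>\<^sup>+x. ennreal (-1 * g x) * indicator (box a b) x \<partial>lborel) < top"
      using fin[of 1 "box a b"] fin[of "-1" "box a b"] by simp_all
    ultimately have "(\<integral>\<^sup>+x. ennreal (1 * g x) * indicator (box a b) x \<partial>lborel) =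
      (\<integral>\<^sup>+x. ennreal (-1 * g x) * indicator (box a b) x \<partial>lborel)"
      by (rule enn2real_inject)
    then show "emeasure (?M g) X = emeasure (?M (\<lambda>x. - g x)) X"
      by (simp add: X emeasure_density)
  next
    fix n
    show "emeasure (?M g) (box (- (real n *\<^sub>R One)) (real n *\<^sub>R One)) \<noteq> \<infinity>"
      using fin[of 1 "box (- (real n *\<^sub>R One)) (real n *\<^sub>R One)"] by (simp add: emeasure_density)
  qed (auto simp: borel_eq_box UN_box_eq_UNIV)
  have "AE x in lborel. ennreal (g x) = ennreal (- g x)"
    by (rule sigma_finite_measure.density_unique[OF sigma_finite_lborel _ _ eq]) auto
  then show ?thesis
  proof eventually_elim
    case (elim x)
    then show "g x = 0"
      by (cases "g x \<ge> 0") (auto simp: ennreal_neg ennreal_eq_0_iff dest!: sym[of 0])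
  qed
qed

lemma lebesgue_ex_borel_version:
  fixes g :: "'a::euclidean_space \<Rightarrow> real"
  assumes "integrable lebesgue g"
  obtains g' where "g' \<in> borel_measurable borel" "integrable lborel g'" "AE x in lebesgue. g x = g' x"
proof -
  obtain g' where g': "g' \<in> borel_measurable lborel" "AE x in lborel. g x = g' x"
    using completion_ex_borel_measurable_real[of g lborel] assms by auto
  have ae: "AE x in lebesgue. g x = g' x" using g'(2) AE_completion by blast
  have "integrable lebesgue g'"
    using assms ae g'(1) integrable_cong_AE[of g lebesgue g'] measurable_completion by blast
  then have "integrable lborel g'" using g'(1) integrable_completion by blast
  then show thesis using that g' ae by auto
qed

lemma test_functions_zero: "\<phi> \<in> test_functions D \<Longrightarrow> x \<notin> D \<Longrightarrow> \<phi> x = 0"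
  using closure_subset[of "{x. \<phi> x \<noteq> 0}"] by (auto simp: test_functions_def)

lemma continuous_on_imp_borel: "continuous_on UNIV f \<Longrightarrow> f \<in> borel_measurable lborel"
  by (simp add: borel_measurable_continuous_onI)

lemma AE_not_in_frontier_interval:
  "AE x in lebesgue. x \<notin> cbox c d - box c (d :: 'a::euclidean_space)"
  by (rule AE_not_in[OF negligible_iff_null_sets[THEN iffD1, OF negligible_frontier_interval]])

text \<open>
Approximating indicators of boxes by test functions shows that the integral of \<open>g\<close> over every box
with closure in \<open>D\<close> vanishes.  Countably many such boxes cover \<open>D\<close>.
\<close>

lemma L1_loc_zero_if_weakly_zero:
  fixes g :: "'a::euclidean_space \<Rightarrow> real"
  assumes "open D" "g \<in> L1_loc D"
    and zero: "\<And>\<phi>. \<phi> \<in> test_functions D \<Longrightarrow> (LINT x|lebesgue_on D. g x * \<phi> x) = 0"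
  shows "AE x in lebesgue_on D. g x = 0"
proof -
  have D: "D \<in> sets lebesgue" using \<open>open D\<close> by auto
  have loc: "AE x in lebesgue. x \<in> cbox c d \<longrightarrow> g x = 0" if cd: "cbox c d \<subseteq> D" for c d
  proof -
    define h where "h x = indicator (cbox c d) x * g x" for x
    have h: "integrable lebesgue h"
      using assms(2) cd unfolding L1_loc_def h_def set_integrable_def by auto
    have h0: "(LINT x|lebesgue. indicator (box a b) x * h x) = 0" for a b
    proof -
      define a' where "a' = (\<Sum>i\<in>Basis. max (a \<bullet> i) (c \<bullet> i) *\<^sub>R i)"
      define b' where "b' = (\<Sum>i\<in>Basis. min (b \<bullet> i) (d \<bullet> i) *\<^sub>R i)"
      have ab: "box a b \<inter> box c d = box a' b'" unfolding a'_def b'_def by (rule box_Int_box)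
      show ?thesis
      proof (cases "box a' b' = {}")
        case True
        have "AE x in lebesgue. x \<notin> cbox c d - box c d"
          by (rule AE_not_in_frontier_interval)
        then have "AE x in lebesgue. indicator (box a b) x * h x = 0"
          by eventually_elim (use True ab in \<open>auto simp: h_def split: split_indicator\<close>)
        then show ?thesis by (rule integral_eq_zero_AE)
      next
        case False
        then have sub: "cbox a' b' \<subseteq> cbox c d"
          using ab by (metis closure_box closure_mono Int_lower2 Int_empty_right)
        then have subD: "cbox a' b' \<subseteq> D" using cd by auto
        let ?\<phi> = "\<lambda>n. box_approx a' b' n"
        have test: "?\<phi> n \<in> test_functions D" for n by (rule box_approx_test[OF subD])
        have z: "?\<phi> n x = 0" if "x \<notin> cbox c d" for n x
          using that sub test_functions_zero[OF box_approx_test[OF order_refl], of x a' b' n] by auto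
        have "(LINT x|lebesgue. ?\<phi> n x * h x) = 0" for n
        proof -
          have "(LINT x|lebesgue. ?\<phi> n x * h x) = (LINT x|lebesgue. indicator D x *\<^sub>R (g x * ?\<phi> n x))"
            using z cd by (intro Bochner_Integration.integral_cong) (auto simp: h_def split: split_indicator)
          also have "\<dots> = (LINT x|lebesgue_on D. g x * ?\<phi> n x)"
            using D by (simp add: integral_restrict_space)
          finally show ?thesis using zero[OF test] by simp
        qed
        moreover have "(\<lambda>n. LINT x|lebesgue. ?\<phi> n x * h x) \<longlonglongrightarrow>
            (LINT x|lebesgue. indicator (box a' b') x * h x)"
        proof (rule integral_dominated_convergence[where w = "\<lambda>x. \<bar>h x\<bar>"])
          have "continuous_on UNIV (?\<phi> n)" for n
            using test[of n] by (auto simp: test_functions_def dest: spec[of _ 0])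
          from this[THEN continuous_on_imp_borel] 
          have [measurable]: "?\<phi> n \<in> borel_measurable lebesgue" for n
            using measurable_completion by blast
          have [measurable]: "h \<in> borel_measurable lebesgue" using h by auto
          show "(\<lambda>x. ?\<phi> n x * h x) \<in> borel_measurable lebesgue" for n by measurable
          have "box a' b' \<in> sets lebesgue" by auto
          then show "(\<lambda>x. indicator (box a' b') x * h x) \<in> borel_measurable lebesgue" by measurable
          show "AE x in lebesgue. (\<lambda>n. ?\<phi> n x * h x) \<longlonglongrightarrow> indicator (box a' b') x * h x"
            by (intro AE_I2 tendsto_intros box_approx_tendsto)
          show "AE x in lebesgue. norm (?\<phi> n x * h x) \<le> \<bar>h x\<bar>" for n
            using box_approx_bounds[of a' b' n] by (intro AE_I2) (auto simp: abs_mult intro: mult_left_le_one_le)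
        qed (use h in auto)
        ultimately have "(LINT x|lebesgue. indicator (box a' b') x * h x) = 0"
          by (simp add: LIMSEQ_const_iff)
        moreover have "(LINT x|lebesgue. indicator (box a' b') x * h x) =
           (LINT x|lebesgue. indicator (box a b) x * h x)"
        proof (rule integral_cong_AE)
          have "AE x in lebesgue. x \<notin> cbox c d - box c d"
            by (rule AE_not_in_frontier_interval)
          then show "AE x in lebesgue. indicator (box a' b') x * h x = indicator (box a b) x * h x"
            by eventually_elim (auto simp: h_def ab[symmetric] split: split_indicator)
        qed (use h in \<open>auto intro!: borel_measurable_times borel_measurable_indicator\<close>)
        ultimately show ?thesis by simp
      qed
    qed
    obtain h' where h': "h' \<in> borel_measurable borel" "integrable lborel h'" "AE x in lebesgue. h x = h' x"
      using lebesgue_ex_borel_version[OF h] .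
    have "(LINT x|lborel. indicator (box a b) x * h' x) = 0" for a b
    proof -
      have "(LINT x|lborel. indicator (box a b) x * h' x) = (LINT x|lebesgue. indicator (box a b) x * h' x)"
        using h' by (intro integral_completion[symmetric]) auto
      also have "\<dots> = (LINT x|lebesgue. indicator (box a b) x * h x)"
      proof (rule integral_cong_AE)
        have [measurable]: "box a b \<in> sets lebesgue" by auto
        have [measurable]: "h' \<in> borel_measurable lebesgue"
          by (rule measurable_completion) (simp add: h'(1))
        have [measurable]: "h \<in> borel_measurable lebesgue" using h by (rule borel_measurable_integrable)
        show "(\<lambda>x. indicator (box a b) x * h' x) \<in> borel_measurable lebesgue"
          "(\<lambda>x. indicator (box a b) x * h x) \<in> borel_measurable lebesgue"
          by measurable
        show "AE x in lebesgue. indicator (box a b) x * h' x = indicator (box a b) x * h x"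
          using h'(3) by eventually_elim simp
      qed
      finally show ?thesis using h0 by simp
    qed
    from AE_zero_if_integral_box_zero[OF h'(2) this] have "AE x in lebesgue. h' x = 0"
      using AE_completion by blast
    with h'(3) show ?thesis by eventually_elim (auto simp: h_def split: split_indicator_asm)
  qed
  obtain \<D> where \<D>: "countable \<D>" "\<And>X. X \<in> \<D> \<Longrightarrow> \<exists>a b. X = cbox a b" "\<Union>\<D> = D"
    using open_countable_Union_open_cbox[OF \<open>open D\<close>] by metis
  have "AE x in lebesgue. \<forall>X\<in>\<D>. x \<in> X \<longrightarrow> g x = 0"
    unfolding AE_ball_countable[OF \<D>(1)]
  proof
    fix X assume X: "X \<in> \<D>"
    then obtain c d where "X = cbox c d" using \<D>(2) by blast
    then show "AE x in lebesgue. x \<in> X \<longrightarrow> g x = 0" using loc[of c d] X \<D>(3) by blast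
  qed
  then have "AE x in lebesgue. x \<in> D \<longrightarrow> g x = 0"
    by eventually_elim (use \<D>(3) in auto)
  then show ?thesis using D by (simp add: AE_restrict_space_iff)
qed

section \<open>Weak partial derivatives\<close>

lemma test_function_has_derivative:
  assumes "\<phi> \<in> test_functions D"
  shows "(\<phi> has_derivative frechet_derivative \<phi> (at x)) (at x)"
  using assms unfolding test_functions_def
  by (auto dest: spec[of _ 1] simp: differentiable_on_def frechet_derivative_works)

lemma test_function_continuous:
  assumes "\<phi> \<in> test_functions D" shows "continuous_on UNIV \<phi>"
  using assms unfolding test_functions_def by (auto dest: spec[of _ 0])

lemma frechet_derivative_test_sum:
  assumes "\<phi> \<in> test_functions D"
  shows "frechet_derivative \<phi> (at x) b = (\<Sum>i\<in>Basis. (b \<bullet> i) * frechet_derivative \<phi> (at x) i)"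
proof -
  interpret bounded_linear "frechet_derivative \<phi> (at x)"
    using test_function_has_derivative[OF assms] has_derivative_bounded_linear by blast
  have "frechet_derivative \<phi> (at x) (\<Sum>i\<in>Basis. (b \<bullet> i) *\<^sub>R i) = (\<Sum>i\<in>Basis. (b \<bullet> i) * frechet_derivative \<phi> (at x) i)"
    by (simp add: sum scale)
  then show ?thesis by (simp add: euclidean_representation)
qed

lemma test_function_deriv_continuous:
  assumes "\<phi> \<in> test_functions D"
  shows "continuous_on UNIV (\<lambda>x. frechet_derivative \<phi> (at x) b)"
proof -
  have "C_k 1 \<phi>" using assms by (auto simp: test_functions_def)
  then have "continuous_on UNIV (\<lambda>x. frechet_derivative \<phi> (at x) i)" if "i \<in> Basis" for i
    using that by auto
  then show ?thesis unfolding frechet_derivative_test_sum[OF assms, of _ b]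
    by (intro continuous_intros)
qed

lemma test_function_deriv_zero:
  fixes \<phi> :: "'a::euclidean_space \<Rightarrow> real"
  assumes "x \<notin> closure {x. \<phi> x \<noteq> 0}"
  shows "frechet_derivative \<phi> (at x) b = 0"
proof -
  let ?S = "- closure {x. \<phi> x \<noteq> 0}"
  have z: "0 = \<phi> y" if "y \<in> ?S" for y
  proof (rule ccontr)
    assume "0 \<noteq> \<phi> y"
    then have "y \<in> {x. \<phi> x \<noteq> 0}" by simp
    with closure_subset have "y \<in> closure {x. \<phi> x \<noteq> 0}" by (rule subsetD)
    with that show False by simp
  qed
  have c: "((\<lambda>x. 0 :: real) has_derivative (\<lambda>x. 0)) (at x)" by simp
  have o: "open ?S" "x \<in> ?S" using assms by (simp_all add: open_Compl)
  have "(\<phi> has_derivative (\<lambda>x. 0)) (at x)"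
    by (rule has_derivative_transform_within_open[OF c o]) (rule z)
  from fun_cong[OF frechet_derivative_at[OF this], of b] show ?thesis by (rule sym)
qed

text \<open>
A common bound for a test function and one of its derivatives by a multiple of an indicator; this is
the form in which test functions enter estimates.
\<close>

lemma test_function_deriv_bounded:
  assumes "\<phi> \<in> test_functions D"
  obtains K C where "compact K" "K \<subseteq> D" "C \<ge> 0"
    "\<And>x. \<bar>\<phi> x\<bar> \<le> C * indicator K x"
    "\<And>x. \<bar>frechet_derivative \<phi> (at x) b\<bar> \<le> C * indicator K x"
proof -
  let ?K = "closure {x. \<phi> x \<noteq> 0}"
  have K: "compact ?K" "?K \<subseteq> D" using assms by (auto simp: test_functions_def)
  have "bounded ((\<lambda>x. frechet_derivative \<phi> (at x) b) ` ?K)" "bounded (\<phi> ` ?K)"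
    by (intro compact_imp_bounded compact_continuous_image K
        continuous_on_subset[OF test_function_deriv_continuous[OF assms]]
        continuous_on_subset[OF test_function_continuous[OF assms]] subset_UNIV)+
  then obtain A B where AB: "\<And>x. x \<in> ?K \<Longrightarrow> \<bar>frechet_derivative \<phi> (at x) b\<bar> \<le> A"
    "\<And>x. x \<in> ?K \<Longrightarrow> \<bar>\<phi> x\<bar> \<le> B"
    unfolding bounded_iff by (auto simp del: closure_subset)
  show thesis
  proof (rule that[of ?K "max 0 (max A B)"])
    fix x
    show "\<bar>\<phi> x\<bar> \<le> max 0 (max A B) * indicator ?K x"
      using AB(2)[of x] closure_subset[of "{x. \<phi> x \<noteq> 0}"] by (cases "x \<in> ?K") auto
    show "\<bar>frechet_derivative \<phi> (at x) b\<bar> \<le> max 0 (max A B) * indicator ?K x"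
      using AB(1)[of x] test_function_deriv_zero[of x \<phi> b] by (cases "x \<in> ?K") auto
  qed (use K in auto)
qed

lemma continuous_imp_lebesgue_on:
  "continuous_on UNIV f \<Longrightarrow> (f :: 'a::euclidean_space \<Rightarrow> real) \<in> borel_measurable (lebesgue_on D)"
proof -
  assume "continuous_on UNIV f"
  then have "f \<in> borel_measurable borel" by (rule borel_measurable_continuous_onI)
  then have "f \<in> borel_measurable lebesgue" by (intro measurable_completion) simp
  then show ?thesis by (rule measurable_restrict_space1)
qed

lemma L1_loc_iff:
  assumes "open D"
  shows "u \<in> L1_loc D \<longleftrightarrow> u \<in> borel_measurable (lebesgue_on D) \<and>
    (\<forall>K. compact K \<and> K \<subseteq> D \<longrightarrow> integrable (lebesgue_on D) (\<lambda>x. indicator K x * u x))"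
proof -
  have "set_integrable lebesgue K u \<longleftrightarrow> integrable (lebesgue_on D) (\<lambda>x. indicator K x * u x)"
    if "K \<subseteq> D" for K
  proof -
    have "integrable (lebesgue_on D) (\<lambda>x. indicator K x * u x) \<longleftrightarrow>
      integrable lebesgue (\<lambda>x. indicator D x *\<^sub>R (indicator K x * u x))"
      using assms by (subst integrable_restrict_space) auto
    also have "(\<lambda>x. indicator D x *\<^sub>R (indicator K x * u x)) = (\<lambda>x. indicator K x *\<^sub>R u x)"
      using that by (auto simp: fun_eq_iff split: split_indicator)
    finally show ?thesis by (simp add: set_integrable_def)
  qed
  then show ?thesis unfolding L1_loc_def by blast
qed

lemma L2_loc_iff:
  assumes "open D"
  shows "u \<in> L2_loc D \<longleftrightarrow> u \<in> borel_measurable (lebesgue_on D) \<and>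
    (\<forall>K. compact K \<and> K \<subseteq> D \<longrightarrow> integrable (lebesgue_on D) (\<lambda>x. indicator K x * (u x)\<^sup>2))"
proof -
  have "u \<in> L2_loc D \<longleftrightarrow> u \<in> borel_measurable (lebesgue_on D) \<and> (\<lambda>x. (u x)\<^sup>2) \<in> L1_loc D"
    by (auto simp: L2_loc_def L1_loc_def)
  also have "\<dots> \<longleftrightarrow> u \<in> borel_measurable (lebesgue_on D) \<and>
    (\<forall>K. compact K \<and> K \<subseteq> D \<longrightarrow> integrable (lebesgue_on D) (\<lambda>x. indicator K x * (u x)\<^sup>2))"
    by (auto simp: L1_loc_iff[OF assms])
  finally show ?thesis .
qed

lemma compact_in_lebesgue_on:
  assumes "compact K" "K \<subseteq> D" shows "K \<in> sets (lebesgue_on D)"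
  using fmeasurableD[OF lmeasurable_compact[OF assms(1)]] assms(2)
  by (auto simp: sets_restrict_space image_iff intro!: bexI[of _ K])

lemma L1_loc_mult_integrable:
  assumes "open D" "u \<in> L1_loc D" "\<psi> \<in> borel_measurable (lebesgue_on D)"
    "compact K" "K \<subseteq> D" "\<And>x. \<bar>\<psi> x\<bar> \<le> C * indicator K x"
  shows "integrable (lebesgue_on D) (\<lambda>x. u x * \<psi> x)"
proof (rule Bochner_Integration.integrable_bound)
  show "integrable (lebesgue_on D) (\<lambda>x. C * (indicator K x * u x))"
    using assms by (intro integrable_mult_right) (auto simp: L1_loc_iff)
  show "(\<lambda>x. u x * \<psi> x) \<in> borel_measurable (lebesgue_on D)"
    using assms by (intro borel_measurable_times) (auto simp: L1_loc_def)
  have "\<bar>u x\<bar> * \<bar>\<psi> x\<bar> \<le> \<bar>C\<bar> * (indicator K x * \<bar>u x\<bar>)" for x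
  proof -
    have "\<bar>u x\<bar> * \<bar>\<psi> x\<bar> \<le> \<bar>u x\<bar> * (C * indicator K x)"
      by (intro mult_left_mono assms(6)) auto
    also have "\<dots> \<le> \<bar>u x\<bar> * (\<bar>C\<bar> * indicator K x)"
      by (intro mult_left_mono mult_right_mono) auto
    finally show ?thesis by (simp add: mult_ac)
  qed
  then show "AE x in lebesgue_on D. norm (u x * \<psi> x) \<le> norm (C * (indicator K x * u x))"
    by (intro AE_I2) (auto simp: abs_mult)
qed

lemma L1_loc_test_integrable:
  assumes "open D" "u \<in> L1_loc D" "\<phi> \<in> test_functions D"
  shows "integrable (lebesgue_on D) (\<lambda>x. u x * \<phi> x)"
    "integrable (lebesgue_on D) (\<lambda>x. u x * frechet_derivative \<phi> (at x) b)"
proof -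
  obtain K C where K: "compact K" "K \<subseteq> D" "C \<ge> 0"
    "\<And>x. \<bar>\<phi> x\<bar> \<le> C * indicator K x"
    "\<And>x. \<bar>frechet_derivative \<phi> (at x) b\<bar> \<le> C * indicator K x"
    using test_function_deriv_bounded[OF assms(3), of b] by blast
  note c = continuous_imp_lebesgue_on[OF test_function_continuous[OF assms(3)], of D]
    continuous_imp_lebesgue_on[OF test_function_deriv_continuous[OF assms(3), of b], of D]
  show "integrable (lebesgue_on D) (\<lambda>x. u x * \<phi> x)"
    by (rule L1_loc_mult_integrable[OF assms(1,2) c(1) K(1,2,4)])
  show "integrable (lebesgue_on D) (\<lambda>x. u x * frechet_derivative \<phi> (at x) b)"
    by (rule L1_loc_mult_integrable[OF assms(1,2) c(2) K(1,2,5)])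
qed

lemma L1_loc_lincomb:
  assumes "open D" "u \<in> L1_loc D" "v \<in> L1_loc D"
  shows "(\<lambda>x. a * u x + c * v x) \<in> L1_loc D"
  unfolding L1_loc_iff[OF \<open>open D\<close>]
proof (intro conjI allI impI)
  have m: "u \<in> borel_measurable (lebesgue_on D)" "v \<in> borel_measurable (lebesgue_on D)"
    using assms by (auto simp: L1_loc_def)
  show "(\<lambda>x. a * u x + c * v x) \<in> borel_measurable (lebesgue_on D)"
    by (intro borel_measurable_add borel_measurable_times borel_measurable_const m)
  fix K assume "compact K \<and> K \<subseteq> D"
  then have "integrable (lebesgue_on D) (\<lambda>x. a * (indicator K x * u x) + c * (indicator K x * v x))"
    using assms by (intro Bochner_Integration.integrable_add integrable_mult_right) (auto simp: L1_loc_iff)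
  then show "integrable (lebesgue_on D) (\<lambda>x. indicator K x * (a * u x + c * v x))"
    by (simp add: algebra_simps)
qed

lemma L1_loc_AE_cong:
  assumes "open D" "u \<in> L1_loc D" "v \<in> borel_measurable (lebesgue_on D)" "AE x in lebesgue_on D. u x = v x"
  shows "v \<in> L1_loc D"
  unfolding L1_loc_iff[OF \<open>open D\<close>]
proof (intro conjI allI impI assms)
  have u: "u \<in> borel_measurable (lebesgue_on D)" using assms by (auto simp: L1_loc_def)
  fix K assume K: "compact K \<and> K \<subseteq> D"
  then have "integrable (lebesgue_on D) (\<lambda>x. indicator K x * u x)"
    using assms by (auto simp: L1_loc_iff)
  moreover have "AE x in lebesgue_on D. indicator K x * u x = indicator K x * v x"
    using assms(4) by eventually_elim simp
  ultimately show "integrable (lebesgue_on D) (\<lambda>x. indicator K x * v x)"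
    using K compact_in_lebesgue_on
    by (subst integrable_cong_AE[symmetric])
      (auto intro!: borel_measurable_times borel_measurable_indicator u assms)
qed

lemma weak_pderiv_unique:
  assumes "open D" "is_weak_pderiv D b u g" "is_weak_pderiv D b u h"
  shows "AE x in lebesgue_on D. g x = h x"
proof -
  have L: "g \<in> L1_loc D" "h \<in> L1_loc D" using assms by (auto simp: is_weak_pderiv_def)
  have "AE x in lebesgue_on D. 1 * g x + (-1) * h x = 0"
  proof (rule L1_loc_zero_if_weakly_zero[OF \<open>open D\<close> L1_loc_lincomb[OF \<open>open D\<close> L]])
    fix \<phi> assume \<phi>: "\<phi> \<in> test_functions D"
    have "(LINT x|lebesgue_on D. g x * \<phi> x) = (LINT x|lebesgue_on D. h x * \<phi> x)"
      using bspec[OF assms(2)[unfolded is_weak_pderiv_def, THEN conjunct2, THEN conjunct2] \<phi>]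
        bspec[OF assms(3)[unfolded is_weak_pderiv_def, THEN conjunct2, THEN conjunct2] \<phi>] by linarith
    then show "(LINT x|lebesgue_on D. (1 * g x + (-1) * h x) * \<phi> x) = 0"
      using L1_loc_test_integrable(1)[OF \<open>open D\<close> _ \<phi>] L
      by (simp add: left_diff_distrib Bochner_Integration.integral_diff)
  qed
  then show ?thesis by simp
qed

lemma weak_pderiv_lincomb:
  assumes "open D" "is_weak_pderiv D b u g" "is_weak_pderiv D b v h"
  shows "is_weak_pderiv D b (\<lambda>x. a * u x + c * v x) (\<lambda>x. a * g x + c * h x)"
  unfolding is_weak_pderiv_def
proof (intro conjI ballI)
  have L: "u \<in> L1_loc D" "v \<in> L1_loc D" "g \<in> L1_loc D" "h \<in> L1_loc D"
    using assms by (auto simp: is_weak_pderiv_def)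
  show "(\<lambda>x. a * u x + c * v x) \<in> L1_loc D" "(\<lambda>x. a * g x + c * h x) \<in> L1_loc D"
    using L1_loc_lincomb[OF \<open>open D\<close>] L by auto
  fix \<phi> assume \<phi>: "\<phi> \<in> test_functions D"
  note I = L1_loc_test_integrable[OF \<open>open D\<close> _ \<phi>]
  have "(LINT x|lebesgue_on D. (a * u x + c * v x) * frechet_derivative \<phi> (at x) b) =
    (LINT x|lebesgue_on D. a * (u x * frechet_derivative \<phi> (at x) b) + c * (v x * frechet_derivative \<phi> (at x) b))"
    by (simp add: algebra_simps)
  also have "\<dots> = a * (LINT x|lebesgue_on D. u x * frechet_derivative \<phi> (at x) b) + 
     c * (LINT x|lebesgue_on D. v x * frechet_derivative \<phi> (at x) b)"
    using I L by (subst Bochner_Integration.integral_add) auto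
  also have "\<dots> = a * - (LINT x|lebesgue_on D. g x * \<phi> x) + c * - (LINT x|lebesgue_on D. h x * \<phi> x)"
    using assms(2,3) \<phi> by (simp add: is_weak_pderiv_def)
  also have "\<dots> = - (LINT x|lebesgue_on D. a * (g x * \<phi> x) + c * (h x * \<phi> x))"
    using I L by (subst Bochner_Integration.integral_add) auto
  also have "\<dots> = - (LINT x|lebesgue_on D. (a * g x + c * h x) * \<phi> x)"
    by (simp add: algebra_simps)
  finally show "(LINT x|lebesgue_on D. (a * u x + c * v x) * frechet_derivative \<phi> (at x) b) = \<dots>" .
qed

lemma weak_pderiv_AE_cong:
  assumes "open D" "is_weak_pderiv D b u g"
    "u' \<in> borel_measurable (lebesgue_on D)" "AE x in lebesgue_on D. u x = u' x"
    "g' \<in> borel_measurable (lebesgue_on D)" "AE x in lebesgue_on D. g x = g' x"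
  shows "is_weak_pderiv D b u' g'"
  unfolding is_weak_pderiv_def
proof (intro conjI ballI)
  have L: "u \<in> L1_loc D" "g \<in> L1_loc D" using assms by (auto simp: is_weak_pderiv_def)
  then show L': "u' \<in> L1_loc D" "g' \<in> L1_loc D"
    using L1_loc_AE_cong[OF \<open>open D\<close>] assms by auto
  fix \<phi> assume \<phi>: "\<phi> \<in> test_functions D"
  note m = L1_loc_test_integrable[OF \<open>open D\<close> _ \<phi>, THEN borel_measurable_integrable]
  have "(LINT x|lebesgue_on D. u' x * frechet_derivative \<phi> (at x) b) =
     (LINT x|lebesgue_on D. u x * frechet_derivative \<phi> (at x) b)"
    using assms(4) by (intro integral_cong_AE m L L') auto
  also have "\<dots> = - (LINT x|lebesgue_on D. g x * \<phi> x)" using assms(2) \<phi> by (simp add: is_weak_pderiv_def)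
  also have "(LINT x|lebesgue_on D. g x * \<phi> x) = (LINT x|lebesgue_on D. g' x * \<phi> x)"
    using assms(6) by (intro integral_cong_AE m L L') auto
  finally show "(LINT x|lebesgue_on D. u' x * frechet_derivative \<phi> (at x) b) = - (LINT x|lebesgue_on D. g' x * \<phi> x)" .
qed

lemma L1_loc_sum:
  assumes "open D" "finite S" "\<And>i. i \<in> S \<Longrightarrow> G i \<in> L1_loc D"
  shows "(\<lambda>x. \<Sum>i\<in>S. c i * G i x) \<in> L1_loc D"
  using assms(2,3)
proof (induction S rule: finite_induct)
  case empty then show ?case using \<open>open D\<close> by (simp add: L1_loc_iff)
next
  case (insert i S)
  from L1_loc_lincomb[OF \<open>open D\<close>, of "G i" "\<lambda>x. \<Sum>i\<in>S. c i * G i x" "c i" 1] insert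
  show ?case by simp
qed

text \<open>
The predicate for weak derivatives makes sense for every vector \<open>b\<close>, and having all directional
derivatives available later allows translations by arbitrary vectors to be treated in one step.
\<close>

lemma weak_pderiv_direction:
  assumes "open D" "\<And>i. i \<in> Basis \<Longrightarrow> is_weak_pderiv D i u (G i)"
  shows "is_weak_pderiv D b u (\<lambda>x. \<Sum>i\<in>Basis. (b \<bullet> i) * G i x)"
  unfolding is_weak_pderiv_def
proof (intro conjI ballI)
  show u: "u \<in> L1_loc D" using assms(2) nonempty_Basis unfolding is_weak_pderiv_def by blast
  have G: "G i \<in> L1_loc D" if "i \<in> Basis" for i using assms(2)[OF that] by (auto simp: is_weak_pderiv_def)
  then show "(\<lambda>x. \<Sum>i\<in>Basis. (b \<bullet> i) * G i x) \<in> L1_loc D"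
    by (intro L1_loc_sum assms) auto
  fix \<phi> assume \<phi>: "\<phi> \<in> test_functions D"
  note I = L1_loc_test_integrable[OF \<open>open D\<close> _ \<phi>]
  have "(LINT x|lebesgue_on D. u x * frechet_derivative \<phi> (at x) b) =
    (LINT x|lebesgue_on D. (\<Sum>i\<in>Basis. (b \<bullet> i) * (u x * frechet_derivative \<phi> (at x) i)))"
    by (subst frechet_derivative_test_sum[OF \<phi>, of _ b]) (simp add: sum_distrib_left mult_ac)
  also have "\<dots> = (\<Sum>i\<in>Basis. (b \<bullet> i) * (LINT x|lebesgue_on D. u x * frechet_derivative \<phi> (at x) i))"
    using I(2)[OF u] by (subst Bochner_Integration.integral_sum) auto
  also have "\<dots> = (\<Sum>i\<in>Basis. (b \<bullet> i) * - (LINT x|lebesgue_on D. G i x * \<phi> x))"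
    using assms(2) \<phi> by (intro sum.cong refl) (simp add: is_weak_pderiv_def)
  also have "\<dots> = - (LINT x|lebesgue_on D. (\<Sum>i\<in>Basis. (b \<bullet> i) * (G i x * \<phi> x)))"
    using I(1)[OF G] by (subst Bochner_Integration.integral_sum) (auto simp: sum_negf)
  also have "\<dots> = - (LINT x|lebesgue_on D. (\<Sum>i\<in>Basis. (b \<bullet> i) * G i x) * \<phi> x)"
    by (simp only: sum_distrib_right mult.assoc)
  finally show "(LINT x|lebesgue_on D. u x * frechet_derivative \<phi> (at x) b) = \<dots>" .
qed

lemma tendsto_integral_mult_bounded:
  assumes "open D" "\<And>n. u n \<in> L1_loc D" "v \<in> L1_loc D"
    and lim: "(\<lambda>n. LINT x|lebesgue_on D. indicator K x * \<bar>u n x - v x\<bar>) \<longlonglongrightarrow> 0"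
    and \<psi>: "\<psi> \<in> borel_measurable (lebesgue_on D)" "compact K" "K \<subseteq> D" "\<And>x. \<bar>\<psi> x\<bar> \<le> C * indicator K x"
  shows "(\<lambda>n. LINT x|lebesgue_on D. u n x * \<psi> x) \<longlonglongrightarrow> (LINT x|lebesgue_on D. v x * \<psi> x)"
proof (rule LIM_zero_cancel)
  show "(\<lambda>n. (LINT x|lebesgue_on D. u n x * \<psi> x) - (LINT x|lebesgue_on D. v x * \<psi> x)) \<longlonglongrightarrow> 0"
  proof (rule Lim_null_comparison)
    show "(\<lambda>n. C * (LINT x|lebesgue_on D. indicator K x * \<bar>u n x - v x\<bar>)) \<longlonglongrightarrow> 0"
      using tendsto_mult_right_zero[OF lim] by simp
    have d: "(\<lambda>x. 1 * u n x + (-1) * v x) \<in> L1_loc D" for n by (intro L1_loc_lincomb assms)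
    have I: "integrable (lebesgue_on D) (\<lambda>x. indicator K x * (u n x - v x))" for n
      using d[of n] \<psi> by (simp add: L1_loc_iff[OF \<open>open D\<close>])
    have I': "integrable (lebesgue_on D) (\<lambda>x. indicator K x * \<bar>u n x - v x\<bar>)" for n
      using integrable_abs[OF I[of n]] by (simp add: abs_mult)
    have "norm ((LINT x|lebesgue_on D. u n x * \<psi> x) - (LINT x|lebesgue_on D. v x * \<psi> x))
      \<le> C * (LINT x|lebesgue_on D. indicator K x * \<bar>u n x - v x\<bar>)" for n
    proof -
      note P = L1_loc_mult_integrable[OF \<open>open D\<close> _ \<psi>]
      have "(LINT x|lebesgue_on D. u n x * \<psi> x) - (LINT x|lebesgue_on D. v x * \<psi> x) =
        (LINT x|lebesgue_on D. (u n x - v x) * \<psi> x)"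
        by (subst Bochner_Integration.integral_diff[symmetric, OF P[OF assms(2)] P[OF assms(3)]])
          (simp add: left_diff_distrib)
      also have "norm \<dots> \<le> (LINT x|lebesgue_on D. C * (indicator K x * \<bar>u n x - v x\<bar>))"
      proof (rule order_trans[OF integral_norm_bound integral_mono])
        show "integrable (lebesgue_on D) (\<lambda>x. norm ((u n x - v x) * \<psi> x))"
          using integrable_norm[OF P[OF d[of n]]] by simp
        show "integrable (lebesgue_on D) (\<lambda>x. C * (indicator K x * \<bar>u n x - v x\<bar>))" using I' by simp
        fix x
        have "\<bar>u n x - v x\<bar> * \<bar>\<psi> x\<bar> \<le> \<bar>u n x - v x\<bar> * (C * indicator K x)"
          by (intro mult_left_mono \<psi>) auto
        then show "norm ((u n x - v x) * \<psi> x) \<le> C * (indicator K x * \<bar>u n x - v x\<bar>)"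
          by (simp add: abs_mult mult_ac)
      qed
      finally show ?thesis by simp
    qed
    then show "\<forall>\<^sub>F n in sequentially. norm ((LINT x|lebesgue_on D. u n x * \<psi> x) - (LINT x|lebesgue_on D. v x * \<psi> x))
      \<le> C * (LINT x|lebesgue_on D. indicator K x * \<bar>u n x - v x\<bar>)" by simp
  qed
qed

text \<open>
Weak derivatives are closed under local convergence in \<open>L\<^sup>1\<close> of the functions and of the
derivatives, since test functions are bounded with compact support.
\<close>

lemma weak_pderiv_limit:
  assumes "open D" "\<And>n::nat. is_weak_pderiv D b (u n) (g n)" "v \<in> L1_loc D" "h \<in> L1_loc D"
    and "\<And>K. compact K \<Longrightarrow> K \<subseteq> D \<Longrightarrow> (\<lambda>n. LINT x|lebesgue_on D. indicator K x * \<bar>u n x - v x\<bar>) \<longlonglongrightarrow> 0"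
    and "\<And>K. compact K \<Longrightarrow> K \<subseteq> D \<Longrightarrow> (\<lambda>n. LINT x|lebesgue_on D. indicator K x * \<bar>g n x - h x\<bar>) \<longlonglongrightarrow> 0"
  shows "is_weak_pderiv D b v h"
  unfolding is_weak_pderiv_def
proof (intro conjI ballI assms)
  have L: "u n \<in> L1_loc D" "g n \<in> L1_loc D" for n using assms(2)[of n] by (auto simp: is_weak_pderiv_def)
  fix \<phi> assume \<phi>: "\<phi> \<in> test_functions D"
  obtain K C where K: "compact K" "K \<subseteq> D" "C \<ge> 0"
    "\<And>x. \<bar>\<phi> x\<bar> \<le> C * indicator K x"
    "\<And>x. \<bar>frechet_derivative \<phi> (at x) b\<bar> \<le> C * indicator K x"
    using test_function_deriv_bounded[OF \<phi>, of b] by blast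
  note c = continuous_imp_lebesgue_on[OF test_function_continuous[OF \<phi>], of D]
    continuous_imp_lebesgue_on[OF test_function_deriv_continuous[OF \<phi>, of b], of D]
  have "(\<lambda>n. LINT x|lebesgue_on D. u n x * frechet_derivative \<phi> (at x) b) \<longlonglongrightarrow>
     (LINT x|lebesgue_on D. v x * frechet_derivative \<phi> (at x) b)"
    by (rule tendsto_integral_mult_bounded[OF \<open>open D\<close> L(1) assms(3) assms(5)[OF K(1,2)] c(2) K(1,2,5)])
  moreover have "(\<lambda>n. LINT x|lebesgue_on D. g n x * \<phi> x) \<longlonglongrightarrow> (LINT x|lebesgue_on D. h x * \<phi> x)"
    by (rule tendsto_integral_mult_bounded[OF \<open>open D\<close> L(2) assms(4) assms(6)[OF K(1,2)] c(1) K(1,2,4)])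
  then have "(\<lambda>n. - (LINT x|lebesgue_on D. g n x * \<phi> x)) \<longlonglongrightarrow> - (LINT x|lebesgue_on D. h x * \<phi> x)"
    by (rule tendsto_minus)
  moreover have "(LINT x|lebesgue_on D. u n x * frechet_derivative \<phi> (at x) b) = - (LINT x|lebesgue_on D. g n x * \<phi> x)" for n
    using assms(2)[of n] \<phi> by (simp add: is_weak_pderiv_def)
  ultimately show "(LINT x|lebesgue_on D. v x * frechet_derivative \<phi> (at x) b) = - (LINT x|lebesgue_on D. h x * \<phi> x)"
    using LIMSEQ_unique by simp
qed

section \<open>Square integrability, weak gradients and the space BL\<close>

lemma L2_space_bound:
  assumes "g \<in> L2_space M" "f \<in> borel_measurable M" "AE x in M. \<bar>f x\<bar> \<le> \<bar>g x\<bar>"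
  shows "f \<in> L2_space M"
proof -
  have "integrable M (\<lambda>x. (f x)\<^sup>2)"
  proof (rule Bochner_Integration.integrable_bound)
    show "integrable M (\<lambda>x. (g x)\<^sup>2)" using assms(1) by (simp add: L2_space_def)
    show "AE x in M. norm ((f x)\<^sup>2) \<le> norm ((g x)\<^sup>2)"
      using assms(3)
    proof eventually_elim
      case (elim x)
      from power_mono[OF this, of 2] show ?case by simp
    qed
    show "(\<lambda>x. (f x)\<^sup>2) \<in> borel_measurable M" by (intro borel_measurable_power assms(2))
  qed
  then show ?thesis using assms(2) by (simp add: L2_space_def)
qed

lemma L2_space_AE_cong:
  "g \<in> L2_space M \<Longrightarrow> f \<in> borel_measurable M \<Longrightarrow> AE x in M. f x = g x \<Longrightarrow> f \<in> L2_space M"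
  by (rule L2_space_bound) (auto elim: eventually_mono)

lemma L2_mult_integrable:
  assumes "f \<in> L2_space M" "g \<in> L2_space M"
  shows "integrable M (\<lambda>x. f x * g x)"
proof (rule Bochner_Integration.integrable_bound)
  have [measurable]: "f \<in> borel_measurable M" "g \<in> borel_measurable M"
    using assms by (auto simp: L2_space_def)
  show "integrable M (\<lambda>x. (f x)\<^sup>2 + (g x)\<^sup>2)" using assms by (simp add: L2_space_def)
  show "(\<lambda>x. f x * g x) \<in> borel_measurable M" by measurable
  have "\<bar>a * b\<bar> \<le> a\<^sup>2 + b\<^sup>2" for a b :: real
    using zero_le_power2[of "\<bar>a\<bar> - \<bar>b\<bar>"] zero_le_power2[of a] zero_le_power2[of b]
    unfolding power2_diff abs_mult power2_abs by linarith
  then show "AE x in M. norm (f x * g x) \<le> norm ((f x)\<^sup>2 + (g x)\<^sup>2)"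
    by (intro AE_I2) simp
qed

lemma L2_space_lincomb:
  assumes "f \<in> L2_space M" "g \<in> L2_space M"
  shows "(\<lambda>x. a * f x + c * g x) \<in> L2_space M"
proof -
  have [measurable]: "f \<in> borel_measurable M" "g \<in> borel_measurable M"
    using assms by (auto simp: L2_space_def)
  have "integrable M (\<lambda>x. a\<^sup>2 * (f x)\<^sup>2 + (2 * a * c) * (f x * g x) + c\<^sup>2 * (g x)\<^sup>2)"
    using assms L2_mult_integrable[OF assms]
    by (intro Bochner_Integration.integrable_add integrable_mult_right) (auto simp: L2_space_def)
  moreover have "a\<^sup>2 * (f x)\<^sup>2 + (2 * a * c) * (f x * g x) + c\<^sup>2 * (g x)\<^sup>2 = (a * f x + c * g x)\<^sup>2" for x
    by (simp add: power2_eq_square algebra_simps)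
  ultimately show ?thesis by (simp add: L2_space_def)
qed

lemma L2_loc_iff_L2_space:
  assumes "open D"
  shows "u \<in> L2_loc D \<longleftrightarrow> u \<in> borel_measurable (lebesgue_on D) \<and>
    (\<forall>K. compact K \<and> K \<subseteq> D \<longrightarrow> (\<lambda>x. indicator K x * u x) \<in> L2_space (lebesgue_on D))"
proof -
  have "indicator K x * (u x)\<^sup>2 = (indicator K x * u x)\<^sup>2" for K x
    by (simp split: split_indicator)
  moreover have "(\<lambda>x. indicator K x * u x) \<in> borel_measurable (lebesgue_on D)"
    if "compact K" "K \<subseteq> D" "u \<in> borel_measurable (lebesgue_on D)" for K
    using compact_in_lebesgue_on[OF that(1,2)] that(3)
    by (intro borel_measurable_times borel_measurable_indicator)
  ultimately show ?thesis unfolding L2_loc_iff[OF assms] L2_space_def by auto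
qed

lemma L2_loc_lincomb:
  assumes "open D" "u \<in> L2_loc D" "v \<in> L2_loc D"
  shows "(\<lambda>x. a * u x + c * v x) \<in> L2_loc D"
  unfolding L2_loc_iff_L2_space[OF \<open>open D\<close>]
proof (intro conjI allI impI)
  have m: "u \<in> borel_measurable (lebesgue_on D)" "v \<in> borel_measurable (lebesgue_on D)"
    using assms by (auto simp: L2_loc_def)
  show "(\<lambda>x. a * u x + c * v x) \<in> borel_measurable (lebesgue_on D)"
    by (intro borel_measurable_add borel_measurable_times borel_measurable_const m)
  fix K assume "compact K \<and> K \<subseteq> D"
  then have "(\<lambda>x. a * (indicator K x * u x) + c * (indicator K x * v x)) \<in> L2_space (lebesgue_on D)"
    using assms by (intro L2_space_lincomb) (auto simp: L2_loc_iff_L2_space)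
  then show "(\<lambda>x. indicator K x * (a * u x + c * v x)) \<in> L2_space (lebesgue_on D)"
    by (simp add: algebra_simps)
qed

lemma L2_loc_bound:
  assumes "open D" "v \<in> L2_loc D" "u \<in> borel_measurable (lebesgue_on D)"
    "AE x in lebesgue_on D. \<bar>u x\<bar> \<le> \<bar>v x\<bar>"
  shows "u \<in> L2_loc D"
  unfolding L2_loc_iff_L2_space[OF \<open>open D\<close>]
proof (intro conjI allI impI assms)
  fix K assume K: "compact K \<and> K \<subseteq> D"
  show "(\<lambda>x. indicator K x * u x) \<in> L2_space (lebesgue_on D)"
  proof (rule L2_space_bound)
    show "(\<lambda>x. indicator K x * v x) \<in> L2_space (lebesgue_on D)"
      using assms K by (auto simp: L2_loc_iff_L2_space)
    show "(\<lambda>x. indicator K x * u x) \<in> borel_measurable (lebesgue_on D)"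
      using K compact_in_lebesgue_on by (auto intro!: borel_measurable_times borel_measurable_indicator assms)
    show "AE x in lebesgue_on D. \<bar>indicator K x * u x\<bar> \<le> \<bar>indicator K x * v x\<bar>"
      using assms(4) by eventually_elim (simp split: split_indicator)
  qed
qed

lemma integrable_indicator_compact:
  assumes "open D" "compact K" "K \<subseteq> D"
  shows "integrable (lebesgue_on D) (indicator K :: _ \<Rightarrow> real)"
proof -
  have "integrable lebesgue (\<lambda>x. indicator D x *\<^sub>R (indicator K x :: real))"
    using lmeasurable_compact[OF assms(2)] assms(3)
    by (subst Bochner_Integration.integrable_cong[where g = "indicator K"])
      (auto simp: fmeasurable_def split: split_indicator)
  then show ?thesis using assms(1) by (subst integrable_restrict_space) auto
qed

lemma L2_loc_const:
  assumes "open D" shows "(\<lambda>x. c) \<in> L2_loc D"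
  using integrable_indicator_compact[OF assms] by (simp add: L2_loc_iff[OF assms])

lemma L2_loc_imp_L1_loc:
  assumes "open D" "u \<in> L2_loc D" shows "u \<in> L1_loc D"
  unfolding L1_loc_iff[OF \<open>open D\<close>]
proof (intro conjI allI impI)
  show m: "u \<in> borel_measurable (lebesgue_on D)" using assms by (auto simp: L2_loc_def)
  fix K assume K: "compact K \<and> K \<subseteq> D"
  show "integrable (lebesgue_on D) (\<lambda>x. indicator K x * u x)"
  proof (rule Bochner_Integration.integrable_bound)
    show "integrable (lebesgue_on D) (\<lambda>x. indicator K x + indicator K x * (u x)\<^sup>2)"
      using K assms integrable_indicator_compact[OF assms(1)]
      by (intro Bochner_Integration.integrable_add) (auto simp: L2_loc_iff)
    show "(\<lambda>x. indicator K x * u x) \<in> borel_measurable (lebesgue_on D)"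
      using K compact_in_lebesgue_on by (auto intro!: borel_measurable_times borel_measurable_indicator m)
    have "\<bar>a\<bar> \<le> 1 + a\<^sup>2" for a :: real
      using zero_le_power2[of "\<bar>a\<bar> - 1"] zero_le_power2[of a] by (simp add: power2_diff)
    then show "AE x in lebesgue_on D. norm (indicator K x * u x) \<le> norm (indicator K x + indicator K x * (u x)\<^sup>2)"
      by (intro AE_I2) (auto split: split_indicator simp: abs_mult)
  qed
qed

lemma L2_space_imp_L2_loc:
  assumes "open D" "u \<in> L2_space (lebesgue_on D)" shows "u \<in> L2_loc D"
  unfolding L2_loc_iff_L2_space[OF \<open>open D\<close>]
proof (intro conjI allI impI)
  show m: "u \<in> borel_measurable (lebesgue_on D)" using assms by (auto simp: L2_space_def)
  fix K assume K: "compact K \<and> K \<subseteq> D"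
  show "(\<lambda>x. indicator K x * u x) \<in> L2_space (lebesgue_on D)"
  proof (rule L2_space_bound[OF assms(2)])
    show "(\<lambda>x. indicator K x * u x) \<in> borel_measurable (lebesgue_on D)"
      using K compact_in_lebesgue_on by (auto intro!: borel_measurable_times borel_measurable_indicator m)
  qed (auto split: split_indicator)
qed

text \<open>
The choice in the definition of the weak gradient is justified as soon as each partial derivative
exists, because the components can be assembled into one vector field.
\<close>

lemma weak_grad_works:
  assumes "\<And>b. b \<in> Basis \<Longrightarrow> is_weak_pderiv D b u (g b)" "b \<in> Basis"
  shows "is_weak_pderiv D b u (\<lambda>x. weak_grad D u x \<bullet> b)"
proof -
  let ?G = "\<lambda>x. \<Sum>b\<in>Basis. g b x *\<^sub>R b"
  have "?G x \<bullet> b = g b x" if "b \<in> Basis" for b x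
    using that by (simp add: inner_sum_left inner_Basis if_distrib cong: if_cong)
  then have "\<forall>b\<in>Basis. is_weak_pderiv D b u (\<lambda>x. ?G x \<bullet> b)"
    using assms(1) by simp
  then have "\<forall>b\<in>Basis. is_weak_pderiv D b u (\<lambda>x. weak_grad D u x \<bullet> b)"
    unfolding weak_grad_def
    by (rule someI[where P = "\<lambda>g. \<forall>b\<in>Basis. is_weak_pderiv D b u (\<lambda>x. g x \<bullet> b)"])
  then show ?thesis using assms(2) by blast
qed

lemma weak_grad_AE:
  assumes "open D" "\<And>b. b \<in> Basis \<Longrightarrow> is_weak_pderiv D b u (g b)"
  shows "AE x in lebesgue_on D. \<forall>b\<in>Basis. weak_grad D u x \<bullet> b = g b x"
proof -
  have "AE x in lebesgue_on D. weak_grad D u x \<bullet> b = g b x" if "b \<in> Basis" for b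
    by (rule weak_pderiv_unique[OF \<open>open D\<close> weak_grad_works assms(2)]) (use assms that in auto)
  then show ?thesis by (simp add: AE_ball_countable countable_finite)
qed

lemma BL_weak_grad:
  assumes "open D" "u \<in> BL D" "b \<in> Basis"
  shows "is_weak_pderiv D b u (\<lambda>x. weak_grad D u x \<bullet> b)"
    and "(\<lambda>x. weak_grad D u x \<bullet> b) \<in> L2_space (lebesgue_on D)"
proof -
  have "\<forall>b\<in>Basis. \<exists>g. g \<in> L2_space (lebesgue_on D) \<and> is_weak_pderiv D b u g"
    using assms(2) unfolding BL_def by blast
  then have "\<exists>g. \<forall>b\<in>Basis. g b \<in> L2_space (lebesgue_on D) \<and> is_weak_pderiv D b u (g b)"
    by (rule bchoice)
  then obtain g where g: "\<forall>b\<in>Basis. g b \<in> L2_space (lebesgue_on D) \<and> is_weak_pderiv D b u (g b)"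
    by (rule exE)
  show w: "is_weak_pderiv D b u (\<lambda>x. weak_grad D u x \<bullet> b)"
    by (rule weak_grad_works[where g = g]) (use g assms(3) in auto)
  have gb: "g b \<in> L2_space (lebesgue_on D)" "is_weak_pderiv D b u (g b)" using g assms(3) by auto
  show "(\<lambda>x. weak_grad D u x \<bullet> b) \<in> L2_space (lebesgue_on D)"
  proof (rule L2_space_AE_cong[OF gb(1)])
    show "(\<lambda>x. weak_grad D u x \<bullet> b) \<in> borel_measurable (lebesgue_on D)"
      using w by (simp add: is_weak_pderiv_def L1_loc_def)
    show "AE x in lebesgue_on D. weak_grad D u x \<bullet> b = g b x"
      by (rule weak_pderiv_unique[OF \<open>open D\<close> w gb(2)])
  qed
qed

lemma BL_I:
  assumes "u \<in> L2_loc D" "\<And>b. b \<in> Basis \<Longrightarrow> is_weak_pderiv D b u (g b)"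
    "\<And>b. b \<in> Basis \<Longrightarrow> g b \<in> L2_space (lebesgue_on D)"
  shows "u \<in> BL D"
  using assms unfolding BL_def by blast

text \<open>
Any weak partial derivatives may be used to compute the Dirichlet integral; later arguments never
look at the chosen gradient itself.
\<close>

lemma Dirichlet_int_eq_sum:
  assumes "open D" "u \<in> BL D" "v \<in> BL D"
    "\<And>b. b \<in> Basis \<Longrightarrow> is_weak_pderiv D b u (g b)"
    "\<And>b. b \<in> Basis \<Longrightarrow> is_weak_pderiv D b v (h b)"
  shows "Dirichlet_int D u v = (\<Sum>b\<in>Basis. LINT x|lebesgue_on D. g b x * h b x)"
proof -
  have AE: "AE x in lebesgue_on D. \<forall>b\<in>Basis. weak_grad D u x \<bullet> b = g b x"
      "AE x in lebesgue_on D. \<forall>b\<in>Basis. weak_grad D v x \<bullet> b = h b x"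
    using weak_grad_AE[OF \<open>open D\<close>] assms by auto
  have m: "g b \<in> borel_measurable (lebesgue_on D)" "h b \<in> borel_measurable (lebesgue_on D)"
    if "b \<in> Basis" for b
    using assms(4,5)[OF that] by (auto simp: is_weak_pderiv_def L1_loc_def)
  have "Dirichlet_int D u v = (LINT x|lebesgue_on D. (\<Sum>b\<in>Basis. (weak_grad D u x \<bullet> b) * (weak_grad D v x \<bullet> b)))"
    unfolding Dirichlet_int_def by (subst euclidean_inner) simp
  also have "\<dots> = (\<Sum>b\<in>Basis. LINT x|lebesgue_on D. (weak_grad D u x \<bullet> b) * (weak_grad D v x \<bullet> b))"
    using BL_weak_grad(2)[OF \<open>open D\<close>] assms
    by (intro Bochner_Integration.integral_sum L2_mult_integrable) auto
  also have "\<dots> = (\<Sum>b\<in>Basis. LINT x|lebesgue_on D. g b x * h b x)"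
  proof (intro sum.cong refl integral_cong_AE)
    fix b :: 'a assume b: "b \<in> Basis"
    show "(\<lambda>x. (weak_grad D u x \<bullet> b) * (weak_grad D v x \<bullet> b)) \<in> borel_measurable (lebesgue_on D)"
      using BL_weak_grad(2)[OF \<open>open D\<close> _ b] assms by (intro borel_measurable_times) (auto simp: L2_space_def)
    show "(\<lambda>x. g b x * h b x) \<in> borel_measurable (lebesgue_on D)"
      using m[OF b] by (intro borel_measurable_times)
    show "AE x in lebesgue_on D. (weak_grad D u x \<bullet> b) * (weak_grad D v x \<bullet> b) = g b x * h b x"
      using AE by eventually_elim (use b in simp)
  qed
  finally show ?thesis .
qed

lemma Dirichlet_int_nonneg: "0 \<le> Dirichlet_int D u u"
  unfolding Dirichlet_int_def by (rule integral_nonneg_AE) auto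

lemma BL_imp_L2_loc: "u \<in> BL D \<Longrightarrow> u \<in> L2_loc D" by (simp add: BL_def)

lemma BL_lincomb:
  assumes "open D" "u \<in> BL D" "v \<in> BL D"
  shows "(\<lambda>x. a * u x + c * v x) \<in> BL D"
proof (rule BL_I)
  show "(\<lambda>x. a * u x + c * v x) \<in> L2_loc D" using assms BL_imp_L2_loc by (intro L2_loc_lincomb) auto
  fix b :: 'a assume b: "b \<in> Basis"
  show "is_weak_pderiv D b (\<lambda>x. a * u x + c * v x) (\<lambda>x. a * (weak_grad D u x \<bullet> b) + c * (weak_grad D v x \<bullet> b))"
    using BL_weak_grad(1) assms b by (intro weak_pderiv_lincomb) auto
  show "(\<lambda>x. a * (weak_grad D u x \<bullet> b) + c * (weak_grad D v x \<bullet> b)) \<in> L2_space (lebesgue_on D)"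
    using BL_weak_grad(2) assms b by (intro L2_space_lincomb) auto
qed

lemma weak_grad_AE_cong:
  assumes "open D" "AE x in lebesgue_on D. u x = v x"
    "u \<in> borel_measurable (lebesgue_on D)" "v \<in> borel_measurable (lebesgue_on D)"
  shows "is_weak_pderiv D b u = is_weak_pderiv D b v" "weak_grad D u = weak_grad D v"
proof -
  have *: "is_weak_pderiv D b u g \<longleftrightarrow> is_weak_pderiv D b v g" for b g
  proof
    assume w: "is_weak_pderiv D b u g"
    then have "g \<in> borel_measurable (lebesgue_on D)" by (auto simp: is_weak_pderiv_def L1_loc_def)
    then show "is_weak_pderiv D b v g"
      by (intro weak_pderiv_AE_cong[OF assms(1) w] assms) auto
  next
    assume w: "is_weak_pderiv D b v g"
    then have "g \<in> borel_measurable (lebesgue_on D)" by (auto simp: is_weak_pderiv_def L1_loc_def)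
    moreover have "AE x in lebesgue_on D. v x = u x" using assms(2) by eventually_elim simp
    ultimately show "is_weak_pderiv D b u g"
      by (intro weak_pderiv_AE_cong[OF assms(1) w] assms) auto
  qed
  then show "is_weak_pderiv D b u = is_weak_pderiv D b v" by (simp add: fun_eq_iff)
  show "weak_grad D u = weak_grad D v" unfolding weak_grad_def * ..
qed

lemma BL_AE_cong:
  assumes "open D" "u \<in> BL D" "v \<in> borel_measurable (lebesgue_on D)" "AE x in lebesgue_on D. u x = v x"
  shows "v \<in> BL D"
proof -
  have u: "u \<in> borel_measurable (lebesgue_on D)" using assms(2) by (simp add: BL_def L2_loc_def)
  have "v \<in> L2_loc D"
    by (rule L2_loc_bound[OF \<open>open D\<close> BL_imp_L2_loc[OF assms(2)] assms(3)])
      (use assms(4) in eventually_elim, auto)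
  moreover have "is_weak_pderiv D b u = is_weak_pderiv D b v" for b
    by (rule weak_grad_AE_cong(1)[OF assms(1,4) u assms(3)])
  ultimately show ?thesis using assms(2) by (simp add: BL_def)
qed

section \<open>Translation estimates\<close>

lemma lborel_integral_shift:
  fixes f :: "'a::euclidean_space \<Rightarrow> real"
  assumes [measurable]: "f \<in> borel_measurable borel"
  shows "(LINT x|lborel. f (x + c)) = (LINT x|lborel. f x)"
    and "integrable lborel (\<lambda>x. f (x + c)) \<longleftrightarrow> integrable lborel f"
proof -
  have "(LINT x|lborel. f x) = (LINT x|distr lborel borel ((+) c). f x)"
    by (simp add: lborel_distr_plus)
  also have "\<dots> = (LINT x|lborel. f (c + x))" by (rule integral_distr) simp_all
  finally show "(LINT x|lborel. f (x + c)) = (LINT x|lborel. f x)" by (simp add: add.commute)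
  have "integrable lborel f \<longleftrightarrow> integrable (distr lborel borel ((+) c)) f"
    by (simp add: lborel_distr_plus)
  also have "\<dots> \<longleftrightarrow> integrable lborel (\<lambda>x. f (c + x))" by (rule integrable_distr_eq) simp_all
  finally show "integrable lborel (\<lambda>x. f (x + c)) \<longleftrightarrow> integrable lborel f" by (simp add: add.commute)
qed

lemma lborel_nn_integral_shift:
  fixes f :: "'a::euclidean_space \<Rightarrow> ennreal"
  assumes [measurable]: "f \<in> borel_measurable borel"
  shows "(\<integral>\<^sup>+x. f (x + c) \<partial>lborel) = (\<integral>\<^sup>+x. f x \<partial>lborel)"
proof -
  have "(\<integral>\<^sup>+x. f x \<partial>lborel) = (\<integral>\<^sup>+x. f x \<partial>distr lborel borel ((+) c))"
    by (simp add: lborel_distr_plus)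
  also have "\<dots> = (\<integral>\<^sup>+x. f (c + x) \<partial>lborel)" by (rule nn_integral_distr) simp_all
  finally show ?thesis by (simp add: add.commute)
qed

lemma integrable_mult_bounded:
  fixes h :: "'a \<Rightarrow> real"
  assumes "integrable M h" "\<psi> \<in> borel_measurable M" "\<And>x. \<bar>\<psi> x\<bar> \<le> C"
  shows "integrable M (\<lambda>x. h x * \<psi> x)"
proof (rule Bochner_Integration.integrable_bound)
  show "integrable M (\<lambda>x. C * h x)" using assms(1) by (rule integrable_mult_right)
  show "(\<lambda>x. h x * \<psi> x) \<in> borel_measurable M"
    using assms by (intro borel_measurable_times) auto
  have "\<bar>h x\<bar> * \<bar>\<psi> x\<bar> \<le> \<bar>C\<bar> * \<bar>h x\<bar>" for x
    using mult_left_mono[OF order_trans[OF assms(3)[of x] abs_ge_self], of "\<bar>h x\<bar>"]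
    by (simp add: mult.commute)
  then show "AE x in M. norm (h x * \<psi> x) \<le> norm (C * h x)"
    by (intro AE_I2) (simp add: abs_mult)
qed

text \<open>
Along a segment of translates the slices all have the same norm in \<open>L\<^sup>1\<close>, up to a bounded factor; over an
interval of finite length a uniform bound is all that Fubini's theorem asks for.
\<close>

lemma Fubini_strip:
  fixes k :: "real \<Rightarrow> 'a::euclidean_space \<Rightarrow> real"
  assumes meas: "case_prod k \<in> borel_measurable (lborel \<Otimes>\<^sub>M lborel)"
    and int: "\<And>s. integrable lborel (k s)" and le: "\<And>s. (LINT x|lborel. \<bar>k s x\<bar>) \<le> B"
  shows "integrable (lborel \<Otimes>\<^sub>M lborel) (\<lambda>(s, x). indicator {0..t} s * k s x)"
    and "(LINT s|lborel. indicator {0..t} s * (LINT x|lborel. k s x)) =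
         (LINT x|lborel. (LINT s|lborel. indicator {0..t} s * k s x))"
proof -
  have m[measurable]: "(\<lambda>z. k (fst z) (snd z)) \<in> borel_measurable (lborel \<Otimes>\<^sub>M lborel)"
    using meas by (simp add: case_prod_beta')
  show I: "integrable (lborel \<Otimes>\<^sub>M lborel) (\<lambda>(s, x). indicator {0..t} s * k s x)"
  proof (rule lborel_pair.Fubini_integrable)
    show "(\<lambda>(s, x). indicator {0..t} s * k s x) \<in> borel_measurable (lborel \<Otimes>\<^sub>M lborel)"
      unfolding case_prod_beta' by measurable
    have mm: "(\<lambda>s. LINT x|lborel. \<bar>k s x\<bar>) \<in> borel_measurable lborel"
      using lborel.borel_measurable_lebesgue_integral[of "\<lambda>s x. \<bar>k s x\<bar>" lborel] m
      by (simp add: case_prod_beta')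
    have "integrable lborel (\<lambda>s. indicator {0..t} s * (LINT x|lborel. \<bar>k s x\<bar>))"
    proof (rule integrable_mult_bounded[OF _ mm])
      show "integrable lborel (indicator {0..t} :: real \<Rightarrow> real)"
        by (cases "0 \<le> t") (auto simp: integrable_indicator_iff)
      show "\<bar>LINT x|lborel. \<bar>k s x\<bar>\<bar> \<le> B" for s
        using le[of s] by (subst abs_of_nonneg) (auto intro: integral_nonneg_AE)
    qed
    then show "integrable lborel (\<lambda>s. LINT x|lborel. norm (case (s, x) of (s, x) \<Rightarrow> indicator {0..t} s * k s x))"
      by (simp add: abs_mult)
    show "AE s in lborel. integrable lborel (\<lambda>x. case (s, x) of (s, x) \<Rightarrow> indicator {0..t} s * k s x)"
      using int by simp
  qed
  show "(LINT s|lborel. indicator {0..t} s * (LINT x|lborel. k s x)) =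
         (LINT x|lborel. (LINT s|lborel. indicator {0..t} s * k s x))"
    using lborel_pair.Fubini_integral[OF I] by simp
qed

lemma test_function_shift:
  assumes "\<phi> \<in> test_functions V" "\<And>x. x \<in> V \<Longrightarrow> x + c \<in> U"
  shows "(\<lambda>y. \<phi> (y - c)) \<in> test_functions U"
    and "frechet_derivative (\<lambda>y. \<phi> (y - c)) (at y) b = frechet_derivative \<phi> (at (y - c)) b"
proof -
  let ?K = "closure {x. \<phi> x \<noteq> 0}"
  show "(\<lambda>y. \<phi> (y - c)) \<in> test_functions U"
  proof (rule test_functionsI[where K = "(\<lambda>x. x + c) ` ?K"])
    show "C_k k (\<lambda>y. \<phi> (y - c))" for k
      using C_k_shift[of k \<phi> "- c"] assms(1) by (simp add: test_functions_def)
    show "compact ((\<lambda>x. x + c) ` ?K)"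
      using assms(1) by (intro compact_continuous_image continuous_intros) (simp add: test_functions_def)
    show "(\<lambda>x. x + c) ` ?K \<subseteq> U" using assms by (auto simp: test_functions_def)
    show "\<phi> (y - c) = 0" if "y \<notin> (\<lambda>x. x + c) ` ?K" for y
    proof (rule ccontr)
      assume "\<phi> (y - c) \<noteq> 0"
      then have "y - c \<in> ?K" using closure_subset[of "{x. \<phi> x \<noteq> 0}"] by blast
      then have "(y - c) + c \<in> (\<lambda>x. x + c) ` ?K" by (rule imageI)
      with that show False by simp
    qed
  qed
  have "\<phi> differentiable (at (y + - c))"
    using test_function_has_derivative[OF assms(1)] by (auto simp: differentiable_def)
  from frechet_derivative_shift(1)[OF this]
  show "frechet_derivative (\<lambda>y. \<phi> (y - c)) (at y) b = frechet_derivative \<phi> (at (y - c)) b" by simp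
qed

lemma test_function_FTC:
  assumes "\<phi> \<in> test_functions V" "t \<ge> 0"
  shows "(LINT s|lborel. indicator {0..t} s * frechet_derivative \<phi> (at (y - s *\<^sub>R b)) b) =
    \<phi> y - \<phi> (y - t *\<^sub>R b)"
proof -
  let ?d = "\<lambda>s. frechet_derivative \<phi> (at (y - s *\<^sub>R b)) b"
  have "((\<lambda>s. - \<phi> (y - s *\<^sub>R b)) has_vector_derivative ?d s) (at s within {0..t})" for s
  proof -
    have "((\<lambda>s. y - s *\<^sub>R b) has_derivative (\<lambda>h. - (h *\<^sub>R b))) (at s within {0..t})"
      by (auto intro!: derivative_eq_intros)
    from has_derivative_compose[OF this test_function_has_derivative[OF assms(1)]]
    have *: "((\<lambda>s. \<phi> (y - s *\<^sub>R b)) has_derivative (\<lambda>h. frechet_derivative \<phi> (at (y - s *\<^sub>R b)) (- (h *\<^sub>R b))))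
      (at s within {0..t})" .
    interpret bounded_linear "frechet_derivative \<phi> (at (y - s *\<^sub>R b))"
      using test_function_has_derivative[OF assms(1)] has_derivative_bounded_linear by blast
    from has_derivative_minus[OF *] show ?thesis
      unfolding has_vector_derivative_def by (simp add: neg scale)
  qed
  moreover have "continuous_on {0..t} ?d"
    by (rule continuous_on_compose2[OF test_function_deriv_continuous[OF assms(1)]])
      (auto intro!: continuous_intros)
  ultimately show ?thesis
    using integral_FTC_atLeastAtMost[OF assms(2), of "\<lambda>s. - \<phi> (y - s *\<^sub>R b)" ?d] by simp
qed

text \<open>
Weak derivatives for integrable functions on the whole space, tested only by functions supported in
\<open>U\<close>.  After multiplication with the indicator of a compact neighbourhood, every weak derivative on
\<open>D\<close> takes this form, and translations then need no domain restrictions.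
\<close>

definition has_weak_deriv_on ::
    "'a::euclidean_space set \<Rightarrow> 'a \<Rightarrow> ('a \<Rightarrow> real) \<Rightarrow> ('a \<Rightarrow> real) \<Rightarrow> bool" where
  "has_weak_deriv_on U b u g \<longleftrightarrow> integrable lborel u \<and> integrable lborel g \<and>
     (\<forall>\<phi>\<in>test_functions U.
        (LINT x|lborel. u x * frechet_derivative \<phi> (at x) b) = - (LINT x|lborel. g x * \<phi> x))"

text \<open>
Move the translation to the test function, write its increment as an integral of its derivative,
exchange the integrals, and use the weak derivative against each translated test function.
\<close>

lemma weak_deriv_shift_integral:
  fixes u g :: "'a::euclidean_space \<Rightarrow> real"
  assumes w: "has_weak_deriv_on U b u g" and \<phi>: "\<phi> \<in> test_functions V" and t: "t \<ge> 0"
    and sub: "\<And>x s. x \<in> V \<Longrightarrow> s \<in> {0..t} \<Longrightarrow> x + s *\<^sub>R b \<in> U"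
  shows "(LINT x|lborel. (u (x + t *\<^sub>R b) - u x) * \<phi> x) =
    (LINT s|lborel. indicator {0..t} s * (LINT y|lborel. g y * \<phi> (y - s *\<^sub>R b)))"
proof -
  have iu: "integrable lborel u" "integrable lborel g" using w by (auto simp: has_weak_deriv_on_def)
  then have mu[measurable]: "u \<in> borel_measurable borel" "g \<in> borel_measurable borel" by auto
  obtain K C where "compact K" "K \<subseteq> V" and K: "C \<ge> 0" "\<And>x. \<bar>\<phi> x\<bar> \<le> C * indicator K x"
    "\<And>x. \<bar>frechet_derivative \<phi> (at x) b\<bar> \<le> C * indicator K x"
    using test_function_deriv_bounded[OF \<phi>, of b] by blast
  have C: "\<bar>\<phi> x\<bar> \<le> C" "\<bar>frechet_derivative \<phi> (at x) b\<bar> \<le> C" for x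
    using K(1) K(2)[of x] K(3)[of x] by (auto split: split_indicator_asm)
  let ?d = "\<lambda>x. frechet_derivative \<phi> (at x) b"
  have m\<phi>[measurable]: "\<phi> \<in> borel_measurable borel"
    by (rule borel_measurable_continuous_onI[OF test_function_continuous[OF \<phi>]])
  have md[measurable]: "?d \<in> borel_measurable borel"
    by (rule borel_measurable_continuous_onI[OF test_function_deriv_continuous[OF \<phi>]])
  have I: "integrable lborel (\<lambda>y. u y * \<phi> (y - c))" "integrable lborel (\<lambda>y. u y * ?d (y - c))" for c
    by (rule integrable_mult_bounded[OF iu(1) _ C(1)], simp)
      (rule integrable_mult_bounded[OF iu(1) _ C(2)], simp)
  have I2: "integrable lborel (\<lambda>x. u (x + c) * \<phi> x)" for c
    using lborel_integral_shift(2)[of "\<lambda>y. u y * \<phi> (y - c)" c] I(1)[of c] by simp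
  have "(LINT x|lborel. (u (x + t *\<^sub>R b) - u x) * \<phi> x) =
      (LINT x|lborel. u (x + t *\<^sub>R b) * \<phi> x) - (LINT x|lborel. u x * \<phi> x)"
    using I2[of "t *\<^sub>R b"] I2[of 0]
    by (subst Bochner_Integration.integral_diff[symmetric]) (auto simp: left_diff_distrib)
  also have "(LINT x|lborel. u (x + t *\<^sub>R b) * \<phi> x) = (LINT y|lborel. u y * \<phi> (y - t *\<^sub>R b))"
    using lborel_integral_shift(1)[of "\<lambda>y. u y * \<phi> (y - t *\<^sub>R b)" "t *\<^sub>R b"] by simp
  also have "(LINT y|lborel. u y * \<phi> (y - t *\<^sub>R b)) - (LINT x|lborel. u x * \<phi> x) =
      - (LINT y|lborel. u y * (\<phi> y - \<phi> (y - t *\<^sub>R b)))"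
    using I(1)[of "t *\<^sub>R b"] I(1)[of 0] 
    by (simp add: right_diff_distrib Bochner_Integration.integral_diff)
  also have "(LINT y|lborel. u y * (\<phi> y - \<phi> (y - t *\<^sub>R b))) =
      (LINT y|lborel. (LINT s|lborel. indicator {0..t} s * (u y * ?d (y - s *\<^sub>R b))))"
  proof (intro Bochner_Integration.integral_cong refl)
    fix y
    have "(LINT s|lborel. indicator {0..t} s * (u y * ?d (y - s *\<^sub>R b))) =
      (LINT s|lborel. u y * (indicator {0..t} s * ?d (y - s *\<^sub>R b)))" by (simp add: mult_ac)
    then show "u y * (\<phi> y - \<phi> (y - t *\<^sub>R b)) = (LINT s|lborel. indicator {0..t} s * (u y * ?d (y - s *\<^sub>R b)))"
      using test_function_FTC[OF \<phi> t, of y b] by simp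
  qed
  also have "\<dots> = (LINT s|lborel. indicator {0..t} s * (LINT y|lborel. u y * ?d (y - s *\<^sub>R b)))"
  proof (rule Fubini_strip(2)[symmetric])
    show "(\<lambda>(s, y). u y * ?d (y - s *\<^sub>R b)) \<in> borel_measurable (lborel \<Otimes>\<^sub>M lborel)"
      by measurable
    show "integrable lborel (\<lambda>y. u y * ?d (y - s *\<^sub>R b))" for s by (rule I)
    show "(LINT y|lborel. \<bar>u y * ?d (y - s *\<^sub>R b)\<bar>) \<le> (LINT y|lborel. \<bar>u y\<bar> * C)" for s
      using integrable_abs[OF I(2)[of "s *\<^sub>R b"]] iu(1) C(2)
      by (intro integral_mono) (auto simp: abs_mult intro!: mult_left_mono)
  qed
  also have "\<dots> = (LINT s|lborel. indicator {0..t} s * - (LINT y|lborel. g y * \<phi> (y - s *\<^sub>R b)))"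
  proof (intro Bochner_Integration.integral_cong refl)
    fix s
    have "(LINT y|lborel. u y * ?d (y - s *\<^sub>R b)) = - (LINT y|lborel. g y * \<phi> (y - s *\<^sub>R b))"
      if "s \<in> {0..t}"
    proof -
      have t: "(\<lambda>y. \<phi> (y - s *\<^sub>R b)) \<in> test_functions U"
        by (rule test_function_shift(1)[OF \<phi>]) (use sub that in auto)
      have d: "frechet_derivative (\<lambda>y. \<phi> (y - s *\<^sub>R b)) (at y) b = ?d (y - s *\<^sub>R b)" for y
        by (rule test_function_shift(2)[OF \<phi>, of _ UNIV]) simp
      have "\<forall>\<phi>\<in>test_functions U.
        (LINT x|lborel. u x * frechet_derivative \<phi> (at x) b) = - (LINT x|lborel. g x * \<phi> x)"
        using w unfolding has_weak_deriv_on_def by blast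
      from bspec[OF this t] show ?thesis unfolding d .
    qed
    then show "indicator {0..t} s * (LINT y|lborel. u y * ?d (y - s *\<^sub>R b)) =
      indicator {0..t} s * - (LINT y|lborel. g y * \<phi> (y - s *\<^sub>R b))"
      by (cases "s \<in> {0..t}") simp_all
  qed
  finally show ?thesis by simp
qed

text \<open>
The same exchange of integrals for an arbitrary bounded multiplier in place of a test function.
\<close>

lemma shift_mean_integrable:
  fixes g :: "'a::euclidean_space \<Rightarrow> real"
  assumes g: "integrable lborel g"
    and [measurable]: "\<psi> \<in> borel_measurable borel" and C: "\<And>x. \<bar>\<psi> x\<bar> \<le> C"
  shows "integrable lborel (\<lambda>x. LINT s|lborel. indicator {0..t} s * g (x + s *\<^sub>R b))"
    and "AE x in lborel. integrable lborel (\<lambda>s. indicator {0..t} s * g (x + s *\<^sub>R b))"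
    and "(LINT x|lborel. (LINT s|lborel. indicator {0..t} s * g (x + s *\<^sub>R b)) * \<psi> x) =
      (LINT s|lborel. indicator {0..t} s * (LINT y|lborel. g y * \<psi> (y - s *\<^sub>R b)))"
proof -
  have [measurable]: "g \<in> borel_measurable borel" using g by auto
  have m: "(\<lambda>(s, x). g (x + s *\<^sub>R b)) \<in> borel_measurable (lborel \<Otimes>\<^sub>M lborel)" by measurable
  have i: "integrable lborel (\<lambda>x. g (x + s *\<^sub>R b))" for s using g lborel_integral_shift(2)[of g] by simp
  have le: "(LINT x|lborel. \<bar>g (x + s *\<^sub>R b)\<bar>) \<le> (LINT x|lborel. \<bar>g x\<bar>)" for s
    using lborel_integral_shift(1)[of "\<lambda>x. \<bar>g x\<bar>" "s *\<^sub>R b"] by simp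
  note F = Fubini_strip[OF m i le]
  show "integrable lborel (\<lambda>x. LINT s|lborel. indicator {0..t} s * g (x + s *\<^sub>R b))"
    using lborel_pair.integrable_snd[OF F(1)] by simp
  show "AE x in lborel. integrable lborel (\<lambda>s. indicator {0..t} s * g (x + s *\<^sub>R b))"
    using lborel_pair.AE_integrable_snd[OF F(1)] by simp
  have i2: "integrable lborel (\<lambda>x. g (x + s *\<^sub>R b) * \<psi> x)" for s
    by (rule integrable_mult_bounded[OF i _ C]) simp
  have "(LINT x|lborel. (LINT s|lborel. indicator {0..t} s * g (x + s *\<^sub>R b)) * \<psi> x) =
    (LINT x|lborel. (LINT s|lborel. indicator {0..t} s * (g (x + s *\<^sub>R b) * \<psi> x)))"
    by (simp add: mult.assoc[symmetric])
  also have "\<dots> = (LINT s|lborel. indicator {0..t} s * (LINT x|lborel. g (x + s *\<^sub>R b) * \<psi> x))"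
  proof (rule Fubini_strip(2)[symmetric, OF _ i2])
    show "(\<lambda>(s, x). g (x + s *\<^sub>R b) * \<psi> x) \<in> borel_measurable (lborel \<Otimes>\<^sub>M lborel)" by measurable
    show "(LINT x|lborel. \<bar>g (x + s *\<^sub>R b) * \<psi> x\<bar>) \<le> (LINT x|lborel. \<bar>g x\<bar> * C)" for s
    proof -
      have "(LINT x|lborel. \<bar>g (x + s *\<^sub>R b) * \<psi> x\<bar>) \<le> (LINT x|lborel. \<bar>g (x + s *\<^sub>R b)\<bar> * C)"
        using integrable_abs[OF i2[of s]] integrable_abs[OF i[of s]] C by (intro integral_mono) (auto simp: abs_mult intro!: mult_left_mono)
      also have "\<dots> = (LINT x|lborel. \<bar>g x\<bar> * C)"
        using lborel_integral_shift(1)[of "\<lambda>x. \<bar>g x\<bar> * C" "s *\<^sub>R b"] by simp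
      finally show ?thesis .
    qed
  qed
  also have "\<dots> = (LINT s|lborel. indicator {0..t} s * (LINT y|lborel. g y * \<psi> (y - s *\<^sub>R b)))"
    using lborel_integral_shift(1)[of "\<lambda>y. g y * \<psi> (y - s *\<^sub>R b)" "s *\<^sub>R b" for s] by simp
  finally show "(LINT x|lborel. (LINT s|lborel. indicator {0..t} s * g (x + s *\<^sub>R b)) * \<psi> x) =
      (LINT s|lborel. indicator {0..t} s * (LINT y|lborel. g y * \<psi> (y - s *\<^sub>R b)))" .
qed

lemma integrable_lborel_imp_L1_loc:
  assumes "open D" "integrable lborel u" shows "u \<in> L1_loc D"
  unfolding L1_loc_def set_integrable_def
proof (intro CollectI conjI allI impI)
  have i: "integrable lebesgue u" using assms(2) integrable_completion[of u lborel] by auto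
  then show "u \<in> borel_measurable (lebesgue_on D)" by (intro measurable_restrict_space1) auto
  fix K assume "compact K \<and> K \<subseteq> D"
  then show "integrable lebesgue (\<lambda>x. indicat_real K x *\<^sub>R u x)"
    using fmeasurableD[OF lmeasurable_compact, of K] by (intro integrable_mult_indicator i) auto
qed

lemma integral_lebesgue_on_lborel:
  fixes f :: "'a::euclidean_space \<Rightarrow> real"
  assumes "open D" "f \<in> borel_measurable borel" "\<And>x. x \<notin> D \<Longrightarrow> f x = 0"
  shows "(LINT x|lebesgue_on D. f x) = (LINT x|lborel. f x)"
proof -
  have "(LINT x|lebesgue_on D. f x) = (LINT x|lebesgue. indicator D x *\<^sub>R f x)"
    using assms(1) by (intro integral_restrict_space) auto
  also have "\<dots> = (LINT x|lebesgue. f x)"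
    using assms(3) by (intro Bochner_Integration.integral_cong) (auto split: split_indicator)
  also have "\<dots> = (LINT x|lborel. f x)" using assms(2) by (intro integral_completion) simp
  finally show ?thesis .
qed

text \<open>
The two previous lemmas identify the pairings of both sides with every test function.
\<close>

lemma weak_deriv_translation:
  fixes u g :: "'a::euclidean_space \<Rightarrow> real"
  assumes w: "has_weak_deriv_on U b u g" and V: "open V" and t: "t \<ge> 0"
    and sub: "\<And>x s. x \<in> V \<Longrightarrow> s \<in> {0..t} \<Longrightarrow> x + s *\<^sub>R b \<in> U"
  shows "AE x in lborel. x \<in> V \<longrightarrow>
    u (x + t *\<^sub>R b) - u x = (LINT s|lborel. indicator {0..t} s * g (x + s *\<^sub>R b))"
proof -
  let ?G = "\<lambda>x. LINT s|lborel. indicator {0..t} s * g (x + s *\<^sub>R b)"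
  let ?w = "\<lambda>x. u (x + t *\<^sub>R b) - u x - ?G x"
  have iu: "integrable lborel u" "integrable lborel g" using w by (auto simp: has_weak_deriv_on_def)
  then have mu[measurable]: "u \<in> borel_measurable borel" "g \<in> borel_measurable borel" by auto
  have G: "integrable lborel ?G" using shift_mean_integrable(1)[OF iu(2), of "\<lambda>_. 0" 0] by simp
  have iw: "integrable lborel (\<lambda>x. u (x + t *\<^sub>R b) - u x)"
    using iu lborel_integral_shift(2)[of u] by simp
  have iw': "integrable lborel ?w" using iw G by simp
  have "AE x in lebesgue_on V. ?w x = 0"
  proof (rule L1_loc_zero_if_weakly_zero[OF V integrable_lborel_imp_L1_loc[OF V iw']])
    fix \<phi> assume \<phi>: "\<phi> \<in> test_functions V"
    obtain K C where K: "C \<ge> 0" "\<And>x. \<bar>\<phi> x\<bar> \<le> C * indicator K x"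
      using test_function_deriv_bounded[OF \<phi>] by metis
    have C: "\<bar>\<phi> x\<bar> \<le> C" for x
      using K(1) K(2)[of x] by (auto split: split_indicator_asm)
    have m\<phi>[measurable]: "\<phi> \<in> borel_measurable borel"
      by (intro borel_measurable_continuous_onI test_function_continuous[OF \<phi>])
    have "?w \<in> borel_measurable borel" using iw' by auto
    then have "(LINT x|lebesgue_on V. ?w x * \<phi> x) = (LINT x|lborel. ?w x * \<phi> x)"
      using test_functions_zero[OF \<phi>] by (intro integral_lebesgue_on_lborel V borel_measurable_times) auto
    also have "\<dots> = (LINT x|lborel. (u (x + t *\<^sub>R b) - u x) * \<phi> x) - (LINT x|lborel. ?G x * \<phi> x)"
      using integrable_mult_bounded[OF iw _ C] integrable_mult_bounded[OF G _ C]
      by (subst Bochner_Integration.integral_diff[symmetric]) (simp_all add: left_diff_distrib)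
    also have "\<dots> = 0"
      using weak_deriv_shift_integral[OF w \<phi> t sub] shift_mean_integrable(3)[OF iu(2) m\<phi> C] by simp
    finally show "(LINT x|lebesgue_on V. ?w x * \<phi> x) = 0" .
  qed
  then have "AE x in lebesgue. x \<in> V \<longrightarrow> ?w x = 0"
    using V by (subst (asm) AE_restrict_space_iff) auto
  then have "AE x in lborel. x \<in> V \<longrightarrow> ?w x = 0"
    by (simp add: AE_completion_iff)
  then show ?thesis by eventually_elim simp
qed

text \<open>
The Cauchy-Schwarz inequality on an interval, in a form that is meaningful when the right side is
infinite; it follows from the nonnegativity of the variance.
\<close>

lemma square_interval_integral_le:
  fixes f :: "real \<Rightarrow> real"
  assumes [measurable]: "f \<in> borel_measurable borel"
    and int: "integrable lborel (\<lambda>s. indicator {0..t} s * f s)" and t: "t \<ge> 0"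
  shows "ennreal ((LINT s|lborel. indicator {0..t} s * f s)\<^sup>2) \<le>
    ennreal t * (\<integral>\<^sup>+s. indicator {0..t} s * ennreal ((f s)\<^sup>2) \<partial>lborel)"
proof (cases "t = 0")
  case True
  have "(LINT s|lborel. indicator {0..t} s * f s) = 0"
  proof (rule integral_eq_zero_AE)
    have "AE s in lborel. s \<noteq> (0::real)" by (rule AE_lborel_singleton)
    then show "AE s in lborel. indicator {0..t} s * f s = 0"
      by eventually_elim (use True in \<open>auto split: split_indicator\<close>)
  qed
  then show ?thesis by simp
next
  case False
  with t have t: "t > 0" by simp
  let ?I = "LINT s|lborel. indicator {0..t} s * f s"
  show ?thesis
  proof (cases "(\<integral>\<^sup>+s. indicator {0..t} s * ennreal ((f s)\<^sup>2) \<partial>lborel) = \<infinity>")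
    case True
    then show ?thesis using t by (simp add: ennreal_mult_top)
  next
    case False
    have e: "indicator {0..t} s * ennreal ((f s)\<^sup>2) = ennreal (indicator {0..t} s * (f s)\<^sup>2)" for s
      by (auto split: split_indicator)
    have i2: "integrable lborel (\<lambda>s. indicator {0..t} s * (f s)\<^sup>2)"
      by (rule integrableI_nonneg) (use False in \<open>auto simp: e less_top split: split_indicator\<close>)
    have i1: "integrable lborel (indicator {0..t} :: real \<Rightarrow> real)"
      using t by (auto simp: integrable_indicator_iff)
    \<comment> \<open>The mean of \<open>f\<close> over the interval.\<close>
    define c where "c = ?I / t"
    have "0 \<le> (LINT s|lborel. indicator {0..t} s * (f s - c)\<^sup>2)"
      by (intro integral_nonneg_AE) (auto split: split_indicator)
    also have "\<dots> = (LINT s|lborel. indicator {0..t} s * (f s)\<^sup>2 - 2 * c * (indicator {0..t} s * f s) + c\<^sup>2 * indicator {0..t} s)"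
      by (simp add: power2_diff algebra_simps)
    also have "\<dots> = (LINT s|lborel. indicator {0..t} s * (f s)\<^sup>2) - 2 * c * ?I + c\<^sup>2 * t"
      using i1 i2 int t by (simp add: measure_def)
    finally have "?I\<^sup>2 \<le> t * (LINT s|lborel. indicator {0..t} s * (f s)\<^sup>2)"
      using t unfolding c_def by (simp add: field_simps power2_eq_square)
    then have "ennreal (?I\<^sup>2) \<le> ennreal (t * (LINT s|lborel. indicator {0..t} s * (f s)\<^sup>2))"
      by (rule ennreal_leI)
    also have "\<dots> = ennreal t * ennreal (LINT s|lborel. indicator {0..t} s * (f s)\<^sup>2)"
      using t by (intro ennreal_mult integral_nonneg_AE) (auto split: split_indicator)
    also have "ennreal (LINT s|lborel. indicator {0..t} s * (f s)\<^sup>2) =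
      (\<integral>\<^sup>+s. indicator {0..t} s * ennreal ((f s)\<^sup>2) \<partial>lborel)"
      unfolding e by (rule nn_integral_eq_integral[OF i2, symmetric]) (auto split: split_indicator)
    finally show ?thesis .
  qed
qed

lemma weak_deriv_translation_L2:
  fixes u g :: "'a::euclidean_space \<Rightarrow> real"
  assumes w: "has_weak_deriv_on U b u g" and V: "open V" and t: "t \<ge> 0"
    and sub: "\<And>x s. x \<in> V \<Longrightarrow> s \<in> {0..t} \<Longrightarrow> x + s *\<^sub>R b \<in> U"
  shows "(\<integral>\<^sup>+x. indicator V x * ennreal ((u (x + t *\<^sub>R b) - u x)\<^sup>2) \<partial>lborel) \<le>
    ennreal (t\<^sup>2) * (\<integral>\<^sup>+x. ennreal ((g x)\<^sup>2) \<partial>lborel)"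
proof -
  let ?G = "\<lambda>x. LINT s|lborel. indicator {0..t} s * g (x + s *\<^sub>R b)"
  have ig: "integrable lborel g" using w by (auto simp: has_weak_deriv_on_def)
  then have mu[measurable]: "g \<in> borel_measurable borel" by auto
  have "AE x in lborel. integrable lborel (\<lambda>s. indicator {0..t} s * g (x + s *\<^sub>R b))"
    using shift_mean_integrable(2)[OF ig, of "\<lambda>_. 0" 0] by simp
  moreover have "AE x in lborel. x \<in> V \<longrightarrow> u (x + t *\<^sub>R b) - u x = ?G x"
    by (rule weak_deriv_translation[OF w V t]) (rule sub)
  ultimately have "AE x in lborel. indicator V x * ennreal ((u (x + t *\<^sub>R b) - u x)\<^sup>2) \<le>
     ennreal t * (\<integral>\<^sup>+s. indicator {0..t} s * ennreal ((g (x + s *\<^sub>R b))\<^sup>2) \<partial>lborel)"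
  proof eventually_elim
    case (elim x)
    show ?case
    proof (cases "x \<in> V")
      case True
      then have "u (x + t *\<^sub>R b) - u x = ?G x" using elim by simp
      then show ?thesis using True elim(1) square_interval_integral_le[of "\<lambda>s. g (x + s *\<^sub>R b)" t] t by simp
    qed simp
  qed
  then have "(\<integral>\<^sup>+x. indicator V x * ennreal ((u (x + t *\<^sub>R b) - u x)\<^sup>2) \<partial>lborel) \<le>
    (\<integral>\<^sup>+x. ennreal t * (\<integral>\<^sup>+s. indicator {0..t} s * ennreal ((g (x + s *\<^sub>R b))\<^sup>2) \<partial>lborel) \<partial>lborel)"
    by (rule nn_integral_mono_AE)
  also have "\<dots> = ennreal t * (\<integral>\<^sup>+x. (\<integral>\<^sup>+s. indicator {0..t} s * ennreal ((g (x + s *\<^sub>R b))\<^sup>2) \<partial>lborel) \<partial>lborel)"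
    by (rule nn_integral_cmult) measurable
  also have "(\<integral>\<^sup>+x. (\<integral>\<^sup>+s. indicator {0..t} s * ennreal ((g (x + s *\<^sub>R b))\<^sup>2) \<partial>lborel) \<partial>lborel) =
     (\<integral>\<^sup>+s. (\<integral>\<^sup>+x. indicator {0..t} s * ennreal ((g (x + s *\<^sub>R b))\<^sup>2) \<partial>lborel) \<partial>lborel)"
    by (rule lborel_pair.Fubini') measurable
  also have "\<dots> = (\<integral>\<^sup>+s. indicator {0..t} s * (\<integral>\<^sup>+x. ennreal ((g x)\<^sup>2) \<partial>lborel) \<partial>lborel)"
    using lborel_nn_integral_shift[of "\<lambda>x. ennreal ((g x)\<^sup>2)" "s *\<^sub>R b" for s]
    by (simp add: nn_integral_cmult)
  also have "\<dots> = ennreal t * (\<integral>\<^sup>+x. ennreal ((g x)\<^sup>2) \<partial>lborel)"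
    using t by (simp add: nn_integral_multc)
  also have "ennreal t * (ennreal t * (\<integral>\<^sup>+x. ennreal ((g x)\<^sup>2) \<partial>lborel)) =
     ennreal (t\<^sup>2) * (\<integral>\<^sup>+x. ennreal ((g x)\<^sup>2) \<partial>lborel)"
    using t by (simp add: power2_eq_square ennreal_mult mult.assoc)
  finally show ?thesis .
qed

section \<open>The chain rule\<close>

lemma weak_deriv_translation_L2_real:
  fixes u g :: "'a::euclidean_space \<Rightarrow> real"
  assumes w: "has_weak_deriv_on U b u g" and V: "open V" and t: "t \<ge> 0"
    and sub: "\<And>x s. x \<in> V \<Longrightarrow> s \<in> {0..t} \<Longrightarrow> x + s *\<^sub>R b \<in> U"
    and g2: "integrable lborel (\<lambda>x. (g x)\<^sup>2)"
  shows "integrable lborel (\<lambda>x. indicator V x * (u (x + t *\<^sub>R b) - u x)\<^sup>2)"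
    and "(LINT x|lborel. indicator V x * (u (x + t *\<^sub>R b) - u x)\<^sup>2) \<le> t\<^sup>2 * (LINT x|lborel. (g x)\<^sup>2)"
proof -
  let ?f = "\<lambda>x. indicator V x * (u (x + t *\<^sub>R b) - u x)\<^sup>2"
  have [measurable]: "u \<in> borel_measurable borel" using w by (auto simp: has_weak_deriv_on_def)
  have [measurable]: "V \<in> sets borel" using V by simp
  have mf: "?f \<in> borel_measurable lborel" by measurable
  have e: "ennreal (?f x) = indicator V x * ennreal ((u (x + t *\<^sub>R b) - u x)\<^sup>2)" for x
    by (auto split: split_indicator)
  have "(\<integral>\<^sup>+x. ennreal (?f x) \<partial>lborel) \<le> ennreal (t\<^sup>2) * (\<integral>\<^sup>+x. ennreal ((g x)\<^sup>2) \<partial>lborel)"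
    unfolding e by (rule weak_deriv_translation_L2[OF w V t]) (rule sub)
  also have "\<dots> = ennreal (t\<^sup>2 * (LINT x|lborel. (g x)\<^sup>2))"
    using nn_integral_eq_integral[OF g2] by (simp add: ennreal_mult)
  finally have le: "(\<integral>\<^sup>+x. ennreal (?f x) \<partial>lborel) \<le> ennreal (t\<^sup>2 * (LINT x|lborel. (g x)\<^sup>2))" .
  show i: "integrable lborel ?f"
    by (rule integrableI_nonneg[OF mf]) (use le in \<open>auto simp: top_unique less_top[symmetric] intro: order.strict_trans1 split: split_indicator\<close>)
  have "ennreal (LINT x|lborel. ?f x) = (\<integral>\<^sup>+x. ennreal (?f x) \<partial>lborel)"
    by (rule nn_integral_eq_integral[OF i, symmetric]) (auto split: split_indicator)
  with le have "ennreal (LINT x|lborel. ?f x) \<le> ennreal (t\<^sup>2 * (LINT x|lborel. (g x)\<^sup>2))" by simp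
  then show "(LINT x|lborel. ?f x) \<le> t\<^sup>2 * (LINT x|lborel. (g x)\<^sup>2)"
    by (subst (asm) ennreal_le_iff) (auto intro!: mult_nonneg_nonneg integral_nonneg_AE)
qed

lemma test_function_shift_le:
  assumes "\<phi> \<in> test_functions V" "s \<ge> 0" "\<And>x. \<bar>frechet_derivative \<phi> (at x) b\<bar> \<le> C"
  shows "\<bar>\<phi> y - \<phi> (y - s *\<^sub>R b)\<bar> \<le> C * s"
proof -
  let ?d = "\<lambda>r. frechet_derivative \<phi> (at (y - r *\<^sub>R b)) b"
  have c: "continuous_on {0..s} ?d"
    by (rule continuous_on_compose2[OF test_function_deriv_continuous[OF assms(1)]])
      (auto intro!: continuous_intros)
  have i: "integrable lborel (\<lambda>r. indicator {0..s} r * ?d r)"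
    using borel_integrable_atLeastAtMost'[OF c] by (simp add: set_integrable_def)
  have i1: "integrable lborel (indicator {0..s} :: real \<Rightarrow> real)"
    using assms(2) by (auto simp: integrable_indicator_iff)
  have "\<bar>\<phi> y - \<phi> (y - s *\<^sub>R b)\<bar> = norm (LINT r|lborel. indicator {0..s} r * ?d r)"
    using test_function_FTC[OF assms(1,2), of y b] by simp
  also have "\<dots> \<le> (LINT r|lborel. norm (indicator {0..s} r * ?d r))" by (rule integral_norm_bound)
  also have "\<dots> \<le> (LINT r|lborel. C * indicator {0..s} r)"
    by (rule integral_mono[OF integrable_norm[OF i]])
      (use i1 assms(3) in \<open>auto split: split_indicator\<close>)
  also have "\<dots> = C * s" using assms(2) by (simp add: measure_def)
  finally show ?thesis .
qed

text \<open>
The functions for which the chain rule is proved by difference quotients: \<open>F'\<close> is bounded and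
Lipschitz, and \<open>F\<close> has a quadratic Taylor error.  The normalization \<open>F 0 = 0\<close> keeps \<open>F \<circ> u\<close>
integrable on the whole space.
\<close>

definition C11_with :: "(real \<Rightarrow> real) \<Rightarrow> (real \<Rightarrow> real) \<Rightarrow> real \<Rightarrow> bool" where
  "C11_with F F' C \<longleftrightarrow> F 0 = 0 \<and> (\<forall>t. \<bar>F' t\<bar> \<le> C) \<and> (\<forall>s t. \<bar>F' t - F' s\<bar> \<le> C * \<bar>t - s\<bar>) \<and>
     (\<forall>s t. \<bar>F t - F s\<bar> \<le> C * \<bar>t - s\<bar>) \<and> (\<forall>s t. \<bar>F t - F s - F' s * (t - s)\<bar> \<le> C * (t - s)\<^sup>2)"

lemma Lipschitz_borel:
  fixes F :: "real \<Rightarrow> real"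
  assumes "\<And>s t. \<bar>F t - F s\<bar> \<le> C * \<bar>t - s\<bar>"
  shows "F \<in> borel_measurable borel"
proof -
  have C: "C \<ge> 0" using assms[of 1 0] by auto
  have "C-lipschitz_on UNIV F" by (rule lipschitz_onI) (use assms C in \<open>auto simp: dist_real_def\<close>)
  then have "continuous_on UNIV F" by (rule lipschitz_on_continuous_on)
  then show ?thesis by (rule borel_measurable_continuous_onI)
qed

text \<open>
Three errors have to be quadratic in \<open>t\<close>.  Replacing the increment of \<open>F \<circ> u\<close> by \<open>F' u\<close> times the
increment of \<open>u\<close> costs the squared increment of \<open>u\<close>, which is \<open>O(t\<^sup>2)\<close> in \<open>L\<^sup>1\<close>.  The increment of \<open>u\<close>
is the integral of \<open>g\<close> along the segment, which moves the translation onto \<open>\<psi> = F' u * \<phi>\<close>.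
Finally \<open>\<psi>\<close> and its translate by \<open>s b\<close> differ by \<open>O(s)\<close> against \<open>g\<close>, because \<open>\<phi>\<close> is Lipschitz and
because \<open>F' u\<close> inherits the translation estimate of \<open>u\<close>.
\<close>

lemma chain_rule_quotient_bound:
  fixes u g :: "'a::euclidean_space \<Rightarrow> real"
  assumes w: "has_weak_deriv_on U b u g" and g2: "integrable lborel (\<lambda>x. (g x)\<^sup>2)"
    and F: "C11_with F F' C" and \<phi>: "\<phi> \<in> test_functions V" and V: "open V"
    and sub: "\<And>x s. x \<in> V \<Longrightarrow> s \<in> {0..\<tau>} \<Longrightarrow> x + s *\<^sub>R b \<in> U"
  obtains B where "\<And>t. 0 < t \<Longrightarrow> t \<le> \<tau> \<Longrightarrow>
    \<bar>(LINT x|lborel. (F (u (x + t *\<^sub>R b)) - F (u x)) * \<phi> x) - t * (LINT y|lborel. g y * (F' (u y) * \<phi> y))\<bar> \<le> B * t\<^sup>2"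
proof -
  have iu: "integrable lborel u" and ig: "integrable lborel g" using w by (auto simp: has_weak_deriv_on_def)
  then have mu[measurable]: "u \<in> borel_measurable borel" "g \<in> borel_measurable borel" by auto
  have F': "\<bar>F' t\<bar> \<le> C" "\<bar>F' t - F' s\<bar> \<le> C * \<bar>t - s\<bar>" "\<bar>F t - F s\<bar> \<le> C * \<bar>t - s\<bar>"
    "\<bar>F t - F s - F' s * (t - s)\<bar> \<le> C * (t - s)\<^sup>2" "F 0 = 0" for s t
    using F by (auto simp: C11_with_def)
  have C0: "C \<ge> 0" using F'(1)[of 0] by linarith
  have mF[measurable]: "F \<in> borel_measurable borel" "F' \<in> borel_measurable borel"
    by (rule Lipschitz_borel[OF F'(3)], rule Lipschitz_borel[OF F'(2)])
  obtain K P where "compact K" "K \<subseteq> V" and K: "P \<ge> 0" "\<And>x. \<bar>\<phi> x\<bar> \<le> P * indicator K x"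
    "\<And>x. \<bar>frechet_derivative \<phi> (at x) b\<bar> \<le> P * indicator K x"
    using test_function_deriv_bounded[OF \<phi>, of b] by blast
  have P: "\<bar>\<phi> x\<bar> \<le> P" "\<bar>frechet_derivative \<phi> (at x) b\<bar> \<le> P" for x
    using K(1) K(2)[of x] K(3)[of x] by (auto split: split_indicator_asm)
  have PV: "\<bar>\<phi> x\<bar> \<le> P * indicator V x" for x
    using K(2)[of x] \<open>K \<subseteq> V\<close> K(1) by (auto split: split_indicator_asm split_indicator)
  have m\<phi>[measurable]: "\<phi> \<in> borel_measurable borel"
    by (rule borel_measurable_continuous_onI[OF test_function_continuous[OF \<phi>]])
  define G where "G = (LINT x|lborel. (g x)\<^sup>2)"
  have G: "G \<ge> 0" unfolding G_def by (rule integral_nonneg_AE) simp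
  define \<psi> where "\<psi> x = F' (u x) * \<phi> x" for x
  have m\<psi>[measurable]: "\<psi> \<in> borel_measurable borel" unfolding \<psi>_def by measurable
  have \<psi>: "\<bar>\<psi> x\<bar> \<le> C * P" for x
    unfolding \<psi>_def abs_mult by (intro mult_mono F' P C0) auto
  have ius: "integrable lborel (\<lambda>x. u (x + c))" for c using iu lborel_integral_shift(2)[of u] by simp
  have igs: "integrable lborel (\<lambda>x. g (x + c))" for c using ig lborel_integral_shift(2)[of g] by simp
  have iF: "integrable lborel (\<lambda>x. F (u (x + c)))" for c
  proof (rule Bochner_Integration.integrable_bound[OF integrable_mult_right[OF ius[of c], of C]])
    show "AE x in lborel. norm (F (u (x + c))) \<le> norm (C * u (x + c))"
      using F'(3)[of _ 0] F'(5) C0 by (intro AE_I2) (simp add: abs_mult)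
  qed measurable
  define A where "A = (LINT y|lborel. g y * \<psi> y)"
  have main: "\<bar>(LINT x|lborel. (F (u (x + t *\<^sub>R b)) - F (u x)) * \<phi> x) - t * A\<bar>
    \<le> (C * P * G + (C * P * (LINT y|lborel. \<bar>g y\<bar>) + C * P * G)) * t\<^sup>2" if t: "0 < t" "t \<le> \<tau>" for t
  proof -
    have sub': "x + s *\<^sub>R b \<in> U" if "x \<in> V" "s \<in> {0..r}" "r \<le> t" for x s r
      using sub[of x s] that t by auto
    have T: "integrable lborel (\<lambda>x. indicator V x * (u (x + r *\<^sub>R b) - u x)\<^sup>2)"
      "(LINT x|lborel. indicator V x * (u (x + r *\<^sub>R b) - u x)\<^sup>2) \<le> r\<^sup>2 * G" if "0 \<le> r" "r \<le> t" for r
      unfolding G_def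
      by (rule weak_deriv_translation_L2_real[OF w V that(1) _ g2], rule sub', use that in auto)+
    let ?\<Delta> = "\<lambda>x. u (x + t *\<^sub>R b) - u x"
    have i\<Delta>: "integrable lborel (\<lambda>x. ?\<Delta> x * \<psi> x)"
      by (rule integrable_mult_bounded[OF _ _ \<psi>]) (use ius[of "t *\<^sub>R b"] iu in simp_all)
    have iD: "integrable lborel (\<lambda>x. (F (u (x + t *\<^sub>R b)) - F (u x)) * \<phi> x)"
      by (rule integrable_mult_bounded[OF _ _ P(1)]) (use iF[of "t *\<^sub>R b"] iF[of 0] in simp_all)
    \<comment> \<open>Linearization: the Taylor error of \<open>F\<close> is quadratic in the increment of \<open>u\<close>.\<close>
    have E1: "\<bar>(LINT x|lborel. (F (u (x + t *\<^sub>R b)) - F (u x)) * \<phi> x) - (LINT x|lborel. ?\<Delta> x * \<psi> x)\<bar>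
      \<le> C * P * G * t\<^sup>2"
    proof -
      have "\<bar>(LINT x|lborel. (F (u (x + t *\<^sub>R b)) - F (u x)) * \<phi> x) - (LINT x|lborel. ?\<Delta> x * \<psi> x)\<bar> =
        norm (LINT x|lborel. (F (u (x + t *\<^sub>R b)) - F (u x)) * \<phi> x - ?\<Delta> x * \<psi> x)"
        using iD i\<Delta> by (simp add: Bochner_Integration.integral_diff)
      also have "\<dots> \<le> (LINT x|lborel. norm ((F (u (x + t *\<^sub>R b)) - F (u x)) * \<phi> x - ?\<Delta> x * \<psi> x))"
        by (rule integral_norm_bound)
      also have "\<dots> \<le> (LINT x|lborel. (C * P) * (indicator V x * (?\<Delta> x)\<^sup>2))"
      proof (rule integral_mono)
        show "integrable lborel (\<lambda>x. norm ((F (u (x + t *\<^sub>R b)) - F (u x)) * \<phi> x - ?\<Delta> x * \<psi> x))"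
          using iD i\<Delta> by (intro integrable_norm Bochner_Integration.integrable_diff)
        show "integrable lborel (\<lambda>x. (C * P) * (indicator V x * (?\<Delta> x)\<^sup>2))"
          using T(1)[of t] t by simp
        fix x
        have "(F (u (x + t *\<^sub>R b)) - F (u x)) * \<phi> x - ?\<Delta> x * \<psi> x =
          (F (u (x + t *\<^sub>R b)) - F (u x) - F' (u x) * ?\<Delta> x) * \<phi> x"
          by (simp add: \<psi>_def algebra_simps)
        then have "norm ((F (u (x + t *\<^sub>R b)) - F (u x)) * \<phi> x - ?\<Delta> x * \<psi> x) =
          \<bar>F (u (x + t *\<^sub>R b)) - F (u x) - F' (u x) * ?\<Delta> x\<bar> * \<bar>\<phi> x\<bar>" by (simp add: abs_mult)
        also have "\<dots> \<le> (C * (?\<Delta> x)\<^sup>2) * (P * indicator V x)"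
          by (intro mult_mono F'(4) PV) (use C0 in auto)
        finally show "norm ((F (u (x + t *\<^sub>R b)) - F (u x)) * \<phi> x - ?\<Delta> x * \<psi> x) \<le>
          (C * P) * (indicator V x * (?\<Delta> x)\<^sup>2)" by (simp add: mult_ac)
      qed
      also have "\<dots> = (C * P) * (LINT x|lborel. indicator V x * (?\<Delta> x)\<^sup>2)" by simp
      also have "\<dots> \<le> (C * P) * (t\<^sup>2 * G)"
        by (intro mult_left_mono T) (use t C0 K(1) in auto)
      finally show ?thesis by (simp add: mult_ac)
    qed
    \<comment> \<open>The increment of \<open>u\<close> is an integral of \<open>g\<close>; the translation moves to \<open>\<psi>\<close>.\<close>
    have E2: "(LINT x|lborel. ?\<Delta> x * \<psi> x) =
      (LINT s|lborel. indicator {0..t} s * (LINT y|lborel. g y * \<psi> (y - s *\<^sub>R b)))"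
    proof -
      let ?G = "\<lambda>x. LINT s|lborel. indicator {0..t} s * g (x + s *\<^sub>R b)"
      note S = shift_mean_integrable[OF ig m\<psi> \<psi>]
      have "AE x in lborel. x \<in> V \<longrightarrow> ?\<Delta> x = ?G x"
        by (rule weak_deriv_translation[OF w V]) (use t sub' in auto)
      then have "AE x in lborel. ?\<Delta> x * \<psi> x = ?G x * \<psi> x"
      proof eventually_elim
        case (elim x)
        show ?case
        proof (cases "x \<in> V")
          case False
          then have "\<phi> x = 0" using PV[of x] by simp
          then show ?thesis by (simp add: \<psi>_def)
        qed (use elim in simp)
      qed
      then have "(LINT x|lborel. ?\<Delta> x * \<psi> x) = (LINT x|lborel. ?G x * \<psi> x)"
        using integrable_mult_bounded[OF S(1) _ \<psi>] by (intro integral_cong_AE) auto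
      then show ?thesis using S(3) by simp
    qed
    have ig\<psi>: "integrable lborel (\<lambda>y. g y * \<psi> (y - c))" for c
      by (rule integrable_mult_bounded[OF ig _ \<psi>]) simp
    define B2 where "B2 = C * P * (LINT y|lborel. \<bar>g y\<bar>) + C * P * G"
    have E3: "\<bar>(LINT y|lborel. g y * \<psi> (y - s *\<^sub>R b)) - A\<bar> \<le> B2 * s" if s: "0 < s" "s \<le> t" for s
    proof -
      let ?h = "\<lambda>y. indicator V (y - s *\<^sub>R b) * (u y - u (y - s *\<^sub>R b))\<^sup>2"
      have [measurable]: "V \<in> sets borel" using V by simp
      have h: "integrable lborel ?h" "(LINT y|lborel. ?h y) \<le> s\<^sup>2 * G"
        using T[of s] s lborel_integral_shift[of ?h "s *\<^sub>R b"] by simp_all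
      let ?k = "\<lambda>y. (C * P * s) * \<bar>g y\<bar> + (C * P / 2) * (s * (g y)\<^sup>2 + (1 / s) * ?h y)"
      have ik: "integrable lborel ?k" using ig g2 h by simp
      have "\<bar>(LINT y|lborel. g y * \<psi> (y - s *\<^sub>R b)) - A\<bar> = norm (LINT y|lborel. g y * \<psi> (y - s *\<^sub>R b) - g y * \<psi> y)"
        unfolding A_def using ig\<psi>[of "s *\<^sub>R b"] ig\<psi>[of 0] by (simp add: Bochner_Integration.integral_diff)
      also have "\<dots> \<le> (LINT y|lborel. norm (g y * \<psi> (y - s *\<^sub>R b) - g y * \<psi> y))"
        by (rule integral_norm_bound)
      also have "\<dots> \<le> (LINT y|lborel. ?k y)"
      proof (rule integral_mono[OF _ ik])
        show "integrable lborel (\<lambda>y. norm (g y * \<psi> (y - s *\<^sub>R b) - g y * \<psi> y))"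
          using ig\<psi>[of "s *\<^sub>R b"] ig\<psi>[of 0] by (intro integrable_norm Bochner_Integration.integrable_diff) simp_all
        fix y
        let ?z = "y - s *\<^sub>R b"
        have "\<psi> ?z - \<psi> y = (F' (u ?z) - F' (u y)) * \<phi> ?z + F' (u y) * (\<phi> ?z - \<phi> y)"
          by (simp add: \<psi>_def algebra_simps)
        then have "\<bar>\<psi> ?z - \<psi> y\<bar> \<le> \<bar>F' (u ?z) - F' (u y)\<bar> * \<bar>\<phi> ?z\<bar> + \<bar>F' (u y)\<bar> * \<bar>\<phi> ?z - \<phi> y\<bar>"
          by (metis abs_mult abs_triangle_ineq)
        also have "\<dots> \<le> (C * \<bar>u ?z - u y\<bar>) * (P * indicator V ?z) + C * (P * s)"
          using test_function_shift_le[OF \<phi> _ P(2), of s y] s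
          by (intro add_mono mult_mono F' PV) (use C0 K(1) in \<open>auto simp: abs_minus_commute\<close>)
        finally have 1: "\<bar>\<psi> ?z - \<psi> y\<bar> \<le> C * P * (indicator V ?z * \<bar>u y - u ?z\<bar>) + C * P * s"
          by (simp add: mult_ac abs_minus_commute)
        have mid: "\<bar>g y\<bar> * (indicator V ?z * \<bar>u y - u ?z\<bar>) \<le> (1/2) * (s * (g y)\<^sup>2 + (1 / s) * ?h y)"
        proof -
          have "0 \<le> (s * \<bar>g y\<bar> - indicator V ?z * \<bar>u y - u ?z\<bar>)\<^sup>2" by simp
          also have "\<dots> = s\<^sup>2 * (g y)\<^sup>2 - 2 * s * (\<bar>g y\<bar> * (indicator V ?z * \<bar>u y - u ?z\<bar>)) + ?h y"
            by (simp add: power2_diff power_mult_distrib split: split_indicator)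
          finally have "2 * s * (\<bar>g y\<bar> * (indicator V ?z * \<bar>u y - u ?z\<bar>)) \<le> s\<^sup>2 * (g y)\<^sup>2 + ?h y" by simp
          then show ?thesis using s by (simp add: field_simps power2_eq_square)
        qed
        have "norm (g y * \<psi> ?z - g y * \<psi> y) = \<bar>g y\<bar> * \<bar>\<psi> ?z - \<psi> y\<bar>"
          by (simp add: right_diff_distrib[symmetric] abs_mult)
        also have "\<dots> \<le> \<bar>g y\<bar> * (C * P * (indicator V ?z * \<bar>u y - u ?z\<bar>) + C * P * s)"
          by (intro mult_left_mono 1) auto
        also have "\<dots> = (C * P) * (\<bar>g y\<bar> * (indicator V ?z * \<bar>u y - u ?z\<bar>)) + C * P * s * \<bar>g y\<bar>"
          by (simp add: algebra_simps)
        also have "\<dots> \<le> (C * P) * ((1/2) * (s * (g y)\<^sup>2 + (1 / s) * ?h y)) + C * P * s * \<bar>g y\<bar>"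
          by (intro add_mono mult_left_mono mid order_refl) (use C0 K(1) in auto)
        finally show "norm (g y * \<psi> ?z - g y * \<psi> y) \<le> ?k y"
          by (simp add: algebra_simps)
      qed
      also have "\<dots> = (C * P * s) * (LINT y|lborel. \<bar>g y\<bar>) + (C * P / 2) * (s * G + (1 / s) * (LINT y|lborel. ?h y))"
        using ig g2 h by (simp add: G_def)
      also have "\<dots> \<le> (C * P * s) * (LINT y|lborel. \<bar>g y\<bar>) + (C * P / 2) * (s * G + (1 / s) * (s\<^sup>2 * G))"
        using C0 K(1) s h(2) by (intro add_mono mult_left_mono order_refl) auto
      also have "\<dots> = B2 * s" using s by (simp add: B2_def field_simps power2_eq_square)
      finally show ?thesis .
    qed
    have E4: "\<bar>(LINT s|lborel. indicator {0..t} s * (LINT y|lborel. g y * \<psi> (y - s *\<^sub>R b))) - t * A\<bar> \<le> B2 * t\<^sup>2"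
    proof -
      let ?q = "\<lambda>s. LINT y|lborel. g y * \<psi> (y - s *\<^sub>R b)"
      have B2: "B2 \<ge> 0" unfolding B2_def using C0 K(1) G
        by (intro add_nonneg_nonneg mult_nonneg_nonneg integral_nonneg_AE) auto
      have i1: "integrable lborel (indicator {0..t} :: real \<Rightarrow> real)" using t by (auto simp: integrable_indicator_iff)
      have mq: "?q \<in> borel_measurable lborel"
        by (rule lborel.borel_measurable_lebesgue_integral) measurable
      have bq: "\<bar>?q s\<bar> \<le> C * P * (LINT y|lborel. \<bar>g y\<bar>)" for s
      proof -
        have "\<bar>?q s\<bar> \<le> (LINT y|lborel. norm (g y * \<psi> (y - s *\<^sub>R b)))"
          using integral_norm_bound[of lborel "\<lambda>y. g y * \<psi> (y - s *\<^sub>R b)"] by simp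
        also have "\<dots> \<le> (LINT y|lborel. (C * P) * \<bar>g y\<bar>)"
          by (rule integral_mono[OF integrable_norm[OF ig\<psi>]])
            (use ig \<psi> in \<open>auto simp: abs_mult mult.commute[of "\<bar>g _\<bar>"] intro!: mult_right_mono\<close>)
        finally show ?thesis by simp
      qed
      have iq: "integrable lborel (\<lambda>s. indicator {0..t} s * ?q s)"
        by (rule integrable_mult_bounded[OF i1 mq bq])
      have AEn0: "AE s in lborel. s \<noteq> (0::real)" by (rule AE_lborel_singleton)
      have "\<bar>(LINT s|lborel. indicator {0..t} s * ?q s) - t * A\<bar> =
        norm (LINT s|lborel. indicator {0..t} s * ?q s - indicator {0..t} s * A)"
        using iq i1 t by (simp add: Bochner_Integration.integral_diff measure_def)
      also have "\<dots> \<le> (LINT s|lborel. norm (indicator {0..t} s * ?q s - indicator {0..t} s * A))"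
        by (rule integral_norm_bound)
      also have "\<dots> \<le> (LINT s|lborel. (B2 * t) * indicator {0..t} s)"
      proof (rule integral_mono_AE)
        show "integrable lborel (\<lambda>s. norm (indicator {0..t} s * ?q s - indicator {0..t} s * A))"
          using iq i1 by (intro integrable_norm Bochner_Integration.integrable_diff) auto
        show "AE s in lborel. norm (indicator {0..t} s * ?q s - indicator {0..t} s * A) \<le> (B2 * t) * indicator {0..t} s"
          using AEn0
        proof eventually_elim
          case (elim s)
          show ?case
          proof (cases "s \<in> {0..t}")
            case True
            with elim have s: "0 < s" "s \<le> t" by auto
            have "\<bar>?q s - A\<bar> \<le> B2 * s" by (rule E3[OF s])
            also have "\<dots> \<le> B2 * t" using s B2 by (intro mult_left_mono)
            finally show ?thesis using True by simp
          qed simp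
        qed
      qed (use i1 in simp)
      also have "\<dots> = B2 * t\<^sup>2" using t by (simp add: measure_def power2_eq_square)
      finally show ?thesis .
    qed
    have "\<bar>(LINT x|lborel. (F (u (x + t *\<^sub>R b)) - F (u x)) * \<phi> x) - t * A\<bar> \<le> C * P * G * t\<^sup>2 + B2 * t\<^sup>2"
      using E1 E4 unfolding E2 by linarith
    then show ?thesis by (simp add: B2_def algebra_simps)
  qed
  show thesis by (rule that, rule main[unfolded A_def \<psi>_def])
qed

lemma compact_tube:
  fixes S U :: "'a::euclidean_space set"
  assumes "compact S" "open U" "S \<subseteq> U"
  obtains e where "e > 0" "\<And>x y. x \<in> S \<Longrightarrow> dist x y < e \<Longrightarrow> y \<in> U"
proof -
  obtain e where e: "e > 0" "(\<Union>x\<in>S. ball x e) \<subseteq> U"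
    using compact_subset_open_imp_ball_epsilon_subset[OF assms] .
  have "y \<in> U" if "x \<in> S" "dist x y < e" for x y
  proof -
    have "y \<in> (\<Union>x\<in>S. ball x e)" using that by auto
    with e(2) show ?thesis by (rule subsetD)
  qed
  with e(1) show thesis by (rule that)
qed

text \<open>
Divide the previous bound by \<open>t\<close> and let \<open>t\<close> tend to \<open>0\<close>; the translation on the left is moved to the
test function, whose difference quotients converge boundedly to its derivative.
\<close>

lemma chain_rule_whole_space:
  fixes u g :: "'a::euclidean_space \<Rightarrow> real"
  assumes w: "has_weak_deriv_on U b u g" and g2: "integrable lborel (\<lambda>x. (g x)\<^sup>2)"
    and F: "C11_with F F' C" and U: "open U" and \<phi>: "\<phi> \<in> test_functions U"
  shows "(LINT x|lborel. F (u x) * frechet_derivative \<phi> (at x) b) = - (LINT y|lborel. g y * (F' (u y) * \<phi> y))"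
proof -
  have iu: "integrable lborel u" and ig: "integrable lborel g" using w by (auto simp: has_weak_deriv_on_def)
  then have mu[measurable]: "u \<in> borel_measurable borel" "g \<in> borel_measurable borel" by auto
  have F': "\<bar>F t - F s\<bar> \<le> C * \<bar>t - s\<bar>" "F 0 = 0" "\<bar>F' t\<bar> \<le> C" for s t
    using F by (auto simp: C11_with_def)
  have C0: "C \<ge> 0" using F'(3)[of 0] by linarith
  have mF[measurable]: "F \<in> borel_measurable borel" by (rule Lipschitz_borel[OF F'(1)])
  let ?S = "closure {x. \<phi> x \<noteq> 0}"
  let ?d = "\<lambda>x. frechet_derivative \<phi> (at x) b"
  have S: "compact ?S" "?S \<subseteq> U" using \<phi> by (auto simp: test_functions_def)
  obtain e where e: "e > 0" "\<And>x y. x \<in> ?S \<Longrightarrow> dist x y < e \<Longrightarrow> y \<in> U"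
    using compact_tube[OF S(1) U S(2)] by blast
  define V where "V = (\<Union>x\<in>?S. ball x (e/2))"
  \<comment> \<open>Translations up to \<open>\<tau>\<close> keep the neighbourhood \<open>V\<close> of the support of \<open>\<phi>\<close> inside \<open>U\<close>.\<close>
  define \<tau> where "\<tau> = e / (2 * (norm b + 1))"
  have \<tau>: "\<tau> > 0" using e(1) by (simp add: \<tau>_def add_nonneg_pos)
  have V: "open V" unfolding V_def by blast
  have sub: "x + s *\<^sub>R b \<in> U" if "x \<in> V" "s \<in> {0..\<tau>}" for x s
  proof -
    obtain z where z: "z \<in> ?S" "dist z x < e/2" using \<open>x \<in> V\<close> by (auto simp: V_def)
    have "norm (s *\<^sub>R b) \<le> \<tau> * norm b" using that(2) by (auto intro: mult_right_mono)
    also have "\<dots> \<le> e / 2" using e(1) by (simp add: \<tau>_def divide_simps add_nonneg_pos)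
    finally have "dist x (x + s *\<^sub>R b) \<le> e/2" by (simp add: dist_norm)
    then have "dist z (x + s *\<^sub>R b) < e" using z(2) dist_triangle[of z "x + s *\<^sub>R b" x] by linarith
    then show ?thesis using e(2)[OF z(1)] by blast
  qed
  have \<phi>V: "\<phi> \<in> test_functions V"
    using \<phi> e(1) unfolding test_functions_def V_def by (auto intro!: bexI)
  obtain B where B: "\<And>t. 0 < t \<Longrightarrow> t \<le> \<tau> \<Longrightarrow>
    \<bar>(LINT x|lborel. (F (u (x + t *\<^sub>R b)) - F (u x)) * \<phi> x) - t * (LINT y|lborel. g y * (F' (u y) * \<phi> y))\<bar> \<le> B * t\<^sup>2"
    using chain_rule_quotient_bound[OF w g2 F \<phi>V V sub] by blast
  obtain K P where "compact K" "K \<subseteq> V" and K: "P \<ge> 0" "\<And>x. \<bar>\<phi> x\<bar> \<le> P * indicator K x"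
    "\<And>x. \<bar>?d x\<bar> \<le> P * indicator K x"
    using test_function_deriv_bounded[OF \<phi>V, of b] by blast
  have P: "\<bar>\<phi> x\<bar> \<le> P" "\<bar>?d x\<bar> \<le> P" for x
    using K(1) K(2)[of x] K(3)[of x] by (auto split: split_indicator_asm)
  have m\<phi>[measurable]: "\<phi> \<in> borel_measurable borel"
    by (rule borel_measurable_continuous_onI[OF test_function_continuous[OF \<phi>]])
  have md[measurable]: "?d \<in> borel_measurable borel"
    by (rule borel_measurable_continuous_onI[OF test_function_deriv_continuous[OF \<phi>]])
  have iF: "integrable lborel (\<lambda>x. F (u x))"
  proof (rule Bochner_Integration.integrable_bound[OF integrable_mult_right[OF iu, of C]])
    show "AE x in lborel. norm (F (u x)) \<le> norm (C * u x)"
      using F'(1)[of _ 0] F'(2) C0 by (intro AE_I2) (simp add: abs_mult)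
  qed measurable
  define A where "A = (LINT y|lborel. g y * (F' (u y) * \<phi> y))"
  define t where "t n = \<tau> / real (Suc n)" for n
  have t: "0 < t n" "t n \<le> \<tau>" for n using \<tau> by (auto simp: t_def divide_simps)
  have t0: "t \<longlonglongrightarrow> 0" unfolding t_def by (rule LIMSEQ_Suc[OF lim_const_over_n])
  let ?q = "\<lambda>n y. (\<phi> y - \<phi> (y - t n *\<^sub>R b)) / t n"
  have "(\<lambda>n. LINT y|lborel. F (u y) * ?q n y) \<longlonglongrightarrow> (LINT y|lborel. F (u y) * ?d y)"
  proof (rule integral_dominated_convergence[where w = "\<lambda>y. \<bar>F (u y)\<bar> * P"])
    show "AE y in lborel. (\<lambda>n. F (u y) * ?q n y) \<longlonglongrightarrow> F (u y) * ?d y"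
    proof (intro AE_I2 tendsto_mult tendsto_const)
      fix y
      have "((\<lambda>s. y - s *\<^sub>R b) has_derivative (\<lambda>h. - (h *\<^sub>R b))) (at 0)"
        by (auto intro!: derivative_eq_intros)
      from has_derivative_compose[OF this test_function_has_derivative[OF \<phi>]]
      have D: "((\<lambda>s. \<phi> (y - s *\<^sub>R b)) has_derivative (\<lambda>h. frechet_derivative \<phi> (at y) (- (h *\<^sub>R b)))) (at 0)" by simp
      interpret bounded_linear "frechet_derivative \<phi> (at y)"
        using test_function_has_derivative[OF \<phi>] has_derivative_bounded_linear by blast
      have "((\<lambda>s. \<phi> (y - s *\<^sub>R b)) has_real_derivative - ?d y) (at 0)"
      proof -
        have "(\<lambda>h. frechet_derivative \<phi> (at y) (- (h *\<^sub>R b))) = (*) (- ?d y)"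
          by (simp add: fun_eq_iff neg scale)
        with D show ?thesis unfolding has_field_derivative_def by simp
      qed
      then have "(\<lambda>h. (\<phi> (y - h *\<^sub>R b) - \<phi> y) / h) \<midarrow>0\<rightarrow> - ?d y" by (simp add: DERIV_def)
      moreover have "filterlim t (at 0) sequentially"
        using t0 t(1) by (auto simp: filterlim_at less_imp_neq[THEN not_sym] intro!: always_eventually)
      ultimately have "(\<lambda>n. (\<phi> (y - t n *\<^sub>R b) - \<phi> y) / t n) \<longlonglongrightarrow> - ?d y" by (rule filterlim_compose)
      from tendsto_minus[OF this] show "(\<lambda>n. ?q n y) \<longlonglongrightarrow> ?d y" by (simp add: minus_divide_left)
    qed
    show "AE y in lborel. norm (F (u y) * ?q n y) \<le> \<bar>F (u y)\<bar> * P" for n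
    proof (rule AE_I2)
      fix y
      have "\<bar>?q n y\<bar> \<le> P" using test_function_shift_le[OF \<phi> _ P(2), of "t n" y] t(1)[of n]
        by (simp add: divide_simps)
      then show "norm (F (u y) * ?q n y) \<le> \<bar>F (u y)\<bar> * P" unfolding real_norm_def abs_mult
        by (intro mult_left_mono) auto
    qed
    show "integrable lborel (\<lambda>y. \<bar>F (u y)\<bar> * P)" using iF by simp
  qed measurable
  moreover have "(\<lambda>n. LINT y|lborel. F (u y) * ?q n y) \<longlonglongrightarrow> - A"
  proof (rule LIM_zero_cancel, rule Lim_null_comparison)
    show "(\<lambda>n. B * t n) \<longlonglongrightarrow> 0" using tendsto_mult_right_zero[OF t0] by simp
    have "norm ((LINT y|lborel. F (u y) * ?q n y) - - A) \<le> B * t n" for n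
    proof -
      have i: "integrable lborel (\<lambda>y. F (u y) * \<phi> (y - c))" for c
        by (rule integrable_mult_bounded[OF iF _ P(1)]) simp
      have i': "integrable lborel (\<lambda>x. F (u (x + c)) * \<phi> x)" for c
        using i[of c] lborel_integral_shift(2)[of "\<lambda>y. F (u y) * \<phi> (y - c)" c] by simp
      have e: "(LINT y|lborel. F (u y) * \<phi> (y - t n *\<^sub>R b)) = (LINT x|lborel. F (u (x + t n *\<^sub>R b)) * \<phi> x)"
        using lborel_integral_shift(1)[of "\<lambda>y. F (u y) * \<phi> (y - t n *\<^sub>R b)" "t n *\<^sub>R b"] by simp
      have "t n * (LINT y|lborel. F (u y) * ?q n y) = (LINT y|lborel. F (u y) * \<phi> y - F (u y) * \<phi> (y - t n *\<^sub>R b))"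
      proof -
        have "t n * (F (u y) * ?q n y) = F (u y) * \<phi> y - F (u y) * \<phi> (y - t n *\<^sub>R b)" for y
          using t(1)[of n] by (simp add: field_simps)
        then show ?thesis by (simp only: integral_mult_right_zero[symmetric])
      qed
      also have "\<dots> = - (LINT x|lborel. (F (u (x + t n *\<^sub>R b)) - F (u x)) * \<phi> x)"
        using i[of 0] i[of "t n *\<^sub>R b"] i'[of "t n *\<^sub>R b"] e
        by (simp add: left_diff_distrib Bochner_Integration.integral_diff)
      finally have q: "t n * (LINT y|lborel. F (u y) * ?q n y) = - (LINT x|lborel. (F (u (x + t n *\<^sub>R b)) - F (u x)) * \<phi> x)" .
      have pull: "r * \<bar>x + y\<bar> = \<bar>r * x + r * y\<bar>" if "r > 0" for r x y :: real
        using that by (simp add: distrib_left[symmetric] abs_mult)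
      have "t n * \<bar>(LINT y|lborel. F (u y) * ?q n y) + A\<bar> = \<bar>t n * (LINT y|lborel. F (u y) * ?q n y) + t n * A\<bar>"
        by (rule pull) (rule t(1))
      also have "\<dots> \<le> B * (t n)\<^sup>2" unfolding q A_def using B[OF t, of n] by linarith
      also have "\<dots> = t n * (B * t n)" by (simp add: power2_eq_square)
      finally show ?thesis using t(1)[of n] by simp
    qed
    then show "\<forall>\<^sub>F n in sequentially. norm ((LINT y|lborel. F (u y) * ?q n y) - - A) \<le> B * t n" by simp
  qed
  ultimately show ?thesis unfolding A_def by (rule LIMSEQ_unique)
qed

lemma L1_loc_bound:
  assumes "open D" "v \<in> L1_loc D" "u \<in> borel_measurable (lebesgue_on D)"
    "AE x in lebesgue_on D. \<bar>u x\<bar> \<le> \<bar>v x\<bar>"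
  shows "u \<in> L1_loc D"
  unfolding L1_loc_iff[OF \<open>open D\<close>]
proof (intro conjI allI impI assms)
  fix K assume K: "compact K \<and> K \<subseteq> D"
  show "integrable (lebesgue_on D) (\<lambda>x. indicator K x * u x)"
  proof (rule Bochner_Integration.integrable_bound)
    show "integrable (lebesgue_on D) (\<lambda>x. indicator K x * v x)"
      using assms K by (auto simp: L1_loc_iff)
    show "(\<lambda>x. indicator K x * u x) \<in> borel_measurable (lebesgue_on D)"
      using K compact_in_lebesgue_on by (auto intro!: borel_measurable_times borel_measurable_indicator assms)
    show "AE x in lebesgue_on D. norm (indicator K x * u x) \<le> norm (indicator K x * v x)"
      using assms(4) by eventually_elim (simp split: split_indicator)
  qed
qed

lemma lebesgue_on_AE_iff:
  assumes "open (D :: 'a::euclidean_space set)"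
  shows "(AE x in lebesgue_on D. P x) \<longleftrightarrow> (AE x in lebesgue. x \<in> D \<longrightarrow> P x)"
  using assms by (subst AE_restrict_space_iff) auto

text \<open>
Cutting off at a compact set gives a function that is integrable on the whole space, and a Borel
version of it is needed for product measures.
\<close>

lemma L1_loc_borel_version:
  assumes "open D" "u \<in> L1_loc D" "compact K" "K \<subseteq> D"
  obtains u' where "u' \<in> borel_measurable borel" "integrable lborel u'"
    "AE x in lebesgue. x \<in> K \<longrightarrow> u x = u' x" "\<And>x. x \<notin> K \<Longrightarrow> u' x = 0"
proof -
  have i: "integrable lebesgue (\<lambda>x. indicator K x * u x)"
    using assms by (auto simp: L1_loc_def set_integrable_def)
  obtain v where v: "v \<in> borel_measurable borel" "integrable lborel v"
    "AE x in lebesgue. indicator K x * u x = v x"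
    using lebesgue_ex_borel_version[OF i] .
  have K: "K \<in> sets borel" by (rule borel_closed[OF compact_imp_closed[OF assms(3)]])
  show thesis
  proof (rule that[of "\<lambda>x. indicator K x * v x"])
    show "(\<lambda>x. indicator K x * v x) \<in> borel_measurable borel"
      by (intro borel_measurable_times borel_measurable_indicator K v(1))
    show "integrable lborel (\<lambda>x. indicator K x * v x)"
      using integrable_mult_indicator[OF _ v(2), of K] K by simp
    show "AE x in lebesgue. x \<in> K \<longrightarrow> u x = indicator K x * v x"
      using v(3) by eventually_elim auto
  qed auto
qed

lemma borel_version_L2:
  assumes "open D" "u \<in> L2_loc D" "compact K" "K \<subseteq> D"
    "u' \<in> borel_measurable borel" "AE x in lebesgue. x \<in> K \<longrightarrow> u x = u' x" "\<And>x. x \<notin> K \<Longrightarrow> u' x = 0"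
  shows "integrable lborel (\<lambda>x. (u' x)\<^sup>2)"
    and "(LINT x|lborel. (u' x)\<^sup>2) = (LINT x|lebesgue_on D. indicator K x * (u x)\<^sup>2)"
proof -
  have m: "(\<lambda>x. (u' x)\<^sup>2) \<in> borel_measurable borel" by (intro borel_measurable_power assms)
  have mu: "u \<in> borel_measurable (lebesgue_on D)" using assms by (auto simp: L2_loc_def)
  have i: "integrable (lebesgue_on D) (\<lambda>x. indicator K x * (u x)\<^sup>2)"
    using assms by (auto simp: L2_loc_iff)
  have mD: "(\<lambda>x. (u' x)\<^sup>2) \<in> borel_measurable (lebesgue_on D)"
    by (intro measurable_restrict_space1 measurable_completion) (use m in simp)
  have AE: "AE x in lebesgue_on D. indicator K x * (u x)\<^sup>2 = (u' x)\<^sup>2"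
    unfolding lebesgue_on_AE_iff[OF \<open>open D\<close>] using assms(6)
    by eventually_elim (use assms(7) in \<open>auto split: split_indicator\<close>)
  have "integrable (lebesgue_on D) (\<lambda>x. (u' x)\<^sup>2)"
    using i integrable_cong_AE[OF borel_measurable_integrable[OF i] mD AE] by simp
  then have "integrable lebesgue (\<lambda>x. indicator D x *\<^sub>R (u' x)\<^sup>2)"
    using assms(1) by (subst (asm) integrable_restrict_space) auto
  also have "(\<lambda>x. indicator D x *\<^sub>R (u' x)\<^sup>2) = (\<lambda>x. (u' x)\<^sup>2)"
    using assms(4,7) by (auto simp: fun_eq_iff split: split_indicator)
  finally show "integrable lborel (\<lambda>x. (u' x)\<^sup>2)"
    using m by (subst (asm) integrable_completion) auto
  have "(LINT x|lborel. (u' x)\<^sup>2) = (LINT x|lebesgue_on D. (u' x)\<^sup>2)"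
    using assms(4,7) by (intro integral_lebesgue_on_lborel[symmetric] assms(1) m) auto
  also have "\<dots> = (LINT x|lebesgue_on D. indicator K x * (u x)\<^sup>2)"
    using AE by (intro integral_cong_AE mD borel_measurable_integrable[OF i]) (auto elim: eventually_mono)
  finally show "(LINT x|lborel. (u' x)\<^sup>2) = (LINT x|lebesgue_on D. indicator K x * (u x)\<^sup>2)" .
qed

lemma integral_test_transfer:
  fixes u u' \<psi> :: "'a::euclidean_space \<Rightarrow> real"
  assumes D: "open D" and K: "K \<subseteq> D" and \<psi>: "continuous_on UNIV \<psi>" "\<And>x. x \<notin> K \<Longrightarrow> \<psi> x = 0"
    and u: "u \<in> borel_measurable (lebesgue_on D)" and u': "u' \<in> borel_measurable borel"
    and ae: "AE x in lebesgue. x \<in> K \<longrightarrow> u x = u' x"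
  shows "(LINT x|lebesgue_on D. u x * \<psi> x) = (LINT x|lborel. u' x * \<psi> x)"
proof -
  have m\<psi>: "\<psi> \<in> borel_measurable borel" using \<psi>(1) by (rule borel_measurable_continuous_onI)
  have b: "(\<lambda>x. u' x * \<psi> x) \<in> borel_measurable borel" by (intro borel_measurable_times u' m\<psi>)
  have "(LINT x|lebesgue_on D. u x * \<psi> x) = (LINT x|lebesgue_on D. u' x * \<psi> x)"
  proof (rule integral_cong_AE)
    show "(\<lambda>x. u x * \<psi> x) \<in> borel_measurable (lebesgue_on D)"
      by (intro borel_measurable_times u continuous_imp_lebesgue_on \<psi>)
    show "(\<lambda>x. u' x * \<psi> x) \<in> borel_measurable (lebesgue_on D)"
      by (intro measurable_restrict_space1 measurable_completion) (use b in simp)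
    show "AE x in lebesgue_on D. u x * \<psi> x = u' x * \<psi> x"
      unfolding lebesgue_on_AE_iff[OF D] using ae
    proof eventually_elim
      case (elim x)
      then show ?case using \<psi>(2)[of x] by (cases "x \<in> K") auto
    qed
  qed
  also have "\<dots> = (LINT x|lborel. u' x * \<psi> x)"
    using K \<psi>(2) by (intro integral_lebesgue_on_lborel D b) auto
  finally show ?thesis .
qed

lemma has_weak_deriv_on_localI:
  assumes D: "open D" and w: "is_weak_pderiv D b u g" and K: "K \<subseteq> D" and U: "U \<subseteq> K"
    and u': "integrable lborel u'" "AE x in lebesgue. x \<in> K \<longrightarrow> u x = u' x"
    and g': "integrable lborel g'" "AE x in lebesgue. x \<in> K \<longrightarrow> g x = g' x"
  shows "has_weak_deriv_on U b u' g'"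
  unfolding has_weak_deriv_on_def
proof (intro conjI ballI u' g')
  have L: "u \<in> L1_loc D" "g \<in> L1_loc D" using w by (auto simp: is_weak_pderiv_def)
  have m: "u' \<in> borel_measurable borel" "g' \<in> borel_measurable borel" using u' g' by auto
  fix \<phi> assume \<phi>: "\<phi> \<in> test_functions U"
  then have \<phi>D: "\<phi> \<in> test_functions D" using U K by (auto simp: test_functions_def)
  have z: "\<phi> x = 0" "frechet_derivative \<phi> (at x) b = 0" if "x \<notin> K" for x
  proof -
    have "x \<notin> closure {x. \<phi> x \<noteq> 0}" using \<phi> U that by (auto simp: test_functions_def)
    then show "\<phi> x = 0" "frechet_derivative \<phi> (at x) b = 0"
      using closure_subset[of "{x. \<phi> x \<noteq> 0}"] test_function_deriv_zero[of x \<phi> b] by blast+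
  qed
  have "(LINT x|lborel. u' x * frechet_derivative \<phi> (at x) b) =
      (LINT x|lebesgue_on D. u x * frechet_derivative \<phi> (at x) b)"
    by (rule integral_test_transfer[OF D K test_function_deriv_continuous[OF \<phi>] z(2) _ m(1) u'(2), symmetric])
      (use L in \<open>auto simp: L1_loc_def\<close>)
  also have "\<dots> = - (LINT x|lebesgue_on D. g x * \<phi> x)"
    using w \<phi>D by (simp add: is_weak_pderiv_def)
  also have "(LINT x|lebesgue_on D. g x * \<phi> x) = (LINT x|lborel. g' x * \<phi> x)"
    by (rule integral_test_transfer[OF D K test_function_continuous[OF \<phi>] z(1) _ m(2) g'(2)])
      (use L in \<open>auto simp: L1_loc_def\<close>)
  finally show "(LINT x|lborel. u' x * frechet_derivative \<phi> (at x) b) = - (LINT x|lborel. g' x * \<phi> x)" .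
qed

lemma weak_pderiv_localize:
  assumes D: "open D" and w: "is_weak_pderiv D b u g" and K: "compact K" "K \<subseteq> D" and U: "U \<subseteq> K"
  obtains u' g' where "has_weak_deriv_on U b u' g'"
    "u' \<in> borel_measurable borel" "g' \<in> borel_measurable borel"
    "AE x in lebesgue. x \<in> K \<longrightarrow> u x = u' x" "\<And>x. x \<notin> K \<Longrightarrow> u' x = 0"
    "AE x in lebesgue. x \<in> K \<longrightarrow> g x = g' x" "\<And>x. x \<notin> K \<Longrightarrow> g' x = 0"
proof -
  have L: "u \<in> L1_loc D" "g \<in> L1_loc D" using w by (auto simp: is_weak_pderiv_def)
  obtain u' where u': "u' \<in> borel_measurable borel" "integrable lborel u'"
    "AE x in lebesgue. x \<in> K \<longrightarrow> u x = u' x" "\<And>x. x \<notin> K \<Longrightarrow> u' x = 0"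
    using L1_loc_borel_version[OF D L(1) K] by blast
  obtain g' where g': "g' \<in> borel_measurable borel" "integrable lborel g'"
    "AE x in lebesgue. x \<in> K \<longrightarrow> g x = g' x" "\<And>x. x \<notin> K \<Longrightarrow> g' x = 0"
    using L1_loc_borel_version[OF D L(2) K] by blast
  have "has_weak_deriv_on U b u' g'"
    by (rule has_weak_deriv_on_localI[OF D w K(2) U u'(2,3) g'(2,3)])
  then show thesis using that u' g' by blast
qed

lemma compact_open_between:
  fixes S D :: "'a::euclidean_space set"
  assumes "compact S" "open D" "S \<subseteq> D"
  obtains U K where "open U" "compact K" "S \<subseteq> U" "U \<subseteq> K" "K \<subseteq> D"
proof -
  obtain e where e: "e > 0" "\<And>x y. x \<in> S \<Longrightarrow> dist x y < e \<Longrightarrow> y \<in> D"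
    using compact_tube[OF assms] by blast
  define U where "U = (\<Union>x\<in>S. ball x (e/2))"
  have "closure U \<subseteq> D"
  proof
    fix y assume "y \<in> closure U"
    then obtain z where z: "z \<in> U" "dist z y < e/2"
      using e(1) closure_approachable[of y U] half_gt_zero by blast
    then obtain x where x: "x \<in> S" "dist x z < e/2" by (auto simp: U_def)
    have "dist x y < e" using dist_triangle[of x y z] x z by linarith
    then show "y \<in> D" using e(2)[OF x(1)] by blast
  qed
  moreover have "bounded U"
  proof -
    obtain B where B: "\<And>x. x \<in> S \<Longrightarrow> norm x \<le> B"
      using compact_imp_bounded[OF assms(1)] unfolding bounded_iff by blast
    have "norm y \<le> B + e/2" if "y \<in> U" for y
    proof -
      obtain x where x: "x \<in> S" "dist x y < e/2" using \<open>y \<in> U\<close> by (auto simp: U_def)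
      have "norm y \<le> norm x + dist x y" by (metis dist_norm norm_minus_commute norm_triangle_sub)
      then show ?thesis using B[OF x(1)] x(2) by linarith
    qed
    then show ?thesis by (rule boundedI)
  qed
  moreover have "S \<subseteq> U" using e(1) by (force simp: U_def)
  moreover have "open U" by (auto simp: U_def)
  ultimately show thesis using that[of U "closure U"] closure_subset[of U] by (simp add: compact_closure)
qed

lemma weak_pderiv_chain_C11:
  assumes D: "open D" and w: "is_weak_pderiv D b u g" and g: "g \<in> L2_loc D" and F: "C11_with F F' C"
  shows "is_weak_pderiv D b (\<lambda>x. F (u x)) (\<lambda>x. F' (u x) * g x)"
  unfolding is_weak_pderiv_def
proof (intro conjI ballI)
  have L: "u \<in> L1_loc D" "g \<in> L1_loc D" using w by (auto simp: is_weak_pderiv_def)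
  then have mu: "u \<in> borel_measurable (lebesgue_on D)" "g \<in> borel_measurable (lebesgue_on D)"
    by (auto simp: L1_loc_def)
  have F': "\<bar>F t - F s\<bar> \<le> C * \<bar>t - s\<bar>" "F 0 = 0" "\<bar>F' t\<bar> \<le> C" "\<bar>F' t - F' s\<bar> \<le> C * \<bar>t - s\<bar>" for s t
    using F by (auto simp: C11_with_def)
  have C0: "C \<ge> 0" using F'(3)[of 0] by linarith
  have mF: "F \<in> borel_measurable borel" "F' \<in> borel_measurable borel"
    by (rule Lipschitz_borel[OF F'(1)], rule Lipschitz_borel[OF F'(4)])
  have mFu: "(\<lambda>x. F (u x)) \<in> borel_measurable (lebesgue_on D)"
    "(\<lambda>x. F' (u x) * g x) \<in> borel_measurable (lebesgue_on D)"
    using measurable_compose[OF mu(1) mF(1)] measurable_compose[OF mu(1) mF(2)] mu(2)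
    by (auto intro: borel_measurable_times)
  show "(\<lambda>x. F (u x)) \<in> L1_loc D"
  proof (rule L1_loc_bound[OF D _ mFu(1)])
    show "(\<lambda>x. C * u x + 0 * u x) \<in> L1_loc D" by (intro L1_loc_lincomb D L)
    show "AE x in lebesgue_on D. \<bar>F (u x)\<bar> \<le> \<bar>C * u x + 0 * u x\<bar>"
      using F'(1)[of _ 0] F'(2) C0 by (intro AE_I2) (simp add: abs_mult)
  qed
  show "(\<lambda>x. F' (u x) * g x) \<in> L1_loc D"
  proof (rule L1_loc_bound[OF D _ mFu(2)])
    show "(\<lambda>x. C * g x + 0 * g x) \<in> L1_loc D" by (intro L1_loc_lincomb D L)
    show "AE x in lebesgue_on D. \<bar>F' (u x) * g x\<bar> \<le> \<bar>C * g x + 0 * g x\<bar>"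
      using F'(3) C0 by (intro AE_I2) (simp add: abs_mult mult_right_mono)
  qed
  fix \<phi> assume \<phi>: "\<phi> \<in> test_functions D"
  let ?S = "closure {x. \<phi> x \<noteq> 0}"
  have S: "compact ?S" "?S \<subseteq> D" using \<phi> by (auto simp: test_functions_def)
  obtain U K where UK: "open U" "compact K" "?S \<subseteq> U" "U \<subseteq> K" "K \<subseteq> D"
    using compact_open_between[OF S(1) D S(2)] by blast
  obtain u' g' where ug: "has_weak_deriv_on U b u' g'"
    "u' \<in> borel_measurable borel" "g' \<in> borel_measurable borel"
    "AE x in lebesgue. x \<in> K \<longrightarrow> u x = u' x" "\<And>x. x \<notin> K \<Longrightarrow> u' x = 0"
    "AE x in lebesgue. x \<in> K \<longrightarrow> g x = g' x" "\<And>x. x \<notin> K \<Longrightarrow> g' x = 0"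
    using weak_pderiv_localize[OF D w UK(2,5,4)] by blast
  have \<phi>U: "\<phi> \<in> test_functions U" using \<phi> UK(3) by (auto simp: test_functions_def)
  have g2: "integrable lborel (\<lambda>x. (g' x)\<^sup>2)"
    by (rule borel_version_L2(1)[OF D g UK(2,5) ug(3,6,7)])
  have z: "\<phi> x = 0" "frechet_derivative \<phi> (at x) b = 0" if "x \<notin> K" for x
  proof -
    have "x \<notin> ?S" using UK that by blast
    then show "\<phi> x = 0" "frechet_derivative \<phi> (at x) b = 0"
      using closure_subset[of "{x. \<phi> x \<noteq> 0}"] test_function_deriv_zero[of x \<phi> b] by blast+
  qed
  have "(LINT x|lebesgue_on D. F (u x) * frechet_derivative \<phi> (at x) b) =
    (LINT x|lborel. F (u' x) * frechet_derivative \<phi> (at x) b)"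
  proof (rule integral_test_transfer[OF D UK(5) test_function_deriv_continuous[OF \<phi>] z(2) mFu(1)])
    show "(\<lambda>x. F (u' x)) \<in> borel_measurable borel" by (rule measurable_compose[OF ug(2) mF(1)])
    show "AE x in lebesgue. x \<in> K \<longrightarrow> F (u x) = F (u' x)" using ug(4) by eventually_elim auto
  qed
  also have "\<dots> = - (LINT y|lborel. g' y * (F' (u' y) * \<phi> y))"
    by (rule chain_rule_whole_space[OF ug(1) g2 F UK(1) \<phi>U])
  also have "(LINT y|lborel. g' y * (F' (u' y) * \<phi> y)) = (LINT x|lborel. (F' (u' x) * g' x) * \<phi> x)"
    by (simp add: mult_ac)
  also have "\<dots> = (LINT x|lebesgue_on D. (F' (u x) * g x) * \<phi> x)"
  proof (rule integral_test_transfer[OF D UK(5) test_function_continuous[OF \<phi>] z(1) mFu(2), symmetric])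
    show "(\<lambda>x. F' (u' x) * g' x) \<in> borel_measurable borel"
      by (intro borel_measurable_times measurable_compose[OF ug(2) mF(2)] ug)
    show "AE x in lebesgue. x \<in> K \<longrightarrow> F' (u x) * g x = F' (u' x) * g' x"
      using ug(4,6) by eventually_elim auto
  qed
  finally show "(LINT x|lebesgue_on D. F (u x) * frechet_derivative \<phi> (at x) b) =
    - (LINT x|lebesgue_on D. F' (u x) * g x * \<phi> x)" .
qed

text \<open>
Almost everywhere convergence with locally integrable majorants implies the local convergence in
\<open>L\<^sup>1\<close> required for the limit of weak derivatives.
\<close>

lemma weak_pderiv_dominated:
  assumes D: "open D" and w: "\<And>n::nat. is_weak_pderiv D b (u n) (g n)"
    and W: "W \<in> L1_loc D" "Z \<in> L1_loc D"
    and m: "v \<in> borel_measurable (lebesgue_on D)" "h \<in> borel_measurable (lebesgue_on D)"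
    and le: "\<And>n. AE x in lebesgue_on D. \<bar>u n x\<bar> \<le> W x" "\<And>n. AE x in lebesgue_on D. \<bar>g n x\<bar> \<le> Z x"
    and lim: "AE x in lebesgue_on D. (\<lambda>n. u n x) \<longlonglongrightarrow> v x" "AE x in lebesgue_on D. (\<lambda>n. g n x) \<longlonglongrightarrow> h x"
  shows "is_weak_pderiv D b v h"
proof -
  have A: "r \<in> L1_loc D \<and> (\<lambda>n. LINT x|lebesgue_on D. indicator K x * \<bar>f n x - r x\<bar>) \<longlonglongrightarrow> 0"
    if f: "\<And>n. f n \<in> L1_loc D" and Y: "Y \<in> L1_loc D" and r: "r \<in> borel_measurable (lebesgue_on D)"
      and le: "\<And>n. AE x in lebesgue_on D. \<bar>f n x\<bar> \<le> Y x" and lim: "AE x in lebesgue_on D. (\<lambda>n. f n x) \<longlonglongrightarrow> r x"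
      and K: "compact K" "K \<subseteq> D" for f :: "nat \<Rightarrow> _" and Y r K
  proof
    have all: "AE x in lebesgue_on D. \<forall>n. \<bar>f n x\<bar> \<le> Y x" using le by (simp add: AE_all_countable)
    then have rY: "AE x in lebesgue_on D. \<bar>r x\<bar> \<le> \<bar>Y x\<bar>" using lim
    proof eventually_elim
      case (elim x)
      have "\<bar>r x\<bar> \<le> Y x"
        by (rule LIMSEQ_le_const2[OF tendsto_rabs[OF elim(2)]]) (use elim(1) in auto)
      then show ?case by simp
    qed
    show "r \<in> L1_loc D" by (rule L1_loc_bound[OF D Y r rY])
    have mf: "f n \<in> borel_measurable (lebesgue_on D)" for n using f by (auto simp: L1_loc_def)
    have mK: "(\<lambda>x. indicator K x :: real) \<in> borel_measurable (lebesgue_on D)"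
      using compact_in_lebesgue_on[OF K] by (intro borel_measurable_indicator)
    have "(\<lambda>n. LINT x|lebesgue_on D. indicator K x * \<bar>f n x - r x\<bar>) \<longlonglongrightarrow> (LINT x|lebesgue_on D. 0)"
    proof (rule integral_dominated_convergence[where w = "\<lambda>x. 2 * (indicator K x * Y x)"])
      show "(\<lambda>x. indicator K x * \<bar>f n x - r x\<bar>) \<in> borel_measurable (lebesgue_on D)" for n
        by (intro borel_measurable_times mK borel_measurable_abs borel_measurable_diff mf r)
      show "integrable (lebesgue_on D) (\<lambda>x. 2 * (indicator K x * Y x))"
        using Y K by (intro integrable_mult_right) (auto simp: L1_loc_iff[OF D])
      show "AE x in lebesgue_on D. (\<lambda>n. indicator K x * \<bar>f n x - r x\<bar>) \<longlonglongrightarrow> 0"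
        using lim
      proof eventually_elim
        case (elim x)
        have "(\<lambda>n. \<bar>f n x - r x\<bar>) \<longlonglongrightarrow> 0"
          using tendsto_rabs_zero[OF LIM_zero[OF elim]] .
        then show ?case by (rule tendsto_mult_right_zero)
      qed
      show "AE x in lebesgue_on D. norm (indicator K x * \<bar>f n x - r x\<bar>) \<le> 2 * (indicator K x * Y x)" for n
        using all rY
      proof eventually_elim
        case (elim x)
        have "\<bar>f n x\<bar> \<le> Y x" using elim(1) by blast
        then have "\<bar>f n x - r x\<bar> \<le> 2 * Y x" using elim(2) by linarith
        then show ?case by (simp split: split_indicator)
      qed
    qed simp
    then show "(\<lambda>n. LINT x|lebesgue_on D. indicator K x * \<bar>f n x - r x\<bar>) \<longlonglongrightarrow> 0" by simp
  qed
  have L: "u n \<in> L1_loc D" "g n \<in> L1_loc D" for n using w[of n] by (auto simp: is_weak_pderiv_def)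
  note B = A[OF L(1) W(1) m(1) le(1) lim(1)] A[OF L(2) W(2) m(2) le(2) lim(2)]
  show ?thesis
    by (rule weak_pderiv_limit[OF D w]) (use B B[of "{}"] in auto)
qed

section \<open>Truncation\<close>

text \<open>
A quadratic error forces \<open>F'\<close> to be the derivative of \<open>F\<close>, so the mean value theorem applies.
\<close>

lemma Lipschitz_if_quadratic_error:
  fixes F F' :: "real \<Rightarrow> real"
  assumes quad: "\<And>s t. \<bar>F t - F s - F' s * (t - s)\<bar> \<le> C * (t - s)\<^sup>2"
    and bd: "\<And>t. \<bar>F' t\<bar> \<le> B"
  shows "\<bar>F t - F s\<bar> \<le> B * \<bar>t - s\<bar>"
proof -
  have D: "(F has_real_derivative F' x) (at x)" for x
    unfolding DERIV_def
  proof (rule LIM_zero_cancel, rule Lim_null_comparison)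
    show "((\<lambda>h. C * \<bar>h\<bar>) \<longlongrightarrow> 0) (at 0)"
      by (rule tendsto_mult_right_zero) (rule tendsto_rabs_zero[OF tendsto_ident_at])
    have "norm ((F (x + h) - F x) / h - F' x) \<le> C * \<bar>h\<bar>" if "h \<noteq> 0" for h
    proof -
      have "(a / h - d) * h = a - d * h" for a d using that by (simp add: field_simps)
      then have "((F (x + h) - F x) / h - F' x) * h = F (x + h) - F x - F' x * h" .
      then have "\<bar>(F (x + h) - F x) / h - F' x\<bar> * \<bar>h\<bar> = \<bar>F (x + h) - F x - F' x * h\<bar>"
        by (simp only: abs_mult[symmetric])
      also have "\<dots> \<le> (C * \<bar>h\<bar>) * \<bar>h\<bar>" using quad[of "x + h" x] by (simp add: power2_eq_square mult.assoc)
      finally show ?thesis using that by simp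
    qed
    then show "\<forall>\<^sub>F h in at 0. norm ((F (x + h) - F x) / h - F' x) \<le> C * \<bar>h\<bar>"
      by (auto simp: eventually_at_filter)
  qed
  have "norm (F t - F s) \<le> B * norm (t - s)"
    by (rule field_differentiable_bound[of UNIV F F'])
      (use D bd in \<open>auto intro: has_field_derivative_at_within\<close>)
  then show ?thesis by simp
qed

text \<open>
The primitive of the positive part.  It is the simplest function whose derivative is Lipschitz and
which distinguishes the two half lines; the smoothed positive parts below are difference
quotients of it.
\<close>

definition half_sq_pos :: "real \<Rightarrow> real" where "half_sq_pos t = (max t 0)\<^sup>2 / 2"

lemma half_sq_pos_quadratic: "\<bar>half_sq_pos t - half_sq_pos s - max s 0 * (t - s)\<bar> \<le> (t - s)\<^sup>2 / 2"
proof -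
  consider "s \<ge> 0" "t \<ge> 0" | "s \<ge> 0" "t < 0" | "s < 0" "t \<ge> 0" | "s < 0" "t < 0" by linarith
  then show ?thesis
  proof cases
    case 1
    then have e: "half_sq_pos t - half_sq_pos s - max s 0 * (t - s) = (t - s)\<^sup>2 / 2"
      by (simp add: half_sq_pos_def power2_eq_square field_simps)
    show ?thesis unfolding e by simp
  next
    case 2
    then have e: "half_sq_pos t - half_sq_pos s - max s 0 * (t - s) = s\<^sup>2 / 2 - s * t"
      by (simp add: half_sq_pos_def power2_eq_square field_simps)
    have "s * t \<le> 0" using 2 by (simp add: mult_nonneg_nonpos)
    moreover have "s\<^sup>2 / 2 - s * t \<le> (t - s)\<^sup>2 / 2" by (simp add: power2_eq_square field_simps)
    moreover have "0 \<le> s\<^sup>2 / 2" by simp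
    ultimately show ?thesis unfolding e by linarith
  next
    case 3
    then have e: "half_sq_pos t - half_sq_pos s - max s 0 * (t - s) = t\<^sup>2 / 2"
      by (simp add: half_sq_pos_def)
    have "t\<^sup>2 \<le> (t - s)\<^sup>2" using 3 by (intro power_mono) auto
    then show ?thesis unfolding e by simp
  next
    case 4
    then show ?thesis by (simp add: half_sq_pos_def)
  qed
qed

text \<open>
The function \<open>\<lambda>t. max (t - c) 0\<close> with its corner smoothed: the derivative is a ramp of width
\<open>1 / n\<close> to the right of \<open>c\<close>, so that it tends pointwise to the indicator of \<open>{c<..}\<close>.
\<close>

definition smooth_pos :: "real \<Rightarrow> real \<Rightarrow> real \<Rightarrow> real" where
  "smooth_pos n c t = n * (half_sq_pos (t - c) - half_sq_pos (t - c - 1 / n))"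

definition smooth_pos' :: "real \<Rightarrow> real \<Rightarrow> real \<Rightarrow> real" where
  "smooth_pos' n c t = n * (max (t - c) 0 - max (t - c - 1 / n) 0)"

lemma smooth_pos'_bounds: 
  assumes "n > 0" shows "0 \<le> smooth_pos' n c t" "smooth_pos' n c t \<le> 1"
proof -
  have "0 \<le> max (t - c) 0 - max (t - c - 1 / n) 0" "max (t - c) 0 - max (t - c - 1 / n) 0 \<le> 1 / n"
  proof -
    have "0 < 1 / n" using assms by simp
    then show "0 \<le> max (t - c) 0 - max (t - c - 1 / n) 0" "max (t - c) 0 - max (t - c - 1 / n) 0 \<le> 1 / n"
      by linarith+
  qed
  then show "0 \<le> smooth_pos' n c t" "smooth_pos' n c t \<le> 1"
    using assms mult_left_mono[of "max (t - c) 0 - max (t - c - 1 / n) 0" "1 / n" n]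
    by (auto simp: smooth_pos'_def)
qed

lemma smooth_pos_quadratic:
  assumes "n > 0" shows "\<bar>smooth_pos n c t - smooth_pos n c s - smooth_pos' n c s * (t - s)\<bar> \<le> n * (t - s)\<^sup>2"
proof -
  let ?e = "\<lambda>a. half_sq_pos (t - a) - half_sq_pos (s - a) - max (s - a) 0 * (t - s)"
  have e: "\<bar>?e a\<bar> \<le> (t - s)\<^sup>2 / 2" for a using half_sq_pos_quadratic[of "t - a" "s - a"] by simp
  have eq: "smooth_pos n c t - smooth_pos n c s - smooth_pos' n c s * (t - s) = n * (?e c - ?e (c + 1 / n))"
    by (simp add: smooth_pos_def smooth_pos'_def algebra_simps)
  have "\<bar>smooth_pos n c t - smooth_pos n c s - smooth_pos' n c s * (t - s)\<bar> = n * \<bar>?e c - ?e (c + 1 / n)\<bar>"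
    unfolding eq abs_mult using assms by simp
  also have "\<dots> \<le> n * (t - s)\<^sup>2"
    using e[of c] e[of "c + 1 / n"] assms by (intro mult_left_mono) linarith+
  finally show ?thesis .
qed

lemma smooth_pos_le:
  assumes "n > 0" "c \<ge> 0" shows "\<bar>smooth_pos n c t\<bar> \<le> \<bar>t\<bar>" and "smooth_pos n c 0 = 0"
proof -
  show z: "smooth_pos n c 0 = 0"
  proof -
    have "0 < 1 / n" using assms by simp
    then have "max (0 - c) 0 = 0" "max (0 - c - 1 / n) 0 = 0" using assms by linarith+
    then show ?thesis by (simp add: smooth_pos_def half_sq_pos_def)
  qed
  have "\<bar>smooth_pos n c t - smooth_pos n c 0\<bar> \<le> 1 * \<bar>t - 0\<bar>"
    by (rule Lipschitz_if_quadratic_error[OF smooth_pos_quadratic[OF assms(1)]])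
      (use smooth_pos'_bounds[OF assms(1)] in \<open>simp add: abs_le_iff order_trans[of _ 0]\<close>)
  then show "\<bar>smooth_pos n c t\<bar> \<le> \<bar>t\<bar>" using z by simp
qed

lemma C11_smooth_pos:
  assumes "n \<ge> 1" "c \<ge> 0" shows "C11_with (smooth_pos n c) (smooth_pos' n c) (2 * n)"
  unfolding C11_with_def
proof (intro conjI allI)
  have n: "n > 0" using assms by simp
  show "smooth_pos n c 0 = 0" by (rule smooth_pos_le(2)[OF n assms(2)])
  have b: "\<bar>smooth_pos' n c t\<bar> \<le> 2 * n" for t using smooth_pos'_bounds[OF n, of c t] assms by linarith
  show "\<bar>smooth_pos' n c t\<bar> \<le> 2 * n" for t by (rule b)
  show "\<bar>smooth_pos n c t - smooth_pos n c s\<bar> \<le> 2 * n * \<bar>t - s\<bar>" for s t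
    by (rule Lipschitz_if_quadratic_error[OF smooth_pos_quadratic[OF n] b])
  show "\<bar>smooth_pos n c t - smooth_pos n c s - smooth_pos' n c s * (t - s)\<bar> \<le> 2 * n * (t - s)\<^sup>2" for s t
    using smooth_pos_quadratic[OF n, of c t s] mult_nonneg_nonneg[OF less_imp_le[OF n] zero_le_power2[of "t - s"]]
    by linarith
  show "\<bar>smooth_pos' n c t - smooth_pos' n c s\<bar> \<le> 2 * n * \<bar>t - s\<bar>" for s t
  proof -
    have m: "\<bar>max (t - a) 0 - max (s - a) 0\<bar> \<le> \<bar>t - s\<bar>" for a by (cases "t \<le> a"; cases "s \<le> a") simp_all
    have e: "smooth_pos' n c t - smooth_pos' n c s =
      n * ((max (t - c) 0 - max (s - c) 0) - (max (t - (c + 1 / n)) 0 - max (s - (c + 1 / n)) 0))"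
      by (simp add: smooth_pos'_def algebra_simps)
    have "\<bar>smooth_pos' n c t - smooth_pos' n c s\<bar> =
      n * \<bar>(max (t - c) 0 - max (s - c) 0) - (max (t - (c + 1 / n)) 0 - max (s - (c + 1 / n)) 0)\<bar>"
      unfolding e abs_mult using n by simp
    also have "\<dots> \<le> n * (2 * \<bar>t - s\<bar>)"
    proof (rule mult_left_mono)
      have tri: "\<bar>x - y\<bar> \<le> 2 * d" if "\<bar>x\<bar> \<le> d" "\<bar>y\<bar> \<le> d" for x y d :: real
        using that by linarith
      show "\<bar>(max (t - c) 0 - max (s - c) 0) - (max (t - (c + 1 / n)) 0 - max (s - (c + 1 / n)) 0)\<bar> \<le> 2 * \<bar>t - s\<bar>"
        by (rule tri[OF m m])
    qed (use n in simp)
    finally show ?thesis by (simp add: mult_ac)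
  qed
qed

lemma smooth_pos_eventually:
  assumes "t \<noteq> c" "n > 0" "n * \<bar>t - c\<bar> \<ge> 1"
  shows "smooth_pos' n c t = (if t > c then 1 else 0)"
    and "smooth_pos n c t = (if t > c then t - c - 1 / (2 * n) else 0)"
proof -
  define r where "r = 1 / n"
  have r: "r > 0" "n * r = 1" using assms(2) by (auto simp: r_def)
  have "smooth_pos' n c t = (if t > c then 1 else 0) \<and>
    smooth_pos n c t = (if t > c then t - c - r / 2 else 0)"
  proof (cases "t > c")
    case True
    have "n * r \<le> n * (t - c)" using assms(3) True r(2) by simp
    then have "r \<le> t - c" using assms(2) by simp
    then have m: "max (t - c) 0 = t - c" "max (t - c - r) 0 = t - c - r" using r by auto
    have id: "n * (x\<^sup>2 / 2 - (x - r)\<^sup>2 / 2) = (n * r) * x - (n * r) * r / 2" for x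
      by (simp add: power2_eq_square field_simps)
    have "smooth_pos n c t = (n * r) * (t - c) - (n * r) * r / 2"
      unfolding smooth_pos_def half_sq_pos_def r_def[symmetric] m by (rule id)
    moreover have "smooth_pos' n c t = n * r"
      unfolding smooth_pos'_def r_def[symmetric] m by simp
    ultimately show ?thesis using True r(2) by simp
  next
    case False
    then have m: "max (t - c) 0 = 0" "max (t - c - r) 0 = 0" using r by auto
    show ?thesis
      using False unfolding smooth_pos_def smooth_pos'_def half_sq_pos_def r_def[symmetric] m by simp
  qed
  then show "smooth_pos' n c t = (if t > c then 1 else 0)"
    "smooth_pos n c t = (if t > c then t - c - 1 / (2 * n) else 0)"
    by (auto simp: r_def)
qed

lemma smooth_pos_tendsto:
  "(\<lambda>n. smooth_pos' (real (Suc n)) c t) \<longlonglongrightarrow> (if t > c then 1 else 0)"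
  "(\<lambda>n. smooth_pos (real (Suc n)) c t) \<longlonglongrightarrow> max (t - c) 0"
proof -
  have "(\<lambda>n. smooth_pos' (real (Suc n)) c t) \<longlonglongrightarrow> (if t > c then 1 else 0) \<and>
    (\<lambda>n. smooth_pos (real (Suc n)) c t) \<longlonglongrightarrow> max (t - c) 0"
  proof (cases "t = c")
    case True
    have m: "max (t - c) 0 = 0" "max (t - c - 1 / real (Suc n)) 0 = 0" for n using True by auto
    show ?thesis unfolding smooth_pos_def smooth_pos'_def half_sq_pos_def m using True by simp
  next
    case False
    obtain N :: nat where N: "1 / \<bar>t - c\<bar> < real N" using reals_Archimedean2 by blast
    have ev: "real (Suc n) * \<bar>t - c\<bar> \<ge> 1" if "n \<ge> N" for n
    proof -
      have "1 / \<bar>t - c\<bar> < real (Suc n)" using N that by linarith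
      then show ?thesis using False by (simp add: field_simps)
    qed
    have l: "(\<lambda>n. t - c - 1 / (2 * real (Suc n))) \<longlonglongrightarrow> t - c - 0"
    proof (intro tendsto_diff tendsto_const)
      have "(\<lambda>n. (1/2) * (1 / real (Suc n))) \<longlonglongrightarrow> 0"
        by (rule tendsto_mult_right_zero[OF LIMSEQ_Suc[OF lim_const_over_n]])
      then show "(\<lambda>n. 1 / (2 * real (Suc n))) \<longlonglongrightarrow> 0" by (simp add: field_simps)
    qed
    have "\<forall>\<^sub>F n in sequentially. (if t > c then 1 else 0) = smooth_pos' (real (Suc n)) c t"
      using eventually_ge_at_top[of N]
      by eventually_elim (use smooth_pos_eventually(1)[OF False _ ev] in simp)
    then have 1: "(\<lambda>n. smooth_pos' (real (Suc n)) c t) \<longlonglongrightarrow> (if t > c then 1 else 0)"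
      by (rule Lim_transform_eventually[OF tendsto_const])
    have "\<forall>\<^sub>F n in sequentially. (if t > c then t - c - 1 / (2 * real (Suc n)) else 0) = smooth_pos (real (Suc n)) c t"
      using eventually_ge_at_top[of N]
      by eventually_elim (use smooth_pos_eventually(2)[OF False _ ev] in simp)
    moreover have "(\<lambda>n. if t > c then t - c - 1 / (2 * real (Suc n)) else 0) \<longlonglongrightarrow> max (t - c) 0"
      using l by (cases "t > c") (auto simp: max_def)
    ultimately have 2: "(\<lambda>n. smooth_pos (real (Suc n)) c t) \<longlonglongrightarrow> max (t - c) 0"
      by (rule Lim_transform_eventually[rotated])
    from 1 2 show ?thesis ..
  qed
  then show "(\<lambda>n. smooth_pos' (real (Suc n)) c t) \<longlonglongrightarrow> (if t > c then 1 else 0)"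
    "(\<lambda>n. smooth_pos (real (Suc n)) c t) \<longlonglongrightarrow> max (t - c) 0" by auto
qed

text \<open>
The smoothed positive parts are dominated by \<open>\<bar>u\<bar>\<close> and their derivatives by \<open>\<bar>g\<bar>\<close>; for this
bound the corner must not lie to the left of \<open>0\<close>.
\<close>

lemma weak_pderiv_pos_part:
  assumes D: "open D" and w: "is_weak_pderiv D b u g" and g: "g \<in> L2_loc D" and c: "c \<ge> 0"
  shows "is_weak_pderiv D b (\<lambda>x. max (u x - c) 0) (\<lambda>x. if u x > c then g x else 0)"
proof (rule weak_pderiv_dominated[OF D])
  have L: "u \<in> L1_loc D" "g \<in> L1_loc D" using w by (auto simp: is_weak_pderiv_def)
  then have [measurable]: "u \<in> borel_measurable (lebesgue_on D)" "g \<in> borel_measurable (lebesgue_on D)"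
    by (auto simp: L1_loc_def)
  show "is_weak_pderiv D b (\<lambda>x. smooth_pos (real (Suc n)) c (u x)) (\<lambda>x. smooth_pos' (real (Suc n)) c (u x) * g x)" for n
    by (rule weak_pderiv_chain_C11[OF D w g C11_smooth_pos]) (use c in auto)
  show "(\<lambda>x. \<bar>u x\<bar>) \<in> L1_loc D" by (rule L1_loc_bound[OF D L(1)]) auto
  show "(\<lambda>x. \<bar>g x\<bar>) \<in> L1_loc D" by (rule L1_loc_bound[OF D L(2)]) auto
  show "(\<lambda>x. max (u x - c) 0) \<in> borel_measurable (lebesgue_on D)" by measurable
  show "(\<lambda>x. if u x > c then g x else 0) \<in> borel_measurable (lebesgue_on D)" by measurable
  show "AE x in lebesgue_on D. \<bar>smooth_pos (real (Suc n)) c (u x)\<bar> \<le> \<bar>u x\<bar>" for n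
    by (intro AE_I2 smooth_pos_le) (use c in auto)
  show "AE x in lebesgue_on D. \<bar>smooth_pos' (real (Suc n)) c (u x) * g x\<bar> \<le> \<bar>g x\<bar>" for n
  proof (rule AE_I2)
    fix x
    have "\<bar>smooth_pos' (real (Suc n)) c (u x)\<bar> \<le> 1"
      using smooth_pos'_bounds[of "real (Suc n)" c "u x"] by simp
    then show "\<bar>smooth_pos' (real (Suc n)) c (u x) * g x\<bar> \<le> \<bar>g x\<bar>"
      unfolding abs_mult by (intro mult_left_le_one_le) auto
  qed
  show "AE x in lebesgue_on D. (\<lambda>n. smooth_pos (real (Suc n)) c (u x)) \<longlonglongrightarrow> max (u x - c) 0"
    by (intro AE_I2 smooth_pos_tendsto)
  show "AE x in lebesgue_on D. (\<lambda>n. smooth_pos' (real (Suc n)) c (u x) * g x) \<longlonglongrightarrow> (if u x > c then g x else 0)"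
  proof (rule AE_I2)
    fix x
    have "(\<lambda>n. smooth_pos' (real (Suc n)) c (u x) * g x) \<longlonglongrightarrow> (if u x > c then 1 else 0) * g x"
      by (intro tendsto_mult tendsto_const smooth_pos_tendsto)
    then show "(\<lambda>n. smooth_pos' (real (Suc n)) c (u x) * g x) \<longlonglongrightarrow> (if u x > c then g x else 0)"
      by (simp split: if_splits)
  qed
qed

text \<open>
Clipping to \<open>[- a, c]\<close> subtracts the excess above \<open>c\<close> and adds the excess of \<open>- u\<close> above \<open>a\<close>.
\<close>

lemma weak_pderiv_clip:
  assumes D: "open D" and w: "is_weak_pderiv D b u g" and g: "g \<in> L2_loc D" and c: "a \<ge> 0" "c \<ge> 0"
  shows "is_weak_pderiv D b (\<lambda>x. min (max (- a) (u x)) c) (\<lambda>x. if - a \<le> u x \<and> u x \<le> c then g x else 0)"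
proof -
  have w': "is_weak_pderiv D b (\<lambda>x. (-1) * u x + 0 * u x) (\<lambda>x. (-1) * g x + 0 * g x)"
    by (rule weak_pderiv_lincomb[OF D w w])
  have g': "(\<lambda>x. (-1) * g x + 0 * g x) \<in> L2_loc D" by (rule L2_loc_lincomb[OF D g g])
  have "is_weak_pderiv D b
     (\<lambda>x. 1 * (1 * u x + (-1) * max (u x - c) 0) + 1 * max ((-1) * u x + 0 * u x - a) 0)
     (\<lambda>x. 1 * (1 * g x + (-1) * (if u x > c then g x else 0)) +
        1 * (if (-1) * u x + 0 * u x > a then (-1) * g x + 0 * g x else 0))"
    by (intro weak_pderiv_lincomb weak_pderiv_pos_part D w g w' g' c)
  moreover have "1 * (1 * u x + (-1) * max (u x - c) 0) + 1 * max ((-1) * u x + 0 * u x - a) 0 =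
     min (max (- a) (u x)) c" for x using c by (auto simp: max_def min_def)
  moreover have "1 * (1 * g x + (-1) * (if u x > c then g x else 0)) +
        1 * (if (-1) * u x + 0 * u x > a then (-1) * g x + 0 * g x else 0) =
      (if - a \<le> u x \<and> u x \<le> c then g x else 0)" for x using c by auto
  ultimately show ?thesis by simp
qed

lemma BL_pos_part:
  assumes D: "open D" and u: "u \<in> BL D" and c: "c \<ge> 0"
  shows "(\<lambda>x. max (u x - c) 0) \<in> BL D"
proof (rule BL_I)
  have m[measurable]: "u \<in> borel_measurable (lebesgue_on D)" using u by (simp add: BL_def L2_loc_def)
  show "(\<lambda>x. max (u x - c) 0) \<in> L2_loc D"
    by (rule L2_loc_bound[OF D BL_imp_L2_loc[OF u]]) (use c in \<open>auto simp: max_def\<close>)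
  fix b :: 'a assume b: "b \<in> Basis"
  note G = BL_weak_grad[OF D u b]
  have [measurable]: "(\<lambda>x. weak_grad D u x \<bullet> b) \<in> borel_measurable (lebesgue_on D)"
    using G(2) by (simp add: L2_space_def)
  show "is_weak_pderiv D b (\<lambda>x. max (u x - c) 0) (\<lambda>x. if u x > c then weak_grad D u x \<bullet> b else 0)"
    by (rule weak_pderiv_pos_part[OF D G(1) L2_space_imp_L2_loc[OF D G(2)] c])
  show "(\<lambda>x. if u x > c then weak_grad D u x \<bullet> b else 0) \<in> L2_space (lebesgue_on D)"
    by (rule L2_space_bound[OF G(2)]) auto
qed

lemma BL_clip:
  assumes D: "open D" and u: "u \<in> BL D" and c: "a \<ge> 0" "c \<ge> 0"
  shows "(\<lambda>x. min (max (- a) (u x)) c) \<in> BL D"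
    and "AE x in lebesgue_on D. weak_grad D (\<lambda>x. min (max (- a) (u x)) c) x =
      (if - a \<le> u x \<and> u x \<le> c then weak_grad D u x else 0)"
proof -
  have m[measurable]: "u \<in> borel_measurable (lebesgue_on D)" using u by (simp add: BL_def L2_loc_def)
  have w: "is_weak_pderiv D b (\<lambda>x. min (max (- a) (u x)) c)
      (\<lambda>x. if - a \<le> u x \<and> u x \<le> c then weak_grad D u x \<bullet> b else 0)" if b: "b \<in> Basis" for b
    using BL_weak_grad[OF D u b] by (intro weak_pderiv_clip D c L2_space_imp_L2_loc)
  show "(\<lambda>x. min (max (- a) (u x)) c) \<in> BL D"
  proof (rule BL_I[OF _ w])
    show "(\<lambda>x. min (max (- a) (u x)) c) \<in> L2_loc D"
      by (rule L2_loc_bound[OF D BL_imp_L2_loc[OF u]]) (use c in \<open>auto simp: max_def min_def\<close>)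
    fix b :: 'a assume b: "b \<in> Basis"
    have [measurable]: "(\<lambda>x. weak_grad D u x \<bullet> b) \<in> borel_measurable (lebesgue_on D)"
      using BL_weak_grad(2)[OF D u b] by (simp add: L2_space_def)
    show "(\<lambda>x. if - a \<le> u x \<and> u x \<le> c then weak_grad D u x \<bullet> b else 0) \<in> L2_space (lebesgue_on D)"
      by (rule L2_space_bound[OF BL_weak_grad(2)[OF D u b]]) auto
  qed
  have "AE x in lebesgue_on D. \<forall>b\<in>Basis. weak_grad D (\<lambda>x. min (max (- a) (u x)) c) x \<bullet> b =
      (if - a \<le> u x \<and> u x \<le> c then weak_grad D u x \<bullet> b else 0)"
    by (rule weak_grad_AE[OF D w])
  then show "AE x in lebesgue_on D. weak_grad D (\<lambda>x. min (max (- a) (u x)) c) x =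
      (if - a \<le> u x \<and> u x \<le> c then weak_grad D u x else 0)"
    by eventually_elim (auto simp: euclidean_eq_iff[where 'a='a])
qed

lemma integrable_norm_weak_grad:
  assumes D: "open D" and u: "u \<in> BL D"
  shows "integrable (lebesgue_on D) (\<lambda>x. (norm (weak_grad D u x))\<^sup>2)"
proof -
  have "integrable (lebesgue_on D) (\<lambda>x. \<Sum>b\<in>Basis. (weak_grad D u x \<bullet> b)\<^sup>2)"
    using BL_weak_grad(2)[OF D u] by (intro Bochner_Integration.integrable_sum) (auto simp: L2_space_def)
  moreover have "(norm y)\<^sup>2 = (\<Sum>b\<in>Basis. (y \<bullet> b)\<^sup>2)" for y :: 'a
    by (simp only: power2_norm_eq_inner) (subst euclidean_inner, simp add: power2_eq_square)
  ultimately show ?thesis by simp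
qed

lemma Dirichlet_int_ext_eq:
  assumes D: "open D" and u: "u \<in> BL D"
  shows "Dirichlet_int_ext D u = ennreal (Dirichlet_int D u u)"
  unfolding Dirichlet_int_ext_def Dirichlet_int_def
  using nn_integral_eq_integral[OF integrable_norm_weak_grad[OF assms]]
  by (simp add: power2_norm_eq_inner)

text \<open>
This contains the Markov property (clip to \<open>[0,1]\<close>) and the energy bound for the truncations (clip to
\<open>[- k, k]\<close>).
\<close>

lemma Dirichlet_int_clip_le:
  assumes D: "open D" and u: "u \<in> BL D" and c: "a \<ge> 0" "c \<ge> 0"
  shows "Dirichlet_int D (\<lambda>x. min (max (- a) (u x)) c) (\<lambda>x. min (max (- a) (u x)) c) \<le> Dirichlet_int D u u"
proof -
  have "(LINT x|lebesgue_on D. (norm (weak_grad D (\<lambda>x. min (max (- a) (u x)) c) x))\<^sup>2) \<le>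
    (LINT x|lebesgue_on D. (norm (weak_grad D u x))\<^sup>2)"
  proof (rule integral_mono_AE)
    show "AE x in lebesgue_on D. (norm (weak_grad D (\<lambda>x. min (max (- a) (u x)) c) x))\<^sup>2 \<le> (norm (weak_grad D u x))\<^sup>2"
      using BL_clip(2)[OF D u c] by eventually_elim auto
  qed (intro integrable_norm_weak_grad D u BL_clip c)+
  then show ?thesis by (simp add: Dirichlet_int_def power2_norm_eq_inner)
qed

section \<open>Compactly supported smooth functions as elements of the Sobolev space\<close>

lemma integrable_test_lborel:
  assumes "\<phi> \<in> test_functions D"
  shows "integrable lborel \<phi>" "integrable lborel (\<lambda>x. frechet_derivative \<phi> (at x) b)"
proof -
  obtain K C where K: "compact K" "K \<subseteq> D" "C \<ge> 0"
    "\<And>x. \<bar>\<phi> x\<bar> \<le> C * indicator K x"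
    "\<And>x. \<bar>frechet_derivative \<phi> (at x) b\<bar> \<le> C * indicator K x"
    using test_function_deriv_bounded[OF assms, of b] by blast
  have i: "integrable lborel (\<lambda>x. C * indicator K x)"
    using K(1) emeasure_bounded_finite[OF compact_imp_bounded[OF K(1)]]
    by (intro integrable_mult_right) (simp add: integrable_indicator_iff borel_compact)
  have ab: "\<bar>c\<bar> \<le> \<bar>d\<bar>" if "\<bar>c\<bar> \<le> d" for c d :: real using that by linarith
  show "integrable lborel \<phi>"
    by (rule Bochner_Integration.integrable_bound[OF i continuous_on_imp_borel[OF test_function_continuous[OF assms]]])
      (use ab[OF K(4)] in simp)
  show "integrable lborel (\<lambda>x. frechet_derivative \<phi> (at x) b)"
    by (rule Bochner_Integration.integrable_bound[OF i continuous_on_imp_borel[OF test_function_deriv_continuous[OF assms]]])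
      (use ab[OF K(5)] in simp)
qed

text \<open>
A test function and its translate have the same integral, and their difference is a mean of
translates of the derivative.
\<close>

lemma integral_test_deriv_zero:
  assumes \<phi>: "\<phi> \<in> test_functions D"
  shows "(LINT x|lborel. frechet_derivative \<phi> (at x) b) = 0"
proof -
  let ?d = "\<lambda>x. frechet_derivative \<phi> (at x) b"
  have m\<phi>[measurable]: "\<phi> \<in> borel_measurable borel"
    by (rule borel_measurable_continuous_onI[OF test_function_continuous[OF \<phi>]])
  have md[measurable]: "?d \<in> borel_measurable borel"
    by (rule borel_measurable_continuous_onI[OF test_function_deriv_continuous[OF \<phi>]])
  have i: "integrable lborel (\<lambda>y. ?d (y - s *\<^sub>R b))" for s
    using lborel_integral_shift(2)[OF md, of "- (s *\<^sub>R b)"] integrable_test_lborel(2)[OF \<phi>] by simp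
  have e: "(LINT y|lborel. ?d (y - s *\<^sub>R b)) = (LINT y|lborel. ?d y)" for s
    using lborel_integral_shift(1)[OF md, of "- (s *\<^sub>R b)"] by simp
  have "(LINT y|lborel. ?d y) = (LINT s|lborel. indicator {0..1} s * (LINT y|lborel. ?d (y - s *\<^sub>R b)))"
    unfolding e by (simp add: measure_def)
  also have "\<dots> = (LINT y|lborel. (LINT s|lborel. indicator {0..1} s * ?d (y - s *\<^sub>R b)))"
  proof (rule Fubini_strip(2)[OF _ i])
    show "(\<lambda>(s, y). ?d (y - s *\<^sub>R b)) \<in> borel_measurable (lborel \<Otimes>\<^sub>M lborel)" by measurable
    show "(LINT y|lborel. \<bar>?d (y - s *\<^sub>R b)\<bar>) \<le> (LINT y|lborel. \<bar>?d y\<bar>)" for s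
      using lborel_integral_shift(1)[of "\<lambda>y. \<bar>?d y\<bar>" "- (s *\<^sub>R b)"] by simp
  qed
  also have "\<dots> = (LINT y|lborel. \<phi> y - \<phi> (y - 1 *\<^sub>R b))"
    using test_function_FTC[OF \<phi>, of 1 _ b] by simp
  also have "\<dots> = (LINT y|lborel. \<phi> y) - (LINT y|lborel. \<phi> (y - b))"
    using lborel_integral_shift(2)[OF m\<phi>, of "- b"] integrable_test_lborel(1)[OF \<phi>]
    by (simp add: Bochner_Integration.integral_diff)
  also have "\<dots> = 0" using lborel_integral_shift(1)[OF m\<phi>, of "- b"] by simp
  finally show ?thesis .
qed

lemma test_function_mult:
  assumes \<psi>: "\<psi> \<in> test_functions E" and \<phi>: "\<phi> \<in> test_functions D"
  shows "(\<lambda>x. \<psi> x * \<phi> x) \<in> test_functions D"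
    and "frechet_derivative (\<lambda>x. \<psi> x * \<phi> x) (at x) b =
      \<psi> x * frechet_derivative \<phi> (at x) b + frechet_derivative \<psi> (at x) b * \<phi> x"
proof -
  show "(\<lambda>x. \<psi> x * \<phi> x) \<in> test_functions D"
  proof (rule test_functionsI[where K = "closure {x. \<phi> x \<noteq> 0}"])
    show "C_k k (\<lambda>x. \<psi> x * \<phi> x)" for k using assms by (auto simp: test_functions_def intro: C_k_mult)
    show "\<psi> x * \<phi> x = 0" if "x \<notin> closure {x. \<phi> x \<noteq> 0}" for x
    proof -
      have "\<phi> x = 0" using that closure_subset[of "{x. \<phi> x \<noteq> 0}"] by blast
      then show ?thesis by simp
    qed
  qed (use \<phi> in \<open>auto simp: test_functions_def\<close>)
  show "frechet_derivative (\<lambda>x. \<psi> x * \<phi> x) (at x) b =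
      \<psi> x * frechet_derivative \<phi> (at x) b + frechet_derivative \<psi> (at x) b * \<phi> x"
    using fun_cong[OF frechet_derivative_at[OF has_derivative_mult[OF
      test_function_has_derivative[OF \<psi>, of x] test_function_has_derivative[OF \<phi>, of x]]], of b]
    by (rule sym)
qed

text \<open>
Integration by parts: the product with a test function on \<open>D\<close> is again a test function, whose
derivative has integral zero.
\<close>

lemma weak_pderiv_smooth:
  assumes D: "open D" and \<psi>: "\<psi> \<in> test_functions UNIV"
  shows "is_weak_pderiv D b \<psi> (\<lambda>x. frechet_derivative \<psi> (at x) b)"
  unfolding is_weak_pderiv_def
proof (intro conjI ballI)
  show L: "\<psi> \<in> L1_loc D" "(\<lambda>x. frechet_derivative \<psi> (at x) b) \<in> L1_loc D"
    by (intro integrable_lborel_imp_L1_loc D integrable_test_lborel[OF \<psi>])+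
  fix \<phi> assume \<phi>: "\<phi> \<in> test_functions D"
  note t = test_function_mult[OF \<psi> \<phi>]
  note I = L1_loc_test_integrable[OF D _ \<phi>]
  have "0 = (LINT x|lborel. frechet_derivative (\<lambda>x. \<psi> x * \<phi> x) (at x) b)"
    by (rule integral_test_deriv_zero[OF t(1), symmetric])
  also have "\<dots> = (LINT x|lebesgue_on D. frechet_derivative (\<lambda>x. \<psi> x * \<phi> x) (at x) b)"
  proof (rule integral_lebesgue_on_lborel[OF D, symmetric])
    show "(\<lambda>x. frechet_derivative (\<lambda>x. \<psi> x * \<phi> x) (at x) b) \<in> borel_measurable borel"
      by (rule borel_measurable_continuous_onI[OF test_function_deriv_continuous[OF t(1)]])
    show "frechet_derivative (\<lambda>x. \<psi> x * \<phi> x) (at x) b = 0" if "x \<notin> D" for x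
      by (rule test_function_deriv_zero) (use t(1) that in \<open>auto simp: test_functions_def\<close>)
  qed
  also have "\<dots> = (LINT x|lebesgue_on D. \<psi> x * frechet_derivative \<phi> (at x) b) +
      (LINT x|lebesgue_on D. frechet_derivative \<psi> (at x) b * \<phi> x)"
    unfolding t(2) by (rule Bochner_Integration.integral_add[OF I(2)[OF L(1)] I(1)[OF L(2)]])
  finally show "(LINT x|lebesgue_on D. \<psi> x * frechet_derivative \<phi> (at x) b) =
      - (LINT x|lebesgue_on D. frechet_derivative \<psi> (at x) b * \<phi> x)" by simp
qed

lemma L2_space_compact_support:
  assumes D: "open D" and "compact K" "f \<in> borel_measurable (lebesgue_on D)" "\<And>x. \<bar>f x\<bar> \<le> C * indicator K x"
  shows "f \<in> L2_space (lebesgue_on D)"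
proof (rule L2_space_bound[OF _ assms(3)])
  have K: "K \<in> sets lebesgue" "emeasure lebesgue K < \<infinity>"
    using lmeasurable_compact[OF assms(2)] by (auto simp: fmeasurable_def)
  have i: "integrable (lebesgue_on D) (indicator K :: _ \<Rightarrow> real)"
  proof -
    have "integrable lebesgue (\<lambda>x. indicator D x *\<^sub>R (indicator K x :: real))"
      using K D by (intro integrable_mult_indicator) (auto simp: integrable_indicator_iff)
    then show ?thesis using D by (subst integrable_restrict_space) auto
  qed
  have "integrable (lebesgue_on D) (\<lambda>x. C\<^sup>2 * indicator K x)" using i by simp
  moreover have "C\<^sup>2 * indicator K x = (C * indicator K x)\<^sup>2" for x by (simp split: split_indicator)
  moreover have "(\<lambda>x. C * indicator K x) \<in> borel_measurable (lebesgue_on D)"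
    using borel_measurable_integrable[OF i] by (intro borel_measurable_times borel_measurable_const)
  ultimately show "(\<lambda>x. C * indicator K x) \<in> L2_space (lebesgue_on D)" by (simp add: L2_space_def)
  show "AE x in lebesgue_on D. \<bar>f x\<bar> \<le> \<bar>C * indicator K x\<bar>"
    using assms(4) by (intro AE_I2) (meson abs_ge_self order_trans)
qed

lemma smooth_in_W12:
  assumes D: "open D" and \<psi>: "\<psi> \<in> test_functions UNIV"
  shows "\<psi> \<in> W12 D"
proof -
  have L2: "\<psi> \<in> L2_space (lebesgue_on D)" "(\<lambda>x. frechet_derivative \<psi> (at x) b) \<in> L2_space (lebesgue_on D)" for b
  proof -
    obtain K C where K: "compact K" "K \<subseteq> UNIV" "C \<ge> 0"
      "\<And>x. \<bar>\<psi> x\<bar> \<le> C * indicator K x"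
      "\<And>x. \<bar>frechet_derivative \<psi> (at x) b\<bar> \<le> C * indicator K x"
      using test_function_deriv_bounded[OF \<psi>, of b] by blast
    show "\<psi> \<in> L2_space (lebesgue_on D)"
      by (rule L2_space_compact_support[OF D K(1) continuous_imp_lebesgue_on[OF test_function_continuous[OF \<psi>]] K(4)])
    show "(\<lambda>x. frechet_derivative \<psi> (at x) b) \<in> L2_space (lebesgue_on D)"
      by (rule L2_space_compact_support[OF D K(1) continuous_imp_lebesgue_on[OF test_function_deriv_continuous[OF \<psi>]] K(5)])
  qed
  have "\<psi> \<in> BL D"
    by (rule BL_I[OF L2_space_imp_L2_loc[OF D L2(1)] weak_pderiv_smooth[OF D \<psi>] L2(2)])
  with L2(1) show ?thesis by (simp add: W12_def)
qed

section \<open>A local Poincare inequality\<close>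

lemma directional_derivative_BL:
  assumes D: "open D" and v: "v \<in> BL D"
  shows "is_weak_pderiv D h v (\<lambda>x. h \<bullet> weak_grad D v x)"
    and "(\<lambda>x. h \<bullet> weak_grad D v x) \<in> L2_space (lebesgue_on D)"
    and "(LINT x|lebesgue_on D. (h \<bullet> weak_grad D v x)\<^sup>2) \<le> (norm h)\<^sup>2 * Dirichlet_int D v v"
proof -
  have e: "(\<Sum>b\<in>Basis. (h \<bullet> b) * (weak_grad D v x \<bullet> b)) = h \<bullet> weak_grad D v x" for x
    by (rule euclidean_inner[symmetric])
  show w: "is_weak_pderiv D h v (\<lambda>x. h \<bullet> weak_grad D v x)"
    using weak_pderiv_direction[OF D BL_weak_grad(1)[OF D v], of h] unfolding e by simp
  have i: "integrable (lebesgue_on D) (\<lambda>x. (norm h)\<^sup>2 * (norm (weak_grad D v x))\<^sup>2)"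
    by (intro integrable_mult_right integrable_norm_weak_grad D v)
  have m: "(\<lambda>x. h \<bullet> weak_grad D v x) \<in> borel_measurable (lebesgue_on D)"
    using w by (simp add: is_weak_pderiv_def L1_loc_def)
  have le: "(h \<bullet> weak_grad D v x)\<^sup>2 \<le> (norm h)\<^sup>2 * (norm (weak_grad D v x))\<^sup>2" for x
    using power_mono[OF Cauchy_Schwarz_ineq2[of h "weak_grad D v x"], of 2] by (simp add: power_mult_distrib)
  have i2: "integrable (lebesgue_on D) (\<lambda>x. (h \<bullet> weak_grad D v x)\<^sup>2)"
    by (rule Bochner_Integration.integrable_bound[OF i borel_measurable_power[OF m]]) (use le in simp)
  with m show "(\<lambda>x. h \<bullet> weak_grad D v x) \<in> L2_space (lebesgue_on D)" by (simp add: L2_space_def)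
  have "(LINT x|lebesgue_on D. (h \<bullet> weak_grad D v x)\<^sup>2) \<le> (LINT x|lebesgue_on D. (norm h)\<^sup>2 * (norm (weak_grad D v x))\<^sup>2)"
    by (rule integral_mono[OF i2 i le])
  then show "(LINT x|lebesgue_on D. (h \<bullet> weak_grad D v x)\<^sup>2) \<le> (norm h)\<^sup>2 * Dirichlet_int D v v"
    by (simp add: Dirichlet_int_def power2_norm_eq_inner)
qed

text \<open>
The translation estimate for the directional derivative in direction \<open>h\<close>, with step \<open>1\<close>.  One Borel
version \<open>v'\<close> of \<open>v\<close> serves all vectors \<open>h\<close>, which makes it possible to integrate over \<open>h\<close>.
\<close>

lemma BL_translation_estimate:
  assumes D: "open D" and v: "v \<in> BL D" and K: "compact K" "K \<subseteq> D" and V: "open V"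
    and sub: "\<And>x s. x \<in> V \<Longrightarrow> s \<in> {0..1} \<Longrightarrow> x + s *\<^sub>R h \<in> interior K"
    and v': "integrable lborel v'" "AE x in lebesgue. x \<in> K \<longrightarrow> v x = v' x"
  shows "(\<integral>\<^sup>+x. indicator V x * ennreal ((v' (x + h) - v' x)\<^sup>2) \<partial>lborel) \<le>
    ennreal ((norm h)\<^sup>2 * Dirichlet_int D v v)"
proof -
  note G = directional_derivative_BL[OF D v, of h]
  have L: "(\<lambda>x. h \<bullet> weak_grad D v x) \<in> L1_loc D" using G(1) by (simp add: is_weak_pderiv_def)
  obtain g' where g': "g' \<in> borel_measurable borel" "integrable lborel g'"
    "AE x in lebesgue. x \<in> K \<longrightarrow> h \<bullet> weak_grad D v x = g' x" "\<And>x. x \<notin> K \<Longrightarrow> g' x = 0"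
    using L1_loc_borel_version[OF D L K] by blast
  have w: "has_weak_deriv_on (interior K) h v' g'"
    by (rule has_weak_deriv_on_localI[OF D G(1) K(2) interior_subset v' g'(2,3)])
  note g2 = borel_version_L2[OF D L2_space_imp_L2_loc[OF D G(2)] K g'(1,3,4)]
  have "(\<integral>\<^sup>+x. indicator V x * ennreal ((v' (x + 1 *\<^sub>R h) - v' x)\<^sup>2) \<partial>lborel) \<le>
    ennreal (1\<^sup>2) * (\<integral>\<^sup>+x. ennreal ((g' x)\<^sup>2) \<partial>lborel)"
    by (rule weak_deriv_translation_L2[OF w V]) (use sub in auto)
  also have "\<dots> = ennreal (LINT x|lborel. (g' x)\<^sup>2)"
    using nn_integral_eq_integral[OF g2(1)] by simp
  also have "\<dots> \<le> ennreal ((norm h)\<^sup>2 * Dirichlet_int D v v)"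
  proof (rule ennreal_leI)
    have "(LINT x|lborel. (g' x)\<^sup>2) = (LINT x|lebesgue_on D. indicator K x * (h \<bullet> weak_grad D v x)\<^sup>2)" by (rule g2(2))
    also have "\<dots> \<le> (LINT x|lebesgue_on D. (h \<bullet> weak_grad D v x)\<^sup>2)"
      using G(2) L2_space_imp_L2_loc[OF D G(2)] K
      by (intro integral_mono) (auto simp: L2_space_def L2_loc_iff[OF D] split: split_indicator)
    also note G(3)
    finally show "(LINT x|lborel. (g' x)\<^sup>2) \<le> (norm h)\<^sup>2 * Dirichlet_int D v v" .
  qed
  finally show ?thesis by simp
qed

text \<open>
Substitute \<open>y = x + h\<close>.  Two points of the ball differ by a vector \<open>h\<close> of length less than \<open>2 R\<close>, and
the segment joining them stays in the concentric ball of radius \<open>4 R\<close>, where the translation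
estimate is available.
\<close>

lemma local_Poincare:
  fixes D :: "'a::euclidean_space set"
  assumes D: "open D" and R: "R > 0" "cball x0 (4 * R) \<subseteq> D"
    and v: "v \<in> BL D" and v': "integrable lborel v'" "AE x in lebesgue. x \<in> cball x0 (4 * R) \<longrightarrow> v x = v' x"
  shows "(\<integral>\<^sup>+x. \<integral>\<^sup>+y. indicator (ball x0 R) x * (indicator (ball x0 R) y * ennreal ((v' y - v' x)\<^sup>2)) \<partial>lborel \<partial>lborel)
    \<le> emeasure lborel (ball (0 :: 'a) (2 * R)) * ennreal ((2 * R)\<^sup>2 * Dirichlet_int D v v)"
proof -
  let ?A = "ball x0 R" and ?H = "ball (0::'a) (2 * R)"
  have [measurable]: "v' \<in> borel_measurable borel" using v'(1) by auto
  have mA[measurable]: "?A \<in> sets borel" by simp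
  have mH[measurable]: "?H \<in> sets borel" by simp
  have "(\<integral>\<^sup>+x. \<integral>\<^sup>+y. indicator ?A x * (indicator ?A y * ennreal ((v' y - v' x)\<^sup>2)) \<partial>lborel \<partial>lborel) =
    (\<integral>\<^sup>+x. \<integral>\<^sup>+h. indicator ?A x * (indicator ?A (h + x) * ennreal ((v' (h + x) - v' x)\<^sup>2)) \<partial>lborel \<partial>lborel)"
  proof (rule nn_integral_cong)
    fix x
    show "(\<integral>\<^sup>+y. indicator ?A x * (indicator ?A y * ennreal ((v' y - v' x)\<^sup>2)) \<partial>lborel) =
      (\<integral>\<^sup>+h. indicator ?A x * (indicator ?A (h + x) * ennreal ((v' (h + x) - v' x)\<^sup>2)) \<partial>lborel)"
      by (rule lborel_nn_integral_shift[of "\<lambda>y. indicator ?A x * (indicator ?A y * ennreal ((v' y - v' x)\<^sup>2))" x, symmetric])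
        measurable
  qed
  also have "\<dots> \<le> (\<integral>\<^sup>+x. \<integral>\<^sup>+h. indicator ?H h * (indicator ?A x * ennreal ((v' (x + h) - v' x)\<^sup>2)) \<partial>lborel \<partial>lborel)"
  proof (intro nn_integral_mono)
    fix x h
    have "h \<in> ?H" if "x \<in> ?A" "h + x \<in> ?A"
    proof -
      have "norm h = dist (h + x) x" by (simp add: dist_norm)
      also have "\<dots> \<le> dist x0 (h + x) + dist x0 x" by (rule dist_triangle3)
      finally show ?thesis using that by simp
    qed
    then show "indicator ?A x * (indicator ?A (h + x) * ennreal ((v' (h + x) - v' x)\<^sup>2)) \<le>
      indicator ?H h * (indicator ?A x * ennreal ((v' (x + h) - v' x)\<^sup>2))"
      by (cases "x \<in> ?A"; cases "h + x \<in> ?A") (auto simp: add.commute)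
  qed
  also have "\<dots> = (\<integral>\<^sup>+h. \<integral>\<^sup>+x. indicator ?H h * (indicator ?A x * ennreal ((v' (x + h) - v' x)\<^sup>2)) \<partial>lborel \<partial>lborel)"
    by (rule lborel_pair.Fubini') measurable
  also have "\<dots> = (\<integral>\<^sup>+h. indicator ?H h * (\<integral>\<^sup>+x. indicator ?A x * ennreal ((v' (x + h) - v' x)\<^sup>2) \<partial>lborel) \<partial>lborel)"
    by (intro nn_integral_cong nn_integral_cmult) measurable
  also have "\<dots> \<le> (\<integral>\<^sup>+h. indicator ?H h * ennreal ((2 * R)\<^sup>2 * Dirichlet_int D v v) \<partial>lborel)"
  proof (intro nn_integral_mono)
    fix h
    show "indicator ?H h * (\<integral>\<^sup>+x. indicator ?A x * ennreal ((v' (x + h) - v' x)\<^sup>2) \<partial>lborel) \<le>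
      indicator ?H h * ennreal ((2 * R)\<^sup>2 * Dirichlet_int D v v)"
    proof (cases "h \<in> ?H")
      case True
      have "(\<integral>\<^sup>+x. indicator ?A x * ennreal ((v' (x + h) - v' x)\<^sup>2) \<partial>lborel) \<le> ennreal ((norm h)\<^sup>2 * Dirichlet_int D v v)"
      proof (rule BL_translation_estimate[OF D v _ R(2) open_ball _ v'])
        fix x :: 'a and s :: real assume x: "x \<in> ?A" and s: "s \<in> {0..1}"
        have "dist x0 (x + s *\<^sub>R h) \<le> dist x0 x + dist x (x + s *\<^sub>R h)" by (rule dist_triangle)
        also have "dist x (x + s *\<^sub>R h) = s * norm h" using s by (simp add: dist_norm)
        also have "s * norm h \<le> norm h" using s by (intro mult_left_le_one_le) auto
        finally show "x + s *\<^sub>R h \<in> interior (cball x0 (4 * R))" using x True R(1) by (simp add: interior_cball)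
      qed simp
      also have "\<dots> \<le> ennreal ((2 * R)\<^sup>2 * Dirichlet_int D v v)"
        using True by (intro ennreal_leI mult_right_mono power_mono Dirichlet_int_nonneg) auto
      finally show ?thesis using True by simp
    qed simp
  qed
  also have "\<dots> = emeasure lborel ?H * ennreal ((2 * R)\<^sup>2 * Dirichlet_int D v v)"
    by (simp add: nn_integral_multc)
  finally show ?thesis .
qed

text \<open>
Average \<open>(v x)\<^sup>2 \<le> 2 (v y - v x)\<^sup>2 + 2 (v y)\<^sup>2\<close> over \<open>y\<close> in \<open>E\<close> and integrate over \<open>x\<close> in the ball.
\<close>

lemma local_Poincare_subset:
  fixes D :: "'a::euclidean_space set"
  assumes D: "open D" and R: "R > 0" "cball x0 (4 * R) \<subseteq> D"
    and v: "v \<in> BL D" and E: "E \<in> sets lebesgue" "E \<subseteq> ball x0 R"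
  shows "emeasure lebesgue E * (\<integral>\<^sup>+x. indicator (ball x0 R) x * ennreal ((v x)\<^sup>2) \<partial>lebesgue) \<le>
    2 * (emeasure lborel (ball (0 :: 'a) (2 * R)) * ennreal ((2 * R)\<^sup>2 * Dirichlet_int D v v)) +
    2 * emeasure lborel (ball x0 R) * (\<integral>\<^sup>+x. indicator E x * ennreal ((v x)\<^sup>2) \<partial>lebesgue)"
proof -
  let ?A = "ball x0 R" and ?K = "cball x0 (4 * R)"
  have AK: "?A \<subseteq> ?K" using R(1) by auto
  obtain v' where v': "v' \<in> borel_measurable borel" "integrable lborel v'"
    "AE x in lebesgue. x \<in> ?K \<longrightarrow> v x = v' x" "\<And>x. x \<notin> ?K \<Longrightarrow> v' x = 0"
    using L1_loc_borel_version[OF D L2_loc_imp_L1_loc[OF D BL_imp_L2_loc[OF v]] compact_cball R(2)] by blast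
  note [measurable] = v'(1)
  have mA[measurable]: "?A \<in> sets borel" by simp
  obtain e :: "'a \<Rightarrow> ennreal" where e: "e \<in> borel_measurable lborel" "AE x in lborel. indicator E x = e x"
    using completion_ex_borel_measurable[of "indicator E" lborel] E(1) borel_measurable_indicator by blast
  from e(1) have [measurable]: "e \<in> borel_measurable borel" by simp
  have vl: "AE x in lborel. x \<in> ?K \<longrightarrow> v x = v' x" using v'(3) by (simp add: AE_completion_iff)
  \<comment> \<open>\<open>e\<close> is a Borel version of the indicator of \<open>E\<close>, needed for the product measure.\<close>
  have eA: "AE x in lborel. e x \<le> indicator ?A x \<and> e x \<le> 1"
    using e(2)
  proof eventually_elim
    case (elim x)
    show ?case
    proof (cases "x \<in> E")
      case True
      then have "e x = 1" "x \<in> ?A" using elim E(2) by auto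
      then show ?thesis by simp
    next
      case False
      then have "e x = 0" using elim by simp
      then show ?thesis by simp
    qed
  qed
  have "emeasure lebesgue E = (\<integral>\<^sup>+x. indicator E x \<partial>lebesgue)" using E(1) by simp
  also have "\<dots> = (\<integral>\<^sup>+x. e x \<partial>lborel)"
    unfolding nn_integral_completion using e(2) by (rule nn_integral_cong_AE)
  finally have eE: "emeasure lebesgue E = (\<integral>\<^sup>+x. e x \<partial>lborel)" .
  have vA: "(\<integral>\<^sup>+x. indicator ?A x * ennreal ((v x)\<^sup>2) \<partial>lebesgue) = (\<integral>\<^sup>+x. indicator ?A x * ennreal ((v' x)\<^sup>2) \<partial>lborel)"
    unfolding nn_integral_completion
    by (rule nn_integral_cong_AE) (use vl AK in \<open>auto elim!: eventually_mono split: split_indicator\<close>)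
  have vE: "(\<integral>\<^sup>+x. indicator E x * ennreal ((v x)\<^sup>2) \<partial>lebesgue) = (\<integral>\<^sup>+x. e x * ennreal ((v' x)\<^sup>2) \<partial>lborel)"
    unfolding nn_integral_completion
  proof (rule nn_integral_cong_AE)
    show "AE x in lborel. indicator E x * ennreal ((v x)\<^sup>2) = e x * ennreal ((v' x)\<^sup>2)"
      using e(2) vl
    proof eventually_elim
      case (elim x)
      show ?case
      proof (cases "x \<in> E")
        case True
        then have "v x = v' x" using elim(2) E(2) AK by blast
        then show ?thesis by (simp only: elim(1))
      next
        case False
        then have "e x = 0" using elim(1) by simp
        then show ?thesis using False by simp
      qed
    qed
  qed
  have sq: "ennreal (a\<^sup>2) \<le> 2 * ennreal ((b - a)\<^sup>2) + 2 * ennreal (b\<^sup>2)" for a b :: real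
  proof -
    have "a\<^sup>2 \<le> 2 * (b - a)\<^sup>2 + 2 * b\<^sup>2"
      using zero_le_power2[of "a - 2 * b"] by (simp add: power2_eq_square algebra_simps)
    then have "ennreal (a\<^sup>2) \<le> ennreal (2 * (b - a)\<^sup>2 + 2 * b\<^sup>2)" by (rule ennreal_leI)
    also have "\<dots> = 2 * ennreal ((b - a)\<^sup>2) + 2 * ennreal (b\<^sup>2)"
      by (simp add: ennreal_plus ennreal_mult)
    finally show ?thesis .
  qed
  have "emeasure lebesgue E * (\<integral>\<^sup>+x. indicator ?A x * ennreal ((v' x)\<^sup>2) \<partial>lborel) =
    (\<integral>\<^sup>+x. \<integral>\<^sup>+y. e y * (indicator ?A x * ennreal ((v' x)\<^sup>2)) \<partial>lborel \<partial>lborel)"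
  proof -
    have "(\<integral>\<^sup>+x. \<integral>\<^sup>+y. e y * (indicator ?A x * ennreal ((v' x)\<^sup>2)) \<partial>lborel \<partial>lborel) =
      (\<integral>\<^sup>+x. emeasure lebesgue E * (indicator ?A x * ennreal ((v' x)\<^sup>2)) \<partial>lborel)"
      unfolding eE by (intro nn_integral_cong nn_integral_multc) measurable
    also have "\<dots> = emeasure lebesgue E * (\<integral>\<^sup>+x. indicator ?A x * ennreal ((v' x)\<^sup>2) \<partial>lborel)"
      by (rule nn_integral_cmult) measurable
    finally show ?thesis by (rule sym)
  qed
  also have "\<dots> \<le> (\<integral>\<^sup>+x. \<integral>\<^sup>+y. 2 * (indicator ?A x * (indicator ?A y * ennreal ((v' y - v' x)\<^sup>2))) +
       2 * (indicator ?A x * (e y * ennreal ((v' y)\<^sup>2))) \<partial>lborel \<partial>lborel)"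
  proof (rule nn_integral_mono, rule nn_integral_mono_AE)
    fix x
    show "AE y in lborel. e y * (indicator ?A x * ennreal ((v' x)\<^sup>2)) \<le>
      2 * (indicator ?A x * (indicator ?A y * ennreal ((v' y - v' x)\<^sup>2))) +
       2 * (indicator ?A x * (e y * ennreal ((v' y)\<^sup>2)))"
      using eA
    proof eventually_elim
      case (elim y)
      show ?case
      proof (cases "x \<in> ?A")
        case True
        have "e y * ennreal ((v' x)\<^sup>2) \<le> e y * (2 * ennreal ((v' y - v' x)\<^sup>2) + 2 * ennreal ((v' y)\<^sup>2))"
          by (intro mult_left_mono sq) auto
        also have "\<dots> = 2 * (e y * ennreal ((v' y - v' x)\<^sup>2)) + 2 * (e y * ennreal ((v' y)\<^sup>2))"
          by (simp add: distrib_left mult_ac)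
        also have "\<dots> \<le> 2 * (indicator ?A y * ennreal ((v' y - v' x)\<^sup>2)) + 2 * (e y * ennreal ((v' y)\<^sup>2))"
          using elim by (intro add_mono mult_left_mono mult_right_mono) auto
        finally show ?thesis using True by simp
      qed simp
    qed
  qed
  also have "\<dots> = 2 * (\<integral>\<^sup>+x. \<integral>\<^sup>+y. indicator ?A x * (indicator ?A y * ennreal ((v' y - v' x)\<^sup>2)) \<partial>lborel \<partial>lborel) +
      2 * emeasure lborel ?A * (\<integral>\<^sup>+y. e y * ennreal ((v' y)\<^sup>2) \<partial>lborel)"
    by (simp add: nn_integral_add nn_integral_cmult nn_integral_multc mult.assoc)
  also have "\<dots> \<le> 2 * (emeasure lborel (ball (0 :: 'a) (2 * R)) * ennreal ((2 * R)\<^sup>2 * Dirichlet_int D v v)) +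
      2 * emeasure lborel ?A * (\<integral>\<^sup>+y. e y * ennreal ((v' y)\<^sup>2) \<partial>lborel)"
    by (intro add_mono mult_left_mono local_Poincare[OF D R v v'(2,3)]) auto
  finally show ?thesis unfolding vA vE .
qed

section \<open>Closedness of the Dirichlet integral\<close>

text \<open>
A rapidly converging subsequence converges almost everywhere, and Fatou's lemma bounds the distance
of the whole sequence to its limit.
\<close>

lemma L2_complete:
  fixes u :: "nat \<Rightarrow> 'a \<Rightarrow> real"
  assumes u: "\<And>n. u n \<in> L2_space M"
    and cauchy: "\<And>\<epsilon>. \<epsilon> > 0 \<Longrightarrow> \<exists>N. \<forall>i\<ge>N. \<forall>j\<ge>N. (LINT x|M. (u i x - u j x)\<^sup>2) < \<epsilon>"
  obtains v where "v \<in> L2_space M" "(\<lambda>n. LINT x|M. (u n x - v x)\<^sup>2) \<longlonglongrightarrow> 0"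
proof -
  have m[measurable]: "u n \<in> borel_measurable M" for n using u by (simp add: L2_space_def)
  have i: "integrable M (\<lambda>x. (u i x - u j x)\<^sup>2)" for i j
    using L2_space_lincomb[OF u[of i] u[of j], of 1 "-1"] by (simp add: L2_space_def)
  have nn: "(\<integral>\<^sup>+x. ennreal ((u i x - u j x)\<^sup>2) \<partial>M) = ennreal (LINT x|M. (u i x - u j x)\<^sup>2)" for i j
    by (rule nn_integral_eq_integral[OF i]) simp
  define r where "r k = (SOME N. \<forall>i\<ge>N. \<forall>j\<ge>N. (LINT x|M. (u i x - u j x)\<^sup>2) < (1/8) ^ k)" for k :: nat
  have r: "(LINT x|M. (u i x - u j x)\<^sup>2) < (1/8) ^ k" if "i \<ge> r k" "j \<ge> r k" for i j k
    using someI_ex[OF cauchy[of "(1/8) ^ k"]] that unfolding r_def by simp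
  \<comment> \<open>Adding \<open>k\<close> and all earlier indices makes \<open>s\<close> monotone and unbounded.\<close>
  define s where "s k = k + (\<Sum>i\<le>k. r i)" for k
  have s_ge: "s k \<ge> r k" for k unfolding s_def using member_le_sum[of k "{..k}" r] by simp
  have s_mono: "s k \<le> s (Suc k)" for k by (simp add: s_def)
  have s_ge_id: "s k \<ge> k" for k by (simp add: s_def)
  define d where "d k x = (u (s (Suc k)) x - u (s k) x)\<^sup>2" for k x
  have md[measurable]: "d k \<in> borel_measurable M" for k unfolding d_def by measurable
  \<comment> \<open>The decay \<open>(1/8) ^ k\<close> leaves room for the weight \<open>2 ^ k\<close>, which makes the increments geometrically small at almost every point.\<close>
  have d_int: "(\<integral>\<^sup>+x. ennreal (2 ^ k * d k x) \<partial>M) \<le> ennreal ((1/4) ^ k)" for k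
  proof -
    have "(\<integral>\<^sup>+x. ennreal (2 ^ k * d k x) \<partial>M) = ennreal (2 ^ k) * (\<integral>\<^sup>+x. ennreal (d k x) \<partial>M)"
      by (simp add: ennreal_mult d_def nn_integral_cmult)
    also have "\<dots> \<le> ennreal (2 ^ k) * ennreal ((1/8) ^ k)"
      unfolding d_def nn
      by (intro mult_left_mono ennreal_leI less_imp_le r order_trans[OF s_ge s_mono] s_ge) simp
    also have "\<dots> = ennreal ((1/4) ^ k)"
      by (simp add: ennreal_mult[symmetric] power_mult_distrib[symmetric])
    finally show ?thesis .
  qed
  have "(\<integral>\<^sup>+x. (\<Sum>k. ennreal (2 ^ k * d k x)) \<partial>M) = (\<Sum>k. \<integral>\<^sup>+x. ennreal (2 ^ k * d k x) \<partial>M)"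
    by (rule nn_integral_suminf) measurable
  also have "\<dots> \<le> (\<Sum>k. ennreal ((1/4) ^ k))" by (intro suminf_le d_int) auto
  also have "\<dots> < \<infinity>" by (subst suminf_ennreal2) (auto intro: summable_geometric)
  finally have "(\<integral>\<^sup>+x. (\<Sum>k. ennreal (2 ^ k * d k x)) \<partial>M) \<noteq> \<infinity>" by simp
  then have "AE x in M. (\<Sum>k. ennreal (2 ^ k * d k x)) \<noteq> \<infinity>"
    by (intro nn_integral_PInf_AE) measurable
  then have conv: "AE x in M. convergent (\<lambda>k. u (s k) x)"
  proof eventually_elim
    case (elim x)
    have sm: "summable (\<lambda>k. 2 ^ k * d k x)"
      by (rule summable_suminf_not_top) (use elim in \<open>auto simp: d_def\<close>)
    define S where "S = (\<Sum>k. 2 ^ k * d k x)"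
    have le: "2 ^ k * d k x \<le> S" for k
      unfolding S_def using sum_le_suminf[OF sm, of "{k}"] by (simp add: d_def)
    have b: "\<bar>u (s (Suc k)) x - u (s k) x\<bar> \<le> sqrt S * (sqrt (1/2)) ^ k" for k
    proof -
      have "d k x \<le> S * (1/2) ^ k" using le[of k] by (simp add: field_simps power_divide)
      then have "sqrt (d k x) \<le> sqrt (S * (1/2) ^ k)" by (rule real_sqrt_le_mono)
      moreover have "sqrt (d k x) = \<bar>u (s (Suc k)) x - u (s k) x\<bar>" by (simp add: d_def)
      moreover have "sqrt (S * (1/2) ^ k) = sqrt S * (sqrt (1/2)) ^ k"
        by (simp only: real_sqrt_mult real_sqrt_power)
      ultimately show ?thesis by simp
    qed
    have "summable (\<lambda>k. u (s (Suc k)) x - u (s k) x)"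
    proof (rule summable_comparison_test'[of "\<lambda>k. sqrt S * (sqrt (1/2)) ^ k" 0])
      show "summable (\<lambda>k. sqrt S * (sqrt (1/2)) ^ k)"
        by (intro summable_mult summable_geometric) (simp add: real_sqrt_divide)
    qed (use b in simp)
    then have "convergent (\<lambda>n. \<Sum>k<n. u (s (Suc k)) x - u (s k) x)" by (simp add: summable_iff_convergent)
    then have "convergent (\<lambda>n. u (s n) x - u (s 0) x)" by (simp only: sum_lessThan_telescope[of "\<lambda>k. u (s k) x"])
    then have "convergent (\<lambda>n. (u (s n) x - u (s 0) x) + u (s 0) x)" by (intro convergent_add convergent_const)
    then show ?case by simp
  qed
  define v where "v x = lim (\<lambda>k. u (s k) x)" for x
  have mv[measurable]: "v \<in> borel_measurable M" unfolding v_def by (rule borel_measurable_lim_metric) measurable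
  have lim: "AE x in M. (\<lambda>k. u (s k) x) \<longlonglongrightarrow> v x"
    using conv by eventually_elim (simp add: v_def convergent_LIMSEQ_iff)
  have F: "(\<integral>\<^sup>+x. ennreal ((u n x - v x)\<^sup>2) \<partial>M) \<le> ennreal \<epsilon>"
    if N: "\<forall>i\<ge>N. \<forall>j\<ge>N. (LINT x|M. (u i x - u j x)\<^sup>2) < \<epsilon>" and n: "n \<ge> N" for n N \<epsilon>
  proof -
    have "(\<integral>\<^sup>+x. ennreal ((u n x - v x)\<^sup>2) \<partial>M) = (\<integral>\<^sup>+x. liminf (\<lambda>k. ennreal ((u n x - u (s k) x)\<^sup>2)) \<partial>M)"
    proof (rule nn_integral_cong_AE)
      show "AE x in M. ennreal ((u n x - v x)\<^sup>2) = liminf (\<lambda>k. ennreal ((u n x - u (s k) x)\<^sup>2))"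
        using lim
      proof eventually_elim
        case (elim x)
        have "(\<lambda>k. ennreal ((u n x - u (s k) x)\<^sup>2)) \<longlonglongrightarrow> ennreal ((u n x - v x)\<^sup>2)"
          by (intro tendsto_intros elim)
        then show ?case by (rule lim_imp_Liminf[symmetric, rotated]) simp
      qed
    qed
    also have "\<dots> \<le> liminf (\<lambda>k. \<integral>\<^sup>+x. ennreal ((u n x - u (s k) x)\<^sup>2) \<partial>M)"
      by (rule nn_integral_liminf) measurable
    also have "\<dots> \<le> ennreal \<epsilon>"
    proof (rule Liminf_le)
      show "\<forall>\<^sub>F k in sequentially. (\<integral>\<^sup>+x. ennreal ((u n x - u (s k) x)\<^sup>2) \<partial>M) \<le> ennreal \<epsilon>"
        using eventually_ge_at_top[of N]
      proof eventually_elim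
        case (elim k)
        have "s k \<ge> N" using s_ge_id[of k] elim by simp
        then have "(LINT x|M. (u n x - u (s k) x)\<^sup>2) < \<epsilon>" using N n by blast
        then show ?case unfolding nn by (intro ennreal_leI) simp
      qed
    qed simp
    finally show ?thesis .
  qed
  obtain N where N: "\<forall>i\<ge>N. \<forall>j\<ge>N. (LINT x|M. (u i x - u j x)\<^sup>2) < 1" using cauchy[of 1] by auto
  have "integrable M (\<lambda>x. (u N x - v x)\<^sup>2)"
    by (rule integrableI_nonneg) (use F[OF N order_refl] in \<open>auto simp: less_top[symmetric] top_unique intro: order.strict_trans1\<close>)
  then have "(\<lambda>x. u N x - v x) \<in> L2_space M" by (simp add: L2_space_def)
  from L2_space_lincomb[OF u[of N] this, of 1 "-1"] have vL: "v \<in> L2_space M" by simp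
  have iv: "integrable M (\<lambda>x. (u n x - v x)\<^sup>2)" for n
    using L2_space_lincomb[OF u[of n] vL, of 1 "-1"] by (simp add: L2_space_def)
  have "(\<lambda>n. LINT x|M. (u n x - v x)\<^sup>2) \<longlonglongrightarrow> 0"
  proof (rule LIMSEQ_I)
    fix e :: real assume e: "e > 0"
    obtain N where N: "\<forall>i\<ge>N. \<forall>j\<ge>N. (LINT x|M. (u i x - u j x)\<^sup>2) < e / 2" using cauchy[of "e / 2"] e by auto
    have "norm ((LINT x|M. (u n x - v x)\<^sup>2) - 0) < e" if "n \<ge> N" for n
    proof -
      have "ennreal (LINT x|M. (u n x - v x)\<^sup>2) = (\<integral>\<^sup>+x. ennreal ((u n x - v x)\<^sup>2) \<partial>M)"
        by (rule nn_integral_eq_integral[OF iv, symmetric]) simp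
      also have "\<dots> \<le> ennreal (e / 2)" by (rule F[OF N that])
      finally have "(LINT x|M. (u n x - v x)\<^sup>2) \<le> e / 2" using e by (subst (asm) ennreal_le_iff) auto
      moreover have "0 \<le> (LINT x|M. (u n x - v x)\<^sup>2)" by (rule integral_nonneg_AE) simp
      ultimately show ?thesis using e by simp
    qed
    then show "\<exists>N. \<forall>n\<ge>N. norm ((LINT x|M. (u n x - v x)\<^sup>2) - 0) < e" by blast
  qed
  with vL show thesis by (rule that)
qed

lemma L1_tendsto_if_L2_tendsto:
  assumes D: "open D" and K: "compact K" "K \<subseteq> D" and f: "\<And>n::nat. f n \<in> borel_measurable (lebesgue_on D)"
    and lim: "(\<lambda>n. \<integral>\<^sup>+x. indicator K x * ennreal ((f n x)\<^sup>2) \<partial>lebesgue_on D) \<longlonglongrightarrow> 0"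
  shows "(\<lambda>n. LINT x|lebesgue_on D. indicator K x * \<bar>f n x\<bar>) \<longlonglongrightarrow> 0"
proof (rule LIMSEQ_I)
  let ?M = "lebesgue_on D"
  fix e :: real assume e: "e > 0"
  have iK: "integrable ?M (indicator K :: _ \<Rightarrow> real)" by (rule integrable_indicator_compact[OF D K])
  have [measurable]: "K \<in> sets ?M" by (rule compact_in_lebesgue_on[OF K])
  note [measurable] = f
  define k where "k = (LINT x|?M. indicator K x :: real)"
  have k: "k \<ge> 0" unfolding k_def by (rule integral_nonneg_AE) simp
  define \<delta> where "\<delta> = e / (2 * (k + 1))"
  have \<delta>: "\<delta> > 0" "\<delta> * k \<le> e / 2" using e k by (auto simp: \<delta>_def field_simps)
  have nK: "(\<integral>\<^sup>+x. ennreal \<delta> * indicator K x \<partial>?M) = ennreal (\<delta> * k)"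
  proof -
    have "(\<integral>\<^sup>+x. ennreal \<delta> * indicator K x \<partial>?M) = (\<integral>\<^sup>+x. ennreal (\<delta> * indicator K x) \<partial>?M)"
      using \<delta>(1) by (intro nn_integral_cong) (auto split: split_indicator)
    also have "\<dots> = ennreal (LINT x|?M. \<delta> * indicator K x)"
      using iK \<delta>(1) by (intro nn_integral_eq_integral) auto
    finally show ?thesis by (simp add: k_def)
  qed
  have "\<forall>\<^sub>F n in sequentially. (\<integral>\<^sup>+x. indicator K x * ennreal ((f n x)\<^sup>2) \<partial>?M) < ennreal (\<delta> * (e / 4))"
    using lim \<delta>(1) e by (intro order_tendstoD) auto
  then obtain N where N: "\<And>n. n \<ge> N \<Longrightarrow> (\<integral>\<^sup>+x. indicator K x * ennreal ((f n x)\<^sup>2) \<partial>?M) < ennreal (\<delta> * (e / 4))"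
    unfolding eventually_sequentially by blast
  have "norm ((LINT x|?M. indicator K x * \<bar>f n x\<bar>) - 0) < e" if "n \<ge> N" for n
  proof -
    have le: "\<bar>y\<bar> \<le> \<delta> + (1 / \<delta>) * y\<^sup>2" for y :: real
    proof -
      have "0 \<le> (\<bar>y\<bar> - \<delta>)\<^sup>2 + \<delta> * \<bar>y\<bar>" using \<delta>(1) by simp
      also have "\<dots> = y\<^sup>2 + \<delta>\<^sup>2 - \<delta> * \<bar>y\<bar>" by (simp add: power2_diff)
      finally have "\<delta> * \<bar>y\<bar> \<le> \<delta> * (\<delta> + (1 / \<delta>) * y\<^sup>2)" using \<delta>(1) by (simp add: power2_eq_square distrib_left)
      then show ?thesis using \<delta>(1) by simp
    qed
    have "(\<integral>\<^sup>+x. ennreal (indicator K x * \<bar>f n x\<bar>) \<partial>?M) \<le>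
      (\<integral>\<^sup>+x. ennreal \<delta> * indicator K x + ennreal (1 / \<delta>) * (indicator K x * ennreal ((f n x)\<^sup>2)) \<partial>?M)"
    proof (intro nn_integral_mono)
      fix x
      have "ennreal \<bar>f n x\<bar> \<le> ennreal (\<delta> + (1 / \<delta>) * (f n x)\<^sup>2)" by (intro ennreal_leI le)
      also have "\<dots> = ennreal \<delta> + ennreal (1 / \<delta>) * ennreal ((f n x)\<^sup>2)"
        using \<delta>(1) by (simp add: ennreal_plus ennreal_mult[symmetric])
      finally show "ennreal (indicator K x * \<bar>f n x\<bar>) \<le>
        ennreal \<delta> * indicator K x + ennreal (1 / \<delta>) * (indicator K x * ennreal ((f n x)\<^sup>2))"
        by (auto split: split_indicator)
    qed
    also have "\<dots> = ennreal (\<delta> * k) + ennreal (1 / \<delta>) * (\<integral>\<^sup>+x. indicator K x * ennreal ((f n x)\<^sup>2) \<partial>?M)"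
      using nK by (simp add: nn_integral_add nn_integral_cmult)
    also have "\<dots> \<le> ennreal (e / 2) + ennreal (1 / \<delta>) * ennreal (\<delta> * (e / 4))"
      using N[OF that] \<delta>(2) by (intro add_mono mult_left_mono ennreal_leI) auto
    also have "\<dots> = ennreal (e / 2 + e / 4)"
      using \<delta>(1) e by (simp add: ennreal_mult[symmetric] ennreal_plus[symmetric] del: ennreal_plus)
    finally have "enn2real (\<integral>\<^sup>+x. ennreal (indicator K x * \<bar>f n x\<bar>) \<partial>?M) \<le> e / 2 + e / 4"
      using e by (intro enn2real_leI) auto
    moreover have "(LINT x|?M. indicator K x * \<bar>f n x\<bar>) = enn2real (\<integral>\<^sup>+x. ennreal (indicator K x * \<bar>f n x\<bar>) \<partial>?M)"
      by (rule integral_eq_nn_integral) auto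
    moreover have "0 \<le> (LINT x|?M. indicator K x * \<bar>f n x\<bar>)" by (rule integral_nonneg_AE) auto
    ultimately show ?thesis using e by simp
  qed
  then show "\<exists>N. \<forall>n\<ge>N. norm ((LINT x|?M. indicator K x * \<bar>f n x\<bar>) - 0) < e" by blast
qed

text \<open>
Each partial derivative of a sequence that is Cauchy for the Dirichlet integral is Cauchy in \<open>L\<^sup>2\<close>.
\<close>

lemma Dirichlet_int_ge_partial:
  assumes D: "open D" and u: "u \<in> BL D" and v: "v \<in> BL D" and b: "b \<in> Basis"
  shows "(LINT x|lebesgue_on D. (weak_grad D u x \<bullet> b - weak_grad D v x \<bullet> b)\<^sup>2) \<le>
    Dirichlet_int D (\<lambda>x. u x - v x) (\<lambda>x. u x - v x)"
proof -
  have uv: "(\<lambda>x. 1 * u x + (-1) * v x) \<in> BL D" by (rule BL_lincomb[OF D u v])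
  have w: "is_weak_pderiv D b (\<lambda>x. 1 * u x + (-1) * v x) (\<lambda>x. 1 * (weak_grad D u x \<bullet> b) + (-1) * (weak_grad D v x \<bullet> b))"
    if "b \<in> Basis" for b
    using that by (intro weak_pderiv_lincomb D BL_weak_grad(1) u v)
  have "Dirichlet_int D (\<lambda>x. 1 * u x + (-1) * v x) (\<lambda>x. 1 * u x + (-1) * v x) =
    (\<Sum>b\<in>Basis. LINT x|lebesgue_on D. (1 * (weak_grad D u x \<bullet> b) + (-1) * (weak_grad D v x \<bullet> b)) *
       (1 * (weak_grad D u x \<bullet> b) + (-1) * (weak_grad D v x \<bullet> b)))"
    by (rule Dirichlet_int_eq_sum[OF D uv uv w w])
  then have e: "Dirichlet_int D (\<lambda>x. u x - v x) (\<lambda>x. u x - v x) =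
    (\<Sum>b\<in>Basis. LINT x|lebesgue_on D. (weak_grad D u x \<bullet> b - weak_grad D v x \<bullet> b)\<^sup>2)"
    by (simp add: power2_eq_square)
  show ?thesis unfolding e
    by (rule member_le_sum[OF b]) (auto intro: integral_nonneg_AE)
qed

text \<open>
The partial derivatives converge in \<open>L\<^sup>2\<close> by completeness, and local convergence of the functions
identifies the limits as the partial derivatives of \<open>u\<close>.
\<close>

lemma BL_closed:
  assumes D: "open D" and w: "\<And>n::nat. w n \<in> BL D" and u: "u \<in> borel_measurable (lebesgue_on D)"
    and cauchy: "\<And>\<epsilon>. \<epsilon> > 0 \<Longrightarrow> \<exists>N. \<forall>i\<ge>N. \<forall>j\<ge>N. Dirichlet_int D (\<lambda>x. w i x - w j x) (\<lambda>x. w i x - w j x) < \<epsilon>"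
    and loc: "\<And>K. compact K \<Longrightarrow> K \<subseteq> D \<Longrightarrow>
      (\<lambda>n. \<integral>\<^sup>+x. indicator K x * ennreal ((w n x - u x)\<^sup>2) \<partial>lebesgue_on D) \<longlonglongrightarrow> 0"
  shows "u \<in> BL D" and "(\<lambda>n. Dirichlet_int D (\<lambda>x. w n x - u x) (\<lambda>x. w n x - u x)) \<longlonglongrightarrow> 0"
proof -
  let ?M = "lebesgue_on D"
  have mw[measurable]: "w n \<in> borel_measurable ?M" for n using w by (simp add: BL_def L2_loc_def)
  note u[measurable]
  have uL: "u \<in> L2_loc D"
    unfolding L2_loc_iff_L2_space[OF D]
  proof (intro conjI allI impI u)
    fix K assume K: "compact K \<and> K \<subseteq> D"
    have [measurable]: "K \<in> sets ?M" using K compact_in_lebesgue_on by blast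
    have "\<forall>\<^sub>F n in sequentially. (\<integral>\<^sup>+x. indicator K x * ennreal ((w n x - u x)\<^sup>2) \<partial>?M) < 1"
      using loc[of K] K by (intro order_tendstoD) auto
    then obtain n where n: "(\<integral>\<^sup>+x. indicator K x * ennreal ((w n x - u x)\<^sup>2) \<partial>?M) < 1"
      unfolding eventually_sequentially by blast
    have e: "ennreal ((indicator K x * (w n x - u x))\<^sup>2) = indicator K x * ennreal ((w n x - u x)\<^sup>2)" for x
      by (auto split: split_indicator)
    have "integrable ?M (\<lambda>x. (indicator K x * (w n x - u x))\<^sup>2)"
      by (rule integrableI_nonneg) (use n in \<open>auto simp: e intro: order.strict_trans\<close>)
    then have 1: "(\<lambda>x. indicator K x * (w n x - u x)) \<in> L2_space ?M" by (simp add: L2_space_def)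
    have 2: "(\<lambda>x. indicator K x * w n x) \<in> L2_space ?M"
      using BL_imp_L2_loc[OF w[of n]] K by (simp add: L2_loc_iff_L2_space[OF D])
    from L2_space_lincomb[OF 2 1, of 1 "-1"] show "(\<lambda>x. indicator K x * u x) \<in> L2_space ?M"
      by (simp add: algebra_simps)
  qed
  have "\<exists>h. h \<in> L2_space ?M \<and> (\<lambda>n. LINT x|?M. (weak_grad D (w n) x \<bullet> b - h x)\<^sup>2) \<longlonglongrightarrow> 0 \<and> is_weak_pderiv D b u h"
    if b: "b \<in> Basis" for b
  proof -
    note G = BL_weak_grad[OF D w b]
    have C: "\<exists>N. \<forall>i\<ge>N. \<forall>j\<ge>N. (LINT x|?M. (weak_grad D (w i) x \<bullet> b - weak_grad D (w j) x \<bullet> b)\<^sup>2) < \<epsilon>" if "\<epsilon> > 0" for \<epsilon>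
    proof -
      obtain N where N: "\<forall>i\<ge>N. \<forall>j\<ge>N. Dirichlet_int D (\<lambda>x. w i x - w j x) (\<lambda>x. w i x - w j x) < \<epsilon>"
        using cauchy[OF \<open>\<epsilon> > 0\<close>] by blast
      have "(LINT x|?M. (weak_grad D (w i) x \<bullet> b - weak_grad D (w j) x \<bullet> b)\<^sup>2) < \<epsilon>" if "i \<ge> N" "j \<ge> N" for i j
        by (rule order.strict_trans1[OF Dirichlet_int_ge_partial[OF D w w b]]) (use N that in blast)
      then show ?thesis by blast
    qed
    obtain h where h: "h \<in> L2_space ?M" "(\<lambda>n. LINT x|?M. (weak_grad D (w n) x \<bullet> b - h x)\<^sup>2) \<longlonglongrightarrow> 0"
      by (rule L2_complete[OF G(2) C]) (assumption | rule that)+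
    have mh[measurable]: "h \<in> borel_measurable ?M" "(\<lambda>x. weak_grad D (w n) x \<bullet> b) \<in> borel_measurable ?M" for n
      using h(1) G(2)[of n] by (auto simp: L2_space_def)
    have "is_weak_pderiv D b u h"
    proof (rule weak_pderiv_limit[OF D G(1) L2_loc_imp_L1_loc[OF D uL]
          L2_loc_imp_L1_loc[OF D L2_space_imp_L2_loc[OF D h(1)]]])
      fix K assume K: "compact K" "K \<subseteq> D"
      show "(\<lambda>n. LINT x|?M. indicator K x * \<bar>w n x - u x\<bar>) \<longlonglongrightarrow> 0"
        by (rule L1_tendsto_if_L2_tendsto[OF D K _ loc[OF K]]) measurable
      show "(\<lambda>n. LINT x|?M. indicator K x * \<bar>weak_grad D (w n) x \<bullet> b - h x\<bar>) \<longlonglongrightarrow> 0"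
      proof (rule L1_tendsto_if_L2_tendsto[OF D K])
        show "(\<lambda>n. \<integral>\<^sup>+x. indicator K x * ennreal ((weak_grad D (w n) x \<bullet> b - h x)\<^sup>2) \<partial>?M) \<longlonglongrightarrow> 0"
        proof (rule tendsto_sandwich[OF _ _ tendsto_const])
          show "(\<lambda>n. ennreal (LINT x|?M. (weak_grad D (w n) x \<bullet> b - h x)\<^sup>2)) \<longlonglongrightarrow> 0"
            using tendsto_ennrealI[OF h(2)] by simp
          have "(\<integral>\<^sup>+x. indicator K x * ennreal ((weak_grad D (w n) x \<bullet> b - h x)\<^sup>2) \<partial>?M) \<le>
            ennreal (LINT x|?M. (weak_grad D (w n) x \<bullet> b - h x)\<^sup>2)" for n
          proof -
            have "integrable ?M (\<lambda>x. (weak_grad D (w n) x \<bullet> b - h x)\<^sup>2)"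
              using L2_space_lincomb[OF G(2)[of n] h(1), of 1 "-1"] by (simp add: L2_space_def)
            from nn_integral_eq_integral[OF this]
            have "ennreal (LINT x|?M. (weak_grad D (w n) x \<bullet> b - h x)\<^sup>2) =
              (\<integral>\<^sup>+x. ennreal ((weak_grad D (w n) x \<bullet> b - h x)\<^sup>2) \<partial>?M)" by simp
            moreover have "(\<integral>\<^sup>+x. indicator K x * ennreal ((weak_grad D (w n) x \<bullet> b - h x)\<^sup>2) \<partial>?M) \<le>
              (\<integral>\<^sup>+x. ennreal ((weak_grad D (w n) x \<bullet> b - h x)\<^sup>2) \<partial>?M)"
              by (intro nn_integral_mono) (auto split: split_indicator)
            ultimately show ?thesis by simp
          qed
          then show "\<forall>\<^sub>F n in sequentially. (\<integral>\<^sup>+x. indicator K x * ennreal ((weak_grad D (w n) x \<bullet> b - h x)\<^sup>2) \<partial>?M) \<le>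
            ennreal (LINT x|?M. (weak_grad D (w n) x \<bullet> b - h x)\<^sup>2)" by simp
        qed simp
      qed measurable
    qed
    with h show ?thesis by blast
  qed
  then have "\<forall>b\<in>Basis. \<exists>h. h \<in> L2_space ?M \<and> (\<lambda>n. LINT x|?M. (weak_grad D (w n) x \<bullet> b - h x)\<^sup>2) \<longlonglongrightarrow> 0 \<and> is_weak_pderiv D b u h"
    by blast
  then have "\<exists>h. \<forall>b\<in>Basis. h b \<in> L2_space ?M \<and> (\<lambda>n. LINT x|?M. (weak_grad D (w n) x \<bullet> b - h b x)\<^sup>2) \<longlonglongrightarrow> 0 \<and> is_weak_pderiv D b u (h b)"
    by (rule bchoice)
  then obtain h where h: "\<forall>b\<in>Basis. h b \<in> L2_space ?M \<and> (\<lambda>n. LINT x|?M. (weak_grad D (w n) x \<bullet> b - h b x)\<^sup>2) \<longlonglongrightarrow> 0 \<and> is_weak_pderiv D b u (h b)"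
    by (rule exE)
  show uBL: "u \<in> BL D" by (rule BL_I[OF uL, of h]) (use h in auto)
  have "Dirichlet_int D (\<lambda>x. w n x - u x) (\<lambda>x. w n x - u x) =
    (\<Sum>b\<in>Basis. LINT x|?M. (weak_grad D (w n) x \<bullet> b - h b x)\<^sup>2)" for n
  proof -
    have wu: "(\<lambda>x. 1 * w n x + (-1) * u x) \<in> BL D" by (rule BL_lincomb[OF D w uBL])
    have ww: "is_weak_pderiv D b (\<lambda>x. 1 * w n x + (-1) * u x) (\<lambda>x. 1 * (weak_grad D (w n) x \<bullet> b) + (-1) * h b x)"
      if "b \<in> Basis" for b
      by (intro weak_pderiv_lincomb D BL_weak_grad(1) w that) (use h that in auto)
    show ?thesis using Dirichlet_int_eq_sum[OF D wu wu ww ww] by (simp add: power2_eq_square)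
  qed
  moreover have "(\<lambda>n. \<Sum>b\<in>Basis. LINT x|?M. (weak_grad D (w n) x \<bullet> b - h b x)\<^sup>2) \<longlonglongrightarrow> 0"
    by (rule tendsto_null_sum) (use h in auto)
  ultimately show "(\<lambda>n. Dirichlet_int D (\<lambda>x. w n x - u x) (\<lambda>x. w n x - u x)) \<longlonglongrightarrow> 0" by simp
qed

section \<open>The extended Dirichlet space\<close>

text \<open>
The finite set depends on the compact set and the radii alone, so that one cover serves a whole
sequence of integrands.
\<close>

lemma compact_nn_integral_cover:
  fixes K :: "'a::euclidean_space set"
  assumes K: "compact K" and r: "\<And>x. x \<in> K \<Longrightarrow> r x > 0"
  obtains F where "finite F" "F \<subseteq> K"
    "\<And>f. f \<in> borel_measurable (lebesgue_on D) \<Longrightarrow>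
      (\<integral>\<^sup>+x. indicator K x * f x \<partial>lebesgue_on D) \<le> (\<Sum>c\<in>F. \<integral>\<^sup>+x. indicator (ball c (r c)) x * f x \<partial>lebesgue_on D)"
proof -
  have "K \<subseteq> (\<Union>c\<in>K. ball c (r c))" using r by force
  then obtain F where F: "F \<subseteq> K" "finite F" "K \<subseteq> (\<Union>c\<in>F. ball c (r c))"
    using compactE_image[OF K, of K "\<lambda>c. ball c (r c)"] by auto
  show thesis
  proof (rule that[OF F(2,1)])
    fix f :: "'a \<Rightarrow> ennreal" assume [measurable]: "f \<in> borel_measurable (lebesgue_on D)"
    have mb: "(\<lambda>x. indicator (ball c (r c)) x :: ennreal) \<in> borel_measurable (lebesgue_on D)" for c
      by (intro measurable_restrict_space1 borel_measurable_indicator) auto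
    have "(\<integral>\<^sup>+x. indicator K x * f x \<partial>lebesgue_on D) \<le> (\<integral>\<^sup>+x. (\<Sum>c\<in>F. indicator (ball c (r c)) x * f x) \<partial>lebesgue_on D)"
    proof (rule nn_integral_mono)
      fix x
      show "indicator K x * f x \<le> (\<Sum>c\<in>F. indicator (ball c (r c)) x * f x)"
      proof (cases "x \<in> K")
        case True
        then obtain c where c: "c \<in> F" "x \<in> ball c (r c)" using F(3) by blast
        have "indicator (ball c (r c)) x * f x \<le> (\<Sum>c\<in>F. indicator (ball c (r c)) x * f x)"
          by (rule member_le_sum[OF c(1) _ F(2)]) simp
        then show ?thesis using c True by simp
      qed simp
    qed
    also have "\<dots> = (\<Sum>c\<in>F. \<integral>\<^sup>+x. indicator (ball c (r c)) x * f x \<partial>lebesgue_on D)"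
      using mb by (intro nn_integral_sum borel_measurable_times_ennreal) auto
    finally show "(\<integral>\<^sup>+x. indicator K x * f x \<partial>lebesgue_on D) \<le>
      (\<Sum>c\<in>F. \<integral>\<^sup>+x. indicator (ball c (r c)) x * f x \<partial>lebesgue_on D)" .
  qed
qed

lemma nn_integral_lebesgue_on_subset:
  assumes "open (D :: 'a::euclidean_space set)" "A \<subseteq> D"
  shows "(\<integral>\<^sup>+x. indicator A x * f x \<partial>lebesgue_on D) = (\<integral>\<^sup>+x. indicator A x * f x \<partial>lebesgue)"
proof -
  have "(\<integral>\<^sup>+x. indicator A x * f x \<partial>lebesgue_on D) = (\<integral>\<^sup>+x. (indicator A x * f x) * indicator D x \<partial>lebesgue)"
    using assms(1) by (intro nn_integral_restrict_space) auto
  also have "\<dots> = (\<integral>\<^sup>+x. indicator A x * f x \<partial>lebesgue)"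
    using assms(2) by (intro nn_integral_cong) (auto split: split_indicator)
  finally show ?thesis .
qed

text \<open>
If the sets where \<open>P N\<close> holds exhaust almost all of the ball, one of them has positive measure.  This
provides the set \<open>E\<close> for the Poincare inequality, \<open>P N\<close> being boundedness by \<open>N\<close>.
\<close>

lemma positive_measure_in_ball:
  fixes D :: "'a::euclidean_space set"
  assumes D: "open D" and R: "R > 0" "ball x0 R \<subseteq> D"
    and m: "\<And>N::nat. {x \<in> D. P N x} \<in> sets (lebesgue_on D)"
    and ae: "AE x in lebesgue_on D. \<exists>N. P N x"
  obtains N E where "E = {x \<in> ball x0 R. P N x}" "E \<in> sets lebesgue" "0 < emeasure lebesgue E" "emeasure lebesgue E < \<infinity>"
proof -
  define E where "E N = {x \<in> ball x0 R. P N x}" for N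
  have sE: "E N \<in> sets lebesgue" for N
  proof -
    have "{x \<in> D. P N x} \<in> sets lebesgue"
      using m[of N] D by (subst (asm) sets_restrict_space_iff) auto
    moreover have "E N = ball x0 R \<inter> {x \<in> D. P N x}" using R(2) by (auto simp: E_def)
    ultimately show ?thesis by (simp add: sets.Int)
  qed
  have "\<exists>N. emeasure lebesgue (E N) \<noteq> 0"
  proof (rule ccontr)
    assume "\<not> (\<exists>N. emeasure lebesgue (E N) \<noteq> 0)"
    then have "\<forall>N. E N \<in> null_sets lebesgue" using sE by (auto simp: null_sets_def)
    then have "AE x in lebesgue. \<forall>N. x \<notin> E N" by (simp add: AE_all_countable AE_not_in)
    moreover have "AE x in lebesgue. x \<in> D \<longrightarrow> (\<exists>N. P N x)" using ae unfolding lebesgue_on_AE_iff[OF D] .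
    ultimately have "AE x in lebesgue. x \<notin> ball x0 R"
      by eventually_elim (use R(2) in \<open>auto simp: E_def\<close>)
    then have "ball x0 R \<in> null_sets lebesgue" by (subst (asm) AE_iff_null_sets[symmetric]) auto
    then have "negligible (ball x0 R)" by (simp add: negligible_iff_null_sets)
    moreover have "ball x0 R \<noteq> {}" using R(1) by simp
    ultimately show False using open_not_negligible[OF open_ball] by blast
  qed
  then obtain N where N: "emeasure lebesgue (E N) \<noteq> 0" by blast
  have "emeasure lebesgue (E N) \<le> emeasure lebesgue (ball x0 R)" by (intro emeasure_mono) (auto simp: E_def)
  also have "\<dots> < \<infinity>" using emeasure_bounded_finite[OF bounded_ball, of x0 R] by simp
  finally show thesis using that[of "E N" N] sE[of N] N by (simp add: E_def zero_less_iff_neq_zero)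
qed

lemma Poincare_lebesgue_on:
  fixes D :: "'a::euclidean_space set"
  assumes D: "open D" and R: "R > 0" "cball x0 (4 * R) \<subseteq> D"
    and E: "E \<in> sets lebesgue" "E \<subseteq> ball x0 R" and pos: "0 < emeasure lebesgue E" "emeasure lebesgue E < \<infinity>"
  obtains c where "c \<ge> 0" "\<And>v. v \<in> BL D \<Longrightarrow>
    (\<integral>\<^sup>+x. indicator (ball x0 R) x * ennreal ((v x)\<^sup>2) \<partial>lebesgue_on D) \<le>
    ennreal c * (ennreal (Dirichlet_int D v v) + (\<integral>\<^sup>+x. indicator E x * ennreal ((v x)\<^sup>2) \<partial>lebesgue_on D))"
proof -
  obtain e where e: "emeasure lebesgue E = ennreal e" "e > 0"
    using pos by (cases "emeasure lebesgue E") (auto simp: ennreal_less_zero_iff)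
  obtain p where p: "emeasure lborel (ball (0::'a) (2 * R)) = ennreal p" "p \<ge> 0"
    using emeasure_bounded_finite[OF bounded_ball, of "0::'a" "2 * R"]
    by (cases "emeasure lborel (ball (0::'a) (2 * R))") auto
  obtain q where q: "emeasure lborel (ball x0 R) = ennreal q" "q \<ge> 0"
    using emeasure_bounded_finite[OF bounded_ball, of x0 R]
    by (cases "emeasure lborel (ball x0 R)") auto
  have sub: "ball x0 R \<subseteq> D" "E \<subseteq> D"
  proof -
    have "ball x0 R \<subseteq> cball x0 (4 * R)" using R(1) by auto
    then show "ball x0 R \<subseteq> D" using R(2) by blast
    then show "E \<subseteq> D" using E(2) by blast
  qed
  define c where "c = (1 / e) * (2 * (p * (2 * R)\<^sup>2) + 2 * q)"
  show thesis
  proof (rule that[of c])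
    show "c \<ge> 0" using e p q by (simp add: c_def)
    fix v assume v: "v \<in> BL D"
    define X where "X = (\<integral>\<^sup>+x. indicator (ball x0 R) x * ennreal ((v x)\<^sup>2) \<partial>lebesgue_on D)"
    define Y where "Y = (\<integral>\<^sup>+x. indicator E x * ennreal ((v x)\<^sup>2) \<partial>lebesgue_on D)"
    define d where "d = Dirichlet_int D v v"
    have d: "d \<ge> 0" unfolding d_def by (rule Dirichlet_int_nonneg)
    have "ennreal e * X \<le> 2 * (ennreal p * ennreal ((2 * R)\<^sup>2 * d)) + 2 * ennreal q * Y"
      using local_Poincare_subset[OF D R v E]
      unfolding X_def Y_def d_def e(1) p(1) q(1) nn_integral_lebesgue_on_subset[OF D sub(1)]
        nn_integral_lebesgue_on_subset[OF D sub(2)] .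
    also have "2 * (ennreal p * ennreal ((2 * R)\<^sup>2 * d)) = ennreal (2 * (p * (2 * R)\<^sup>2)) * ennreal d"
    proof -
      have "2 * (ennreal p * ennreal t) = ennreal (2 * (p * t))" if "t \<ge> 0" for t
        using p(2) that by (simp add: ennreal_mult)
      then have "2 * (ennreal p * ennreal ((2 * R)\<^sup>2 * d)) = ennreal (2 * (p * ((2 * R)\<^sup>2 * d)))"
        using d by simp
      also have "\<dots> = ennreal (2 * (p * (2 * R)\<^sup>2)) * ennreal d"
        using p(2) d by (subst ennreal_mult[symmetric]) (simp_all add: mult_ac)
      finally show ?thesis .
    qed
    also have "2 * ennreal q = ennreal (2 * q)" using q(2) by (simp add: ennreal_mult)
    also have "ennreal (2 * (p * (2 * R)\<^sup>2)) * ennreal d + ennreal (2 * q) * Y \<le>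
       ennreal (2 * (p * (2 * R)\<^sup>2) + 2 * q) * (ennreal d + Y)"
      unfolding distrib_left using p(2) q(2) by (intro add_mono mult_right_mono ennreal_leI) auto
    finally have le: "ennreal e * X \<le> ennreal (2 * (p * (2 * R)\<^sup>2) + 2 * q) * (ennreal d + Y)" .
    have "X = ennreal (1 / e) * (ennreal e * X)"
      using e(2) by (simp add: mult.assoc[symmetric] ennreal_mult[symmetric])
    also have "\<dots> \<le> ennreal (1 / e) * (ennreal (2 * (p * (2 * R)\<^sup>2) + 2 * q) * (ennreal d + Y))"
      by (intro mult_left_mono le) simp
    also have "\<dots> = ennreal c * (ennreal d + Y)"
    proof -
      have "ennreal c = ennreal (1 / e) * ennreal (2 * (p * (2 * R)\<^sup>2) + 2 * q)"
        unfolding c_def by (rule ennreal_mult) (use e(2) p(2) q(2) in auto)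
      then show ?thesis by (simp only: mult.assoc)
    qed
    finally show "X \<le> ennreal c * (ennreal d + Y)" .
  qed
qed

text \<open>
On a set \<open>E\<close> of positive measure the sequence is uniformly bounded, so it converges there in \<open>L\<^sup>2\<close> by
dominated convergence.  The Poincare inequality for the differences \<open>w i - w j\<close> extends the Cauchy
property from \<open>E\<close> to the ball, and Fatou's lemma replaces \<open>w j\<close> by its limit \<open>u\<close>.
\<close>

lemma Dirichlet_Cauchy_imp_local_L2:
  fixes D :: "'a::euclidean_space set"
  assumes D: "open D" and w: "\<And>n::nat. w n \<in> BL D" and u: "u \<in> borel_measurable (lebesgue_on D)"
    and cauchy: "\<And>\<epsilon>. \<epsilon> > 0 \<Longrightarrow> \<exists>N. \<forall>i\<ge>N. \<forall>j\<ge>N. Dirichlet_int D (\<lambda>x. w i x - w j x) (\<lambda>x. w i x - w j x) < \<epsilon>"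
    and ae: "AE x in lebesgue_on D. (\<lambda>n. w n x) \<longlonglongrightarrow> u x"
    and R: "R > 0" "cball x0 (4 * R) \<subseteq> D"
  shows "(\<lambda>n. \<integral>\<^sup>+x. indicator (ball x0 R) x * ennreal ((w n x - u x)\<^sup>2) \<partial>lebesgue_on D) \<longlonglongrightarrow> 0"
proof -
  let ?M = "lebesgue_on D" and ?A = "ball x0 R"
  have [measurable]: "w n \<in> borel_measurable ?M" for n using w by (simp add: BL_def L2_loc_def)
  note u[measurable]
  have AD: "?A \<subseteq> D"
  proof -
    have "ball x0 R \<subseteq> cball x0 (4 * R)" using R(1) by auto
    then show "ball x0 R \<subseteq> D" using R(2) by blast
  qed
  obtain N E where E: "E = {x \<in> ?A. \<forall>n. \<bar>w n x\<bar> \<le> real N}" "E \<in> sets lebesgue"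
    "0 < emeasure lebesgue E" "emeasure lebesgue E < \<infinity>"
  proof (rule positive_measure_in_ball[OF D R(1) AD, of "\<lambda>N x. \<forall>n. \<bar>w n x\<bar> \<le> real N"])
    show "{x \<in> D. \<forall>n. \<bar>w n x\<bar> \<le> real N} \<in> sets ?M" for N
    proof -
      have "{x \<in> space ?M. \<forall>n. \<bar>w n x\<bar> \<le> real N} \<in> sets ?M" by measurable
      then show ?thesis by simp
    qed
    show "AE x in ?M. \<exists>N. \<forall>n. \<bar>w n x\<bar> \<le> real N"
      using ae
    proof eventually_elim
      case (elim x)
      then have "Bseq (\<lambda>n. w n x)" by (rule convergent_imp_Bseq[OF convergentI])
      then obtain B where B: "\<And>n. \<bar>w n x\<bar> \<le> B" by (auto simp: Bseq_def)
      obtain N where "B \<le> real N" using real_arch_simple by blast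
      then show ?case using B order_trans by blast
    qed
  qed (rule that)
  have ED: "E \<subseteq> D" "E \<subseteq> ?A" using E(1) AD by auto
  have [measurable]: "E \<in> sets ?M" using E(2) ED D by (auto simp: sets_restrict_space_iff)
  have finE: "(\<integral>\<^sup>+x. indicator E x * ennreal c \<partial>?M) < \<infinity>" for c
  proof -
    have "(\<integral>\<^sup>+x. indicator E x * ennreal c \<partial>?M) = emeasure ?M E * ennreal c"
      by (rule nn_integral_multc[THEN trans]) simp_all
    also have "emeasure ?M E = emeasure lebesgue E" using ED D by (intro emeasure_restrict_space) auto
    finally show ?thesis using E(4) by (simp add: ennreal_mult_less_top)
  qed
  obtain c where c: "c \<ge> 0" "\<And>v. v \<in> BL D \<Longrightarrow>
    (\<integral>\<^sup>+x. indicator ?A x * ennreal ((v x)\<^sup>2) \<partial>?M) \<le>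
    ennreal c * (ennreal (Dirichlet_int D v v) + (\<integral>\<^sup>+x. indicator E x * ennreal ((v x)\<^sup>2) \<partial>?M))"
    using Poincare_lebesgue_on[OF D R E(2) ED(2) E(3,4)] by blast
  define d where "d n = (\<integral>\<^sup>+x. indicator E x * ennreal ((w n x - u x)\<^sup>2) \<partial>?M)" for n
  have d: "d \<longlonglongrightarrow> 0"
  proof -
    have "(\<lambda>n. d n) \<longlonglongrightarrow> (\<integral>\<^sup>+x. 0 \<partial>?M)"
      unfolding d_def
    proof (rule nn_integral_dominated_convergence[where w = "\<lambda>x. indicator E x * ennreal ((2 * real N)\<^sup>2)"])
      show "(\<integral>\<^sup>+x. indicator E x * ennreal ((2 * real N)\<^sup>2) \<partial>?M) < \<infinity>" by (rule finE)
      show "AE x in ?M. (\<lambda>n. indicator E x * ennreal ((w n x - u x)\<^sup>2)) \<longlonglongrightarrow> 0"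
        using ae
      proof eventually_elim
        case (elim x)
        have "(\<lambda>n. (w n x - u x)\<^sup>2) \<longlonglongrightarrow> 0\<^sup>2" by (intro tendsto_power LIM_zero elim)
        then have "(\<lambda>n. ennreal ((w n x - u x)\<^sup>2)) \<longlonglongrightarrow> 0" using tendsto_ennrealI by fastforce
        then show ?case by (cases "x \<in> E") simp_all
      qed
      show "AE x in ?M. indicator E x * ennreal ((w n x - u x)\<^sup>2) \<le> indicator E x * ennreal ((2 * real N)\<^sup>2)" for n
        using ae
      proof eventually_elim
        case (elim x)
        show ?case
        proof (cases "x \<in> E")
          case True
          then have b: "\<bar>w k x\<bar> \<le> real N" for k using E(1) by auto
          have "\<bar>u x\<bar> \<le> real N" by (rule LIMSEQ_le_const2[OF tendsto_rabs[OF elim]]) (use b in auto)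
          then have "\<bar>w n x - u x\<bar> \<le> 2 * real N" using b[of n] by linarith
          from power_mono[OF this, of 2] have "(w n x - u x)\<^sup>2 \<le> (2 * real N)\<^sup>2" by simp
          then show ?thesis by (intro mult_left_mono ennreal_leI) auto
        qed simp
      qed
    qed measurable
    then show ?thesis by simp
  qed
  have sq: "ennreal ((a - b)\<^sup>2) \<le> 2 * ennreal ((a - s)\<^sup>2) + 2 * ennreal ((b - s)\<^sup>2)" for a b s :: real
  proof -
    have "(a - b)\<^sup>2 \<le> 2 * (a - s)\<^sup>2 + 2 * (b - s)\<^sup>2"
      using zero_le_power2[of "(a - s) + (b - s)"] by (simp add: power2_eq_square algebra_simps)
    then have "ennreal ((a - b)\<^sup>2) \<le> ennreal (2 * (a - s)\<^sup>2 + 2 * (b - s)\<^sup>2)" by (rule ennreal_leI)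
    then show ?thesis by (simp add: ennreal_plus ennreal_mult)
  qed
  have pair: "(\<integral>\<^sup>+x. indicator E x * ennreal ((w i x - w j x)\<^sup>2) \<partial>?M) \<le> 2 * d i + 2 * d j" for i j
  proof -
    have "(\<integral>\<^sup>+x. indicator E x * ennreal ((w i x - w j x)\<^sup>2) \<partial>?M) \<le>
      (\<integral>\<^sup>+x. 2 * (indicator E x * ennreal ((w i x - u x)\<^sup>2)) + 2 * (indicator E x * ennreal ((w j x - u x)\<^sup>2)) \<partial>?M)"
      using sq by (intro nn_integral_mono) (auto split: split_indicator)
    also have "\<dots> = 2 * d i + 2 * d j"
      unfolding d_def by (simp add: nn_integral_add nn_integral_cmult)
    finally show ?thesis .
  qed
  show ?thesis
  proof (rule tendsto_zero_ennreal)
    fix r :: real assume r: "r > 0"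
    define \<eta> where "\<eta> = r / (10 * (c + 1))"
    have "q * (5 * (r / (10 * q))) = r / 2" if "q > 0" for q :: real
      using that by (simp add: field_simps)
    from this[of "c + 1"] have "(c + 1) * (5 * \<eta>) = r / 2" using c(1) by (simp add: \<eta>_def)
    then have "c * (5 * \<eta>) + 5 * \<eta> = r / 2" by (simp only: distrib_right mult_1_left)
    moreover have \<eta>0: "\<eta> > 0" using r c(1) by (simp add: \<eta>_def)
    ultimately have \<eta>: "\<eta> > 0" "c * (5 * \<eta>) < r" using r by linarith+
    obtain N1 where N1: "\<forall>i\<ge>N1. \<forall>j\<ge>N1. Dirichlet_int D (\<lambda>x. w i x - w j x) (\<lambda>x. w i x - w j x) < \<eta>"
      using cauchy[OF \<eta>(1)] by blast
    have "\<forall>\<^sub>F n in sequentially. d n < ennreal \<eta>" using d \<eta>(1) by (intro order_tendstoD) auto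
    then obtain N2 where N2: "\<And>n. n \<ge> N2 \<Longrightarrow> d n < ennreal \<eta>" unfolding eventually_sequentially by blast
    define N0 where "N0 = max N1 N2"
    have B: "(\<integral>\<^sup>+x. indicator ?A x * ennreal ((w i x - w j x)\<^sup>2) \<partial>?M) \<le> ennreal (c * (5 * \<eta>))"
      if "i \<ge> N0" "j \<ge> N0" for i j
    proof -
      have "(\<lambda>x. 1 * w i x + (-1) * w j x) \<in> BL D" by (rule BL_lincomb[OF D w w])
      then have v: "(\<lambda>x. w i x - w j x) \<in> BL D" by simp
      have "(\<integral>\<^sup>+x. indicator ?A x * ennreal ((w i x - w j x)\<^sup>2) \<partial>?M) \<le>
        ennreal c * (ennreal (Dirichlet_int D (\<lambda>x. w i x - w j x) (\<lambda>x. w i x - w j x)) +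
          (\<integral>\<^sup>+x. indicator E x * ennreal ((w i x - w j x)\<^sup>2) \<partial>?M))" by (rule c(2)[OF v])
      also have "\<dots> \<le> ennreal c * (ennreal \<eta> + (2 * ennreal \<eta> + 2 * ennreal \<eta>))"
        using N1 N2[of i] N2[of j] that unfolding N0_def
        by (intro mult_left_mono add_mono order_trans[OF pair] ennreal_leI) (auto intro: less_imp_le)
      also have "\<dots> = ennreal (c * (5 * \<eta>))"
      proof -
        have "ennreal \<eta> + (2 * ennreal \<eta> + 2 * ennreal \<eta>) = ennreal (\<eta> + (2 * \<eta> + 2 * \<eta>))"
        proof -
          have "2 * ennreal \<eta> = ennreal (2 * \<eta>)" using \<eta>(1) by (simp add: ennreal_mult)
          then show ?thesis using \<eta>(1) by (simp add: ennreal_plus[symmetric] del: ennreal_plus)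
        qed
        also have "\<eta> + (2 * \<eta> + 2 * \<eta>) = 5 * \<eta>" by simp
        finally show ?thesis using \<eta>(1) c(1) by (simp add: ennreal_mult)
      qed
      finally show ?thesis .
    qed
    have mA: "(\<lambda>x. indicator ?A x :: ennreal) \<in> borel_measurable ?M"
      by (intro measurable_restrict_space1 borel_measurable_indicator) auto
    have "(\<integral>\<^sup>+x. indicator ?A x * ennreal ((w i x - u x)\<^sup>2) \<partial>?M) < ennreal r" if i: "i \<ge> N0" for i
    proof -
      have "(\<integral>\<^sup>+x. indicator ?A x * ennreal ((w i x - u x)\<^sup>2) \<partial>?M) =
        (\<integral>\<^sup>+x. liminf (\<lambda>j. indicator ?A x * ennreal ((w i x - w j x)\<^sup>2)) \<partial>?M)"
      proof (rule nn_integral_cong_AE)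
        show "AE x in ?M. indicator ?A x * ennreal ((w i x - u x)\<^sup>2) = liminf (\<lambda>j. indicator ?A x * ennreal ((w i x - w j x)\<^sup>2))"
          using ae
        proof eventually_elim
          case (elim x)
          have "(\<lambda>j. ennreal ((w i x - w j x)\<^sup>2)) \<longlonglongrightarrow> ennreal ((w i x - u x)\<^sup>2)"
            by (intro tendsto_intros elim)
          then have "(\<lambda>j. indicator ?A x * ennreal ((w i x - w j x)\<^sup>2)) \<longlonglongrightarrow> indicator ?A x * ennreal ((w i x - u x)\<^sup>2)"
            by (cases "x \<in> ?A") simp_all
          then show ?case by (rule lim_imp_Liminf[symmetric, rotated]) simp
        qed
      qed
      also have "\<dots> \<le> liminf (\<lambda>j. \<integral>\<^sup>+x. indicator ?A x * ennreal ((w i x - w j x)\<^sup>2) \<partial>?M)"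
        by (rule nn_integral_liminf) (intro borel_measurable_times_ennreal mA, measurable)
      also have "\<dots> \<le> ennreal (c * (5 * \<eta>))"
      proof (rule Liminf_le)
        show "\<forall>\<^sub>F j in sequentially. (\<integral>\<^sup>+x. indicator ?A x * ennreal ((w i x - w j x)\<^sup>2) \<partial>?M) \<le> ennreal (c * (5 * \<eta>))"
          using eventually_ge_at_top[of N0] by eventually_elim (rule B[OF i])
      qed simp
      also have "\<dots> < ennreal r" using \<eta>(2) r by (rule ennreal_lessI[rotated])
      finally show ?thesis .
    qed
    then show "\<forall>\<^sub>F n in sequentially. (\<integral>\<^sup>+x. indicator ?A x * ennreal ((w n x - u x)\<^sup>2) \<partial>?M) < ennreal r"
      unfolding eventually_sequentially by blast
  qed
qed

lemma radius_in_open: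
  fixes D :: "'a::euclidean_space set"
  assumes "open D" obtains R where "\<And>x. x \<in> D \<Longrightarrow> R x > 0" "\<And>x. x \<in> D \<Longrightarrow> cball x (4 * R x) \<subseteq> D"
proof -
  have "\<forall>x\<in>D. \<exists>r. r > 0 \<and> cball x (4 * r) \<subseteq> D"
  proof
    fix x assume "x \<in> D"
    then obtain e where "e > 0" "cball x e \<subseteq> D" using assms open_contains_cball by blast
    then show "\<exists>r. r > 0 \<and> cball x (4 * r) \<subseteq> D" by (intro exI[of _ "e / 4"]) simp
  qed
  then have "\<exists>R. \<forall>x\<in>D. R x > 0 \<and> cball x (4 * R x) \<subseteq> D" by (rule bchoice)
  then show thesis using that by blast
qed

lemma W12_ext_subset_BL:
  assumes D: "open D" shows "W12_ext D \<subseteq> BL D"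
proof
  fix u assume u: "u \<in> W12_ext D"
  let ?M = "lebesgue_on D"
  have mu[measurable]: "u \<in> borel_measurable ?M" using u by (simp add: W12_ext_def)
  obtain w where w: "\<And>n::nat. w n \<in> W12 D"
    and cauchy: "\<And>\<epsilon>. \<epsilon> > 0 \<Longrightarrow> \<exists>N. \<forall>i\<ge>N. \<forall>j\<ge>N. Dirichlet_int D (\<lambda>x. w i x - w j x) (\<lambda>x. w i x - w j x) < \<epsilon>"
    and ae: "AE x in ?M. (\<lambda>n. w n x) \<longlonglongrightarrow> u x"
    using u unfolding W12_ext_def by blast
  have wBL: "w n \<in> BL D" for n using w by (simp add: W12_def)
  have [measurable]: "w n \<in> borel_measurable ?M" for n using wBL by (simp add: BL_def L2_loc_def)
  obtain R where R: "\<And>x. x \<in> D \<Longrightarrow> R x > 0" "\<And>x. x \<in> D \<Longrightarrow> cball x (4 * R x) \<subseteq> D"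
    using radius_in_open[OF D] by blast
  show "u \<in> BL D"
  proof (rule BL_closed(1)[OF D wBL mu cauchy])
    fix K assume K: "compact K" "K \<subseteq> D"
    have RK: "R x > 0" if "x \<in> K" for x using R(1) that K by blast
    obtain F where F: "finite F" "F \<subseteq> K" "\<And>f. f \<in> borel_measurable ?M \<Longrightarrow>
      (\<integral>\<^sup>+x. indicator K x * f x \<partial>?M) \<le> (\<Sum>c\<in>F. \<integral>\<^sup>+x. indicator (ball c (R c)) x * f x \<partial>?M)"
      using compact_nn_integral_cover[where r = R and D = D, OF K(1) RK] by blast
    show "(\<lambda>n. \<integral>\<^sup>+x. indicator K x * ennreal ((w n x - u x)\<^sup>2) \<partial>?M) \<longlonglongrightarrow> 0"
    proof (rule tendsto_sandwich[OF _ _ tendsto_const])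
      show "(\<lambda>n. \<Sum>c\<in>F. \<integral>\<^sup>+x. indicator (ball c (R c)) x * ennreal ((w n x - u x)\<^sup>2) \<partial>?M) \<longlonglongrightarrow> 0"
      proof (rule tendsto_null_sum)
        fix c assume "c \<in> F"
        then have "c \<in> D" using F(2) K by blast
        then show "(\<lambda>n. \<integral>\<^sup>+x. indicator (ball c (R c)) x * ennreal ((w n x - u x)\<^sup>2) \<partial>?M) \<longlonglongrightarrow> 0"
          by (intro Dirichlet_Cauchy_imp_local_L2[OF D wBL mu cauchy ae] R)
      qed
      show "\<forall>\<^sub>F n in sequentially. (\<integral>\<^sup>+x. indicator K x * ennreal ((w n x - u x)\<^sup>2) \<partial>?M) \<le>
        (\<Sum>c\<in>F. \<integral>\<^sup>+x. indicator (ball c (R c)) x * ennreal ((w n x - u x)\<^sup>2) \<partial>?M)"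
        by (intro always_eventually allI F(3)) measurable
    qed simp
  qed
qed

section \<open>From BL to the reflected Dirichlet space\<close>

lemma borel_measurable_weighted: "borel_measurable (weighted D m) = borel_measurable (lebesgue_on D)"
  unfolding weighted_def by (intro measurable_cong_sets) simp_all

lemma weight_measurable:
  assumes "open D" "continuous_on (closure D) m"
  shows "m \<in> borel_measurable (lebesgue_on D)"
  using assms closure_subset
  by (intro continuous_imp_measurable_on_sets_lebesgue) (auto intro: continuous_on_subset)

lemma AE_weighted:
  assumes D: "open D" and m: "continuous_on (closure D) m" "\<forall>x\<in>closure D. m x > 0"
  shows "(AE x in weighted D m. P x) \<longleftrightarrow> (AE x in lebesgue_on D. P x)"
proof -
  have m0: "m x > 0" if "x \<in> D" for x using m(2) that closure_subset by blast
  have "(AE x in weighted D m. P x) \<longleftrightarrow> (AE x in lebesgue_on D. 0 < ennreal (m x) \<longrightarrow> P x)"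
    unfolding weighted_def using weight_measurable[OF D m(1)] by (intro AE_density) simp
  also have "\<dots> \<longleftrightarrow> (AE x in lebesgue_on D. P x)"
    by (rule AE_cong) (use m0 in simp)
  finally show ?thesis .
qed

lemma weighted_integral:
  fixes f :: "'a::euclidean_space \<Rightarrow> real"
  assumes D: "open D" and m: "continuous_on (closure D) m" "\<forall>x\<in>closure D. m x > 0"
    and f: "f \<in> borel_measurable (lebesgue_on D)"
  shows "integrable (weighted D m) f \<longleftrightarrow> integrable (lebesgue_on D) (\<lambda>x. m x * f x)"
    and "(LINT x|weighted D m. f x) = (LINT x|lebesgue_on D. m x * f x)"
proof -
  have nn: "AE x in lebesgue_on D. 0 \<le> m x"
    by (rule AE_I2) (use m(2) closure_subset in \<open>force intro: less_imp_le\<close>)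
  note W = weight_measurable[OF D m(1)]
  show "integrable (weighted D m) f \<longleftrightarrow> integrable (lebesgue_on D) (\<lambda>x. m x * f x)"
    unfolding weighted_def using integrable_density[OF f W nn] by simp
  show "(LINT x|weighted D m. f x) = (LINT x|lebesgue_on D. m x * f x)"
    unfolding weighted_def using integral_density[OF f W nn] by simp
qed

lemma L2_space_imp_weighted:
  assumes D: "open D" and m: "continuous_on (closure D) m" "\<forall>x\<in>closure D. m x > 0"
    and b: "bounded (m ` closure D)" and u: "u \<in> L2_space (lebesgue_on D)"
  shows "u \<in> L2_space (weighted D m)"
proof -
  obtain B where B: "\<And>x. x \<in> closure D \<Longrightarrow> \<bar>m x\<bar> \<le> B" using b unfolding bounded_iff by auto
  have mu[measurable]: "u \<in> borel_measurable (lebesgue_on D)" using u by (simp add: L2_space_def)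
  note [measurable] = weight_measurable[OF D m(1)]
  have "integrable (lebesgue_on D) (\<lambda>x. m x * (u x)\<^sup>2)"
  proof (rule Bochner_Integration.integrable_bound)
    show "integrable (lebesgue_on D) (\<lambda>x. B * (u x)\<^sup>2)" using u by (simp add: L2_space_def)
    show "AE x in lebesgue_on D. norm (m x * (u x)\<^sup>2) \<le> norm (B * (u x)\<^sup>2)"
    proof (rule AE_I2)
      fix x assume "x \<in> space (lebesgue_on D)"
      then have "\<bar>m x\<bar> \<le> B" using B[of x] closure_subset by auto
      then show "norm (m x * (u x)\<^sup>2) \<le> norm (B * (u x)\<^sup>2)"
        by (auto simp: abs_mult intro!: mult_right_mono)
    qed
  qed measurable
  then have "integrable (weighted D m) (\<lambda>x. (u x)\<^sup>2)"
    by (subst weighted_integral(1)[OF D m]) measurable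
  then show ?thesis using mu by (simp add: L2_space_def borel_measurable_weighted)
qed

lemma trunc_comp_eq: "trunc k \<circ> f = (\<lambda>x. min (max (- real k) (f x)) (real k))"
  by (simp add: fun_eq_iff trunc_def)

lemma Dirichlet_int_zero:
  assumes "open D" "u \<in> BL D" shows "Dirichlet_int D (\<lambda>x. 0) (\<lambda>x. 0) = 0"
proof -
  have z: "(\<lambda>x. 0 * u x + 0 * u x) \<in> BL D" by (rule BL_lincomb[OF assms(1,2,2)])
  have w: "is_weak_pderiv D b (\<lambda>x. 0 * u x + 0 * u x) (\<lambda>x. 0 * (weak_grad D u x \<bullet> b) + 0 * (weak_grad D u x \<bullet> b))"
    if "b \<in> Basis" for b
    using that by (intro weak_pderiv_lincomb BL_weak_grad(1) assms)
  show ?thesis using Dirichlet_int_eq_sum[OF assms(1) z z w w] by simp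
qed

lemma W12_subset_W12_ext:
  assumes D: "open D" shows "W12 D \<subseteq> W12_ext D"
proof
  fix u assume u: "u \<in> W12 D"
  then have "u \<in> borel_measurable (lebesgue_on D)" by (simp add: W12_def L2_space_def)
  moreover have "Dirichlet_int D (\<lambda>x. u x - u x) (\<lambda>x. u x - u x) = 0"
    using Dirichlet_int_zero[OF D, of u] u by (simp add: W12_def)
  ultimately show "u \<in> W12_ext D"
    unfolding W12_ext_def using u by (auto intro!: exI[of _ "\<lambda>n. u"])
qed

text \<open>
Clip \<open>f\<close> between \<open>- \<psi>\<close> and \<open>\<psi>\<close>, where \<open>\<psi>\<close> is a multiple of a bump function that exceeds the bound of
\<open>f\<close> on \<open>G\<close>.  The result agrees with \<open>f\<close> on \<open>G\<close>, has finite Dirichlet integral since \<open>f\<close> and \<open>\<psi>\<close> do, and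
is square integrable since \<open>\<psi>\<close> is.  The support of \<open>\<psi>\<close> may meet the boundary of \<open>D\<close>.
\<close>

lemma bounded_BL_in_F0_loc:
  fixes D :: "'a::euclidean_space set"
  assumes D: "open D" and m: "continuous_on (closure D) m" "\<forall>x\<in>closure D. m x > 0"
    and b: "bounded (m ` closure D)" and f: "f \<in> BL D" and k: "\<And>x. \<bar>f x\<bar> \<le> k"
  shows "f \<in> F0_loc D m"
  unfolding F0_loc_def
proof (intro CollectI allI impI)
  fix G assume G: "openin (top_of_set (closure D)) G \<and> compact (closure G)"
  then have "bounded (closure G)" by (intro compact_imp_bounded) simp
  from bounded_subset_box_symmetric[OF this] obtain a where a: "closure G \<subseteq> box (- a) a" by blast
  have k0: "k \<ge> 0" using k[of undefined] by linarith
  obtain c where c: "c > 0" "\<And>x. x \<in> G \<Longrightarrow> c \<le> bump (- a) a x"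
  proof (cases "closure G = {}")
    case True
    then show thesis using that[of 1] by simp
  next
    case False
    have "continuous_on UNIV (bump (- a) a)" using C_k_bump[of 0 "- a" a] by simp
    then have "continuous_on (closure G) (bump (- a) a)" by (rule continuous_on_subset) simp
    from continuous_attains_inf[OF _ False this] G obtain x where
      x: "x \<in> closure G" "\<And>y. y \<in> closure G \<Longrightarrow> bump (- a) a x \<le> bump (- a) a y" by blast
    have "bump (- a) a x > 0" using a x(1) by (subst bump_pos_iff) blast
    then show thesis using that[of "bump (- a) a x"] x(2) closure_subset by blast
  qed
  define \<psi> where "\<psi> x = (k / c) * bump (- a) a x" for x
  have \<psi>0: "\<psi> x \<ge> 0" for x unfolding \<psi>_def by (intro mult_nonneg_nonneg divide_nonneg_pos k0 c(1) bump_nonneg)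
  have \<psi>G: "k \<le> \<psi> x" if "x \<in> G" for x
  proof -
    have "k / c * c \<le> k / c * bump (- a) a x" using k0 c(1) c(2)[OF that] by (intro mult_left_mono) auto
    then show ?thesis using c(1) by (simp add: \<psi>_def)
  qed
  have "\<psi> \<in> test_functions UNIV"
  proof (rule test_functionsI[OF _ compact_cbox subset_UNIV])
    show "C_k j \<psi>" for j
    proof -
      have "C_k j (\<lambda>x. (k / c) * bump (- a) a x)" by (rule C_k_mult[OF C_k_const C_k_bump])
      then show ?thesis by (simp add: \<psi>_def[abs_def])
    qed
    show "\<psi> x = 0" if "x \<notin> cbox (- a) a" for x
    proof -
      have "x \<notin> box (- a) a" using that box_subset_cbox[of "- a" a] by blast
      then show ?thesis by (simp add: \<psi>_def bump_eq_0)
    qed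
  qed
  then have \<psi>W: "\<psi> \<in> W12 D" by (rule smooth_in_W12[OF D])
  then have \<psi>BL: "\<psi> \<in> BL D" and \<psi>L2: "\<psi> \<in> L2_space (lebesgue_on D)" by (auto simp: W12_def)
  define u where "u x = 1 * (1 * f x + (-1) * max ((1 * f x + (-1) * \<psi> x) - 0) 0) +
     1 * max (((-1) * f x + (-1) * \<psi> x) - 0) 0" for x
  have uBL: "u \<in> BL D" unfolding u_def[abs_def]
    by (intro BL_lincomb BL_pos_part D f \<psi>BL) simp_all
  have u: "u x = min (max (- \<psi> x) (f x)) (\<psi> x)" for x
    using \<psi>0[of x] by (auto simp: u_def max_def min_def)
  have "u \<in> L2_space (lebesgue_on D)"
  proof (rule L2_space_bound[OF \<psi>L2])
    show "u \<in> borel_measurable (lebesgue_on D)" using uBL by (simp add: BL_def L2_loc_def)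
    have "\<bar>u x\<bar> \<le> \<bar>\<psi> x\<bar>" for x using \<psi>0[of x] unfolding u by (auto simp: max_def min_def)
    then show "AE x in lebesgue_on D. \<bar>u x\<bar> \<le> \<bar>\<psi> x\<bar>" by simp
  qed
  then have "u \<in> W12 D" "u \<in> L2_space (weighted D m)"
    using uBL L2_space_imp_weighted[OF D m b] by (auto simp: W12_def)
  then have "u \<in> F0 D m" using W12_subset_W12_ext[OF D] by (auto simp: F0_def)
  moreover have "f x = u x" if "x \<in> G" for x
    using \<psi>G[OF that] k[of x] unfolding u by (auto simp: max_def min_def abs_le_iff)
  ultimately show "\<exists>u\<in>F0 D m. AE x in weighted D m. x \<in> G \<longrightarrow> f x = u x"
    by (intro bexI[of _ u]) auto
qed

lemma BL_subset_F_ref: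
  fixes D :: "'a::euclidean_space set"
  assumes D: "open D" and m: "continuous_on (closure D) m" "\<forall>x\<in>closure D. m x > 0"
    and b: "bounded (m ` closure D)"
  shows "BL D \<subseteq> F_ref D m"
proof
  fix f assume f: "f \<in> BL D"
  have mf: "f \<in> borel_measurable (lebesgue_on D)" using f by (simp add: BL_def L2_loc_def)
  have T: "trunc k \<circ> f \<in> BL D" for k
    unfolding trunc_comp_eq by (rule BL_clip(1)[OF D f]) simp_all
  have "trunc k \<circ> f \<in> F0_loc D m" for k
    by (rule bounded_BL_in_F0_loc[OF D m b T, of _ "real k"]) (auto simp: trunc_def)
  moreover have "Dirichlet_int_ext D (trunc k \<circ> f) \<le> ennreal (Dirichlet_int D f f)" for k
  proof -
    have "Dirichlet_int_ext D (trunc k \<circ> f) = ennreal (Dirichlet_int D (trunc k \<circ> f) (trunc k \<circ> f))"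
      by (rule Dirichlet_int_ext_eq[OF D T])
    also have "\<dots> \<le> ennreal (Dirichlet_int D f f)"
      unfolding trunc_comp_eq by (intro ennreal_leI Dirichlet_int_clip_le D f) simp_all
    finally show ?thesis .
  qed
  then have "(SUP k\<in>{1..}. Dirichlet_int_ext D (trunc k \<circ> f)) \<le> ennreal (Dirichlet_int D f f)"
    by (intro SUP_least)
  then have "(SUP k\<in>{1..}. Dirichlet_int_ext D (trunc k \<circ> f)) < \<infinity>"
    by (rule order.strict_trans1) simp
  ultimately show "f \<in> F_ref D m" using mf by (simp add: F_ref_def)
qed

section \<open>From the reflected Dirichlet space to BL\<close>

text \<open>
Write \<open>v\<close> as the difference of its positive and negative parts and compare the two expressions for
the derivative.
\<close>

lemma weak_pderiv_zero_on_zero_set: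
  assumes D: "open D" and w: "is_weak_pderiv D b v g" and g: "g \<in> L2_loc D"
  shows "AE x in lebesgue_on D. v x = 0 \<longrightarrow> g x = 0"
proof -
  have w': "is_weak_pderiv D b (\<lambda>x. (-1) * v x + 0 * v x) (\<lambda>x. (-1) * g x + 0 * g x)"
    by (rule weak_pderiv_lincomb[OF D w w])
  have g': "(\<lambda>x. (-1) * g x + 0 * g x) \<in> L2_loc D" by (rule L2_loc_lincomb[OF D g g])
  have "is_weak_pderiv D b (\<lambda>x. 1 * max (v x - 0) 0 + (-1) * max ((-1) * v x + 0 * v x - 0) 0)
    (\<lambda>x. 1 * (if v x > 0 then g x else 0) + (-1) * (if (-1) * v x + 0 * v x > 0 then (-1) * g x + 0 * g x else 0))"
    by (intro weak_pderiv_lincomb weak_pderiv_pos_part D w g w' g') simp_all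
  moreover have "1 * max (v x - 0) 0 + (-1) * max ((-1) * v x + 0 * v x - 0) 0 = v x" for x
    by (auto simp: max_def)
  ultimately have "is_weak_pderiv D b v
    (\<lambda>x. 1 * (if v x > 0 then g x else 0) + (-1) * (if (-1) * v x + 0 * v x > 0 then (-1) * g x + 0 * g x else 0))"
    by simp
  from weak_pderiv_unique[OF D w this] show ?thesis by eventually_elim auto
qed

text \<open>
On the smaller of two balls the difference of two of the functions \<open>u n\<close> vanishes, hence so does
its derivative.  The derivative of \<open>h\<close> at \<open>x\<close> is therefore taken from the first ball, in an
enumeration by integer radii, that contains \<open>x\<close>.
\<close>

lemma weak_pderiv_paste:
  fixes D :: "'a::euclidean_space set"
  assumes D: "open D" and h: "h \<in> L2_loc D"
    and u: "\<And>n. u n \<in> BL D" "\<And>n::nat. AE x in lebesgue_on D. x \<in> ball 0 (real n) \<longrightarrow> h x = u n x"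
    and b: "b \<in> Basis"
  shows "\<exists>g. is_weak_pderiv D b h g"
proof -
  let ?M = "lebesgue_on D"
  define g where "g n x = weak_grad D (u n) x \<bullet> b" for n x
  have wg: "is_weak_pderiv D b (u n) (g n)" and gL2: "g n \<in> L2_space ?M" for n
    using BL_weak_grad[OF D u(1) b] by (auto simp: g_def[abs_def])
  have gm[measurable]: "g n \<in> borel_measurable ?M" for n using gL2 by (simp add: L2_space_def)
  have "AE x in ?M. x \<in> ball 0 (real n) \<longrightarrow> g n x = g k x" if "n \<le> k" for n k
  proof -
    have w: "is_weak_pderiv D b (\<lambda>x. 1 * u n x + (-1) * u k x) (\<lambda>x. 1 * g n x + (-1) * g k x)"
      by (rule weak_pderiv_lincomb[OF D wg wg])
    have l: "(\<lambda>x. 1 * g n x + (-1) * g k x) \<in> L2_loc D"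
      by (intro L2_loc_lincomb D L2_space_imp_L2_loc gL2)
    show ?thesis
      using weak_pderiv_zero_on_zero_set[OF D w l] u(2)[of n] u(2)[of k]
    proof eventually_elim
      case (elim x)
      show ?case
      proof
        assume x: "x \<in> ball 0 (real n)"
        have "x \<in> ball 0 (real k)" using x that by simp
        then show "g n x = g k x" using elim x by simp
      qed
    qed
  qed
  then have "AE x in ?M. \<forall>n k. n \<le> k \<longrightarrow> x \<in> ball 0 (real n) \<longrightarrow> g n x = g k x"
    by (simp add: AE_all_countable)
  moreover define N where "N x = nat \<lfloor>norm x\<rfloor> + 1" for x :: 'a
  moreover define G where "G x = g (N x) x" for x
  moreover have N: "x \<in> ball 0 (real (N x))" for x unfolding N_def by simp linarith
  moreover have Nle: "N x \<le> n" if "x \<in> ball 0 (real n)" for x n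
  proof -
    have "\<lfloor>norm x\<rfloor> < int n" using that by (simp add: floor_less_iff)
    then have "nat \<lfloor>norm x\<rfloor> < n" by (simp add: nat_less_iff)
    then show ?thesis by (simp add: N_def)
  qed
  ultimately have GG: "AE x in ?M. \<forall>n. x \<in> ball 0 (real n) \<longrightarrow> G x = g n x"
    by (auto elim!: eventually_mono)
  have Nm: "N \<in> measurable ?M (count_space UNIV)"
  proof -
    have "norm \<in> borel_measurable ?M" by (rule continuous_imp_lebesgue_on) (intro continuous_intros)
    then have "(\<lambda>x. \<lfloor>norm x\<rfloor>) \<in> measurable ?M (count_space UNIV)" by measurable
    then have "(\<lambda>x. (\<lambda>i. nat i + 1) \<lfloor>norm x\<rfloor>) \<in> measurable ?M (count_space UNIV)"
      by (rule measurable_compose) simp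
    then show ?thesis by (simp add: N_def[abs_def])
  qed
  have Gm[measurable]: "G \<in> borel_measurable ?M"
    unfolding G_def[abs_def] by (rule measurable_compose_countable[OF _ Nm]) (rule gm)
  \<comment> \<open>A compact set lies in one of the balls, where eventually nothing changes any more.\<close>
  have K_ball: "\<exists>n::nat. K \<subseteq> ball 0 (real n)" if "compact K" for K :: "'a set"
  proof -
    obtain B where B: "\<And>x. x \<in> K \<Longrightarrow> norm x \<le> B" using compact_imp_bounded[OF \<open>compact K\<close>] unfolding bounded_iff by blast
    obtain n :: nat where "B < real n" using reals_Archimedean2 by blast
    then have "K \<subseteq> ball 0 (real n)" using B by fastforce
    then show ?thesis ..
  qed
  have hm[measurable]: "h \<in> borel_measurable ?M" using h by (simp add: L2_loc_def)
  have um[measurable]: "u n \<in> borel_measurable ?M" for n using u(1)[of n] by (simp add: BL_def L2_loc_def)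
  have GL: "G \<in> L1_loc D"
    unfolding L1_loc_iff[OF D]
  proof (intro conjI allI impI Gm)
    fix K assume K: "compact K \<and> K \<subseteq> D"
    then obtain n where n: "K \<subseteq> ball 0 (real n)" using K_ball by blast
    have [measurable]: "K \<in> sets ?M" using K compact_in_lebesgue_on by blast
    have i: "integrable ?M (\<lambda>x. indicator K x * g n x)"
      using wg[of n] K by (simp add: is_weak_pderiv_def L1_loc_iff[OF D])
    have "AE x in ?M. indicator K x * g n x = indicator K x * G x"
      using GG by eventually_elim (use n in \<open>auto split: split_indicator\<close>)
    then show "integrable ?M (\<lambda>x. indicator K x * G x)"
      using i by (subst (asm) integrable_cong_AE[of _ _ "\<lambda>x. indicator K x * G x"]) measurable
  qed
  have "is_weak_pderiv D b h G"
  proof (rule weak_pderiv_limit[OF D wg L2_loc_imp_L1_loc[OF D h] GL])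
    fix K assume K: "compact K" "K \<subseteq> D"
    obtain n0 where n0: "K \<subseteq> ball 0 (real n0)" using K_ball[OF K(1)] by blast
    have sub: "K \<subseteq> ball 0 (real n)" if "n \<ge> n0" for n using n0 that by fastforce
    show "(\<lambda>n. LINT x|?M. indicator K x * \<bar>u n x - h x\<bar>) \<longlonglongrightarrow> 0"
    proof (rule tendsto_eventually)
      show "\<forall>\<^sub>F n in sequentially. (LINT x|?M. indicator K x * \<bar>u n x - h x\<bar>) = 0"
        using eventually_ge_at_top[of n0]
      proof eventually_elim
        case (elim n)
        have "AE x in ?M. indicator K x * \<bar>u n x - h x\<bar> = 0"
          using u(2)[of n] by eventually_elim (use sub[OF elim] in \<open>auto split: split_indicator\<close>)
        then show ?case by (rule integral_eq_zero_AE)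
      qed
    qed
    show "(\<lambda>n. LINT x|?M. indicator K x * \<bar>g n x - G x\<bar>) \<longlonglongrightarrow> 0"
    proof (rule tendsto_eventually)
      show "\<forall>\<^sub>F n in sequentially. (LINT x|?M. indicator K x * \<bar>g n x - G x\<bar>) = 0"
        using eventually_ge_at_top[of n0]
      proof eventually_elim
        case (elim n)
        have "AE x in ?M. indicator K x * \<bar>g n x - G x\<bar> = 0"
          using GG by eventually_elim (use sub[OF elim] in \<open>auto split: split_indicator\<close>)
        then show ?case by (rule integral_eq_zero_AE)
      qed
    qed
  qed
  then show ?thesis by (rule exI[where x = G])
qed

text \<open>
Finiteness of the extended Dirichlet integral says something about \<open>h\<close> once weak derivatives are
known to exist, for then the chosen gradient is a genuine one.
\<close>

lemma BL_if_Dirichlet_int_ext_finite: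
  assumes D: "open D" and h: "h \<in> L2_loc D"
    and w: "\<And>b. b \<in> Basis \<Longrightarrow> \<exists>g. is_weak_pderiv D b h g" and fin: "Dirichlet_int_ext D h < \<infinity>"
  shows "h \<in> BL D"
proof -
  have "\<exists>g. \<forall>b\<in>Basis. is_weak_pderiv D b h (g b)" by (rule bchoice) (use w in blast)
  then obtain g where g: "\<And>b. b \<in> Basis \<Longrightarrow> is_weak_pderiv D b h (g b)" by blast
  note W = weak_grad_works[OF g]
  show ?thesis
  proof (rule BL_I[OF h W])
    fix b :: 'a assume b: "b \<in> Basis"
    have m[measurable]: "(\<lambda>x. weak_grad D h x \<bullet> b) \<in> borel_measurable (lebesgue_on D)"
      using W[OF _ b] by (simp add: is_weak_pderiv_def L1_loc_def)
    have le: "(weak_grad D h x \<bullet> b)\<^sup>2 \<le> (norm (weak_grad D h x))\<^sup>2" for x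
      using power_mono[OF Basis_le_norm[OF b, of "weak_grad D h x"], of 2] by simp
    have "(\<integral>\<^sup>+x. ennreal ((weak_grad D h x \<bullet> b)\<^sup>2) \<partial>lebesgue_on D) \<le> Dirichlet_int_ext D h"
      unfolding Dirichlet_int_ext_def by (intro nn_integral_mono ennreal_leI le)
    then have "(\<integral>\<^sup>+x. ennreal ((weak_grad D h x \<bullet> b)\<^sup>2) \<partial>lebesgue_on D) < \<infinity>"
      using fin by (rule order.strict_trans1)
    then have "integrable (lebesgue_on D) (\<lambda>x. (weak_grad D h x \<bullet> b)\<^sup>2)"
      by (intro integrableI_nonneg) auto
    then show "(\<lambda>x. weak_grad D h x \<bullet> b) \<in> L2_space (lebesgue_on D)" using m by (simp add: L2_space_def)
  qed
qed

text \<open>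
Local membership in the form domain provides weak derivatives on every ball; these are pasted, and
the bound on the extended Dirichlet integrals puts the truncations into \<open>BL D\<close>.
\<close>

lemma truncations_in_BL:
  fixes D :: "'a::euclidean_space set"
  assumes D: "open D" and m: "continuous_on (closure D) m" "\<forall>x\<in>closure D. m x > 0"
    and f: "f \<in> F_ref D m"
  obtains B where "B \<ge> 0" "\<And>k. k \<ge> 1 \<Longrightarrow> trunc k \<circ> f \<in> BL D"
    "\<And>k. k \<ge> 1 \<Longrightarrow> Dirichlet_int D (trunc k \<circ> f) (trunc k \<circ> f) \<le> B"
proof -
  let ?M = "lebesgue_on D"
  have mf[measurable]: "f \<in> borel_measurable ?M" using f by (simp add: F_ref_def)
  define S where "S = (SUP k\<in>{1..}. Dirichlet_int_ext D (trunc k \<circ> f))"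
  have S: "S < \<infinity>" using f by (simp add: F_ref_def S_def)
  then obtain B where B: "S = ennreal B" "B \<ge> 0" by (cases S) auto
  have le: "Dirichlet_int_ext D (trunc k \<circ> f) \<le> ennreal B" if "k \<ge> 1" for k
    unfolding B(1)[symmetric] S_def by (rule SUP_upper) (use that in simp)
  have BL: "trunc k \<circ> f \<in> BL D" if k: "k \<ge> 1" for k
  proof (rule BL_if_Dirichlet_int_ext_finite[OF D])
    show L2: "trunc k \<circ> f \<in> L2_loc D"
    proof (rule L2_loc_bound[OF D L2_loc_const[OF D, of "real k"]])
      show "trunc k \<circ> f \<in> borel_measurable ?M" unfolding trunc_comp_eq by measurable
      show "AE x in ?M. \<bar>(trunc k \<circ> f) x\<bar> \<le> \<bar>real k\<bar>" by (auto simp: trunc_def)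
    qed
    show "Dirichlet_int_ext D (trunc k \<circ> f) < \<infinity>" using le[OF k] by (rule order.strict_trans1) simp
    have loc: "trunc k \<circ> f \<in> F0_loc D m" using f k by (simp add: F_ref_def)
    have "\<exists>v. v \<in> BL D \<and> (AE x in ?M. x \<in> ball 0 (real n) \<longrightarrow> (trunc k \<circ> f) x = v x)" for n :: nat
    proof -
      let ?G = "closure D \<inter> ball 0 (real n)"
      have "bounded (closure ?G)" by (rule bounded_closure[OF bounded_subset[OF bounded_ball Int_lower2]])
      then have "openin (top_of_set (closure D)) ?G \<and> compact (closure ?G)"
        by (auto simp: compact_eq_bounded_closed openin_open_Int)
      then obtain v where v: "v \<in> F0 D m" "AE x in weighted D m. x \<in> ?G \<longrightarrow> (trunc k \<circ> f) x = v x"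
        using loc unfolding F0_loc_def by blast
      have "v \<in> BL D" using v(1) W12_ext_subset_BL[OF D] by (auto simp: F0_def)
      moreover have "AE x in ?M. x \<in> ball 0 (real n) \<longrightarrow> (trunc k \<circ> f) x = v x"
      proof -
        have "AE x in ?M. x \<in> ?G \<longrightarrow> (trunc k \<circ> f) x = v x" using v(2) unfolding AE_weighted[OF D m] .
        then have "AE x in lebesgue. x \<in> D \<longrightarrow> x \<in> ?G \<longrightarrow> (trunc k \<circ> f) x = v x"
          unfolding lebesgue_on_AE_iff[OF D] .
        then show ?thesis unfolding lebesgue_on_AE_iff[OF D]
          by eventually_elim (use closure_subset in blast)
      qed
      ultimately show ?thesis by blast
    qed
    then obtain v where v: "\<And>n. v n \<in> BL D" "\<And>n::nat. AE x in ?M. x \<in> ball 0 (real n) \<longrightarrow> (trunc k \<circ> f) x = v n x"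
      by metis
    show "\<exists>g. is_weak_pderiv D b (trunc k \<circ> f) g" if "b \<in> Basis" for b
      by (rule weak_pderiv_paste[OF D L2 v that])
  qed
  show thesis
  proof (rule that[OF B(2) BL])
    fix k :: nat assume k: "k \<ge> 1"
    have "ennreal (Dirichlet_int D (trunc k \<circ> f) (trunc k \<circ> f)) \<le> ennreal B"
      using le[OF k] unfolding Dirichlet_int_ext_eq[OF D BL[OF k]] .
    then show "Dirichlet_int D (trunc k \<circ> f) (trunc k \<circ> f) \<le> B" using B(2) by (simp add: ennreal_le_iff)
  qed
qed

lemma trunc_tendsto: "(\<lambda>k. trunc k t) \<longlonglongrightarrow> t"
proof -
  obtain N :: nat where N: "\<bar>t\<bar> \<le> real N" using real_arch_simple by blast
  have "\<forall>\<^sub>F k in sequentially. trunc k t = t"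
    using eventually_ge_at_top[of N]
  proof eventually_elim
    case (elim k)
    then have "\<bar>t\<bar> \<le> real k" using N by linarith
    then show ?case by (auto simp: trunc_def abs_le_iff)
  qed
  then show ?thesis by (rule tendsto_eventually)
qed

lemma trunc_abs_le: "\<bar>trunc k t\<bar> \<le> \<bar>t\<bar>"
  by (auto simp: trunc_def max_def min_def)

text \<open>
The truncations are bounded on a set of positive measure independently of \<open>k\<close>, namely where \<open>f\<close>
itself is bounded.  The Poincare inequality then bounds them in \<open>L\<^sup>2\<close> of a ball, and Fatou's lemma
passes the bound to \<open>f\<close>.
\<close>

lemma F_ref_L2_loc:
  fixes D :: "'a::euclidean_space set"
  assumes D: "open D" and mf: "f \<in> borel_measurable (lebesgue_on D)" and B: "B \<ge> 0"
    and T: "\<And>k. k \<ge> 1 \<Longrightarrow> trunc k \<circ> f \<in> BL D"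
    and le: "\<And>k. k \<ge> 1 \<Longrightarrow> Dirichlet_int D (trunc k \<circ> f) (trunc k \<circ> f) \<le> B"
  shows "f \<in> L2_loc D"
proof -
  let ?M = "lebesgue_on D"
  note mf[measurable]
  obtain R where R: "\<And>x. x \<in> D \<Longrightarrow> R x > 0" "\<And>x. x \<in> D \<Longrightarrow> cball x (4 * R x) \<subseteq> D"
    using radius_in_open[OF D] by blast
  have loc: "(\<integral>\<^sup>+x. indicator (ball x0 (R x0)) x * ennreal ((f x)\<^sup>2) \<partial>?M) < \<infinity>" if x0: "x0 \<in> D" for x0
  proof -
    let ?A = "ball x0 (R x0)"
    have AD: "?A \<subseteq> D"
    proof -
      have "?A \<subseteq> cball x0 (4 * R x0)" using R(1)[OF x0] by auto
      then show ?thesis using R(2)[OF x0] by blast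
    qed
    have [measurable]: "?A \<in> sets ?M" using AD D by (auto simp: sets_restrict_space_iff)
    obtain N E where E: "E = {x \<in> ?A. \<bar>f x\<bar> \<le> real N}" "E \<in> sets lebesgue"
      "0 < emeasure lebesgue E" "emeasure lebesgue E < \<infinity>"
    proof (rule positive_measure_in_ball[OF D R(1)[OF x0] AD, of "\<lambda>N x. \<bar>f x\<bar> \<le> real N"])
      show "{x \<in> D. \<bar>f x\<bar> \<le> real N} \<in> sets ?M" for N
      proof -
        have "{x \<in> space ?M. \<bar>f x\<bar> \<le> real N} \<in> sets ?M" by measurable
        then show ?thesis by simp
      qed
      show "AE x in ?M. \<exists>N. \<bar>f x\<bar> \<le> real N" using real_arch_simple by (intro AE_I2) blast
    qed (rule that)
    have ED: "E \<subseteq> D" "E \<subseteq> ?A" using E(1) AD by auto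
    have [measurable]: "E \<in> sets ?M" using E(2) ED D by (auto simp: sets_restrict_space_iff)
    have "(\<integral>\<^sup>+x. indicator E x * ennreal ((real N)\<^sup>2) \<partial>?M) = emeasure ?M E * ennreal ((real N)\<^sup>2)"
      by (rule nn_integral_multc[THEN trans]) simp_all
    also have "emeasure ?M E = emeasure lebesgue E" using ED D by (intro emeasure_restrict_space) auto
    finally have finE: "(\<integral>\<^sup>+x. indicator E x * ennreal ((real N)\<^sup>2) \<partial>?M) < \<infinity>"
      using E(4) by (simp add: ennreal_mult_less_top)
    obtain c where c: "c \<ge> 0" "\<And>v. v \<in> BL D \<Longrightarrow>
      (\<integral>\<^sup>+x. indicator ?A x * ennreal ((v x)\<^sup>2) \<partial>?M) \<le>
      ennreal c * (ennreal (Dirichlet_int D v v) + (\<integral>\<^sup>+x. indicator E x * ennreal ((v x)\<^sup>2) \<partial>?M))"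
      using Poincare_lebesgue_on[OF D R(1)[OF x0] R(2)[OF x0] E(2) ED(2) E(3,4)] by blast
    define C where "C = ennreal c * (ennreal B + (\<integral>\<^sup>+x. indicator E x * ennreal ((real N)\<^sup>2) \<partial>?M))"
    have C: "C < \<infinity>" using finE by (simp add: C_def ennreal_mult_less_top)
    have bd: "(\<integral>\<^sup>+x. indicator ?A x * ennreal ((trunc k (f x))\<^sup>2) \<partial>?M) \<le> C" if k: "k \<ge> 1" for k
    proof -
      have "(\<integral>\<^sup>+x. indicator ?A x * ennreal (((trunc k \<circ> f) x)\<^sup>2) \<partial>?M) \<le>
        ennreal c * (ennreal (Dirichlet_int D (trunc k \<circ> f) (trunc k \<circ> f)) +
          (\<integral>\<^sup>+x. indicator E x * ennreal (((trunc k \<circ> f) x)\<^sup>2) \<partial>?M))" by (rule c(2)[OF T[OF k]])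
      also have "\<dots> \<le> C"
        unfolding C_def
      proof (rule mult_left_mono[OF add_mono[OF ennreal_leI[OF le[OF k]] nn_integral_mono]])
        fix x
        show "indicator E x * ennreal (((trunc k \<circ> f) x)\<^sup>2) \<le> indicator E x * ennreal ((real N)\<^sup>2)"
        proof (cases "x \<in> E")
          case True
          then have "\<bar>trunc k (f x)\<bar> \<le> real N" using E(1) trunc_abs_le[of k "f x"] by auto
          from power_mono[OF this, of 2] show ?thesis by (intro mult_left_mono ennreal_leI) simp_all
        qed simp
      qed simp
      finally show ?thesis by simp
    qed
    have "(\<integral>\<^sup>+x. indicator ?A x * ennreal ((f x)\<^sup>2) \<partial>?M) =
      (\<integral>\<^sup>+x. liminf (\<lambda>k. indicator ?A x * ennreal ((trunc k (f x))\<^sup>2)) \<partial>?M)"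
    proof (rule nn_integral_cong)
      fix x
      have "(\<lambda>k. ennreal ((trunc k (f x))\<^sup>2)) \<longlonglongrightarrow> ennreal ((f x)\<^sup>2)"
        by (intro tendsto_intros trunc_tendsto)
      then have "(\<lambda>k. indicator ?A x * ennreal ((trunc k (f x))\<^sup>2)) \<longlonglongrightarrow> indicator ?A x * ennreal ((f x)\<^sup>2)"
        by (cases "x \<in> ?A") simp_all
      then show "indicator ?A x * ennreal ((f x)\<^sup>2) = liminf (\<lambda>k. indicator ?A x * ennreal ((trunc k (f x))\<^sup>2))"
        by (rule lim_imp_Liminf[symmetric, rotated]) simp
    qed
    also have "\<dots> \<le> liminf (\<lambda>k. \<integral>\<^sup>+x. indicator ?A x * ennreal ((trunc k (f x))\<^sup>2) \<partial>?M)"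
      by (rule nn_integral_liminf) (unfold trunc_def, measurable)
    also have "\<dots> \<le> C"
    proof (rule Liminf_le)
      show "\<forall>\<^sub>F k in sequentially. (\<integral>\<^sup>+x. indicator ?A x * ennreal ((trunc k (f x))\<^sup>2) \<partial>?M) \<le> C"
        using eventually_ge_at_top[of 1] by eventually_elim (rule bd)
    qed simp
    finally show ?thesis using C by (rule order.strict_trans1)
  qed
  show ?thesis
    unfolding L2_loc_iff_L2_space[OF D]
  proof (intro conjI allI impI mf)
    fix K assume K: "compact K \<and> K \<subseteq> D"
    have [measurable]: "K \<in> sets ?M" using K compact_in_lebesgue_on by blast
    have RK: "R x > 0" if "x \<in> K" for x using R(1) that K by blast
    obtain F where F: "finite F" "F \<subseteq> K" "\<And>f. f \<in> borel_measurable ?M \<Longrightarrow>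
      (\<integral>\<^sup>+x. indicator K x * f x \<partial>?M) \<le> (\<Sum>c\<in>F. \<integral>\<^sup>+x. indicator (ball c (R c)) x * f x \<partial>?M)"
      using compact_nn_integral_cover[where r = R and D = D, OF conjunct1[OF K] RK] by blast
    have "(\<integral>\<^sup>+x. indicator K x * ennreal ((f x)\<^sup>2) \<partial>?M) \<le> (\<Sum>c\<in>F. \<integral>\<^sup>+x. indicator (ball c (R c)) x * ennreal ((f x)\<^sup>2) \<partial>?M)"
      by (rule F(3)) measurable
    also have "\<dots> < \<infinity>" using loc F(2) K by (subst infinity_ennreal_def, subst ennreal_sum_less_top[OF F(1)]) auto
    finally have fin: "(\<integral>\<^sup>+x. indicator K x * ennreal ((f x)\<^sup>2) \<partial>?M) < \<infinity>" .
    have e: "ennreal ((indicator K x * f x)\<^sup>2) = indicator K x * ennreal ((f x)\<^sup>2)" for x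
      by (auto split: split_indicator)
    have "integrable ?M (\<lambda>x. (indicator K x * f x)\<^sup>2)"
      by (rule integrableI_nonneg) (use fin in \<open>auto simp: e\<close>)
    then show "(\<lambda>x. indicator K x * f x) \<in> L2_space ?M" by (simp add: L2_space_def)
  qed
qed

text \<open>
Truncation at level \<open>k\<close> is a clipping of the truncation at any higher level, so outside a null set
the gradients of all truncations of level at least \<open>\<bar>f x\<bar>\<close> agree at \<open>x\<close>, and those of lower level
vanish there or agree with them.  The common value is the gradient of \<open>f\<close>.
\<close>

lemma F_ref_subset_BL:
  fixes D :: "'a::euclidean_space set"
  assumes D: "open D" and m: "continuous_on (closure D) m" "\<forall>x\<in>closure D. m x > 0"
  shows "F_ref D m \<subseteq> BL D"
proof
  fix f assume f: "f \<in> F_ref D m"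
  let ?M = "lebesgue_on D"
  have mf[measurable]: "f \<in> borel_measurable ?M" using f by (simp add: F_ref_def)
  obtain B where B: "B \<ge> 0" "\<And>k. k \<ge> 1 \<Longrightarrow> trunc k \<circ> f \<in> BL D"
    "\<And>k. k \<ge> 1 \<Longrightarrow> Dirichlet_int D (trunc k \<circ> f) (trunc k \<circ> f) \<le> B"
    using truncations_in_BL[OF D m f] by blast
  have L2: "f \<in> L2_loc D" by (rule F_ref_L2_loc[OF D mf B])
  define n where "n x = nat \<lceil>\<bar>f x\<bar>\<rceil> + 1" for x
  have n1: "n x \<ge> 1" for x by (simp add: n_def)
  have fn: "\<bar>f x\<bar> \<le> real (n x)" for x unfolding n_def by linarith
  have nm: "n \<in> measurable ?M (count_space UNIV)"
  proof -
    have "(\<lambda>x. \<lceil>\<bar>f x\<bar>\<rceil>) \<in> measurable ?M (count_space UNIV)" by measurable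
    then have "(\<lambda>x. (\<lambda>i. nat i + 1) \<lceil>\<bar>f x\<bar>\<rceil>) \<in> measurable ?M (count_space UNIV)"
      by (rule measurable_compose) simp
    then show ?thesis by (simp add: n_def[abs_def])
  qed
  define g where "g k x = weak_grad D (trunc k \<circ> f) x" for k x
  have "AE x in ?M. g k x = (if \<bar>f x\<bar> \<le> real k then g j x else 0)" if kj: "1 \<le> k" "k \<le> j" for k j
  proof -
    have e: "(\<lambda>x. min (max (- real k) ((trunc j \<circ> f) x)) (real k)) = trunc k \<circ> f"
      using kj by (auto simp: fun_eq_iff trunc_def max_def min_def)
    have j: "trunc j \<circ> f \<in> BL D" using B(2) kj by simp
    \<comment> \<open>The equivalence needs \<open>k < j\<close>: at equal levels the truncation never leaves \<open>[- k, k]\<close>.\<close>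
    have c: "- real k \<le> trunc j t \<and> trunc j t \<le> real k \<longleftrightarrow> \<bar>t\<bar> \<le> real k" if "k < j" for t
      using kj that by (auto simp: trunc_def max_def min_def abs_le_iff)
    show ?thesis
    proof (cases "k = j")
      case False
      then have "k < j" using kj by simp
      from BL_clip(2)[OF D j, of "real k" "real k", unfolded e]
      have "AE x in ?M. g k x = (if - real k \<le> trunc j (f x) \<and> trunc j (f x) \<le> real k then g j x else 0)"
        by (simp only: g_def comp_apply)
      then show ?thesis unfolding c[OF \<open>k < j\<close>] .
    next
      case True
      have "AE x in ?M. \<not> \<bar>f x\<bar> \<le> real j \<longrightarrow> g j x = 0"
      proof -
        have j': "trunc (Suc j) \<circ> f \<in> BL D" using B(2) by simp
        have e': "(\<lambda>x. min (max (- real j) ((trunc (Suc j) \<circ> f) x)) (real j)) = trunc j \<circ> f"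
          by (auto simp: fun_eq_iff trunc_def max_def min_def)
        have "\<not> (- real j \<le> trunc (Suc j) t \<and> trunc (Suc j) t \<le> real j)" if "\<not> \<bar>t\<bar> \<le> real j" for t
          using that by (auto simp: trunc_def max_def min_def abs_le_iff)
        with BL_clip(2)[OF D j', of "real j" "real j", unfolded e'] show ?thesis
          by (auto simp: g_def elim!: eventually_mono)
      qed
      then show ?thesis using True by (auto elim!: eventually_mono)
    qed
  qed
  then have "AE x in ?M. \<forall>k j. 1 \<le> k \<longrightarrow> k \<le> j \<longrightarrow> g k x = (if \<bar>f x\<bar> \<le> real k then g j x else 0)"
    by (simp add: AE_all_countable)
  then have gn: "AE x in ?M. (\<forall>k\<ge>1. k < n x \<longrightarrow> g k x = g (n x) x \<or> g k x = 0) \<and> (\<forall>k\<ge>n x. g k x = g (n x) x)"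
  proof eventually_elim
    case (elim x)
    show ?case
    proof (intro conjI allI impI)
      fix k assume "1 \<le> k" "k < n x"
      with elim[rule_format, of k "n x"] show "g k x = g (n x) x \<or> g k x = 0" by (auto split: if_splits)
    next
      fix k assume "n x \<le> k"
      with elim[rule_format, of "n x" k] n1[of x] fn[of x] show "g k x = g (n x) x" by simp
    qed
  qed
  define h where "h b x = g (n x) x \<bullet> b" for b x
  have gm: "(\<lambda>x. g k x \<bullet> b) \<in> borel_measurable ?M" if "k \<ge> 1" "b \<in> Basis" for k b
    using BL_weak_grad(2)[OF D B(2)[OF that(1)] that(2)] by (simp add: L2_space_def g_def)
  have hm: "h b \<in> borel_measurable ?M" if b: "b \<in> Basis" for b
  proof -
    have "(\<lambda>x. (\<lambda>k x. g (max 1 k) x \<bullet> b) (n x) x) \<in> borel_measurable ?M"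
      by (rule measurable_compose_countable[OF _ nm]) (rule gm, use b in auto)
    moreover have "max 1 (n x) = n x" for x using n1[of x] by simp
    ultimately show ?thesis by (simp add: h_def[abs_def])
  qed
  have lim: "AE x in ?M. (\<lambda>k. g (Suc k) x \<bullet> b) \<longlonglongrightarrow> h b x" for b
    using gn
  proof eventually_elim
    case (elim x)
    have "\<forall>\<^sub>F k in sequentially. g (Suc k) x \<bullet> b = h b x"
      using eventually_ge_at_top[of "n x"]
    proof eventually_elim
      fix k assume "n x \<le> k"
      then have "g (Suc k) x = g (n x) x" using conjunct2[OF elim, rule_format, of "Suc k"] by simp
      then show "g (Suc k) x \<bullet> b = h b x" by (simp only: h_def)
    qed
    then show ?case by (rule tendsto_eventually)
  qed
  have hle: "AE x in ?M. \<bar>g (Suc k) x \<bullet> b\<bar> \<le> \<bar>h b x\<bar>" for k b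
    using gn
  proof eventually_elim
    case (elim x)
    have "g (Suc k) x = g (n x) x \<or> g (Suc k) x = 0"
    proof (cases "Suc k < n x")
      case True
      then show ?thesis using conjunct1[OF elim, rule_format, of "Suc k"] by simp
    next
      case False
      then show ?thesis using conjunct2[OF elim, rule_format, of "Suc k"] by simp
    qed
    then show ?case by (auto simp: h_def)
  qed
  have hL2: "h b \<in> L2_space ?M" if b: "b \<in> Basis" for b
  proof -
    note hm[OF b, measurable]
    have [measurable]: "(\<lambda>x. g (Suc k) x \<bullet> b) \<in> borel_measurable ?M" for k by (rule gm) (use b in auto)
    have "(\<integral>\<^sup>+x. ennreal ((h b x)\<^sup>2) \<partial>?M) = (\<integral>\<^sup>+x. liminf (\<lambda>k. ennreal ((g (Suc k) x \<bullet> b)\<^sup>2)) \<partial>?M)"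
    proof (rule nn_integral_cong_AE)
      show "AE x in ?M. ennreal ((h b x)\<^sup>2) = liminf (\<lambda>k. ennreal ((g (Suc k) x \<bullet> b)\<^sup>2))"
        using lim[of b]
      proof eventually_elim
        case (elim x)
        have "(\<lambda>k. ennreal ((g (Suc k) x \<bullet> b)\<^sup>2)) \<longlonglongrightarrow> ennreal ((h b x)\<^sup>2)"
          by (intro tendsto_intros elim)
        then show ?case by (rule lim_imp_Liminf[symmetric, rotated]) simp
      qed
    qed
    also have "\<dots> \<le> liminf (\<lambda>k. \<integral>\<^sup>+x. ennreal ((g (Suc k) x \<bullet> b)\<^sup>2) \<partial>?M)"
      by (rule nn_integral_liminf) measurable
    also have "\<dots> \<le> ennreal B"
    proof (rule Liminf_le)
      have "(\<integral>\<^sup>+x. ennreal ((g (Suc k) x \<bullet> b)\<^sup>2) \<partial>?M) \<le> ennreal B" for k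
      proof -
        have T: "trunc (Suc k) \<circ> f \<in> BL D" using B(2) by simp
        have "(\<integral>\<^sup>+x. ennreal ((g (Suc k) x \<bullet> b)\<^sup>2) \<partial>?M) \<le> Dirichlet_int_ext D (trunc (Suc k) \<circ> f)"
          unfolding Dirichlet_int_ext_def g_def
        proof (intro nn_integral_mono ennreal_leI)
          fix x
          show "(weak_grad D (trunc (Suc k) \<circ> f) x \<bullet> b)\<^sup>2 \<le> (norm (weak_grad D (trunc (Suc k) \<circ> f) x))\<^sup>2"
            using power_mono[OF Basis_le_norm[OF b], of "weak_grad D (trunc (Suc k) \<circ> f) x" 2] by simp
        qed
        also have "\<dots> \<le> ennreal B"
          unfolding Dirichlet_int_ext_eq[OF D T] by (intro ennreal_leI B(3)) simp
        finally show ?thesis .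
      qed
      then show "\<forall>\<^sub>F k in sequentially. (\<integral>\<^sup>+x. ennreal ((g (Suc k) x \<bullet> b)\<^sup>2) \<partial>?M) \<le> ennreal B" by simp
    qed simp
    finally have "(\<integral>\<^sup>+x. ennreal ((h b x)\<^sup>2) \<partial>?M) < \<infinity>" by (rule order.strict_trans1) simp
    then have "integrable ?M (\<lambda>x. (h b x)\<^sup>2)" by (intro integrableI_nonneg) auto
    then show ?thesis using hm[OF b] by (simp add: L2_space_def)
  qed
  show "f \<in> BL D"
  proof (rule BL_I[OF L2 _ hL2])
    fix b :: 'a assume b: "b \<in> Basis"
    show "is_weak_pderiv D b f (h b)"
    proof (rule weak_pderiv_dominated[OF D])
      show "is_weak_pderiv D b (trunc (Suc k) \<circ> f) (\<lambda>x. g (Suc k) x \<bullet> b)" for k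
        unfolding g_def by (rule BL_weak_grad(1)[OF D B(2) b]) simp
      show "(\<lambda>x. \<bar>f x\<bar>) \<in> L1_loc D"
        by (rule L1_loc_bound[OF D L2_loc_imp_L1_loc[OF D L2]]) auto
      show "(\<lambda>x. \<bar>h b x\<bar>) \<in> L1_loc D"
        by (rule L1_loc_bound[OF D L2_loc_imp_L1_loc[OF D L2_space_imp_L2_loc[OF D hL2[OF b]]]])
          (use hm[OF b] in auto)
      show "AE x in ?M. \<bar>(trunc (Suc k) \<circ> f) x\<bar> \<le> \<bar>f x\<bar>" for k using trunc_abs_le by simp
      show "AE x in ?M. \<bar>g (Suc k) x \<bullet> b\<bar> \<le> \<bar>h b x\<bar>" for k by (rule hle)
      show "AE x in ?M. (\<lambda>k. (trunc (Suc k) \<circ> f) x) \<longlonglongrightarrow> f x"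
        using LIMSEQ_Suc[OF trunc_tendsto] by simp
      show "AE x in ?M. (\<lambda>k. g (Suc k) x \<bullet> b) \<longlonglongrightarrow> h b x" by (rule lim)
    qed (use mf hm[OF b] in auto)
  qed
qed

section \<open>Density in the weighted space\<close>

definition L2_closure :: "'a measure \<Rightarrow> ('a \<Rightarrow> real) set \<Rightarrow> ('a \<Rightarrow> real) set" where
  "L2_closure M F = {f \<in> L2_space M. \<forall>\<epsilon>>0. \<exists>u\<in>F. (LINT x|M. (f x - u x)\<^sup>2) < \<epsilon>}"

lemma L2_norm_triangle:
  assumes "f \<in> L2_space M" "g \<in> L2_space M"
  shows "(LINT x|M. (f x + g x)\<^sup>2) \<le> 2 * (LINT x|M. (f x)\<^sup>2) + 2 * (LINT x|M. (g x)\<^sup>2)"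
proof -
  have i: "integrable M (\<lambda>x. (f x)\<^sup>2)" "integrable M (\<lambda>x. (g x)\<^sup>2)" using assms by (auto simp: L2_space_def)
  have i': "integrable M (\<lambda>x. (f x + g x)\<^sup>2)"
    using L2_space_lincomb[OF assms, of 1 1] by (simp add: L2_space_def)
  have "(a + b)\<^sup>2 \<le> 2 * a\<^sup>2 + 2 * b\<^sup>2" for a b :: real
    using zero_le_power2[of "a - b"] by (simp add: power2_eq_square algebra_simps)
  then have "(LINT x|M. (f x + g x)\<^sup>2) \<le> (LINT x|M. 2 * (f x)\<^sup>2 + 2 * (g x)\<^sup>2)"
    using i i' by (intro integral_mono) auto
  then show ?thesis using i by simp
qed

lemma L2_closure_closed:
  assumes F: "F \<subseteq> L2_space M" and f: "f \<in> L2_space M"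
    and h: "\<And>\<epsilon>. \<epsilon> > 0 \<Longrightarrow> \<exists>h\<in>L2_closure M F. (LINT x|M. (f x - h x)\<^sup>2) < \<epsilon>"
  shows "f \<in> L2_closure M F"
  unfolding L2_closure_def
proof (intro CollectI conjI allI impI f)
  fix \<epsilon> :: real assume "\<epsilon> > 0"
  then have e: "\<epsilon> / 4 > 0" by simp
  obtain h where h: "h \<in> L2_closure M F" "(LINT x|M. (f x - h x)\<^sup>2) < \<epsilon> / 4" using h[OF e] by blast
  obtain u where u: "u \<in> F" "(LINT x|M. (h x - u x)\<^sup>2) < \<epsilon> / 4" using h(1) e unfolding L2_closure_def by blast
  have L: "h \<in> L2_space M" "u \<in> L2_space M" using h(1) u(1) F by (auto simp: L2_closure_def)
  have "(\<lambda>x. 1 * f x + (-1) * h x) \<in> L2_space M" "(\<lambda>x. 1 * h x + (-1) * u x) \<in> L2_space M"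
    by (intro L2_space_lincomb f L)+
  from L2_norm_triangle[OF this] have "(LINT x|M. (f x - u x)\<^sup>2) < \<epsilon>" using h(2) u(2) by simp
  with u(1) show "\<exists>u\<in>F. (LINT x|M. (f x - u x)\<^sup>2) < \<epsilon>" by blast
qed

lemma L2_closure_dominated:
  fixes s :: "nat \<Rightarrow> 'a \<Rightarrow> real"
  assumes F: "F \<subseteq> L2_space M" and f: "f \<in> borel_measurable M" and s: "\<And>n. s n \<in> L2_closure M F"
    and lim: "AE x in M. (\<lambda>n. s n x) \<longlonglongrightarrow> f x" and W: "W \<in> L2_space M"
    and le: "\<And>n. AE x in M. \<bar>s n x\<bar> \<le> W x"
  shows "f \<in> L2_closure M F"
proof -
  note f[measurable]
  have [measurable]: "s n \<in> borel_measurable M" for n using s[of n] by (simp add: L2_closure_def L2_space_def)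
  have all: "AE x in M. \<forall>n. \<bar>s n x\<bar> \<le> W x" using le by (simp add: AE_all_countable)
  then have fW: "AE x in M. \<bar>f x\<bar> \<le> W x" using lim
  proof eventually_elim
    case (elim x)
    show ?case by (rule LIMSEQ_le_const2[OF tendsto_rabs[OF elim(2)]]) (use elim(1) in auto)
  qed
  have fL: "f \<in> L2_space M" by (rule L2_space_bound[OF W f]) (use fW in \<open>auto elim!: eventually_mono\<close>)
  have "(\<lambda>n. LINT x|M. (f x - s n x)\<^sup>2) \<longlonglongrightarrow> (LINT x|M. 0)"
  proof (rule integral_dominated_convergence[where w = "\<lambda>x. 4 * (W x)\<^sup>2"])
    show "integrable M (\<lambda>x. 4 * (W x)\<^sup>2)" using W by (simp add: L2_space_def)
    show "AE x in M. (\<lambda>n. (f x - s n x)\<^sup>2) \<longlonglongrightarrow> 0"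
      using lim
    proof eventually_elim
      case (elim x)
      have "(\<lambda>n. (f x - s n x)\<^sup>2) \<longlonglongrightarrow> (f x - f x)\<^sup>2" by (intro tendsto_intros elim)
      then show ?case by simp
    qed
    show "AE x in M. norm ((f x - s n x)\<^sup>2) \<le> 4 * (W x)\<^sup>2" for n
      using fW all
    proof eventually_elim
      case (elim x)
      have "\<bar>s n x\<bar> \<le> W x" using elim(2) by blast
      then have "\<bar>f x - s n x\<bar> \<le> 2 * W x" using elim(1) by linarith
      from power_mono[OF this, of 2] show ?case by (simp add: power_mult_distrib)
    qed
  qed measurable
  then have L: "(\<lambda>n. LINT x|M. (f x - s n x)\<^sup>2) \<longlonglongrightarrow> 0" by simp
  show ?thesis
  proof (rule L2_closure_closed[OF F fL])
    fix \<epsilon> :: real assume "\<epsilon> > 0"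
    with L have "\<forall>\<^sub>F n in sequentially. (LINT x|M. (f x - s n x)\<^sup>2) < \<epsilon>" by (rule order_tendstoD)
    then obtain n where "(LINT x|M. (f x - s n x)\<^sup>2) < \<epsilon>" unfolding eventually_sequentially by blast
    then show "\<exists>h\<in>L2_closure M F. (LINT x|M. (f x - h x)\<^sup>2) < \<epsilon>" using s by blast
  qed
qed

lemma L2_closure_lincomb:
  assumes F: "F \<subseteq> L2_space M" and lin: "\<And>u v a c. u \<in> F \<Longrightarrow> v \<in> F \<Longrightarrow> (\<lambda>x. a * u x + c * v x) \<in> F"
    and f: "f \<in> L2_closure M F" and g: "g \<in> L2_closure M F"
  shows "(\<lambda>x. a * f x + c * g x) \<in> L2_closure M F"
proof -
  have L: "f \<in> L2_space M" "g \<in> L2_space M" using f g by (auto simp: L2_closure_def)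
  show ?thesis unfolding L2_closure_def
  proof (intro CollectI conjI allI impI L2_space_lincomb L)
    fix \<epsilon> :: real assume e: "\<epsilon> > 0"
    define \<delta> where "\<delta> = \<epsilon> / (4 * (a\<^sup>2 + c\<^sup>2 + 1))"
    have p: "a\<^sup>2 + c\<^sup>2 + 1 > 0" by (intro add_nonneg_pos add_nonneg_nonneg) auto
    have \<delta>: "\<delta> > 0" using e p by (simp add: \<delta>_def)
    obtain u where u: "u \<in> F" "(LINT x|M. (f x - u x)\<^sup>2) < \<delta>" using f \<delta> unfolding L2_closure_def by blast
    obtain v where v: "v \<in> F" "(LINT x|M. (g x - v x)\<^sup>2) < \<delta>" using g \<delta> unfolding L2_closure_def by blast
    have UV: "u \<in> L2_space M" "v \<in> L2_space M" using u v F by auto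
    have 1: "(\<lambda>x. a * f x + (-a) * u x) \<in> L2_space M" and 2: "(\<lambda>x. c * g x + (-c) * v x) \<in> L2_space M"
      by (intro L2_space_lincomb L UV)+
    have "(LINT x|M. ((a * f x + c * g x) - (a * u x + c * v x))\<^sup>2) =
      (LINT x|M. ((a * f x + (-a) * u x) + (c * g x + (-c) * v x))\<^sup>2)" by (simp add: algebra_simps)
    also have "\<dots> \<le> 2 * (LINT x|M. (a * f x + (-a) * u x)\<^sup>2) + 2 * (LINT x|M. (c * g x + (-c) * v x)\<^sup>2)"
      by (rule L2_norm_triangle[OF 1 2])
    also have "(LINT x|M. (a * f x + (-a) * u x)\<^sup>2) = a\<^sup>2 * (LINT x|M. (f x - u x)\<^sup>2)"
    proof -
      have "(a * f x + (-a) * u x)\<^sup>2 = a\<^sup>2 * (f x - u x)\<^sup>2" for x by (simp add: power2_eq_square algebra_simps)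
      then show ?thesis by simp
    qed
    also have "(LINT x|M. (c * g x + (-c) * v x)\<^sup>2) = c\<^sup>2 * (LINT x|M. (g x - v x)\<^sup>2)"
    proof -
      have "(c * g x + (-c) * v x)\<^sup>2 = c\<^sup>2 * (g x - v x)\<^sup>2" for x by (simp add: power2_eq_square algebra_simps)
      then show ?thesis by simp
    qed
    also have "2 * (a\<^sup>2 * (LINT x|M. (f x - u x)\<^sup>2)) + 2 * (c\<^sup>2 * (LINT x|M. (g x - v x)\<^sup>2)) \<le>
      2 * (a\<^sup>2 * \<delta>) + 2 * (c\<^sup>2 * \<delta>)"
      using u v by (intro add_mono mult_left_mono) auto
    also have "\<dots> < 4 * ((a\<^sup>2 + c\<^sup>2 + 1) * \<delta>)"
    proof -
      have "0 \<le> a\<^sup>2 * \<delta>" "0 \<le> c\<^sup>2 * \<delta>" using \<delta> by auto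
      moreover have "2 * p + 2 * q < 4 * (p + q + \<delta>)" if "0 \<le> p" "0 \<le> q" for p q
        using that \<delta> by simp
      ultimately show ?thesis unfolding distrib_right mult_1_left by blast
    qed
    also have "\<dots> = \<epsilon>"
    proof -
      have "4 * (q * (\<epsilon> / (4 * q))) = \<epsilon>" if "q > 0" for q using that by simp
      from this[OF p] show ?thesis by (simp add: \<delta>_def)
    qed
    finally show "\<exists>w\<in>F. (LINT x|M. ((a * f x + c * g x) - w x)\<^sup>2) < \<epsilon>"
      by (rule bexI[where x = "\<lambda>x. a * u x + c * v x"]) (rule lin[OF u(1) v(1)])
  qed
qed

text \<open>
By the usual induction for nonnegative measurable functions; square integrability passes to the
smaller functions that occur in each step.
\<close>

lemma L2_closure_all:
  fixes M :: "'a measure"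
  assumes F: "F \<subseteq> L2_space M" and lin: "\<And>u v a c. u \<in> F \<Longrightarrow> v \<in> F \<Longrightarrow> (\<lambda>x. a * u x + c * v x) \<in> F"
    and ind: "\<And>A. A \<in> sets M \<Longrightarrow> emeasure M A < \<infinity> \<Longrightarrow> indicator A \<in> L2_closure M F"
    and f: "f \<in> L2_space M"
  shows "f \<in> L2_closure M F"
proof -
  have pos: "u \<in> L2_space M \<longrightarrow> u \<in> L2_closure M F" if "u \<in> borel_measurable M" "\<And>x. 0 \<le> u x" for u
    using that
  proof (induction rule: borel_measurable_induct_real)
    case (set A)
    show ?case
    proof
      assume "indicator A \<in> L2_space M"
      then have "integrable M (\<lambda>x. (indicator A x :: real)\<^sup>2)" by (simp add: L2_space_def)
      then have "integrable M (indicator A :: _ \<Rightarrow> real)" by (simp add: power2_eq_square indicator_inter_arith[symmetric])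
      then have "emeasure M A < \<infinity>" using set sets.sets_into_space[OF set] by (simp add: integrable_indicator_iff Int_absorb2)
      then show "indicator A \<in> L2_closure M F" by (rule ind[OF set])
    qed
  next
    case (mult u c)
    show ?case
    proof
      assume L: "(\<lambda>x. c * u x) \<in> L2_space M"
      show "(\<lambda>x. c * u x) \<in> L2_closure M F"
      proof (cases "c = 0")
        case True
        have "indicator {} \<in> L2_closure M F" by (rule ind) auto
        moreover have "(indicator {} :: 'a \<Rightarrow> real) = (\<lambda>x. c * u x)" using True by (simp add: fun_eq_iff)
        ultimately show ?thesis by simp
      next
        case False
        have e: "(\<lambda>x. (1/c) * (c * u x) + 0 * (c * u x)) = u" using False by (simp add: fun_eq_iff)
        have "u \<in> L2_space M" using L2_space_lincomb[OF L L, of "1/c" 0] unfolding e .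
        then have u: "u \<in> L2_closure M F" using mult.IH by (rule rev_mp)
        have "(\<lambda>x. c * u x + 0 * u x) \<in> L2_closure M F" by (rule L2_closure_lincomb[OF F lin u u])
        then show ?thesis by simp
      qed
    qed
  next
    case (add u v)
    show ?case
    proof
      assume L: "(\<lambda>x. v x + u x) \<in> L2_space M"
      have le: "\<bar>u x\<bar> \<le> \<bar>v x + u x\<bar>" "\<bar>v x\<bar> \<le> \<bar>v x + u x\<bar>" for x
        using add.hyps(2)[of x] add.hyps(4)[of x] by linarith+
      have "u \<in> L2_space M" by (rule L2_space_bound[OF L add.hyps(1) AE_I2[OF le(1)]])
      moreover have "v \<in> L2_space M" by (rule L2_space_bound[OF L add.hyps(3) AE_I2[OF le(2)]])
      ultimately have uv: "u \<in> L2_closure M F" "v \<in> L2_closure M F" using add.IH by (blast intro: rev_mp)+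
      have "(\<lambda>x. 1 * v x + 1 * u x) \<in> L2_closure M F" by (rule L2_closure_lincomb[OF F lin uv(2,1)])
      then show "(\<lambda>x. v x + u x) \<in> L2_closure M F" by simp
    qed
  next
    case (seq U)
    have le: "U i x \<le> u x" if "x \<in> space M" for i x
    proof (rule LIMSEQ_le_const[OF seq.hyps(4)[OF that]])
      show "\<exists>N. \<forall>n\<ge>N. U i x \<le> U n x" using seq.hyps(3) by (auto simp: incseq_def le_fun_def)
    qed
    show ?case
    proof
      assume L: "u \<in> L2_space M"
      have "U i \<in> L2_space M" for i
      proof (rule L2_space_bound[OF L seq.hyps(1)], rule AE_I2)
        fix x assume x: "x \<in> space M"
        show "\<bar>U i x\<bar> \<le> \<bar>u x\<bar>" using le[OF x, of i] seq.hyps(2)[of i x] by linarith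
      qed
      then have cl: "U i \<in> L2_closure M F" for i using seq.IH by blast
      show "u \<in> L2_closure M F"
      proof (rule L2_closure_dominated[OF F _ cl _ L])
        show "u \<in> borel_measurable M" using L by (simp add: L2_space_def)
        show "AE x in M. (\<lambda>n. U n x) \<longlonglongrightarrow> u x" using seq.hyps(4) by (intro AE_I2)
        show "AE x in M. \<bar>U n x\<bar> \<le> u x" for n
        proof (rule AE_I2)
          fix x assume x: "x \<in> space M"
          show "\<bar>U n x\<bar> \<le> u x" using le[OF x, of n] seq.hyps(2)[of n x] by linarith
        qed
      qed
    qed
  qed
  have m: "f \<in> borel_measurable M" using f by (simp add: L2_space_def)
  have "(\<lambda>x. max (f x) 0) \<in> L2_closure M F" "(\<lambda>x. max (- f x) 0) \<in> L2_closure M F"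
  proof -
    have mm: "(\<lambda>x. max (f x) 0) \<in> borel_measurable M" "(\<lambda>x. max (- f x) 0) \<in> borel_measurable M"
      using m by (auto intro!: borel_measurable_max borel_measurable_uminus)
    have "(\<lambda>x. max (f x) 0) \<in> L2_space M" by (rule L2_space_bound[OF f mm(1)]) (auto simp: max_def)
    moreover have "(\<lambda>x. max (- f x) 0) \<in> L2_space M" by (rule L2_space_bound[OF f mm(2)]) (auto simp: max_def)
    ultimately show "(\<lambda>x. max (f x) 0) \<in> L2_closure M F" "(\<lambda>x. max (- f x) 0) \<in> L2_closure M F"
      using pos[of "\<lambda>x. max (f x) 0"] pos[of "\<lambda>x. max (- f x) 0"] by (auto simp: L2_space_def)
  qed
  from L2_closure_lincomb[OF F lin this, of 1 "-1"]
  have "(\<lambda>x. 1 * max (f x) 0 + (-1) * max (- f x) 0) \<in> L2_closure M F" .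
  moreover have "1 * max (f x) 0 + (-1) * max (- f x) 0 = f x" for x by (simp add: max_def)
  ultimately show ?thesis by simp
qed

text \<open>
The domain class gives \<open>v\<close> in \<open>W12 D\<close> uniformly within \<open>\<delta>\<close> of \<open>h\<close> on \<open>D\<close>, but the weighted measure may be
infinite.  Shrinking \<open>v\<close> towards \<open>0\<close> by \<open>\<delta>\<close> makes it vanish wherever \<open>h\<close> does, so that the error lives
on the compact set \<open>S\<close>.
\<close>

lemma continuous_compact_support_approx:
  fixes D :: "'a::euclidean_space set"
  assumes dc: "D \<in> domain_class" and m: "continuous_on (closure D) m" "\<forall>x\<in>closure D. m x > 0"
    and b: "bounded (m ` closure D)"
    and h: "continuous_on UNIV h" and S: "compact S" "S \<subseteq> D" "\<And>x. x \<notin> S \<Longrightarrow> h x = 0"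
  shows "h \<in> L2_closure (weighted D m) (BL D \<inter> L2_space (weighted D m))"
proof -
  let ?M = "weighted D m" and ?F = "BL D \<inter> L2_space (weighted D m)"
  have D: "open D" using dc by (simp add: domain_class_def)
  have SL2: "indicator S \<in> L2_space ?M"
  proof (rule L2_space_imp_weighted[OF D m b])
    show "indicator S \<in> L2_space (lebesgue_on D)"
      using compact_in_lebesgue_on[OF S(1,2)]
      by (intro L2_space_compact_support[OF D S(1), of _ 1] borel_measurable_indicator) auto
  qed
  have hM: "h \<in> borel_measurable ?M" unfolding borel_measurable_weighted by (rule continuous_imp_lebesgue_on[OF h])
  obtain B where B: "\<And>x. x \<in> S \<Longrightarrow> \<bar>h x\<bar> \<le> B"
    using compact_imp_bounded[OF compact_continuous_image[OF continuous_on_subset[OF h subset_UNIV] S(1)]]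
    unfolding bounded_iff by auto
  have hL2: "h \<in> L2_space ?M"
  proof (rule L2_space_bound[OF _ hM])
    show "(\<lambda>x. B * indicator S x + 0 * indicator S x) \<in> L2_space ?M" by (rule L2_space_lincomb[OF SL2 SL2])
    show "AE x in ?M. \<bar>h x\<bar> \<le> \<bar>B * indicator S x + 0 * indicator S x\<bar>"
    proof (rule AE_I2)
      fix x show "\<bar>h x\<bar> \<le> \<bar>B * indicator S x + 0 * indicator S x\<bar>"
        using B[of x] S(3)[of x] by (cases "x \<in> S") auto
    qed
  qed
  define I where "I = (LINT x|?M. (indicator S x :: real)\<^sup>2)"
  have I: "I \<ge> 0" unfolding I_def by (rule integral_nonneg_AE) simp
  show ?thesis
    unfolding L2_closure_def
  proof (intro CollectI conjI allI impI hL2)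
    fix \<epsilon> :: real assume e: "\<epsilon> > 0"
    define \<delta> where "\<delta> = sqrt (\<epsilon> / (8 * (I + 1)))"
    have \<delta>: "\<delta> > 0" using e I by (simp add: \<delta>_def)
    have \<delta>2: "4 * \<delta>\<^sup>2 * I < \<epsilon>"
    proof -
      have "\<delta>\<^sup>2 = \<epsilon> / (8 * (I + 1))" using e I by (simp add: \<delta>_def)
      then have "4 * \<delta>\<^sup>2 * (I + 1) = \<epsilon> / 2" using I by (simp add: field_simps)
      moreover have "4 * \<delta>\<^sup>2 * I \<le> 4 * \<delta>\<^sup>2 * (I + 1)" by (intro mult_left_mono) auto
      ultimately show ?thesis using e by linarith
    qed
    have "h \<in> Cinf_closure D"
      unfolding Cinf_closure_def
    proof (intro CollectI conjI allI impI)
      show "continuous_on (closure D) h" by (rule continuous_on_subset[OF h subset_UNIV])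
      fix r :: real assume "r > 0"
      then show "\<exists>K. compact K \<and> K \<subseteq> closure D \<and> (\<forall>x\<in>closure D - K. \<bar>h x\<bar> < r)"
        using S closure_subset by (intro exI[of _ S]) auto
    qed
    then obtain v where v: "v \<in> W12 D" "\<And>x. x \<in> closure D \<Longrightarrow> \<bar>h x - v x\<bar> < \<delta>"
      using dc \<delta> unfolding domain_class_def by blast
    have vBL: "v \<in> BL D" using v(1) by (simp add: W12_def)
    define w where "w x = 1 * max ((1 * v x + 0 * v x) - \<delta>) 0 + (-1) * max (((-1) * v x + 0 * v x) - \<delta>) 0" for x
    have wBL: "w \<in> BL D" unfolding w_def[abs_def]
      by (intro BL_lincomb BL_pos_part D vBL) (use \<delta> in simp_all)
    have wm: "w \<in> borel_measurable ?M" using wBL unfolding borel_measurable_weighted by (simp add: BL_def L2_loc_def)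
    have d: "\<bar>h x - w x\<bar> \<le> 2 * \<delta> * indicator S x" if "x \<in> D" for x
    proof -
      have hv: "\<bar>h x - v x\<bar> < \<delta>" using v(2) that closure_subset by blast
      have wv: "\<bar>v x - w x\<bar> \<le> \<delta>" using \<delta> by (auto simp: w_def max_def)
      show ?thesis
      proof (cases "x \<in> S")
        case True
        then show ?thesis using hv wv by simp
      next
        case False
        then have "h x = 0" by (rule S(3))
        then have "w x = 0" using hv by (auto simp: w_def max_def)
        then show ?thesis using \<open>h x = 0\<close> False by simp
      qed
    qed
    have sp: "space ?M = D" by (simp add: weighted_def)
    have SL: "(\<lambda>x. (2 * \<delta>) * indicator S x + 0 * indicator S x) \<in> L2_space ?M" by (rule L2_space_lincomb[OF SL2 SL2])
    have dL2: "(\<lambda>x. h x - w x) \<in> L2_space ?M"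
    proof (rule L2_space_bound[OF SL])
      show "(\<lambda>x. h x - w x) \<in> borel_measurable ?M" using hM wm by (intro borel_measurable_diff)
      show "AE x in ?M. \<bar>h x - w x\<bar> \<le> \<bar>2 * \<delta> * indicator S x + 0 * indicator S x\<bar>"
      proof (rule AE_I2)
        fix x assume "x \<in> space ?M"
        then have "x \<in> D" by (simp only: sp)
        from d[OF this] have "\<bar>h x - w x\<bar> \<le> 2 * \<delta> * indicator S x + 0 * indicator S x"
          by (simp only: mult_zero_left add_0_right)
        then show "\<bar>h x - w x\<bar> \<le> \<bar>2 * \<delta> * indicator S x + 0 * indicator S x\<bar>" by (rule order_trans[OF _ abs_ge_self])
      qed
    qed
    have wL2: "w \<in> L2_space ?M"
    proof -
      have "(\<lambda>x. 1 * h x + (-1) * (h x - w x)) = w" by (simp add: fun_eq_iff)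
      then show ?thesis using L2_space_lincomb[OF hL2 dL2, of 1 "-1"] by (simp only:)
    qed
    have "(LINT x|?M. (h x - w x)\<^sup>2) \<le> (LINT x|?M. 4 * \<delta>\<^sup>2 * (indicator S x)\<^sup>2)"
    proof (rule integral_mono)
      show "integrable ?M (\<lambda>x. (h x - w x)\<^sup>2)" using dL2 by (simp add: L2_space_def)
      show "integrable ?M (\<lambda>x. 4 * \<delta>\<^sup>2 * (indicator S x)\<^sup>2)" 
        by (rule integrable_mult_right) (use SL2 in \<open>simp only: L2_space_def mem_Collect_eq\<close>)
      fix x assume "x \<in> space ?M"
      then have "\<bar>h x - w x\<bar> \<le> 2 * \<delta> * indicator S x" using d sp by blast
      from power_mono[OF this, of 2] show "(h x - w x)\<^sup>2 \<le> 4 * \<delta>\<^sup>2 * (indicator S x)\<^sup>2"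
        by (simp add: power_mult_distrib)
    qed
    also have "\<dots> = 4 * \<delta>\<^sup>2 * I" by (simp add: I_def)
    finally have "(LINT x|?M. (h x - w x)\<^sup>2) < \<epsilon>" using \<delta>2 by linarith
    with wBL wL2 show "\<exists>u\<in>?F. (LINT x|?M. (h x - u x)\<^sup>2) < \<epsilon>" by blast
  qed
qed

lemma indicator_compact_approx:
  fixes D :: "'a::euclidean_space set"
  assumes dc: "D \<in> domain_class" and m: "continuous_on (closure D) m" "\<forall>x\<in>closure D. m x > 0"
    and b: "bounded (m ` closure D)" and K: "compact K" "K \<subseteq> D"
  shows "indicator K \<in> L2_closure (weighted D m) (BL D \<inter> L2_space (weighted D m))"
proof -
  let ?M = "weighted D m" and ?F = "BL D \<inter> L2_space (weighted D m)"
  have D: "open D" using dc by (simp add: domain_class_def)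
  obtain U S where US: "open U" "compact S" "K \<subseteq> U" "U \<subseteq> S" "S \<subseteq> D"
    using compact_open_between[OF K(1) D K(2)] by blast
  have SL2: "indicator S \<in> L2_space ?M"
  proof (rule L2_space_imp_weighted[OF D m b])
    show "indicator S \<in> L2_space (lebesgue_on D)"
      using compact_in_lebesgue_on[OF US(2,5)]
      by (intro L2_space_compact_support[OF D US(2), of _ 1] borel_measurable_indicator) auto
  qed
  show ?thesis
  proof (cases "K = {}")
    case True
    have "(\<lambda>x. 0) \<in> L2_closure ?M ?F"
      by (rule continuous_compact_support_approx[OF dc m b _ compact_empty]) auto
    moreover have "(indicator K :: 'a \<Rightarrow> real) = (\<lambda>x. 0)" using True by (simp add: fun_eq_iff)
    ultimately show ?thesis by simp
  next
    case False
    obtain e where e: "e > 0" "\<And>x y. x \<in> K \<Longrightarrow> dist x y < e \<Longrightarrow> y \<in> U"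
      using compact_tube[OF K(1) US(1,3)] by blast
    \<comment> \<open>Starting at \<open>1 / e\<close> keeps the support of every \<open>h n\<close> inside \<open>S\<close>.\<close>
    define r where "r n = 1 / e + real n" for n
    have r: "r n > 0" for n using e(1) by (simp add: r_def add_pos_nonneg)
    define h where "h n x = max 0 (1 - r n * infdist x K)" for n x
    have h0: "h n x = 0" if "x \<notin> S" for n x
    proof -
      have "infdist x K \<ge> e"
      proof (rule ccontr)
        assume "\<not> infdist x K \<ge> e"
        moreover obtain y where "y \<in> K" "infdist x K = dist x y"
          using infdist_attains_inf[OF compact_imp_closed[OF K(1)] False] by blast
        ultimately have "x \<in> U" using e(2)[of y x] by (simp add: dist_commute)
        with that US show False by blast
      qed
      then have "(1 / e) * e \<le> r n * infdist x K"
        using e(1) by (intro mult_mono) (auto simp: r_def)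
      then show ?thesis using e(1) by (simp add: h_def)
    qed
    have hK: "h n x = 1" if "x \<in> K" for n x using that by (simp add: h_def)
    have hb: "0 \<le> h n x" "h n x \<le> 1" for n x using r[of n] by (auto simp: h_def infdist_nonneg)
    show ?thesis
    proof (rule L2_closure_dominated[where s = h and W = "indicator S"])
      show "?F \<subseteq> L2_space ?M" by blast
      show "indicator K \<in> borel_measurable ?M"
        unfolding borel_measurable_weighted by (intro borel_measurable_indicator compact_in_lebesgue_on K)
      show "h n \<in> L2_closure ?M ?F" for n
        by (rule continuous_compact_support_approx[OF dc m b _ US(2,5) h0])
          (auto simp: h_def[abs_def] intro!: continuous_intros)
      show "AE x in ?M. (\<lambda>n. h n x) \<longlonglongrightarrow> indicator K x"
      proof (rule AE_I2)
        fix x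
        show "(\<lambda>n. h n x) \<longlonglongrightarrow> indicator K x"
        proof (cases "x \<in> K")
          case True then show ?thesis by (simp add: hK)
        next
          case nK: False
          have p: "infdist x K > 0"
            using in_closed_iff_infdist_zero[OF compact_imp_closed[OF K(1)] False, of x] nK infdist_nonneg[of x K] by simp
          obtain N :: nat where N: "1 / infdist x K < real N" using reals_Archimedean2 by blast
          have "\<forall>\<^sub>F n in sequentially. h n x = 0"
            using eventually_ge_at_top[of N]
          proof eventually_elim
            case (elim n)
            have "1 / infdist x K \<le> r n" using N elim e(1) by (simp add: r_def add_increasing)
            then have "1 \<le> r n * infdist x K" using p by (simp add: field_simps)
            then show ?case by (simp add: h_def)
          qed
          then show ?thesis using nK by (simp add: tendsto_eventually)
        qed
      qed
      show "indicator S \<in> L2_space ?M" by (rule SL2)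
      show "AE x in ?M. \<bar>h n x\<bar> \<le> indicator S x" for n
        by (rule AE_I2) (use hb[of n] h0[of _ n] in \<open>auto split: split_indicator\<close>)
    qed
  qed
qed

text \<open>
Lebesgue measure is inner regular by closed sets, the weight is bounded, and a closed subset of \<open>A\<close> is
exhausted by compact ones.
\<close>

lemma indicator_approx:
  fixes D :: "'a::euclidean_space set"
  assumes dc: "D \<in> domain_class" and m: "continuous_on (closure D) m" "\<forall>x\<in>closure D. m x > 0"
    and b: "bounded (m ` closure D)" and A: "A \<in> sets (weighted D m)" "emeasure (weighted D m) A < \<infinity>"
  shows "indicator A \<in> L2_closure (weighted D m) (BL D \<inter> L2_space (weighted D m))"
proof -
  let ?M = "weighted D m" and ?F = "BL D \<inter> L2_space (weighted D m)"
  have D: "open D" using dc by (simp add: domain_class_def)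
  have F: "?F \<subseteq> L2_space ?M" by blast
  have AD: "A \<subseteq> D" using sets.sets_into_space[OF A(1)] by (simp add: weighted_def)
  have sM: "sets ?M = sets (lebesgue_on D)" by (simp add: weighted_def)
  have As: "A \<in> sets lebesgue" using A(1) D unfolding sM by (subst (asm) sets_restrict_space_iff) auto
  have ind: "indicator T \<in> L2_space ?M" if "T \<in> sets ?M" "T \<subseteq> A" for T
  proof -
    have "emeasure ?M T < \<infinity>" using emeasure_mono[OF that(2) A(1)] A(2) by (rule order.strict_trans1)
    then have "integrable ?M (indicator T :: _ \<Rightarrow> real)"
      using that(1) sets.sets_into_space[OF that(1)] by (simp add: integrable_indicator_iff Int_absorb2)
    moreover have "(indicator T x :: real)\<^sup>2 = indicator T x" for x by (simp split: split_indicator)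
    ultimately show ?thesis using that(1) by (simp add: L2_space_def)
  qed
  have closed: "indicator T \<in> L2_closure ?M ?F" if T: "closed T" "T \<subseteq> A" for T
  proof (rule L2_closure_dominated[OF F, where s = "\<lambda>n. indicator (T \<inter> cball 0 (real n))" and W = "indicator T"])
    have "T \<in> sets lebesgue" using T(1) by auto
    then have Ts: "T \<in> sets ?M" using T(2) AD D unfolding sM by (subst sets_restrict_space_iff) auto
    show "indicator T \<in> borel_measurable ?M" by (rule borel_measurable_indicator[OF Ts])
    show "indicator T \<in> L2_space ?M" by (rule ind[OF Ts T(2)])
    show "indicator (T \<inter> cball 0 (real n)) \<in> L2_closure ?M ?F" for n
      by (rule indicator_compact_approx[OF dc m b]) (use T AD in \<open>auto intro: closed_Int_compact\<close>)
    show "AE x in ?M. (\<lambda>n. indicator (T \<inter> cball 0 (real n)) x) \<longlonglongrightarrow> (indicator T x :: real)"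
    proof (rule AE_I2, rule tendsto_eventually)
      fix x :: 'a
      obtain N :: nat where N: "norm x \<le> real N" using real_arch_simple by blast
      show "\<forall>\<^sub>F n in sequentially. indicator (T \<inter> cball 0 (real n)) x = (indicator T x :: real)"
        using eventually_ge_at_top[of N] by eventually_elim (use N in \<open>auto split: split_indicator\<close>)
    qed
    show "AE x in ?M. \<bar>indicator (T \<inter> cball 0 (real n)) x\<bar> \<le> (indicator T x :: real)" for n
      by (rule AE_I2) (auto split: split_indicator)
  qed
  have "\<exists>T. closed T \<and> T \<subseteq> A \<and> A - T \<in> lmeasurable \<and> emeasure lebesgue (A - T) < ennreal (1 / real (Suc n))" for n
    using sets_lebesgue_inner_closed[OF As, of "1 / real (Suc n)"] by (metis of_nat_0_less_iff zero_less_Suc zero_less_divide_1_iff)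
  then obtain T where T: "\<And>n. closed (T n)" "\<And>n. T n \<subseteq> A" "\<And>n. A - T n \<in> lmeasurable"
    "\<And>n. emeasure lebesgue (A - T n) < ennreal (1 / real (Suc n))" by metis
  have Ts: "T n \<in> sets ?M" for n
    using T(1,2)[of n] AD D unfolding sM by (subst sets_restrict_space_iff) (auto intro: borel_closed)
  obtain B where B: "\<And>x. x \<in> closure D \<Longrightarrow> \<bar>m x\<bar> \<le> B" using b unfolding bounded_iff by auto
  have B0: "B \<ge> 0"
  proof -
    obtain x where "x \<in> D" using dc by (auto simp: domain_class_def)
    then show ?thesis using B[of x] closure_subset by force
  qed
  show ?thesis
  proof (rule L2_closure_closed[OF F ind[OF A(1) order_refl]])
    fix \<epsilon> :: real assume e: "\<epsilon> > 0"
    obtain n :: nat where n: "(B + 1) / \<epsilon> < real n" using reals_Archimedean2 by blast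
    have i: "integrable (lebesgue_on D) (indicator (A - T n) :: _ \<Rightarrow> real)"
    proof -
      have "integrable lebesgue (\<lambda>x. indicator D x *\<^sub>R (indicator (A - T n) x :: real))"
        using T(3)[of n] D by (intro integrable_mult_indicator) (auto simp: fmeasurable_def integrable_indicator_iff)
      then show ?thesis using D by (subst integrable_restrict_space) auto
    qed
    have iv: "(LINT x|lebesgue_on D. indicator (A - T n) x) \<le> 1 / real (Suc n)"
    proof -
      have "(LINT x|lebesgue_on D. indicator (A - T n) x :: real) = measure (lebesgue_on D) (A - T n)"
        using AD by (simp add: Int_absorb2 Diff_subset[THEN subset_trans])
      also have "\<dots> = measure lebesgue (A - T n)"
        using AD D T(3)[of n] by (intro measure_restrict_space) auto
      also have "\<dots> \<le> 1 / real (Suc n)"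
        unfolding measure_def using T(4)[of n] by (intro enn2real_leI) auto
      finally show ?thesis .
    qed
    have "(LINT x|?M. (indicator A x - indicator (T n) x)\<^sup>2) = (LINT x|lebesgue_on D. m x * (indicator A x - indicator (T n) x)\<^sup>2)"
      using A(1) Ts[of n] unfolding sM
      by (intro weighted_integral(2)[OF D m] borel_measurable_power borel_measurable_diff borel_measurable_indicator)
    also have "\<dots> \<le> (LINT x|lebesgue_on D. B * indicator (A - T n) x)"
    proof (rule integral_mono)
      have sq: "(indicator A x - indicator (T n) x :: real)\<^sup>2 = indicator (A - T n) x" for x
        using T(2)[of n] by (auto split: split_indicator)
      show "integrable (lebesgue_on D) (\<lambda>x. B * indicator (A - T n) x)" using i by simp
      have le: "\<bar>m x * indicator (A - T n) x\<bar> \<le> B * indicator (A - T n) x" if "x \<in> space (lebesgue_on D)" for x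
      proof -
        have "\<bar>m x\<bar> \<le> B" using B[of x] that closure_subset by auto
        then show ?thesis by (simp split: split_indicator)
      qed
      show "integrable (lebesgue_on D) (\<lambda>x. m x * (indicator A x - indicator (T n) x)\<^sup>2)"
        unfolding sq
      proof (rule Bochner_Integration.integrable_bound)
        show "integrable (lebesgue_on D) (\<lambda>x. B * indicator (A - T n) x)" using i by simp
        show "(\<lambda>x. m x * indicator (A - T n) x) \<in> borel_measurable (lebesgue_on D)"
          by (intro borel_measurable_times weight_measurable[OF D m(1)] borel_measurable_integrable[OF i])
        show "AE x in lebesgue_on D. norm (m x * indicator (A - T n) x) \<le> norm (B * indicator (A - T n) x)"
          by (rule AE_I2) (use le in \<open>simp only: real_norm_def, meson abs_ge_self order_trans\<close>)
      qed
      fix x assume "x \<in> space (lebesgue_on D)"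
      from le[OF this] show "m x * (indicator A x - indicator (T n) x)\<^sup>2 \<le> B * indicator (A - T n) x"
        unfolding sq by linarith
    qed
    also have "\<dots> = B * (LINT x|lebesgue_on D. indicator (A - T n) x)" by simp
    also have "\<dots> \<le> B * (1 / real (Suc n))" by (intro mult_left_mono iv B0)
    also have "\<dots> < \<epsilon>"
    proof -
      have "B + 1 < \<epsilon> * real n" using n e by (simp add: field_simps)
      then have "B < \<epsilon> * real (Suc n)" using e by (simp add: algebra_simps)
      then show ?thesis by (simp add: field_simps)
    qed
    finally show "\<exists>h\<in>L2_closure ?M ?F. (LINT x|?M. (indicator A x - h x)\<^sup>2) < \<epsilon>"
      using closed[OF T(1,2)] by blast
  qed
qed

section \<open>The weighted Dirichlet form\<close>

lemma BL_weighted_lincomb: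
  assumes D: "open D" and u: "u \<in> BL D \<inter> L2_space M" and v: "v \<in> BL D \<inter> L2_space M"
  shows "(\<lambda>x. a * u x + c * v x) \<in> BL D \<inter> L2_space M"
  using BL_lincomb[OF D] L2_space_lincomb u v by blast

lemma weighted_form_dense:
  fixes D :: "'a::euclidean_space set"
  assumes dc: "D \<in> domain_class" and m: "continuous_on (closure D) m" "\<forall>x\<in>closure D. m x > 0"
    and b: "bounded (m ` closure D)" and f: "f \<in> L2_space (weighted D m)" and e: "\<epsilon> > 0"
  shows "\<exists>u\<in>BL D \<inter> L2_space (weighted D m). (LINT x|weighted D m. (f x - u x)\<^sup>2) < \<epsilon>"
proof -
  have D: "open D" using dc by (simp add: domain_class_def)
  have "f \<in> L2_closure (weighted D m) (BL D \<inter> L2_space (weighted D m))"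
  proof (rule L2_closure_all[OF Int_lower2 _ _ f])
    show "(\<lambda>x. a * u x + c * v x) \<in> BL D \<inter> L2_space (weighted D m)"
      if "u \<in> BL D \<inter> L2_space (weighted D m)" "v \<in> BL D \<inter> L2_space (weighted D m)" for u v a c
      by (rule BL_weighted_lincomb[OF D that])
    show "indicator A \<in> L2_closure (weighted D m) (BL D \<inter> L2_space (weighted D m))"
      if "A \<in> sets (weighted D m)" "emeasure (weighted D m) A < \<infinity>" for A
      by (rule indicator_approx[OF dc m b that])
  qed
  then show ?thesis using e unfolding L2_closure_def by blast
qed

text \<open>
The limit exists in the weighted space.  Since the weight is bounded below on compact sets, the
sequence also converges locally in the unweighted sense, as closedness of the Dirichlet integral
requires.
\<close>

lemma weighted_form_complete:
  fixes D :: "'a::euclidean_space set"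
  assumes D: "open D" and m: "continuous_on (closure D) m" "\<forall>x\<in>closure D. m x > 0"
    and u: "\<And>n::nat. u n \<in> BL D \<inter> L2_space (weighted D m)"
    and cauchy: "\<And>\<epsilon>. \<epsilon> > 0 \<Longrightarrow> \<exists>N. \<forall>i\<ge>N. \<forall>j\<ge>N.
      1/2 * Dirichlet_int D (\<lambda>x. u i x - u j x) (\<lambda>x. u i x - u j x) + (LINT x|weighted D m. (u i x - u j x)\<^sup>2) < \<epsilon>"
  shows "\<exists>v\<in>BL D \<inter> L2_space (weighted D m). (\<lambda>n. 1/2 * Dirichlet_int D (\<lambda>x. u n x - v x) (\<lambda>x. u n x - v x) +
      (LINT x|weighted D m. (u n x - v x)\<^sup>2)) \<longlonglongrightarrow> 0"
proof -
  let ?M = "weighted D m"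
  have uBL: "u n \<in> BL D" and uL2: "u n \<in> L2_space ?M" for n using u by auto
  have D0: "0 \<le> Dirichlet_int D w w" for w by (rule Dirichlet_int_nonneg)
  have I0: "0 \<le> (LINT x|?M. (w x)\<^sup>2)" for w :: "'a \<Rightarrow> real" by (rule integral_nonneg_AE) simp
  have c1: "\<exists>N. \<forall>i\<ge>N. \<forall>j\<ge>N. Dirichlet_int D (\<lambda>x. u i x - u j x) (\<lambda>x. u i x - u j x) < \<epsilon>" if "\<epsilon> > 0" for \<epsilon>
  proof -
    obtain N where N: "\<forall>i\<ge>N. \<forall>j\<ge>N. 1/2 * Dirichlet_int D (\<lambda>x. u i x - u j x) (\<lambda>x. u i x - u j x) +
      (LINT x|?M. (u i x - u j x)\<^sup>2) < \<epsilon> / 2" using cauchy[OF half_gt_zero[OF \<open>\<epsilon> > 0\<close>]] by blast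
    have "Dirichlet_int D (\<lambda>x. u i x - u j x) (\<lambda>x. u i x - u j x) < \<epsilon>" if "i \<ge> N" "j \<ge> N" for i j
      using N[rule_format, OF that] I0[of "\<lambda>x. u i x - u j x"] by linarith
    then show ?thesis by blast
  qed
  have c2: "\<exists>N. \<forall>i\<ge>N. \<forall>j\<ge>N. (LINT x|?M. (u i x - u j x)\<^sup>2) < \<epsilon>" if "\<epsilon> > 0" for \<epsilon>
  proof -
    obtain N where N: "\<forall>i\<ge>N. \<forall>j\<ge>N. 1/2 * Dirichlet_int D (\<lambda>x. u i x - u j x) (\<lambda>x. u i x - u j x) +
      (LINT x|?M. (u i x - u j x)\<^sup>2) < \<epsilon>" using cauchy[OF \<open>\<epsilon> > 0\<close>] by blast
    have "(LINT x|?M. (u i x - u j x)\<^sup>2) < \<epsilon>" if "i \<ge> N" "j \<ge> N" for i j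
      using N[rule_format, OF that] D0[of "\<lambda>x. u i x - u j x"] by linarith
    then show ?thesis by blast
  qed
  obtain v where v: "v \<in> L2_space ?M" "(\<lambda>n. LINT x|?M. (u n x - v x)\<^sup>2) \<longlonglongrightarrow> 0"
    by (rule L2_complete[OF uL2 c2]) (assumption | rule that)+
  have vm: "v \<in> borel_measurable (lebesgue_on D)" using v(1) by (simp add: L2_space_def borel_measurable_weighted)
  have um: "u n \<in> borel_measurable (lebesgue_on D)" for n using uBL by (simp add: BL_def L2_loc_def)
  have loc: "(\<lambda>n. \<integral>\<^sup>+x. indicator K x * ennreal ((u n x - v x)\<^sup>2) \<partial>lebesgue_on D) \<longlonglongrightarrow> 0"
    if K: "compact K" "K \<subseteq> D" for K
  proof (cases "K = {}")
    case True then show ?thesis by simp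
  next
    case False
    have KD: "K \<subseteq> closure D" using K(2) closure_subset by blast
    obtain x where x: "x \<in> K" "\<And>y. y \<in> K \<Longrightarrow> m x \<le> m y"
      using continuous_attains_inf[OF K(1) False continuous_on_subset[OF m(1) KD]] by blast
    define c where "c = m x"
    have c: "c > 0" "\<And>y. y \<in> K \<Longrightarrow> c \<le> m y" using x m(2) KD by (auto simp: c_def)
    have m0: "m y \<ge> 0" if "y \<in> D" for y using m(2) that closure_subset by (force intro: less_imp_le)
    have le: "(\<integral>\<^sup>+x. indicator K x * ennreal ((u n x - v x)\<^sup>2) \<partial>lebesgue_on D) \<le>
      ennreal ((1 / c) * (LINT x|?M. (u n x - v x)\<^sup>2))" for n
    proof -
      have d: "(\<lambda>x. u n x - v x) \<in> L2_space ?M" using L2_space_lincomb[OF uL2[of n] v(1), of 1 "-1"] by simp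
      have dm: "(\<lambda>x. (u n x - v x)\<^sup>2) \<in> borel_measurable (lebesgue_on D)"
        by (intro borel_measurable_power borel_measurable_diff um vm)
      have i: "integrable (lebesgue_on D) (\<lambda>x. m x * (u n x - v x)\<^sup>2)"
        using d weighted_integral(1)[OF D m dm] by (simp add: L2_space_def)
      have "(\<integral>\<^sup>+x. indicator K x * ennreal ((u n x - v x)\<^sup>2) \<partial>lebesgue_on D) \<le>
        (\<integral>\<^sup>+x. ennreal ((1 / c) * (m x * (u n x - v x)\<^sup>2)) \<partial>lebesgue_on D)"
      proof (rule nn_integral_mono)
        fix y
        show "indicator K y * ennreal ((u n y - v y)\<^sup>2) \<le> ennreal ((1 / c) * (m y * (u n y - v y)\<^sup>2))"
        proof (cases "y \<in> K")
          case True
          have "c * (u n y - v y)\<^sup>2 \<le> m y * (u n y - v y)\<^sup>2" by (intro mult_right_mono c(2)[OF True]) simp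
          then have "(u n y - v y)\<^sup>2 \<le> (1 / c) * (m y * (u n y - v y)\<^sup>2)" using c(1) by (simp add: field_simps)
          then show ?thesis using True by (simp add: ennreal_leI)
        qed simp
      qed
      also have "\<dots> = ennreal (LINT x|lebesgue_on D. (1 / c) * (m x * (u n x - v x)\<^sup>2))"
      proof (rule nn_integral_eq_integral)
        show "integrable (lebesgue_on D) (\<lambda>x. (1 / c) * (m x * (u n x - v x)\<^sup>2))" by (rule integrable_mult_right[OF i])
        show "AE x in lebesgue_on D. 0 \<le> (1 / c) * (m x * (u n x - v x)\<^sup>2)"
          by (rule AE_I2) (use m0 c(1) in simp)
      qed
      also have "(LINT x|lebesgue_on D. (1 / c) * (m x * (u n x - v x)\<^sup>2)) = (1 / c) * (LINT x|?M. (u n x - v x)\<^sup>2)"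
        unfolding weighted_integral(2)[OF D m dm] by (rule integral_mult_right_zero)
      finally show ?thesis .
    qed
    have "(\<lambda>n. (1 / c) * (LINT x|?M. (u n x - v x)\<^sup>2)) \<longlonglongrightarrow> 0" by (rule tendsto_mult_right_zero[OF v(2)])
    from tendsto_ennrealI[OF this]
    have L: "(\<lambda>n. ennreal ((1 / c) * (LINT x|?M. (u n x - v x)\<^sup>2))) \<longlonglongrightarrow> 0" by simp
    show ?thesis
    proof (rule tendsto_sandwich[OF _ _ tendsto_const L])
      show "\<forall>\<^sub>F n in sequentially. (\<integral>\<^sup>+x. indicator K x * ennreal ((u n x - v x)\<^sup>2) \<partial>lebesgue_on D) \<le>
        ennreal ((1 / c) * (LINT x|?M. (u n x - v x)\<^sup>2))" by (intro always_eventually allI le)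
    qed simp
  qed
  note C = BL_closed[OF D uBL vm c1 loc]
  have "(\<lambda>n. 1/2 * Dirichlet_int D (\<lambda>x. u n x - v x) (\<lambda>x. u n x - v x) + (LINT x|?M. (u n x - v x)\<^sup>2)) \<longlonglongrightarrow> 1/2 * 0 + 0"
    by (intro tendsto_add tendsto_mult tendsto_const C(2) v(2))
  then show ?thesis using C(1) v(1) by (intro bexI[of _ v]) simp_all
qed

lemma Dirichlet_int_lincomb_left:
  assumes D: "open D" and u: "u \<in> BL D" and v: "v \<in> BL D" and w: "w \<in> BL D"
  shows "Dirichlet_int D (\<lambda>x. a * u x + c * v x) w = a * Dirichlet_int D u w + c * Dirichlet_int D v w"
proof -
  have uv: "(\<lambda>x. a * u x + c * v x) \<in> BL D" by (rule BL_lincomb[OF D u v])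
  note G = BL_weak_grad[OF D]
  have P: "is_weak_pderiv D b (\<lambda>x. a * u x + c * v x) (\<lambda>x. a * (weak_grad D u x \<bullet> b) + c * (weak_grad D v x \<bullet> b))"
    if "b \<in> Basis" for b
    by (intro weak_pderiv_lincomb D G(1) u v that)
  have i: "integrable (lebesgue_on D) (\<lambda>x. (weak_grad D u x \<bullet> b) * (weak_grad D w x \<bullet> b))"
    "integrable (lebesgue_on D) (\<lambda>x. (weak_grad D v x \<bullet> b) * (weak_grad D w x \<bullet> b))" if "b \<in> Basis" for b
    by (intro L2_mult_integrable G(2) u v w that)+
  have "Dirichlet_int D (\<lambda>x. a * u x + c * v x) w =
    (\<Sum>b\<in>Basis. LINT x|lebesgue_on D. (a * (weak_grad D u x \<bullet> b) + c * (weak_grad D v x \<bullet> b)) * (weak_grad D w x \<bullet> b))"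
    by (rule Dirichlet_int_eq_sum[OF D uv w P G(1)[OF w]])
  also have "\<dots> = (\<Sum>b\<in>Basis. a * (LINT x|lebesgue_on D. (weak_grad D u x \<bullet> b) * (weak_grad D w x \<bullet> b)) +
      c * (LINT x|lebesgue_on D. (weak_grad D v x \<bullet> b) * (weak_grad D w x \<bullet> b)))"
  proof (rule sum.cong[OF refl])
    fix b :: 'a assume b: "b \<in> Basis"
    have "(LINT x|lebesgue_on D. (a * (weak_grad D u x \<bullet> b) + c * (weak_grad D v x \<bullet> b)) * (weak_grad D w x \<bullet> b)) =
      (LINT x|lebesgue_on D. a * ((weak_grad D u x \<bullet> b) * (weak_grad D w x \<bullet> b)) + c * ((weak_grad D v x \<bullet> b) * (weak_grad D w x \<bullet> b)))"
      by (simp only: distrib_right mult.assoc)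
    also have "\<dots> = a * (LINT x|lebesgue_on D. (weak_grad D u x \<bullet> b) * (weak_grad D w x \<bullet> b)) +
      c * (LINT x|lebesgue_on D. (weak_grad D v x \<bullet> b) * (weak_grad D w x \<bullet> b))"
      using i[OF b] by simp
    finally show "(LINT x|lebesgue_on D. (a * (weak_grad D u x \<bullet> b) + c * (weak_grad D v x \<bullet> b)) * (weak_grad D w x \<bullet> b)) =
      a * (LINT x|lebesgue_on D. (weak_grad D u x \<bullet> b) * (weak_grad D w x \<bullet> b)) +
      c * (LINT x|lebesgue_on D. (weak_grad D v x \<bullet> b) * (weak_grad D w x \<bullet> b))" .
  qed
  also have "\<dots> = a * Dirichlet_int D u w + c * Dirichlet_int D v w"
  proof -
    have "Dirichlet_int D u w = (\<Sum>b\<in>Basis. LINT x|lebesgue_on D. (weak_grad D u x \<bullet> b) * (weak_grad D w x \<bullet> b))"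
      by (rule Dirichlet_int_eq_sum[OF D u w G(1)[OF u] G(1)[OF w]])
    moreover have "Dirichlet_int D v w = (\<Sum>b\<in>Basis. LINT x|lebesgue_on D. (weak_grad D v x \<bullet> b) * (weak_grad D w x \<bullet> b))"
      by (rule Dirichlet_int_eq_sum[OF D v w G(1)[OF v] G(1)[OF w]])
    ultimately show ?thesis by (simp only: sum.distrib sum_distrib_left)
  qed
  finally show ?thesis .
qed

lemma Dirichlet_int_commute: "Dirichlet_int D u v = Dirichlet_int D v u"
  by (simp add: Dirichlet_int_def inner_commute)

text \<open>
Polarization.
\<close>

lemma E_ref_eq_Dirichlet_int:
  assumes D: "open D" and u: "u \<in> BL D" and v: "v \<in> BL D"
  shows "E_ref D u v = 1/2 * Dirichlet_int D u v"
proof -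
  have d: "E_ref_diag D w = 1/2 * Dirichlet_int D w w" for w
    by (simp add: E_ref_diag_def Dirichlet_int_def power2_norm_eq_inner)
  have uv: "(\<lambda>x. 1 * u x + 1 * v x) \<in> BL D" by (rule BL_lincomb[OF D u v])
  have e: "Dirichlet_int D (\<lambda>x. 1 * u x + 1 * v x) w = 1 * Dirichlet_int D u w + 1 * Dirichlet_int D v w" if "w \<in> BL D" for w
    by (rule Dirichlet_int_lincomb_left[OF D u v that])
  have "Dirichlet_int D (\<lambda>x. u x + v x) (\<lambda>x. u x + v x) =
    Dirichlet_int D u (\<lambda>x. u x + v x) + Dirichlet_int D v (\<lambda>x. u x + v x)"
    using e[OF uv] by simp
  also have "\<dots> = Dirichlet_int D u u + 2 * Dirichlet_int D u v + Dirichlet_int D v v"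
    using e[OF u] e[OF v] Dirichlet_int_commute[of D u "\<lambda>x. u x + v x"] Dirichlet_int_commute[of D v "\<lambda>x. u x + v x"]
      Dirichlet_int_commute[of D u v] by simp
  finally have S: "Dirichlet_int D (\<lambda>x. u x + v x) (\<lambda>x. u x + v x) =
    Dirichlet_int D u u + 2 * Dirichlet_int D u v + Dirichlet_int D v v" .
  have "1/2 * (1/2 * s - 1/2 * x - 1/2 * z) = 1/2 * y" if "s = x + 2 * y + z" for s x y z :: real
    using that by (simp add: field_simps)
  then show ?thesis unfolding E_ref_def d using S by blast
qed

lemma weighted_dirichlet_form:
  fixes D :: "'a::euclidean_space set"
  assumes dc: "D \<in> domain_class" and m: "continuous_on (closure D) m" "\<forall>x\<in>closure D. m x > 0"
    and b: "bounded (m ` closure D)"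
  shows "dirichlet_form (weighted D m) (\<lambda>u v. 1/2 * Dirichlet_int D u v) (BL D \<inter> L2_space (weighted D m))"
proof -
  let ?M = "weighted D m" and ?F = "BL D \<inter> L2_space (weighted D m)"
  have D: "open D" using dc by (simp add: domain_class_def)
  have cong: "v \<in> ?F \<and> (\<forall>w\<in>?F. 1/2 * Dirichlet_int D v w = 1/2 * Dirichlet_int D u w)"
    if u: "u \<in> ?F" and v: "v \<in> borel_measurable ?M" and ae: "AE x in ?M. u x = v x" for u v
  proof -
    have ae': "AE x in lebesgue_on D. u x = v x" using ae unfolding AE_weighted[OF D m] .
    have mv: "v \<in> borel_measurable (lebesgue_on D)" using v unfolding borel_measurable_weighted .
    have mu: "u \<in> borel_measurable (lebesgue_on D)" using u by (simp add: BL_def L2_loc_def)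
    have "v \<in> BL D" by (rule BL_AE_cong[OF D _ mv ae']) (use u in blast)
    moreover have "v \<in> L2_space ?M"
      by (rule L2_space_AE_cong[OF _ v]) (use u ae in \<open>auto elim!: eventually_mono\<close>)
    moreover have "weak_grad D u = weak_grad D v" by (rule weak_grad_AE_cong(2)[OF D ae' mu mv])
    ultimately show ?thesis by (simp add: Dirichlet_int_def)
  qed
  have lin: "(\<lambda>x. a * u x + c * v x) \<in> ?F \<and> (\<forall>w\<in>?F. 1/2 * Dirichlet_int D (\<lambda>x. a * u x + c * v x) w =
      a * (1/2 * Dirichlet_int D u w) + c * (1/2 * Dirichlet_int D v w))"
    if u: "u \<in> ?F" and v: "v \<in> ?F" for u v a c
  proof (intro conjI ballI)
    show "(\<lambda>x. a * u x + c * v x) \<in> ?F" by (rule BL_weighted_lincomb[OF D u v])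
    fix w assume w: "w \<in> ?F"
    have "Dirichlet_int D (\<lambda>x. a * u x + c * v x) w = a * Dirichlet_int D u w + c * Dirichlet_int D v w"
      by (rule Dirichlet_int_lincomb_left[OF D]) (use u v w in auto)
    then show "1/2 * Dirichlet_int D (\<lambda>x. a * u x + c * v x) w =
      a * (1/2 * Dirichlet_int D u w) + c * (1/2 * Dirichlet_int D v w)" by (simp add: field_simps)
  qed
  have markov: "(\<lambda>x. min (max (u x) 0) 1) \<in> ?F \<and>
      1/2 * Dirichlet_int D (\<lambda>x. min (max (u x) 0) 1) (\<lambda>x. min (max (u x) 0) 1) \<le> 1/2 * Dirichlet_int D u u"
    if u: "u \<in> ?F" for u
  proof -
    have e: "(\<lambda>x. min (max (- 0) (u x)) 1) = (\<lambda>x. min (max (u x) 0) 1)" by (simp add: max.commute)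
    have uB: "u \<in> BL D" using u by blast
    have c: "(\<lambda>x. min (max (u x) 0) 1) \<in> BL D" using BL_clip(1)[OF D uB, of 0 1] unfolding e by simp
    have "(\<lambda>x. min (max (u x) 0) 1) \<in> L2_space ?M"
    proof (rule L2_space_bound)
      show "u \<in> L2_space ?M" using u by blast
      show "(\<lambda>x. min (max (u x) 0) 1) \<in> borel_measurable ?M"
        using c unfolding borel_measurable_weighted by (simp add: BL_def L2_loc_def)
      show "AE x in ?M. \<bar>min (max (u x) 0) 1\<bar> \<le> \<bar>u x\<bar>" by (rule AE_I2) (auto simp: max_def min_def)
    qed
    moreover have "Dirichlet_int D (\<lambda>x. min (max (u x) 0) 1) (\<lambda>x. min (max (u x) 0) 1) \<le> Dirichlet_int D u u"
      using Dirichlet_int_clip_le[OF D uB, of 0 1] unfolding e by simp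
    ultimately show ?thesis using c by simp
  qed
  have complete: "\<exists>v\<in>?F. (\<lambda>n. 1/2 * Dirichlet_int D (\<lambda>x. u n x - v x) (\<lambda>x. u n x - v x) + (LINT x|?M. (u n x - v x)\<^sup>2)) \<longlonglongrightarrow> 0"
    if u: "(\<forall>n::nat. u n \<in> ?F) \<and> (\<forall>\<epsilon>>0. \<exists>N. \<forall>i\<ge>N. \<forall>j\<ge>N.
      1/2 * Dirichlet_int D (\<lambda>x. u i x - u j x) (\<lambda>x. u i x - u j x) + (LINT x|?M. (u i x - u j x)\<^sup>2) < \<epsilon>)" for u
    by (rule weighted_form_complete[OF D m]) (use u in blast)+
  show ?thesis
    unfolding dirichlet_form_def Let_def
  proof (intro conjI)
    show "?F \<subseteq> L2_space ?M" by blast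
    show "\<forall>u\<in>?F. \<forall>v\<in>borel_measurable ?M. (AE x in ?M. u x = v x) \<longrightarrow>
      v \<in> ?F \<and> (\<forall>w\<in>?F. 1/2 * Dirichlet_int D v w = 1/2 * Dirichlet_int D u w)"
      using cong by (intro ballI impI)
    show "\<forall>u\<in>?F. \<forall>v\<in>?F. \<forall>a c. (\<lambda>x. a * u x + c * v x) \<in> ?F \<and>
      (\<forall>w\<in>?F. 1/2 * Dirichlet_int D (\<lambda>x. a * u x + c * v x) w = a * (1/2 * Dirichlet_int D u w) + c * (1/2 * Dirichlet_int D v w))"
      using lin by (intro ballI allI)
    show "\<forall>u\<in>?F. \<forall>v\<in>?F. 1/2 * Dirichlet_int D u v = 1/2 * Dirichlet_int D v u"
      by (simp add: Dirichlet_int_commute)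
    show "\<forall>u\<in>?F. 0 \<le> 1/2 * Dirichlet_int D u u" by (simp add: Dirichlet_int_nonneg)
    show "\<forall>f\<in>L2_space ?M. \<forall>\<epsilon>>0. \<exists>u\<in>?F. (LINT x|?M. (f x - u x)\<^sup>2) < \<epsilon>"
      using weighted_form_dense[OF dc m b] by (intro ballI allI impI)
    show "\<forall>u. (\<forall>n::nat. u n \<in> ?F) \<and> (\<forall>\<epsilon>>0. \<exists>N. \<forall>i\<ge>N. \<forall>j\<ge>N.
        1/2 * Dirichlet_int D (\<lambda>x. u i x - u j x) (\<lambda>x. u i x - u j x) + (LINT x|?M. (u i x - u j x)\<^sup>2) < \<epsilon>) \<longrightarrow>
      (\<exists>v\<in>?F. (\<lambda>n. 1/2 * Dirichlet_int D (\<lambda>x. u n x - v x) (\<lambda>x. u n x - v x) + (LINT x|?M. (u n x - v x)\<^sup>2)) \<longlonglongrightarrow> 0)"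
      using complete by (intro allI impI)
    show "\<forall>u\<in>?F. (\<lambda>x. min (max (u x) 0) 1) \<in> ?F \<and>
      1/2 * Dirichlet_int D (\<lambda>x. min (max (u x) 0) 1) (\<lambda>x. min (max (u x) 0) 1) \<le> 1/2 * Dirichlet_int D u u"
      using markov by (intro ballI)
  qed
qed

theorem theorem3p1:
  fixes D :: "(real ^ 'n) set" and m :: "real ^ 'n \<Rightarrow> real"
  assumes "D \<in> domain_class"
    and "continuous_on (closure D) m" and "bounded (m ` closure D)"
    and "\<forall>x\<in>closure D. m x > 0"
  shows "dirichlet_form (weighted D m)
           (\<lambda>u v. 1/2 * Dirichlet_int D u v) (BL D \<inter> L2_space (weighted D m))
    \<and> same_form (\<lambda>u v. 1/2 * Dirichlet_int D u v, BL D \<inter> L2_space (weighted D m))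
                (E_ref D, F_ref_active D m)
    \<and> F_ref D m = BL D"
proof (intro conjI)
  have D: "open D" using assms(1) by (simp add: domain_class_def)
  show F: "F_ref D m = BL D"
    using F_ref_subset_BL[OF D assms(2,4)] BL_subset_F_ref[OF D assms(2,4,3)] by (rule subset_antisym)
  show "dirichlet_form (weighted D m)
      (\<lambda>u v. 1/2 * Dirichlet_int D u v) (BL D \<inter> L2_space (weighted D m))"
    by (rule weighted_dirichlet_form[OF assms(1,2,4,3)])
  show "same_form (\<lambda>u v. 1/2 * Dirichlet_int D u v, BL D \<inter> L2_space (weighted D m))
      (E_ref D, F_ref_active D m)"
    unfolding same_form_def F_ref_active_def F using E_ref_eq_Dirichlet_int[OF D] by simp
qed

end
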